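(* Let $(p:\mathcal G\to M,\omega)$ be a parabolic geometry of type $(G,Q)$ and $E$ a relative natural bundle. In terms of an adapted local frame $\{X_i,A_r,Z^i\}$ for $\mathcal A_\rho M$ and the elements $A^r$ in the dual frame $\{Z^i,A^r,X_i\}$, the relative curved Casimir operator is given by $$\mathcal C_\rho(\sigma)=-2\sum_iZ^i\bullet D^\rho_{X_i}\sigma-\sum_i\{Z^i,X_i\}\bullet\sigma+\sum_rA^r\bullet A_r\bullet\sigma$$ for $\sigma\in\Gamma(E)$. In particular, the relative curved Casimir is a differential operator of order at most one, and it has order zero on relative natural bundles induced by completely reducible representations of $Q$.
   Context: $G$ is a real or complex semisimple Lie group with Lie algebra $\mathfrak g$; $\mathfrak q\subset\mathfrak p\subset\mathfrak g$ are nested parabolic subalgebras ($\mathfrak p=\mathfrak g$ allowed); $P\subset G$ is a parabolic subgroup with Lie algebra $\mathfrak p$, $Q\subset P$ the normalizer of $\mathfrak q$ in $P$ (Lie algebra $\mathfrak q$). Nilradicals: $\mathfrak p_+\subset\mathfrak q_+\subset\mathfrak q\subset\mathfrak p$; $P_+=\exp(\mathfrak p_+)$. A parabolic geometry of type $(G,Q)$ is a principal $Q$-bundle $\mathcal G\to M$ with a Cartan connection $\omega\in\Omega^1(\mathcal G,\mathfrak g)$. A relative natural bundle is $E=\mathcal G\times_Q\mathbb W$ for a representation $\mathbb W$ of $Q$ on which $P_+$ acts trivially. $\mathcal AM=\mathcal G\times_Q\mathfrak g$, $\mathcal A_\rho M=\mathcal G\times_Q(\mathfrak p/\mathfrak p_+)$,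 with subbundles $\mathcal A^0_\rho M=\mathcal G\times_Q(\mathfrak q/\mathfrak p_+)$, $\mathcal A^1_\rho M=\mathcal G\times_Q(\mathfrak q_+/\mathfrak p_+)$. The Lie bracket of $\mathfrak p/\mathfrak p_+$ induces the algebraic bracket $\{\ ,\ \}$ on $\mathcal A_\rho M$. The infinitesimal representation $\mathfrak q/\mathfrak p_+\times\mathbb W\to\mathbb W$ induces $\bullet:\mathcal A^0_\rho M\times E\to E$. Relative fundamental derivative $D^\rho:\Gamma(\mathcal A_\rho M)\times\Gamma(E)\to\Gamma(E)$: $D^\rho_s\sigma=D_{\tilde s}\sigma$, where $\tilde s\in\Gamma(\mathcal G\times_Q\mathfrak p)\subset\Gamma(\mathcal AM)$ projects onto $s$; $\tilde s$ is identified via $\omega$ with a $Q$-invariant vector field on $\mathcal G$, and $D_{\tilde s}\sigma$ is the derivative along it of the $Q$-equivariant function $\mathcal G\to\mathbb W$ corresponding to $\sigma$ (independent of the choice of $\tilde s$). It may be viewed as $D^\rho:\Gamma(E)\to\Gamma(\mathcal A_\rho^*M\otimes E)$ and iterated. The Killing form of $\mathfrak g$ descends to a non-degenerate $P$-invariant bilinear form $B$ on $\mathfrak p/\mathfrak p_+$, inducing $B$ on $\mathcal A_\rho M$ and $B^{-1}$ on $\mathcal A^*_\rho M$. The relative curved Casimir operator is $\mathcal C_\rho:\Gamma(E)\to\Gamma(E)$, $\mathcal C_\rho(\sigma)=(B^{-1}\otimes\mathrm{id})(D^\rho D^\rho\sigma)$. An adapted local frame for $\mathcal A_\rho M$ is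 a local frame $\{X_i,A_r,Z^i\}$ such that: $Z^i\in\Gamma(\mathcal A^1_\rho M)$ for all $i$ and $A_r\in\Gamma(\mathcal A^0_\rho M)$ for all $r$; $B(X_i,X_j)=0$, $B(A_r,X_i)=0$ and $B(X_i,Z^j)=\delta_i^j$ for all $i,j,r$; and for each $i$ the algebraic bracket $\{Z^i,X_i\}$ is a section of $\mathcal A^0_\rho M$. The frame dual to it with respect to $B$ then has the form $\{Z^i,A^r,X_i\}$ for local sections $A^r\in\Gamma(\mathcal A^0_\rho M)$. *)

theory Defs
  imports "HOL-Analysis.Analysis" "HOL-Algebra.Group"
begin

section \<open>The ground field\<close>

text \<open>The real and the complex case are treated uniformly. The assumptions on \<open>to_complex\<close> leave,
  up to isometric isomorphism, only the fields \<open>\<real>\<close> and \<open>\<complex>\<close>. Differentiability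
  is always meant over the ground field \<open>'k\<close>, so that ``smooth'' means \<open>C\<^sup>\<infinity>\<close> over the reals
  and holomorphic over the complex numbers.\<close>

class real_or_complex = real_normed_field + euclidean_space +
  fixes to_complex :: "'a \<Rightarrow> complex"
  assumes to_complex_add: "to_complex (x + y) = to_complex x + to_complex y"
    and to_complex_mult: "to_complex (x * y) = to_complex x * to_complex y"
    and to_complex_one: "to_complex 1 = 1"
    and to_complex_scaleR: "to_complex (r *\<^sub>R x) = r *\<^sub>R to_complex x"
    and norm_to_complex: "cmod (to_complex x) = norm x"

instantiation real :: real_or_complex
begin
definition to_complex_real :: "real \<Rightarrow> complex" where "to_complex_real = complex_of_real"
instance by standard (simp_all add: to_complex_real_def scaleR_conv_of_real)
end

instantiation complex :: real_or_complex
begin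
definition to_complex_complex :: "complex \<Rightarrow> complex" where "to_complex_complex = id"
instance by standard (simp_all add: to_complex_complex_def)
end


section \<open>Manifolds\<close>

text \<open>\<open>Ck_on r S f\<close>: \<open>f\<close> is \<open>r\<close> times continuously differentiable over \<open>'k\<close>
  on the open set \<open>S\<close>; the \<open>g i\<close> are the partial derivatives.\<close>

primrec Ck_on :: "nat \<Rightarrow> ('k::real_or_complex ^ 'n) set \<Rightarrow> ('k ^ 'n \<Rightarrow> 'k) \<Rightarrow> bool" where
  "Ck_on 0 S f \<longleftrightarrow> continuous_on S f"
| "Ck_on (Suc r) S f \<longleftrightarrow>
     (\<exists>g :: 'n \<Rightarrow> 'k ^ 'n \<Rightarrow> 'k.
        (\<forall>x\<in>S. (f has_derivative (\<lambda>v. \<Sum>i\<in>UNIV. g i x * v $ i)) (at x)) \<and>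
        (\<forall>i. Ck_on r S (g i)))"

type_synonym ('x, 'k, 'n) atlas = "('x set \<times> ('x \<Rightarrow> ('k, 'n) vec)) set"

text \<open>Manifolds occupy a whole type. Hausdorff and second countable are imposed as sorts
  in the theorem.\<close>

definition manifold :: "('x::topological_space, 'k::real_or_complex, 'n::finite) atlas \<Rightarrow> bool" where
  "manifold A \<longleftrightarrow>
     (\<forall>(U, \<phi>)\<in>A. open U \<and> open (\<phi> ` U) \<and> homeomorphism U (\<phi> ` U) \<phi> (inv_into U \<phi>)) \<and>
     (\<Union>(U, \<phi>)\<in>A. U) = UNIV \<and>
     (\<forall>(U, \<phi>)\<in>A. \<forall>(V, \<psi>)\<in>A. \<forall>j r. Ck_on r (\<phi> ` (U \<inter> V)) (\<lambda>y. \<psi> (inv_into U \<phi> y) $ j))"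

definition smooth_fun ::
    "('x::topological_space, 'k::real_or_complex, 'n::finite) atlas \<Rightarrow> 'x set \<Rightarrow> ('x \<Rightarrow> 'k) \<Rightarrow> bool" where
  "smooth_fun A U f \<longleftrightarrow>
     open U \<and> (\<forall>(V, \<phi>)\<in>A. \<forall>r. Ck_on r (\<phi> ` (U \<inter> V)) (\<lambda>y. f (inv_into V \<phi> y)))"

definition smooth_near ::
    "('x::topological_space, 'k::real_or_complex, 'n::finite) atlas \<Rightarrow> 'x \<Rightarrow> ('x \<Rightarrow> 'k) \<Rightarrow> bool" where
  "smooth_near A x f \<longleftrightarrow> (\<exists>U. x \<in> U \<and> smooth_fun A U f)"

definition smooth_map ::
    "('x::topological_space, 'k::real_or_complex, 'n::finite) atlas \<Rightarrow>
     ('y::topological_space, 'k, 'l::finite) atlas \<Rightarrow> 'x set \<Rightarrow> ('x \<Rightarrow> 'y) \<Rightarrow> bool" where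
  "smooth_map A B U F \<longleftrightarrow>
     open U \<and> continuous_on U F \<and>
     (\<forall>V f. smooth_fun B V f \<longrightarrow> smooth_fun A (U \<inter> F -` V) (\<lambda>x. f (F x)))"

text \<open>Smoothness on an arbitrary subset, by local smooth extension. On an embedded submanifold
  (such as a closed subgroup \<open>Q\<close> of \<open>G\<close>, or a product with \<open>Q\<close>) this is smoothness for the
  induced manifold structure.\<close>

definition smooth_map_on_subset ::
    "('x::topological_space, 'k::real_or_complex, 'n::finite) atlas \<Rightarrow>
     ('y::topological_space, 'k, 'l::finite) atlas \<Rightarrow> 'x set \<Rightarrow> ('x \<Rightarrow> 'y) \<Rightarrow> bool" where
  "smooth_map_on_subset A B S F \<longleftrightarrow>
     (\<forall>x\<in>S. \<exists>U F'. x \<in> U \<and> smooth_map A B U F' \<and> (\<forall>y\<in>S \<inter> U. F' y = F y))"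

definition vec_atlas :: "(('k::real_or_complex) ^ 'n, 'k, 'n::finite) atlas" where
  "vec_atlas = {(UNIV, id)}"

definition scalar_atlas :: "('k::real_or_complex, 'k, 1) atlas" where
  "scalar_atlas = {(UNIV, \<lambda>t. \<chi> i. t)}"

definition prod_atlas ::
    "('x, 'k, 'n::finite) atlas \<Rightarrow> ('y, 'k, 'l::finite) atlas \<Rightarrow> ('x \<times> 'y, 'k, 'n + 'l) atlas" where
  "prod_atlas A B =
     {(U \<times> V, \<lambda>(x, y). \<chi> i. case i of Inl a \<Rightarrow> \<phi> x $ a | Inr b \<Rightarrow> \<psi> y $ b) | U \<phi> V \<psi>.
        (U, \<phi>) \<in> A \<and> (V, \<psi>) \<in> B}"

text \<open>A tangent vector at \<open>x\<close> is a directional derivative in a chart, acting on germs of smooth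
  functions; it is normalised to \<open>0\<close> on functions that are not smooth near \<open>x\<close>.\<close>

definition tangent_space ::
    "('x::topological_space, 'k::real_or_complex, 'n::finite) atlas \<Rightarrow> 'x \<Rightarrow> (('x \<Rightarrow> 'k) \<Rightarrow> 'k) set" where
  "tangent_space A x =
     {v. \<exists>(U, \<phi>)\<in>A. x \<in> U \<and>
        (\<exists>w. v = (\<lambda>f. if smooth_near A x f
                      then deriv (\<lambda>t. f (inv_into U \<phi> (\<phi> x + t *s w))) 0 else 0))}"

definition pushforward ::
    "('y::topological_space, 'k::real_or_complex, 'n::finite) atlas \<Rightarrow> ('x \<Rightarrow> 'y) \<Rightarrow> 'x \<Rightarrow>
     (('x \<Rightarrow> 'k) \<Rightarrow> 'k) \<Rightarrow> (('y \<Rightarrow> 'k) \<Rightarrow> 'k)" where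
  "pushforward B F x v = (\<lambda>f. if smooth_near B (F x) f then v (\<lambda>y. f (F y)) else 0)"

definition velocity ::
    "('x::topological_space, 'k::real_or_complex, 'n::finite) atlas \<Rightarrow> ('k \<Rightarrow> 'x) \<Rightarrow> (('x \<Rightarrow> 'k) \<Rightarrow> 'k)" where
  "velocity A c = (\<lambda>f. if smooth_near A (c 0) f then deriv (\<lambda>t. f (c t)) 0 else 0)"

definition smooth_vector_field ::
    "('x::topological_space, 'k::real_or_complex, 'n::finite) atlas \<Rightarrow> 'x set \<Rightarrow>
     ('x \<Rightarrow> ('x \<Rightarrow> 'k) \<Rightarrow> 'k) \<Rightarrow> bool" where
  "smooth_vector_field A U \<xi> \<longleftrightarrow>
     open U \<and> (\<forall>x\<in>U. \<xi> x \<in> tangent_space A x) \<and>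
     (\<forall>V f. V \<subseteq> U \<and> smooth_fun A V f \<longrightarrow> smooth_fun A V (\<lambda>x. \<xi> x f))"


section \<open>Lie algebras\<close>

text \<open>Finite-dimensional Lie algebras are given by a bracket on \<open>'k ^ 'n\<close>.\<close>

type_synonym ('k, 'n) bracket = "('k, 'n) vec \<Rightarrow> ('k, 'n) vec \<Rightarrow> ('k, 'n) vec"

definition bracket_span ::
    "('k::field, 'n::finite) bracket \<Rightarrow> ('k ^ 'n) set \<Rightarrow> ('k ^ 'n) set \<Rightarrow> ('k ^ 'n) set" where
  "bracket_span br a b = vec.span {br x y | x y. x \<in> a \<and> y \<in> b}"

definition lie_subalgebra :: "('k::field, 'n::finite) bracket \<Rightarrow> ('k ^ 'n) set \<Rightarrow> bool" where
  "lie_subalgebra br h \<longleftrightarrow> vec.subspace h \<and> (\<forall>x\<in>h. \<forall>y\<in>h. br x y \<in> h)"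

definition lie_ideal :: "('k::field, 'n::finite) bracket \<Rightarrow> ('k ^ 'n) set \<Rightarrow> ('k ^ 'n) set \<Rightarrow> bool" where
  "lie_ideal br h a \<longleftrightarrow> vec.subspace a \<and> a \<subseteq> h \<and> (\<forall>x\<in>h. \<forall>y\<in>a. br x y \<in> a)"

definition solvable :: "('k::field, 'n::finite) bracket \<Rightarrow> ('k ^ 'n) set \<Rightarrow> bool" where
  "solvable br h \<longleftrightarrow> (\<exists>r. ((\<lambda>a. bracket_span br a a) ^^ r) h = {0})"

definition nilpotent :: "('k::field, 'n::finite) bracket \<Rightarrow> ('k ^ 'n) set \<Rightarrow> bool" where
  "nilpotent br h \<longleftrightarrow> (\<exists>r. ((\<lambda>a. bracket_span br h a) ^^ r) h = {0})"

definition semisimple :: "('k::field, 'n::finite) bracket \<Rightarrow> bool" where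
  "semisimple br \<longleftrightarrow> (\<forall>a. lie_ideal br UNIV a \<and> solvable br a \<longrightarrow> a = {0})"

text \<open>The largest nilpotent ideal, i.e. the sum of all nilpotent ideals.\<close>

definition nilradical :: "('k::field, 'n::finite) bracket \<Rightarrow> ('k ^ 'n) set \<Rightarrow> ('k ^ 'n) set" where
  "nilradical br h = vec.span (\<Union>{a. lie_ideal br h a \<and> nilpotent br a})"

definition borel_subalgebra :: "('k::field, 'n::finite) bracket \<Rightarrow> ('k ^ 'n) set \<Rightarrow> bool" where
  "borel_subalgebra br b \<longleftrightarrow>
     lie_subalgebra br b \<and> solvable br b \<and>
     (\<forall>b'. lie_subalgebra br b' \<and> solvable br b' \<and> b \<subseteq> b' \<longrightarrow> b' = b)"

definition vec_to_complex :: "('k::real_or_complex) ^ 'n \<Rightarrow> complex ^ 'n" where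
  "vec_to_complex x = (\<chi> i. to_complex (x $ i))"

text \<open>Extension of scalars to \<open>\<complex>\<close> over the ground field, through the structure constants:
  the complexification if \<open>'k\<close> is \<open>\<real>\<close>, and the algebra itself if \<open>'k\<close> is \<open>\<complex>\<close>.\<close>

definition complexified_bracket ::
    "('k::real_or_complex, 'n::finite) bracket \<Rightarrow> (complex, 'n) bracket" where
  "complexified_bracket br X Y =
     (\<Sum>i\<in>UNIV. \<Sum>j\<in>UNIV. (X $ i * Y $ j) *s vec_to_complex (br (axis i 1) (axis j 1)))"

text \<open>A parabolic subalgebra of a complex Lie algebra contains a Borel subalgebra; in the real case
  this is required after complexification.\<close>

definition parabolic_subalgebra ::
    "('k::real_or_complex, 'n::finite) bracket \<Rightarrow> ('k ^ 'n) set \<Rightarrow> bool" where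
  "parabolic_subalgebra br p \<longleftrightarrow>
     lie_subalgebra br p \<and>
     (\<exists>b. borel_subalgebra (complexified_bracket br) b \<and> b \<subseteq> vec.span (vec_to_complex ` p))"

definition killing_form :: "('k::field, 'n::finite) bracket \<Rightarrow> 'k ^ 'n \<Rightarrow> 'k ^ 'n \<Rightarrow> 'k" where
  "killing_form br X Y = trace (matrix (\<lambda>Z. br X (br Y Z)))"


section \<open>Lie groups and nested parabolics\<close>

text \<open>\<open>lie_tangent\<close> identifies the coordinate space \<open>'k ^ 'n\<close> underlying the Lie algebra with the
  tangent space of the group at the neutral element.\<close>

record ('g, 'k, 'n::finite) lie_group = "'g monoid" +
  lie_atlas :: "('g, 'k, 'n) atlas"
  lie_tangent :: "('k, 'n) vec \<Rightarrow> ('g \<Rightarrow> 'k) \<Rightarrow> 'k"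

definition lie_group ::
    "('g::topological_space, 'k::real_or_complex, 'n::finite, 'z) lie_group_scheme \<Rightarrow> bool" where
  "lie_group G \<longleftrightarrow>
     group G \<and> carrier G = UNIV \<and> manifold (lie_atlas G) \<and>
     smooth_map (prod_atlas (lie_atlas G) (lie_atlas G)) (lie_atlas G) UNIV (\<lambda>(g, h). g \<otimes>\<^bsub>G\<^esub> h) \<and>
     smooth_map (lie_atlas G) (lie_atlas G) UNIV (m_inv G) \<and>
     bij_betw (lie_tangent G) UNIV (tangent_space (lie_atlas G) \<one>\<^bsub>G\<^esub>) \<and>
     (\<forall>X Y f. lie_tangent G (X + Y) f = lie_tangent G X f + lie_tangent G Y f) \<and>
     (\<forall>c X f. lie_tangent G (c *s X) f = c * lie_tangent G X f)"

text \<open>The commutator at the neutral element of the left-invariant vector fields with values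
  \<open>X\<close> and \<open>Y\<close> there.\<close>

definition lie_bracket ::
    "('g::topological_space, 'k::real_or_complex, 'n::finite, 'z) lie_group_scheme \<Rightarrow> ('k, 'n) bracket" where
  "lie_bracket G X Y =
     inv_into UNIV (lie_tangent G)
       (\<lambda>f. if smooth_near (lie_atlas G) \<one>\<^bsub>G\<^esub> f
            then lie_tangent G X (\<lambda>g. lie_tangent G Y (\<lambda>h. f (g \<otimes>\<^bsub>G\<^esub> h)))
               - lie_tangent G Y (\<lambda>g. lie_tangent G X (\<lambda>h. f (g \<otimes>\<^bsub>G\<^esub> h)))
            else 0)"

definition Ad ::
    "('g::topological_space, 'k::real_or_complex, 'n::finite, 'z) lie_group_scheme \<Rightarrow> 'g \<Rightarrow>
     'k ^ 'n \<Rightarrow> 'k ^ 'n" where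
  "Ad G g X =
     inv_into UNIV (lie_tangent G)
       (pushforward (lie_atlas G) (\<lambda>h. g \<otimes>\<^bsub>G\<^esub> h \<otimes>\<^bsub>G\<^esub> m_inv G g) \<one>\<^bsub>G\<^esub> (lie_tangent G X))"

text \<open>\<open>\<gamma>\<close> is the curve \<open>t \<mapsto> exp (t X)\<close>.\<close>

definition one_parameter_subgroup ::
    "('g::topological_space, 'k::real_or_complex, 'n::finite, 'z) lie_group_scheme \<Rightarrow> 'k ^ 'n \<Rightarrow>
     ('k \<Rightarrow> 'g) \<Rightarrow> bool" where
  "one_parameter_subgroup G X \<gamma> \<longleftrightarrow>
     smooth_map scalar_atlas (lie_atlas G) UNIV \<gamma> \<and>
     (\<forall>s t. \<gamma> (s + t) = \<gamma> s \<otimes>\<^bsub>G\<^esub> \<gamma> t) \<and>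
     velocity (lie_atlas G) \<gamma> = lie_tangent G X"

definition exp_image ::
    "('g::topological_space, 'k::real_or_complex, 'n::finite, 'z) lie_group_scheme \<Rightarrow> ('k ^ 'n) set \<Rightarrow>
     'g set" where
  "exp_image G S = {\<gamma> 1 | \<gamma> X. X \<in> S \<and> one_parameter_subgroup G X \<gamma>}"

text \<open>The Lie algebra of a closed subgroup \<open>H\<close>.\<close>

definition lie_algebra_of ::
    "('g::topological_space, 'k::real_or_complex, 'n::finite, 'z) lie_group_scheme \<Rightarrow> 'g set \<Rightarrow>
     ('k ^ 'n) set" where
  "lie_algebra_of G H = {X. \<exists>\<gamma>. one_parameter_subgroup G X \<gamma> \<and> range \<gamma> \<subseteq> H}"

definition normalizer_in ::
    "('g::topological_space, 'k::real_or_complex, 'n::finite, 'z) lie_group_scheme \<Rightarrow> 'g set \<Rightarrow>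
     ('k ^ 'n) set \<Rightarrow> 'g set" where
  "normalizer_in G H S = {g \<in> H. Ad G g ` S = S}"

text \<open>A parabolic subgroup for the parabolic subalgebra \<open>p\<close> lies between the normalizer of \<open>p\<close>
  and its identity component.\<close>

definition parabolic_subgroup ::
    "('g::topological_space, 'k::real_or_complex, 'n::finite, 'z) lie_group_scheme \<Rightarrow> ('k ^ 'n) set \<Rightarrow>
     'g set \<Rightarrow> bool" where
  "parabolic_subgroup G p P \<longleftrightarrow>
     subgroup P G \<and> P \<subseteq> normalizer_in G UNIV p \<and>
     connected_component_set (normalizer_in G UNIV p) \<one>\<^bsub>G\<^esub> \<subseteq> P \<and>
     lie_algebra_of G P = p"

record ('g, 'k, 'n::finite) nested_parabolics = "('g, 'k, 'n) lie_group" +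
  alg_p :: "('k, 'n) vec set"
  alg_q :: "('k, 'n) vec set"
  grp_P :: "'g set"

definition grp_Q ::
    "('g::topological_space, 'k::real_or_complex, 'n::finite, 'z) nested_parabolics_scheme \<Rightarrow> 'g set" where
  "grp_Q G = normalizer_in G (grp_P G) (alg_q G)"

definition p_plus ::
    "('g::topological_space, 'k::real_or_complex, 'n::finite, 'z) nested_parabolics_scheme \<Rightarrow>
     ('k ^ 'n) set" where
  "p_plus G = nilradical (lie_bracket G) (alg_p G)"

definition q_plus ::
    "('g::topological_space, 'k::real_or_complex, 'n::finite, 'z) nested_parabolics_scheme \<Rightarrow>
     ('k ^ 'n) set" where
  "q_plus G = nilradical (lie_bracket G) (alg_q G)"

definition nested_parabolics ::
    "('g::topological_space, 'k::real_or_complex, 'n::finite, 'z) nested_parabolics_scheme \<Rightarrow> bool" where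
  "nested_parabolics G \<longleftrightarrow>
     lie_group G \<and> semisimple (lie_bracket G) \<and>
     parabolic_subalgebra (lie_bracket G) (alg_p G) \<and>
     parabolic_subalgebra (lie_bracket G) (alg_q G) \<and>
     alg_q G \<subseteq> alg_p G \<and>
     parabolic_subgroup G (alg_p G) (grp_P G) \<and>
     lie_algebra_of G (grp_Q G) = alg_q G"


section \<open>Parabolic geometries of type \<open>(G, Q)\<close>\<close>

text \<open>\<open>conn u\<close> is the Cartan connection on the tangent space of the total space at \<open>u\<close>. Its model
  space \<open>'k ^ 'n\<close> is also that of the charts of the total space, whose dimension is forced to be
  that of \<open>G\<close>. Only the values \<open>act u g\<close> with \<open>g \<in> Q\<close> matter.\<close>

record ('e, 'm, 'g, 'k, 'n::finite, 'b::finite) cartan_geometry =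
  tot_atlas :: "('e, 'k, 'n) atlas"
  base_atlas :: "('m, 'k, 'b) atlas"
  proj :: "'e \<Rightarrow> 'm"
  act :: "'e \<Rightarrow> 'g \<Rightarrow> 'e"
  conn :: "'e \<Rightarrow> (('e \<Rightarrow> 'k) \<Rightarrow> 'k) \<Rightarrow> ('k, 'n) vec"

text \<open>In the local triviality condition, \<open>\<Phi>\<close> is the group component of a trivialisation and
  \<open>\<Psi>\<close> is its inverse.\<close>

definition principal_bundle ::
    "('g::topological_space, 'k::real_or_complex, 'n::finite, 'z) nested_parabolics_scheme \<Rightarrow>
     ('e::topological_space, 'm::topological_space, 'g, 'k, 'n, 'b::finite, 'y) cartan_geometry_scheme \<Rightarrow>
     bool" where
  "principal_bundle G M \<longleftrightarrow>
     manifold (tot_atlas M) \<and> manifold (base_atlas M) \<and>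
     smooth_map (tot_atlas M) (base_atlas M) UNIV (proj M) \<and>
     (\<forall>u. act M u \<one>\<^bsub>G\<^esub> = u) \<and>
     (\<forall>u. \<forall>g\<in>grp_Q G. \<forall>h\<in>grp_Q G. act M u (g \<otimes>\<^bsub>G\<^esub> h) = act M (act M u g) h) \<and>
     smooth_map_on_subset (prod_atlas (tot_atlas M) (lie_atlas G)) (tot_atlas M)
       (UNIV \<times> grp_Q G) (\<lambda>(u, g). act M u g) \<and>
     (\<forall>u. \<forall>g\<in>grp_Q G. proj M (act M u g) = proj M u) \<and>
     (\<forall>x. \<exists>U \<Phi> \<Psi>. open U \<and> x \<in> U \<and>
        smooth_map (tot_atlas M) (lie_atlas G) (proj M -` U) \<Phi> \<and>
        smooth_map_on_subset (prod_atlas (base_atlas M) (lie_atlas G)) (tot_atlas M) (U \<times> grp_Q G) \<Psi> \<and>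
        (\<forall>u\<in>proj M -` U. \<Phi> u \<in> grp_Q G \<and> \<Psi> (proj M u, \<Phi> u) = u) \<and>
        (\<forall>y\<in>U. \<forall>g\<in>grp_Q G. proj M (\<Psi> (y, g)) = y \<and> \<Phi> (\<Psi> (y, g)) = g) \<and>
        (\<forall>u\<in>proj M -` U. \<forall>g\<in>grp_Q G. \<Phi> (act M u g) = \<Phi> u \<otimes>\<^bsub>G\<^esub> g))"

definition cartan_connection ::
    "('g::topological_space, 'k::real_or_complex, 'n::finite, 'z) nested_parabolics_scheme \<Rightarrow>
     ('e::topological_space, 'm::topological_space, 'g, 'k, 'n, 'b::finite, 'y) cartan_geometry_scheme \<Rightarrow>
     bool" where
  "cartan_connection G M \<longleftrightarrow>
     (\<forall>u. bij_betw (conn M u) (tangent_space (tot_atlas M) u) UNIV) \<and>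
     (\<forall>u. \<forall>v\<in>tangent_space (tot_atlas M) u. \<forall>w\<in>tangent_space (tot_atlas M) u.
        conn M u (\<lambda>f. v f + w f) = conn M u v + conn M u w) \<and>
     (\<forall>u c. \<forall>v\<in>tangent_space (tot_atlas M) u. conn M u (\<lambda>f. c * v f) = c *s conn M u v) \<and>
     (\<forall>U \<xi>. smooth_vector_field (tot_atlas M) U \<xi> \<longrightarrow>
        smooth_map (tot_atlas M) vec_atlas U (\<lambda>u. conn M u (\<xi> u))) \<and>
     (\<forall>u. \<forall>g\<in>grp_Q G. \<forall>v\<in>tangent_space (tot_atlas M) u.
        conn M (act M u g) (pushforward (tot_atlas M) (\<lambda>u'. act M u' g) u v)
          = Ad G (m_inv G g) (conn M u v)) \<and>
     (\<forall>u. \<forall>X\<in>alg_q G. \<forall>\<gamma>. one_parameter_subgroup G X \<gamma> \<and> range \<gamma> \<subseteq> grp_Q G \<longrightarrow>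
        conn M u (velocity (tot_atlas M) (\<lambda>t. act M u (\<gamma> t))) = X)"

definition parabolic_geometry ::
    "('g::topological_space, 'k::real_or_complex, 'n::finite, 'z) nested_parabolics_scheme \<Rightarrow>
     ('e::topological_space, 'm::topological_space, 'g, 'k, 'n, 'b::finite, 'y) cartan_geometry_scheme \<Rightarrow>
     bool" where
  "parabolic_geometry G M \<longleftrightarrow> principal_bundle G M \<and> cartan_connection G M"


section \<open>Relative natural bundles\<close>

definition Q_representation ::
    "('g::topological_space, 'k::real_or_complex, 'n::finite, 'z) nested_parabolics_scheme \<Rightarrow>
     ('g \<Rightarrow> 'k ^ 'w \<Rightarrow> 'k ^ 'w) \<Rightarrow> bool" where
  "Q_representation G \<rho> \<longleftrightarrow>
     (\<forall>g\<in>grp_Q G. Vector_Spaces.linear (*s) (*s) (\<rho> g)) \<and>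
     \<rho> \<one>\<^bsub>G\<^esub> = id \<and>
     (\<forall>g\<in>grp_Q G. \<forall>h\<in>grp_Q G. \<rho> (g \<otimes>\<^bsub>G\<^esub> h) = \<rho> g \<circ> \<rho> h) \<and>
     (\<forall>w. smooth_map_on_subset (lie_atlas G) vec_atlas (grp_Q G) (\<lambda>g. \<rho> g w))"

definition relative_representation ::
    "('g::topological_space, 'k::real_or_complex, 'n::finite, 'z) nested_parabolics_scheme \<Rightarrow>
     ('g \<Rightarrow> 'k ^ 'w \<Rightarrow> 'k ^ 'w) \<Rightarrow> bool" where
  "relative_representation G \<rho> \<longleftrightarrow>
     Q_representation G \<rho> \<and> (\<forall>h\<in>exp_image G (p_plus G). \<rho> h = id)"

definition completely_reducible ::
    "('g::topological_space, 'k::real_or_complex, 'n::finite, 'z) nested_parabolics_scheme \<Rightarrow>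
     ('g \<Rightarrow> 'k ^ 'w \<Rightarrow> 'k ^ 'w) \<Rightarrow> bool" where
  "completely_reducible G \<rho> \<longleftrightarrow>
     (let invariant = (\<lambda>S. vec.subspace S \<and> (\<forall>g\<in>grp_Q G. \<rho> g ` S \<subseteq> S)) in
      \<forall>S. invariant S \<longrightarrow> (\<exists>T. invariant T \<and> S \<inter> T = {0} \<and> {x + y | x y. x \<in> S \<and> y \<in> T} = UNIV))"

text \<open>The action of \<open>X \<in> q\<close>: the derivative at \<open>0\<close> of \<open>t \<mapsto> \<rho> (exp (t X)) w\<close>.\<close>

definition inf_rep ::
    "('g::topological_space, 'k::real_or_complex, 'n::finite, 'z) nested_parabolics_scheme \<Rightarrow>
     ('g \<Rightarrow> 'k ^ 'w \<Rightarrow> 'k ^ 'w) \<Rightarrow> 'k ^ 'n \<Rightarrow> 'k ^ 'w \<Rightarrow> 'k ^ 'w" where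
  "inf_rep G \<rho> X w =
     (THE y. \<exists>\<gamma>. one_parameter_subgroup G X \<gamma> \<and> range \<gamma> \<subseteq> grp_Q G \<and>
        (\<forall>j. ((\<lambda>t. \<rho> (\<gamma> t) w $ j) has_field_derivative y $ j) (at 0)))"

text \<open>Sections over \<open>U\<close> of the bundle associated to \<open>\<rho>\<close>, as \<open>Q\<close>-equivariant functions on
  the preimage of \<open>U\<close>; the values elsewhere are irrelevant.\<close>

definition E_sections ::
    "('g::topological_space, 'k::real_or_complex, 'n::finite, 'z) nested_parabolics_scheme \<Rightarrow>
     ('e::topological_space, 'm::topological_space, 'g, 'k, 'n, 'b::finite, 'y) cartan_geometry_scheme \<Rightarrow>
     ('g \<Rightarrow> 'k ^ 'w \<Rightarrow> 'k ^ 'w) \<Rightarrow> 'm set \<Rightarrow> ('e \<Rightarrow> 'k ^ 'w) set" where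
  "E_sections G M \<rho> U =
     {\<sigma>. smooth_map (tot_atlas M) vec_atlas (proj M -` U) \<sigma> \<and>
         (\<forall>u\<in>proj M -` U. \<forall>g\<in>grp_Q G. \<sigma> (act M u g) = \<rho> (m_inv G g) (\<sigma> u))}"


section \<open>The relative adjoint tractor bundle\<close>

text \<open>Elements of \<open>p / p_plus\<close> are cosets. Operations are computed on representatives.\<close>

definition coset ::
    "('g::topological_space, 'k::real_or_complex, 'n::finite, 'z) nested_parabolics_scheme \<Rightarrow>
     'k ^ 'n \<Rightarrow> ('k ^ 'n) set" where
  "coset G X = {X + Z | Z. Z \<in> p_plus G}"

definition rep :: "('k ^ 'n) set \<Rightarrow> 'k ^ 'n" where
  "rep C = (SOME X. X \<in> C)"

definition coset_bracket ::
    "('g::topological_space, 'k::real_or_complex, 'n::finite, 'z) nested_parabolics_scheme \<Rightarrow>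
     ('k ^ 'n) set \<Rightarrow> ('k ^ 'n) set \<Rightarrow> ('k ^ 'n) set" where
  "coset_bracket G C D = coset G (lie_bracket G (rep C) (rep D))"

definition coset_B ::
    "('g::topological_space, 'k::real_or_complex, 'n::finite, 'z) nested_parabolics_scheme \<Rightarrow>
     ('k ^ 'n) set \<Rightarrow> ('k ^ 'n) set \<Rightarrow> 'k" where
  "coset_B G C D = killing_form (lie_bracket G) (rep C) (rep D)"

definition quotient_basis ::
    "('g::topological_space, 'k::real_or_complex, 'n::finite, 'z) nested_parabolics_scheme \<Rightarrow>
     'j set \<Rightarrow> ('j \<Rightarrow> ('k ^ 'n) set) \<Rightarrow> bool" where
  "quotient_basis G J e \<longleftrightarrow>
     finite J \<and> (\<forall>a\<in>J. e a \<in> coset G ` alg_p G) \<and>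
     (\<forall>X\<in>alg_p G. \<exists>c. X - (\<Sum>a\<in>J. c a *s rep (e a)) \<in> p_plus G) \<and>
     (\<forall>c. (\<Sum>a\<in>J. c a *s rep (e a)) \<in> p_plus G \<longrightarrow> (\<forall>a\<in>J. c a = 0))"

text \<open>\<open>B\<^sup>-\<^sup>1 \<otimes> id\<close> applied to a bilinear map \<open>\<beta>\<close> on \<open>p / p_plus\<close> with values in the
  representation space. In terms of any basis \<open>e\<close>, the matrix \<open>c\<close> of the inverse form \<open>B\<^sup>-\<^sup>1\<close>
  with respect to the dual basis is the inverse of the Gram matrix of \<open>B\<close>.\<close>

definition B_inv_contract ::
    "('g::topological_space, 'k::real_or_complex, 'n::finite, 'z) nested_parabolics_scheme \<Rightarrow>
     (('k ^ 'n) set \<Rightarrow> ('k ^ 'n) set \<Rightarrow> 'k ^ 'w) \<Rightarrow> 'k ^ 'w" where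
  "B_inv_contract G \<beta> =
     (THE y. \<exists>(d::nat) e c. quotient_basis G {..<d} e \<and>
        (\<forall>a<d. \<forall>b<d. (\<Sum>k<d. c a k * coset_B G (e k) (e b)) = (if a = b then 1 else 0)) \<and>
        y = (\<Sum>a<d. \<Sum>b<d. c a b *s \<beta> (e a) (e b)))"

text \<open>Sections over \<open>U\<close> of the bundle associated to \<open>p / p_plus\<close>; smoothness means that there is a
  smooth lift to \<open>p\<close>.\<close>

definition A_sections ::
    "('g::topological_space, 'k::real_or_complex, 'n::finite, 'z) nested_parabolics_scheme \<Rightarrow>
     ('e::topological_space, 'm::topological_space, 'g, 'k, 'n, 'b::finite, 'y) cartan_geometry_scheme \<Rightarrow>
     'm set \<Rightarrow> ('e \<Rightarrow> ('k ^ 'n) set) set" where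
  "A_sections G M U =
     {s. (\<exists>s'. smooth_map (tot_atlas M) vec_atlas (proj M -` U) s' \<and>
            (\<forall>u\<in>proj M -` U. s' u \<in> alg_p G \<and> s u = coset G (s' u))) \<and>
         (\<forall>u\<in>proj M -` U. \<forall>g\<in>grp_Q G. s (act M u g) = Ad G (m_inv G g) ` s u)}"

definition A0_sections ::
    "('g::topological_space, 'k::real_or_complex, 'n::finite, 'z) nested_parabolics_scheme \<Rightarrow>
     ('e::topological_space, 'm::topological_space, 'g, 'k, 'n, 'b::finite, 'y) cartan_geometry_scheme \<Rightarrow>
     'm set \<Rightarrow> ('e \<Rightarrow> ('k ^ 'n) set) set" where
  "A0_sections G M U = {s \<in> A_sections G M U. \<forall>u\<in>proj M -` U. s u \<in> coset G ` alg_q G}"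

definition A1_sections ::
    "('g::topological_space, 'k::real_or_complex, 'n::finite, 'z) nested_parabolics_scheme \<Rightarrow>
     ('e::topological_space, 'm::topological_space, 'g, 'k, 'n, 'b::finite, 'y) cartan_geometry_scheme \<Rightarrow>
     'm set \<Rightarrow> ('e \<Rightarrow> ('k ^ 'n) set) set" where
  "A1_sections G M U = {s \<in> A_sections G M U. \<forall>u\<in>proj M -` U. s u \<in> coset G ` q_plus G}"

definition algebraic_bracket ::
    "('g::topological_space, 'k::real_or_complex, 'n::finite, 'z) nested_parabolics_scheme \<Rightarrow>
     ('e \<Rightarrow> ('k ^ 'n) set) \<Rightarrow> ('e \<Rightarrow> ('k ^ 'n) set) \<Rightarrow> ('e \<Rightarrow> ('k ^ 'n) set)" where
  "algebraic_bracket G s t = (\<lambda>u. coset_bracket G (s u) (t u))"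

text \<open>The operation \<open>s \<bullet> \<sigma>\<close>, for \<open>s\<close> with values in \<open>q / p_plus\<close>.\<close>

definition bullet ::
    "('g::topological_space, 'k::real_or_complex, 'n::finite, 'z) nested_parabolics_scheme \<Rightarrow>
     ('g \<Rightarrow> 'k ^ 'w \<Rightarrow> 'k ^ 'w) \<Rightarrow> ('e \<Rightarrow> ('k ^ 'n) set) \<Rightarrow> ('e \<Rightarrow> 'k ^ 'w) \<Rightarrow> ('e \<Rightarrow> 'k ^ 'w)" where
  "bullet G \<rho> s \<sigma> = (\<lambda>u. inf_rep G \<rho> (rep (s u)) (\<sigma> u))"

definition local_frame ::
    "('g::topological_space, 'k::real_or_complex, 'n::finite, 'z) nested_parabolics_scheme \<Rightarrow>
     ('e::topological_space, 'm::topological_space, 'g, 'k, 'n, 'b::finite, 'y) cartan_geometry_scheme \<Rightarrow>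
     'm set \<Rightarrow> 'j set \<Rightarrow> ('j \<Rightarrow> 'e \<Rightarrow> ('k ^ 'n) set) \<Rightarrow> bool" where
  "local_frame G M U J F \<longleftrightarrow>
     open U \<and> (\<forall>a\<in>J. F a \<in> A_sections G M U) \<and>
     (\<forall>u\<in>proj M -` U. quotient_basis G J (\<lambda>a. F a u))"

definition dual_frames ::
    "('g::topological_space, 'k::real_or_complex, 'n::finite, 'z) nested_parabolics_scheme \<Rightarrow>
     ('e::topological_space, 'm::topological_space, 'g, 'k, 'n, 'b::finite, 'y) cartan_geometry_scheme \<Rightarrow>
     'm set \<Rightarrow> 'j set \<Rightarrow> ('j \<Rightarrow> 'e \<Rightarrow> ('k ^ 'n) set) \<Rightarrow> ('j \<Rightarrow> 'e \<Rightarrow> ('k ^ 'n) set) \<Rightarrow> bool" where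
  "dual_frames G M U J F F' \<longleftrightarrow>
     local_frame G M U J F \<and> local_frame G M U J F' \<and>
     (\<forall>u\<in>proj M -` U. \<forall>a\<in>J. \<forall>b\<in>J. coset_B G (F a u) (F' b u) = (if a = b then 1 else 0))"

text \<open>A frame \<open>{X\<^sub>i, A\<^sub>r, Z\<^sup>i}\<close> with \<open>i < m\<close> and \<open>r < l\<close> is indexed by \<open>frame_index m l\<close>.\<close>

definition frame_index :: "nat \<Rightarrow> nat \<Rightarrow> ((nat + nat) + nat) set" where
  "frame_index m l = ({..<m} <+> {..<l}) <+> {..<m}"

definition frame_of :: "(nat \<Rightarrow> 'a) \<Rightarrow> (nat \<Rightarrow> 'a) \<Rightarrow> (nat \<Rightarrow> 'a) \<Rightarrow> (nat + nat) + nat \<Rightarrow> 'a" where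
  "frame_of X A Z = case_sum (case_sum X A) Z"

definition adapted_frame ::
    "('g::topological_space, 'k::real_or_complex, 'n::finite, 'z) nested_parabolics_scheme \<Rightarrow>
     ('e::topological_space, 'm::topological_space, 'g, 'k, 'n, 'b::finite, 'y) cartan_geometry_scheme \<Rightarrow>
     'm set \<Rightarrow> nat \<Rightarrow> nat \<Rightarrow> (nat \<Rightarrow> 'e \<Rightarrow> ('k ^ 'n) set) \<Rightarrow> (nat \<Rightarrow> 'e \<Rightarrow> ('k ^ 'n) set) \<Rightarrow>
     (nat \<Rightarrow> 'e \<Rightarrow> ('k ^ 'n) set) \<Rightarrow> bool" where
  "adapted_frame G M U m l X A Z \<longleftrightarrow>
     local_frame G M U (frame_index m l) (frame_of X A Z) \<and>
     (\<forall>i<m. Z i \<in> A1_sections G M U) \<and>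
     (\<forall>r<l. A r \<in> A0_sections G M U) \<and>
     (\<forall>u\<in>proj M -` U.
        (\<forall>i<m. \<forall>j<m. coset_B G (X i u) (X j u) = 0) \<and>
        (\<forall>i<m. \<forall>r<l. coset_B G (A r u) (X i u) = 0) \<and>
        (\<forall>i<m. \<forall>j<m. coset_B G (X i u) (Z j u) = (if i = j then 1 else 0))) \<and>
     (\<forall>i<m. algebraic_bracket G (Z i) (X i) \<in> A0_sections G M U)"


section \<open>The relative fundamental derivative and the relative curved Casimir operator\<close>

text \<open>The derivative of \<open>\<sigma>\<close> along the vector field on the total space that corresponds to
  the function \<open>X\<close> under the Cartan connection.\<close>

definition fund_deriv ::
    "('e::topological_space, 'm::topological_space, 'g, 'k::real_or_complex, 'n::finite, 'b::finite, 'y)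
       cartan_geometry_scheme \<Rightarrow>
     ('e \<Rightarrow> 'k ^ 'n) \<Rightarrow> ('e \<Rightarrow> 'k ^ 'w) \<Rightarrow> ('e \<Rightarrow> 'k ^ 'w)" where
  "fund_deriv M X \<sigma> =
     (\<lambda>u. \<chi> j. inv_into (tangent_space (tot_atlas M) u) (conn M u) (X u) (\<lambda>u'. \<sigma> u' $ j))"

text \<open>The value at \<open>u\<close> depends on the lift of \<open>s\<close> only through its value at \<open>u\<close>, so lifts can be
  chosen pointwise.\<close>

definition D_rho ::
    "('e::topological_space, 'm::topological_space, 'g, 'k::real_or_complex, 'n::finite, 'b::finite, 'y)
       cartan_geometry_scheme \<Rightarrow>
     ('e \<Rightarrow> ('k ^ 'n) set) \<Rightarrow> ('e \<Rightarrow> 'k ^ 'w) \<Rightarrow> ('e \<Rightarrow> 'k ^ 'w)" where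
  "D_rho M s \<sigma> = fund_deriv M (\<lambda>u. rep (s u)) \<sigma>"

text \<open>\<open>D\<^sup>\<rho>\<sigma>\<close> as the equivariant function with values in linear maps on \<open>p / p_plus\<close>. Since
  evaluation of a linear map at a fixed coset is linear, the fundamental derivative of a function with
  values in linear maps is formed by fixing the argument; this yields \<open>D\<^sup>\<rho>D\<^sup>\<rho>\<sigma>\<close>, with the newer
  differentiation in the first slot.\<close>

definition D_rho_total ::
    "('e::topological_space, 'm::topological_space, 'g, 'k::real_or_complex, 'n::finite, 'b::finite, 'y)
       cartan_geometry_scheme \<Rightarrow>
     ('e \<Rightarrow> 'k ^ 'w) \<Rightarrow> 'e \<Rightarrow> ('k ^ 'n) set \<Rightarrow> 'k ^ 'w" where
  "D_rho_total M \<sigma> u C = D_rho M (\<lambda>_. C) \<sigma> u"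

definition D_rho_D_rho ::
    "('e::topological_space, 'm::topological_space, 'g, 'k::real_or_complex, 'n::finite, 'b::finite, 'y)
       cartan_geometry_scheme \<Rightarrow>
     ('e \<Rightarrow> 'k ^ 'w) \<Rightarrow> 'e \<Rightarrow> ('k ^ 'n) set \<Rightarrow> ('k ^ 'n) set \<Rightarrow> 'k ^ 'w" where
  "D_rho_D_rho M \<sigma> u C C' = D_rho_total M (\<lambda>u'. D_rho_total M \<sigma> u' C') u C"

definition relative_casimir ::
    "('g::topological_space, 'k::real_or_complex, 'n::finite, 'z) nested_parabolics_scheme \<Rightarrow>
     ('e::topological_space, 'm::topological_space, 'g, 'k, 'n, 'b::finite, 'y) cartan_geometry_scheme \<Rightarrow>
     ('e \<Rightarrow> 'k ^ 'w) \<Rightarrow> ('e \<Rightarrow> 'k ^ 'w)" where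
  "relative_casimir G M \<sigma> = (\<lambda>u. B_inv_contract G (D_rho_D_rho M \<sigma> u))"


section \<open>Differential operators\<close>

text \<open>All iterated directional derivatives of \<open>f\<close> of order at most \<open>k\<close> vanish at \<open>x\<close>.\<close>

primrec jet_vanishes :: "nat \<Rightarrow> ('k::real_or_complex ^ 'b \<Rightarrow> 'k) \<Rightarrow> 'k ^ 'b \<Rightarrow> bool" where
  "jet_vanishes 0 f x \<longleftrightarrow> f x = 0"
| "jet_vanishes (Suc k) f x \<longleftrightarrow>
     f x = 0 \<and> (\<forall>v. jet_vanishes k (\<lambda>y. deriv (\<lambda>t. f (y + t *s v)) 0) x)"

text \<open>The \<open>k\<close>-jet of a section of \<open>E\<close> vanishes at \<open>x\<close>, expressed in a chart \<open>\<phi>\<close> of the base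
  and the trivialisation of \<open>E\<close> given by a local section \<open>\<tau>\<close> of the principal bundle.\<close>

definition section_jet_vanishes ::
    "('e::topological_space, 'm::topological_space, 'g, 'k::real_or_complex, 'n::finite, 'b::finite, 'y)
       cartan_geometry_scheme \<Rightarrow>
     nat \<Rightarrow> ('e \<Rightarrow> 'k ^ 'w) \<Rightarrow> 'm \<Rightarrow> bool" where
  "section_jet_vanishes M k \<sigma> x \<longleftrightarrow>
     (\<exists>(V, \<phi>)\<in>base_atlas M. \<exists>N \<tau>. x \<in> V \<and> x \<in> N \<and>
        smooth_map (base_atlas M) (tot_atlas M) N \<tau> \<and> (\<forall>y\<in>N. proj M (\<tau> y) = y) \<and>
        (\<forall>j. jet_vanishes k (\<lambda>z. \<sigma> (\<tau> (inv_into V \<phi> z)) $ j) (\<phi> x)))"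

text \<open>Linear differential operators on \<open>E\<close> of order at most \<open>k\<close>: linear operators on (local)
  sections, whose value at a point depends only on the \<open>k\<close>-jet of the section at that point.\<close>

definition diff_operator_of_order_le ::
    "('g::topological_space, 'k::real_or_complex, 'n::finite, 'z) nested_parabolics_scheme \<Rightarrow>
     ('e::topological_space, 'm::topological_space, 'g, 'k, 'n, 'b::finite, 'y) cartan_geometry_scheme \<Rightarrow>
     ('g \<Rightarrow> 'k ^ 'w \<Rightarrow> 'k ^ 'w) \<Rightarrow> nat \<Rightarrow> (('e \<Rightarrow> 'k ^ 'w) \<Rightarrow> ('e \<Rightarrow> 'k ^ 'w)) \<Rightarrow> bool" where
  "diff_operator_of_order_le G M \<rho> k L \<longleftrightarrow>
     (\<forall>U. open U \<longrightarrow>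
        (\<forall>\<sigma>\<in>E_sections G M \<rho> U. L \<sigma> \<in> E_sections G M \<rho> U) \<and>
        (\<forall>\<sigma>\<in>E_sections G M \<rho> U. \<forall>\<tau>\<in>E_sections G M \<rho> U. \<forall>u\<in>proj M -` U.
           L (\<lambda>u'. \<sigma> u' + \<tau> u') u = L \<sigma> u + L \<tau> u) \<and>
        (\<forall>c. \<forall>\<sigma>\<in>E_sections G M \<rho> U. \<forall>u\<in>proj M -` U. L (\<lambda>u'. c *s \<sigma> u') u = c *s L \<sigma> u) \<and>
        (\<forall>\<sigma>\<in>E_sections G M \<rho> U. \<forall>u\<in>proj M -` U.
           section_jet_vanishes M k \<sigma> (proj M u) \<longrightarrow> L \<sigma> u = 0))"

end

theory Submission
  imports Defs "HOL-Computational_Algebra.Fundamental_Theorem_Algebra"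
begin

text \<open>An equivariant function is differentiated along the fibre in the direction \<open>X \<in> q\<close> by minus the
  infinitesimal action of \<open>X\<close>. Together with the equivariance of \<open>D \<sigma>\<close> this gives
  \<open>D\<^sub>X D\<^sub>Y \<sigma> = - X \<bullet> D\<^sub>Y \<sigma> + D\<^bsub>[X, Y]\<^esub> \<sigma>\<close> for \<open>X \<in> q\<close> and \<open>D\<^sub>X D\<^sub>Y \<sigma> = - Y \<bullet> D\<^sub>X \<sigma>\<close> for \<open>Y \<in> q\<close>.
  Since \<open>p_plus\<close> is the orthogonal complement of \<open>p\<close>, the contraction with \<open>B\<^sup>-\<^sup>1\<close> can be computed with any
  dual pair of systems in \<open>p\<close> modulo \<open>p_plus\<close>; an adapted frame and its dual give the formula. A basis adapted to
  \<open>p_plus \<subseteq> q_plus \<subseteq> q \<subseteq> p\<close> shows that the order is at most one. If the representation is completely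
  reducible, then \<open>q_plus\<close> acts by zero, and the only remaining derivative is in the direction of a sum of brackets
  which lies in \<open>q\<close>.

  That the nilradicals are the orthogonal complements of the parabolics, and act nilpotently in every representation
  of the latter, is reduced to the complexification. There a Borel subalgebra \<open>b\<close> satisfies \<open>b\<^sup>\<bottom> \<subseteq> [b, b]\<close>, by
  maximality, Lie's theorem and Cartan's criterion.\<close>

section \<open>Traces of endomorphisms over an arbitrary field\<close>

section \<open>Linear algebra\<close>

text \<open>The definitions offer no roots or gradings: a parabolic is known only to contain, after
  complexification, a maximal solvable subalgebra, and \<open>nilradical\<close> is just the span of
  the nilpotent ideals. Once \<open>nilradical\<close> is identified with \<open>perp\<close>, the
  inclusion of p_plus in q_plus, the ideal properties and the recovery of q from q_plus are formal
  duality for the Killing form. Quotient spaces are avoided throughout: eigenvectors and Lie's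
  theorem are stated modulo an invariant subspace, traces on a quotient are computed by coordinates.
  At a point of the total space, \<open>relative_casimir\<close> contracts a bilinear map on p, and
  constant elements of p stand in for local sections. This settles the order over every open set
  without constructing frames. Such a basis does not come with the bracket condition of an adapted
  frame, so in the order zero case the individual brackets are not controlled; only their sum is
  shown to lie in q, by a trace argument.\<close>

abbreviation lin :: "(('k::field) ^ 'a \<Rightarrow> 'k ^ 'b) \<Rightarrow> bool" where
  "lin f \<equiv> Vector_Spaces.linear (*s) (*s) f"

abbreviation (input) tr :: "(('k::field) ^ 'a \<Rightarrow> 'k ^ 'a) \<Rightarrow> 'k" where
  "tr f \<equiv> trace (matrix f)"

lemma linI:
  fixes f :: "('k::field) ^ 'a \<Rightarrow> 'k ^ 'b"
  assumes "\<And>x y. f (x + y) = f x + f y" "\<And>c x. f (c *s x) = c *s f x"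
  shows "lin f"
  unfolding Vector_Spaces.linear_iff
  by (intro conjI allI vec.vector_space_axioms assms)

lemmas lin_add = vec.linear_add and lin_scale = vec.linear_scale
  and lin_0 = vec.linear_0 and lin_sum = vec.linear_sum
  and lin_diff = vec.linear_diff and lin_neg = vec.linear_neg

lemma lin_comp: "lin f \<Longrightarrow> lin g \<Longrightarrow> lin (\<lambda>x. f (g x))"
  by (auto intro!: linI simp: lin_add lin_scale)

lemma lin_id: "lin (\<lambda>x. x)"
  by (auto intro!: linI)

lemma lin_funpow: "lin (f :: 'k::field ^ 'a \<Rightarrow> 'k ^ 'a) \<Longrightarrow> lin (f ^^ k)"
proof (induction k)
  case 0
  then show ?case by (auto intro!: linI)
next
  case (Suc k)
  then show ?case using lin_comp[of f "f ^^ k"] by (simp add: o_def)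
qed

lemma lin_shift: "lin T \<Longrightarrow> lin (\<lambda>v. T v - \<mu> *s v)"
  by (auto intro!: linI simp: lin_add lin_scale vec.scale_right_distrib vec.scale_right_diff_distrib)

lemma tr_alt: "tr f = (\<Sum>i\<in>UNIV. f (axis i 1) $ i)"
  by (simp add: trace_def matrix_def)

lemma tr_add: "tr (\<lambda>x. f x + g x) = tr f + tr g"
  by (simp add: tr_alt sum.distrib)

lemma tr_diff: "tr (\<lambda>x. f x - g x) = tr f - tr g"
  by (simp add: tr_alt sum_subtractf)

lemma tr_scale: "tr (\<lambda>x. c *s f x) = c * tr f"
  by (simp add: tr_alt sum_distrib_left)

lemma tr_comm:
  fixes f :: "('k::field) ^ 'a \<Rightarrow> 'k ^ 'a"
  assumes "lin f" "lin g"
  shows "tr (\<lambda>x. f (g x)) = tr (\<lambda>x. g (f x))"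
  using matrix_compose_gen[OF assms] matrix_compose_gen[OF assms(2,1)]
    trace_mul_sym[of "matrix f" "matrix g"] by (simp add: o_def)

text \<open>\<open>trace\<close> refers to the standard basis. Expanding the standard basis vectors
  in B, or the vectors T b in the standard basis, gives the same double sum in two orders.\<close>

lemma tr_basis:
  fixes T :: "('k::field) ^ 'a \<Rightarrow> 'k ^ 'a"
  assumes B: "vec.independent B" "vec.span B = UNIV" and T: "lin T"
  shows "tr T = (\<Sum>b\<in>B. vec.representation B (T b) b)"
proof -
  have fin: "finite B" using B(1) vec.finiteI_independent by blast
  have ex: "x = (\<Sum>b\<in>B. vec.representation B x b *s b)" for x
    using vec.sum_representation_eq[OF B(1) _ fin, of x] B by auto
  have "tr T = (\<Sum>i\<in>UNIV. T (axis i 1) $ i)" by (rule tr_alt)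
  also have "\<dots> = (\<Sum>i\<in>UNIV. \<Sum>b\<in>B. vec.representation B (axis i 1) b * T b $ i)"
  proof (rule sum.cong[OF refl])
    fix i :: 'a
    have "T (axis i 1) = (\<Sum>b\<in>B. vec.representation B (axis i 1) b *s T b)"
      by (subst ex[of "axis i 1"]) (simp add: lin_sum[OF T] lin_scale[OF T])
    then show "T (axis i 1) $ i = (\<Sum>b\<in>B. vec.representation B (axis i 1) b * T b $ i)"
      by simp
  qed
  also have "\<dots> = (\<Sum>b\<in>B. \<Sum>i\<in>UNIV. vec.representation B (axis i 1) b * T b $ i)"
    by (rule sum.swap)
  also have "\<dots> = (\<Sum>b\<in>B. vec.representation B (T b) b)"
  proof (rule sum.cong[OF refl])
    fix b
    have "T b = (\<Sum>i\<in>UNIV. T b $ i *s axis i 1)" by (simp add: basis_expansion)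
    then have "vec.representation B (T b) b = vec.representation B (\<Sum>i\<in>UNIV. T b $ i *s axis i 1) b" by simp
    also have "\<dots> = (\<Sum>i\<in>UNIV. T b $ i * vec.representation B (axis i 1) b)"
      using B by (subst vec.representation_sum) (auto simp: vec.representation_scale)
    finally show "(\<Sum>i\<in>UNIV. vec.representation B (axis i 1) b * T b $ i) = vec.representation B (T b) b"
      by (simp add: mult.commute)
  qed
  finally show ?thesis .
qed

text \<open>A basis is grown along the chain, starting from {0}. Each new vector is mapped into the
  span of the vectors chosen before it, so it never contributes a diagonal entry.\<close>

lemma tr_strict_chain:
  fixes T :: "('k::field) ^ 'a \<Rightarrow> 'k ^ 'a" and V :: "nat \<Rightarrow> ('k ^ 'a) set"
  assumes T: "lin T" and sub: "\<And>i. vec.subspace (V i)" and "V 0 = UNIV" "V N = {0}"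
    and mono: "\<And>i. V (Suc i) \<subseteq> V i" and step: "\<And>i. T ` V i \<subseteq> V (Suc i)"
  shows "tr T = 0"
proof -
  have "\<exists>B. vec.independent B \<and> vec.span B = V (N - i) \<and> (\<Sum>b\<in>B. vec.representation B (T b) b) = 0"
    if "i \<le> N" for i using that
  proof (induction i)
    case 0
    show ?case by (rule exI[of _ "{}"]) (simp add: assms vec.independent_empty)
  next
    case (Suc i)
    then obtain B where B: "vec.independent B" "vec.span B = V (N - i)"
      "(\<Sum>b\<in>B. vec.representation B (T b) b) = 0" by auto
    have NS: "N - i = Suc (N - Suc i)" using Suc.prems by auto
    have "B \<subseteq> V (N - Suc i)" using B(2) mono[of "N - Suc i"] vec.span_superset[of B] NS by auto
    then obtain B' where B': "B \<subseteq> B'" "B' \<subseteq> V (N - Suc i)" "vec.independent B'"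
      "V (N - Suc i) \<subseteq> vec.span B'"
      using vec.maximal_independent_subset_extend[OF _ B(1)] by metis
    have fin: "finite B'" using B'(3) vec.finiteI_independent by blast
    have sp: "vec.span B' = V (N - Suc i)"
      using B' sub by (simp add: vec.span_subspace)
    \<comment> \<open>T b lies in the span of the smaller basis, so its coordinates survive the
      extension of the basis and are zero on the new vectors.\<close>
    have r: "vec.representation B' (T b) b = vec.representation B (T b) b" if "b \<in> B'" for b
    proof -
      have "T b \<in> vec.span B" using that B'(2) step[of "N - Suc i"] NS B(2) by auto
      then show ?thesis using vec.representation_extend[OF B'(3) _ B'(1)] by simp
    qed
    have "(\<Sum>b\<in>B'. vec.representation B' (T b) b) = (\<Sum>b\<in>B'. vec.representation B (T b) b)"
      using r by simp
    also have "\<dots> = (\<Sum>b\<in>B. vec.representation B (T b) b)"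
      using vec.representation_ne_zero by (intro sum.mono_neutral_right fin B'(1)) blast
    finally show ?case using B(3) B'(3) sp by auto
  qed
  from this[of N] show ?thesis using tr_basis[OF _ _ T] assms(3) by auto
qed

lemma tr_nilpotent:
  fixes T :: "('k::field) ^ 'a \<Rightarrow> 'k ^ 'a"
  assumes T: "lin T" and nil: "\<And>v. (T ^^ N) v = 0"
  shows "tr T = 0"
proof (rule tr_strict_chain[OF T, of "\<lambda>i. range (T ^^ i)" N])
  show "vec.subspace (range (T ^^ i))" for i
    using vec.linear_subspace_image[OF lin_funpow[OF T] vec.subspace_UNIV] .
  show "range (T ^^ Suc i) \<subseteq> range (T ^^ i)" for i
    by (auto simp: funpow_swap1)
  show "T ` range (T ^^ i) \<subseteq> range (T ^^ Suc i)" for i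
    by auto
qed (use nil in auto)

section \<open>Generalized eigenspaces and functional calculus over the complex numbers\<close>

subsection \<open>Generalized eigenspaces\<close>

text \<open>W plays the role of a quotient and V that of a restriction. With p = (x - a) q, the
  vector w = q(T) v satisfies T w - a w = p(T) v, an element of W. Either w is the desired vector,
  or w lies in W and q annihilates v modulo W in smaller degree.\<close>

lemma eigenvector_mod_poly:
  fixes T :: "complex ^ 'a \<Rightarrow> complex ^ 'a" and p :: "complex poly"
  assumes T: "lin T" and W: "vec.subspace W" "T ` W \<subseteq> W"
    and V: "vec.subspace V" "T ` V \<subseteq> V"
    and "p \<noteq> 0" "v \<in> V" "v \<notin> W" "(\<Sum>i\<le>degree p. coeff p i *s (T ^^ i) v) \<in> W"
  shows "\<exists>v\<in>V. v \<notin> W \<and> (\<exists>\<mu>. T v - \<mu> *s v \<in> W)"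
  using assms(6-)
proof (induction "degree p" arbitrary: p v)
  case 0
  then have "coeff p 0 *s v \<in> W" "coeff p 0 \<noteq> 0"
    using leading_coeff_neq_0[of p] by auto
  then have "inverse (coeff p 0) *s (coeff p 0 *s v) \<in> W" using W vec.subspace_scale by blast
  then have "v \<in> W" using \<open>coeff p 0 \<noteq> 0\<close> by simp
  then show ?case using 0 by blast
next
  case (Suc n)
  then have "\<not> constant (poly p)" by (simp add: constant_degree)
  then obtain a where "poly p a = 0" using fundamental_theorem_of_algebra by blast
  then obtain q where q: "p = [:-a, 1:] * q" by (metis dvdE poly_eq_0_iff_dvd)
  have qne: "q \<noteq> 0" using Suc.prems(1) q by auto
  have dq: "degree q = n" using Suc.hyps(2) q qne degree_mult_eq[of "[:-a,1:]" q] by auto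
  define w where "w = (\<Sum>i\<le>degree q. coeff q i *s (T ^^ i) v)"
  have stab: "(T ^^ i) v \<in> V" for i using Suc.prems(2) V(2) by (induction i) auto
  have wV: "w \<in> V" unfolding w_def using V(1) stab
    by (intro vec.subspace_sum vec.subspace_scale) auto
  have pq: "coeff p i = (if i = 0 then 0 else coeff q (i - 1)) - a * coeff q i" for i
    unfolding q by (auto simp: coeff_pCons split: nat.split)
  have "(\<Sum>i\<le>degree p. coeff p i *s (T ^^ i) v) =
     (\<Sum>i\<le>Suc n. (if i = 0 then 0 else coeff q (i - 1)) *s (T ^^ i) v) - (\<Sum>i\<le>Suc n. (a * coeff q i) *s (T ^^ i) v)"
    unfolding pq Suc.hyps(2)[symmetric] by (simp add: vec.scale_left_diff_distrib sum_subtractf)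
  also have "(\<Sum>i\<le>Suc n. (if i = 0 then 0 else coeff q (i - 1)) *s (T ^^ i) v) = (\<Sum>i\<le>n. coeff q i *s T ((T ^^ i) v))"
    by (subst sum.atMost_Suc_shift) simp
  also have "\<dots> = T w" unfolding w_def dq by (simp add: lin_sum[OF T] lin_scale[OF T])
  also have "(\<Sum>i\<le>Suc n. (a * coeff q i) *s (T ^^ i) v) = a *s w"
    using dq coeff_eq_0[of q "Suc n"] unfolding w_def by (simp add: vec.scale_sum_right)
  finally have "T w - a *s w \<in> W" using Suc.prems by simp
  show ?case
  proof (cases "w \<in> W")
    case True
    then show ?thesis using Suc.hyps(1)[of q v] dq qne Suc.prems w_def by auto
  next
    case False
    then show ?thesis using \<open>T w - a *s w \<in> W\<close> wV by blast
  qed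
qed

lemma eigenvector_mod:
  fixes T :: "complex ^ 'a \<Rightarrow> complex ^ 'a"
  assumes T: "lin T" and W: "vec.subspace W" "T ` W \<subseteq> W"
    and V: "vec.subspace V" "T ` V \<subseteq> V" and "v \<in> V" "v \<notin> W"
  shows "\<exists>v\<in>V. v \<notin> W \<and> (\<exists>\<mu>. T v - \<mu> *s v \<in> W)"
proof -
  have "\<exists>p. p \<noteq> 0 \<and> (\<Sum>i\<le>degree p. coeff p i *s (T ^^ i) v) = 0"
  proof -
    let ?n = "CARD('a)"
    have "\<exists>c. (\<exists>i\<le>?n. c i \<noteq> 0) \<and> (\<Sum>i\<le>?n. c i *s (T ^^ i) v) = 0"
    \<comment> \<open>\<open>vec.dependent\<close> speaks of sets and does not see a repetition
      among the n + 1 iterates, so that case is treated separately.\<close>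
    proof (cases "inj_on (\<lambda>i. (T ^^ i) v) {..?n}")
      case False
      then obtain i j where ij: "i \<le> ?n" "j \<le> ?n" "i \<noteq> j" "(T ^^ i) v = (T ^^ j) v"
        unfolding inj_on_def by auto
      let ?c = "\<lambda>k. if k = i then 1 else if k = j then - 1 else (0::complex)"
      have "(\<Sum>k\<le>?n. ?c k *s (T ^^ k) v) = (\<Sum>k\<in>{i,j}. ?c k *s (T ^^ k) v)"
        using ij by (intro sum.mono_neutral_right) auto
      also have "\<dots> = 0" using ij by simp
      finally show ?thesis using ij(1) by (intro exI[of _ ?c]) (auto intro!: exI[of _ i])
    next
      case True
      let ?S = "(\<lambda>i. (T ^^ i) v) ` {..?n}"
      have "card ?S = Suc ?n" using True by (simp add: card_image)
      then have "vec.dependent ?S"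
        using vec.independent_card_le_dim[of ?S UNIV] by (auto simp: card_cart_basis)
      then obtain u where u: "\<exists>w\<in>?S. u w \<noteq> 0" "(\<Sum>w\<in>?S. u w *s w) = 0"
        using vec.dependent_finite[of ?S] by auto
      have "(\<Sum>i\<le>?n. u ((T ^^ i) v) *s (T ^^ i) v) = 0"
        using u(2) by (simp add: sum.reindex[OF True])
      then show ?thesis using u(1) by (intro exI[of _ "\<lambda>i. u ((T ^^ i) v)"]) auto
    qed
    then obtain c i where c: "i \<le> ?n" "c i \<noteq> 0" "(\<Sum>i\<le>?n. c i *s (T ^^ i) v) = 0" by auto
    define p where "p = (\<Sum>i\<le>?n. monom (c i) i)"
    have cp: "coeff p j = (if j \<le> ?n then c j else 0)" for j
      unfolding p_def by (simp add: coeff_sum)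
    have "p \<noteq> 0" using c cp[of i] by auto
    have "degree p \<le> ?n" by (rule degree_le) (simp add: cp)
    then have "(\<Sum>i\<le>degree p. coeff p i *s (T ^^ i) v) = (\<Sum>i\<le>?n. coeff p i *s (T ^^ i) v)"
      by (intro sum.mono_neutral_left) (auto intro: coeff_eq_0)
    also have "\<dots> = (\<Sum>i\<le>?n. c i *s (T ^^ i) v)" by (simp add: cp)
    finally show ?thesis using c \<open>p \<noteq> 0\<close> by auto
  qed
  then obtain p where "p \<noteq> 0" "(\<Sum>i\<le>degree p. coeff p i *s (T ^^ i) v) \<in> W"
    using vec.subspace_0[OF W(1)] by metis
  then show ?thesis using eigenvector_mod_poly[OF T W V] assms by blast
qed

definition gen_eig :: "(('k::field) ^ 'a \<Rightarrow> 'k ^ 'a) \<Rightarrow> 'k \<Rightarrow> ('k ^ 'a) set" where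
  "gen_eig T \<mu> = {v. \<exists>k. ((\<lambda>v. T v - \<mu> *s v) ^^ k) v = 0}"

lemma funpow_zero_mono:
  fixes f :: "('k::field) ^ 'a \<Rightarrow> 'k ^ 'a"
  assumes "lin f" "(f ^^ k) v = 0" "k \<le> n"
  shows "(f ^^ n) v = 0"
proof -
  have "(f ^^ n) v = (f ^^ (n - k)) ((f ^^ k) v)"
    using funpow_add[of "n - k" k f] assms(3) by simp
  then show ?thesis using assms(2) lin_0[OF lin_funpow[OF assms(1)]] by simp
qed

lemma subspace_gen_eig: 
  assumes T: "lin T" shows "vec.subspace (gen_eig T \<mu>)"
proof -
  let ?f = "\<lambda>v. T v - \<mu> *s v"
  have l: "lin ?f" using T by (rule lin_shift)
  show ?thesis
  proof (rule vec.subspaceI)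
    show "0 \<in> gen_eig T \<mu>" unfolding gen_eig_def by (auto intro: exI[of _ 0])
    fix x y assume "x \<in> gen_eig T \<mu>" "y \<in> gen_eig T \<mu>"
    then obtain i j where "(?f ^^ i) x = 0" "(?f ^^ j) y = 0" unfolding gen_eig_def by auto
    then have "(?f ^^ (i + j)) x = 0" "(?f ^^ (i + j)) y = 0"
      using funpow_zero_mono[OF l] by simp_all
    then have "(?f ^^ (i + j)) (x + y) = 0" using lin_funpow[OF l] by (simp add: lin_add)
    then show "x + y \<in> gen_eig T \<mu>" unfolding gen_eig_def by blast
  next
    fix c x assume "x \<in> gen_eig T \<mu>"
    then obtain i where "(?f ^^ i) x = 0" unfolding gen_eig_def by auto
    then have "(?f ^^ i) (c *s x) = 0" using lin_funpow[OF l] by (simp add: lin_scale)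
    then show "c *s x \<in> gen_eig T \<mu>" unfolding gen_eig_def by blast
  qed
qed

lemma gen_eig_stable:
  assumes T: "lin T" and "v \<in> gen_eig T \<mu>" shows "T v \<in> gen_eig T \<mu>"
proof -
  let ?f = "\<lambda>v. T v - \<mu> *s v"
  have l: "lin ?f" using T by (rule lin_shift)
  obtain k where k: "(?f ^^ k) v = 0" using assms(2) unfolding gen_eig_def by auto
  have "(?f ^^ k) (?f v) = ?f ((?f ^^ k) v)" by (rule funpow_swap1[of ?f, symmetric])
  then have "(?f ^^ k) (?f v) = 0" using k by (simp add: lin_0[OF T])
  then have "?f v \<in> gen_eig T \<mu>" unfolding gen_eig_def by blast
  moreover have "\<mu> *s v \<in> gen_eig T \<mu>" using assms subspace_gen_eig vec.subspace_scale by blast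
  ultimately have "?f v + \<mu> *s v \<in> gen_eig T \<mu>" using subspace_gen_eig[OF T] vec.subspace_add by blast
  then show ?thesis by simp
qed

lemma gen_eig_disjoint:
  assumes T: "lin T" and v: "v \<in> gen_eig T \<mu>" "T v = \<nu> *s v" and ne: "\<nu> \<noteq> \<mu>"
  shows "v = 0"
proof -
  let ?f = "\<lambda>v. T v - \<mu> *s v"
  have l: "lin ?f" using T by (rule lin_shift)
  have "(?f ^^ k) v = (\<nu> - \<mu>) ^ k *s v" for k
  proof (induction k)
    case (Suc k)
    then show ?case by (simp add: lin_scale[OF T] v(2) vec.scale_left_diff_distrib algebra_simps)
  qed simp
  then show ?thesis using v(1) ne unfolding gen_eig_def by auto
qed

lemma subspace_inj_surj:
  assumes f: "lin (f :: 'k::field ^ 'a \<Rightarrow> 'k ^ 'a)" and W: "vec.subspace W" "f ` W \<subseteq> W"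
    and inj: "\<And>v. v \<in> W \<Longrightarrow> f v = 0 \<Longrightarrow> v = 0"
  shows "f ` W = W"
proof -
  have "inj_on f W" using vec.linear_inj_on_iff_eq_0[OF f W(1)] inj by blast
  then have "vec.dim (f ` W) = vec.dim W"
    using vec.dim_image_eq[OF f, of W] W(1) vec.span_eq_iff by metis
  then show ?thesis
    using vec.subspace_dim_equal[OF _ W(1) W(2)] vec.linear_subspace_image[OF f W(1)] by simp
qed

text \<open>W is covered by its image but may fail to be invariant. A nonzero kernel vector could be
  made part of a basis of W; the images of the other basis vectors would then span W, although there
  are too few of them.\<close>

lemma subspace_surj_inj:
  assumes f: "lin (f :: 'k::field ^ 'a \<Rightarrow> 'k ^ 'a)" and W: "vec.subspace W" "W \<subseteq> f ` W"
    and v: "v \<in> W" "f v = 0"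
  shows "v = 0"
proof (rule ccontr)
  assume "v \<noteq> 0"
  have "vec.independent {v}" using \<open>v \<noteq> 0\<close> by simp
  moreover have "{v} \<subseteq> W" using v by simp
  ultimately obtain B where B: "{v} \<subseteq> B" "B \<subseteq> W" "vec.independent B" "W \<subseteq> vec.span B"
    using vec.maximal_independent_subset_extend by metis
  have finB: "finite B" using B(3) vec.finiteI_independent by blast
  have "f ` W \<subseteq> vec.span (f ` (B - {v}))"
  proof -
    have "f ` W \<subseteq> vec.span (f ` B)" using B(4) vec.linear_span_image[OF f, of B] by blast
    also have "f ` B = insert 0 (f ` (B - {v}))" using v B(1) by auto
    finally show ?thesis by simp
  qed
  then have "vec.dim W \<le> card (f ` (B - {v}))"
    using W(2) finB by (intro vec.dim_le_card) auto
  also have "\<dots> \<le> card (B - {v})" using finB by (intro card_image_le) auto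
  also have "\<dots> < card B" using B(1) finB by (intro card_Diff1_less) auto
  also have "card B = vec.dim W" using B vec.basis_card_eq_dim by blast
  finally show False by simp
qed

lemma gen_eig_shift_surj:
  assumes T: "lin T" and W: "vec.subspace W" "T ` W \<subseteq> W" "W \<subseteq> gen_eig T \<mu>" and ne: "\<nu> \<noteq> \<mu>"
  shows "(\<lambda>v. T v - \<nu> *s v) ` W = W"
proof (rule subspace_inj_surj[OF lin_shift[OF T] W(1)])
  show "(\<lambda>v. T v - \<nu> *s v) ` W \<subseteq> W"
    using W by (auto intro!: vec.subspace_diff vec.subspace_scale)
  show "v = 0" if "v \<in> W" "T v - \<nu> *s v = 0" for v
    using gen_eig_disjoint[OF T _ _ ne, of v] that W(3) by auto
qed

text \<open>The shift by \<mu> is bijective on each generalized eigenspace for another eigenvalue.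
  This serves to correct a vector so that its error lies in the \<mu>-part alone.\<close>

lemma gen_eig_rest_surj:
  assumes T: "lin T" and W: "vec.subspace W" "T ` W \<subseteq> W" 
  shows "vec.span (\<Union>\<nu>\<in>-{\<mu>}. W \<inter> gen_eig T \<nu>) \<subseteq> (\<lambda>v. T v - \<mu> *s v) ` vec.span (\<Union>\<nu>\<in>-{\<mu>}. W \<inter> gen_eig T \<nu>)"
proof (rule vec.span_minimal)
  let ?R = "vec.span (\<Union>\<nu>\<in>-{\<mu>}. W \<inter> gen_eig T \<nu>)"
  show "vec.subspace ((\<lambda>v. T v - \<mu> *s v) ` ?R)"
    using vec.linear_subspace_image[OF lin_shift[OF T]] by blast
  show "(\<Union>\<nu>\<in>-{\<mu>}. W \<inter> gen_eig T \<nu>) \<subseteq> (\<lambda>v. T v - \<mu> *s v) ` ?R"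
  proof
    fix x assume "x \<in> (\<Union>\<nu>\<in>-{\<mu>}. W \<inter> gen_eig T \<nu>)"
    then obtain \<nu> where \<nu>: "\<nu> \<noteq> \<mu>" "x \<in> W \<inter> gen_eig T \<nu>" by auto
    have "(\<lambda>v. T v - \<mu> *s v) ` (W \<inter> gen_eig T \<nu>) = W \<inter> gen_eig T \<nu>"
      using \<nu> W T by (intro gen_eig_shift_surj[of _ _ \<nu>]) (auto intro: vec.subspace_inter subspace_gen_eig gen_eig_stable)
    then obtain y where "y \<in> W \<inter> gen_eig T \<nu>" "x = T y - \<mu> *s y" using \<nu>(2) by (metis (no_types, lifting) imageE)
    moreover from this have "y \<in> ?R" using \<nu>(1) by (intro vec.span_base) auto
    ultimately show "x \<in> (\<lambda>v. T v - \<mu> *s v) ` ?R" by blast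
  qed
qed

text \<open>If the span S missed part of W, there would be an eigenvector v modulo S. Write T v -
  \<mu> v = a + r, with a in the \<mu>-part and r in the span of the other parts. Since r has a
  preimage r' there under the shift, v - r' is a generalized eigenvector for \<mu>, and v lies in S
  after all.\<close>

lemma span_gen_eig:
  fixes T :: "complex ^ 'a \<Rightarrow> complex ^ 'a"
  assumes T: "lin T" and W: "vec.subspace W" "T ` W \<subseteq> W"
  shows "W \<subseteq> vec.span (\<Union>\<mu>. W \<inter> gen_eig T \<mu>)"
proof (rule ccontr)
  let ?S = "vec.span (\<Union>\<mu>. W \<inter> gen_eig T \<mu>)"
  assume "\<not> W \<subseteq> ?S"
  then obtain v0 where v0: "v0 \<in> W" "v0 \<notin> ?S" by auto
  have "T ` ?S = vec.span (T ` (\<Union>\<mu>. W \<inter> gen_eig T \<mu>))" by (rule vec.linear_span_image[OF T, symmetric])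
  also have "\<dots> \<subseteq> ?S"
    using W(2) gen_eig_stable[OF T] by (intro vec.span_mono) blast
  finally have "T ` ?S \<subseteq> ?S" .
  from eigenvector_mod[OF T _ this W v0] obtain v \<mu> where v: "v \<in> W" "v \<notin> ?S" "T v - \<mu> *s v \<in> ?S"
    by auto
  let ?f = "\<lambda>v. T v - \<mu> *s v"
  let ?R = "vec.span (\<Union>\<nu>\<in>-{\<mu>}. W \<inter> gen_eig T \<nu>)"
  have "(\<Union>\<mu>. W \<inter> gen_eig T \<mu>) = (W \<inter> gen_eig T \<mu>) \<union> (\<Union>\<nu>\<in>-{\<mu>}. W \<inter> gen_eig T \<nu>)" by auto
  then have "?S = {x + y | x y. x \<in> vec.span (W \<inter> gen_eig T \<mu>) \<and> y \<in> ?R}" by (simp add: vec.span_Un)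
  moreover have "vec.span (W \<inter> gen_eig T \<mu>) = W \<inter> gen_eig T \<mu>"
    using W(1) subspace_gen_eig[OF T] by (simp add: vec.subspace_inter)
  ultimately obtain a r where ar: "a \<in> W \<inter> gen_eig T \<mu>" "r \<in> ?R" "?f v = a + r" using v(3) by auto
  obtain r' where r': "r' \<in> ?R" "r = ?f r'" using gen_eig_rest_surj[OF T W] ar(2) by blast
  have "?R \<subseteq> W" using W(1) by (intro vec.span_minimal) auto
  have "?R \<subseteq> ?S" by (intro vec.span_mono) auto
  have "?f (v - r') = a" using ar(3) r'(2) by (simp add: lin_diff[OF T] algebra_simps vec.scale_right_diff_distrib)
  obtain k where "(?f ^^ k) a = 0" using ar(1) unfolding gen_eig_def by auto
  then have "(?f ^^ Suc k) (v - r') = 0" using \<open>?f (v - r') = a\<close> by (simp only: funpow_Suc_right comp_def)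
  then have "v - r' \<in> gen_eig T \<mu>" unfolding gen_eig_def by blast
  moreover have "v - r' \<in> W" using v(1) r'(1) \<open>?R \<subseteq> W\<close> W(1) by (auto intro: vec.subspace_diff)
  ultimately have "v - r' \<in> ?S" by (intro vec.span_base) auto
  then have "(v - r') + r' \<in> ?S" using r'(1) \<open>?R \<subseteq> ?S\<close> by (intro vec.span_add) auto
  then show False using v(2) by simp
qed

text \<open>Functional calculus for the semisimple part of T. The basis is chosen before g, so that
  the maps for different g are diagonal in the same basis.\<close>

lemma spectral_map_exists:
  fixes T :: "complex ^ 'a \<Rightarrow> complex ^ 'a"
  assumes T: "lin T"
  shows "\<exists>B m. vec.independent B \<and> vec.span B = UNIV \<and>
    (\<forall>g. \<exists>C. lin C \<and> (\<forall>b\<in>B. C b = g (m b) *s b) \<and> (\<forall>\<mu>. \<forall>v\<in>gen_eig T \<mu>. C v = g \<mu> *s v))"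
proof -
  obtain B where B: "B \<subseteq> (\<Union>\<mu>. gen_eig T \<mu>)" "vec.independent B" "(\<Union>\<mu>. gen_eig T \<mu>) \<subseteq> vec.span B"
    using vec.maximal_independent_subset by metis
  have "UNIV \<subseteq> vec.span (\<Union>\<mu>. UNIV \<inter> gen_eig T \<mu>)" by (rule span_gen_eig[OF T]) auto
  also have "\<dots> \<subseteq> vec.span B" using B(3) by (intro vec.span_minimal) auto
  finally have spB: "vec.span B = UNIV" by auto
  define m where "m b = (SOME \<mu>. b \<in> gen_eig T \<mu>)" for b
  have m: "b \<in> gen_eig T (m b)" if "b \<in> B" for b
    unfolding m_def using that B(1) by (intro someI_ex[of "\<lambda>\<mu>. b \<in> gen_eig T \<mu>"]) auto
  \<comment> \<open>Directness of the decomposition: a generalized eigenvector for \<mu> has no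
    component along basis vectors of other eigenvalues, because the shift by \<mu> is injective on
    their span.\<close>
  have key: "v \<in> vec.span {b\<in>B. m b = \<mu>}" if v: "v \<in> gen_eig T \<mu>" for v \<mu>
  proof -
    let ?B1 = "{b\<in>B. m b = \<mu>}" and ?B2 = "{b\<in>B. m b \<noteq> \<mu>}"
    let ?R = "vec.span (\<Union>\<nu>\<in>-{\<mu>}. UNIV \<inter> gen_eig T \<nu>)"
    have "v \<in> vec.span (?B1 \<union> ?B2)" 
    proof -
      have "?B1 \<union> ?B2 = B" by auto
      then show ?thesis using spB by simp
    qed
    then obtain v1 v2 where v12: "v = v1 + v2" "v1 \<in> vec.span ?B1" "v2 \<in> vec.span ?B2"
      unfolding vec.span_Un by auto
    have "vec.span ?B1 \<subseteq> gen_eig T \<mu>" using m subspace_gen_eig[OF T] by (intro vec.span_minimal) auto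
    then have "v2 \<in> gen_eig T \<mu>"
      using v v12 subspace_gen_eig[OF T, of \<mu>] vec.subspace_diff[of _ v v1] by auto
    have "vec.span ?B2 \<subseteq> ?R" using m by (intro vec.span_mono) auto
    then have "v2 \<in> ?R" using v12 by auto
    let ?f = "\<lambda>v. T v - \<mu> *s v"
    have stab: "?f ` ?R \<subseteq> ?R"
    proof -
      have "?f ` ?R = vec.span (?f ` (\<Union>\<nu>\<in>-{\<mu>}. UNIV \<inter> gen_eig T \<nu>))"
        by (rule vec.linear_span_image[OF lin_shift[OF T], symmetric])
      also have "\<dots> \<subseteq> ?R"
      proof (intro vec.span_mono subsetI)
        fix y assume "y \<in> ?f ` (\<Union>\<nu>\<in>-{\<mu>}. UNIV \<inter> gen_eig T \<nu>)"
        then obtain x \<nu> where x: "y = ?f x" "\<nu> \<noteq> \<mu>" "x \<in> gen_eig T \<nu>" by auto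
        have "?f x \<in> gen_eig T \<nu>"
          using x gen_eig_stable[OF T] subspace_gen_eig[OF T]
          by (intro vec.subspace_diff vec.subspace_scale) auto
        then show "y \<in> (\<Union>\<nu>\<in>-{\<mu>}. UNIV \<inter> gen_eig T \<nu>)" using x by auto
      qed
      finally show ?thesis .
    qed
    have inj: "x = 0" if "x \<in> ?R" "?f x = 0" for x
      using subspace_surj_inj[OF lin_shift[OF T] vec.subspace_span gen_eig_rest_surj[OF T] that] by auto
    have "x = 0" if "(?f ^^ k) x = 0" "x \<in> ?R" for k x
      using that
    proof (induction k)
      case (Suc k)
      have "(?f ^^ k) x \<in> ?R" using Suc.prems(2) stab by (induction k) auto
      then show ?case using inj[of "(?f ^^ k) x"] Suc by auto
    qed simp
    then have "v2 = 0" using \<open>v2 \<in> gen_eig T \<mu>\<close> \<open>v2 \<in> ?R\<close> unfolding gen_eig_def by blast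
    then show ?thesis using v12 by simp
  qed
  have "\<exists>C. lin C \<and> (\<forall>b\<in>B. C b = g (m b) *s b) \<and> (\<forall>\<mu>. \<forall>v\<in>gen_eig T \<mu>. C v = g \<mu> *s v)" for g
  proof -
    obtain C where C: "lin C" "\<forall>b\<in>B. C b = g (m b) *s b"
      using vec.linear_independent_extend[OF B(2), of "\<lambda>b. g (m b) *s b"] by auto
    have "C v = g \<mu> *s v" if v: "v \<in> gen_eig T \<mu>" for v \<mu>
      using vec.linear_eq_on_span[OF C(1), of "\<lambda>v. g \<mu> *s v" "{b\<in>B. m b = \<mu>}"] C(2) key[OF v]
      by (auto intro: linI simp: vec.scale_right_distrib mult.commute)
    then show ?thesis using C by blast
  qed
  then show ?thesis using B(2) spB by blast
qed

lemma spectral_map_stable: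
  fixes T :: "complex ^ 'a \<Rightarrow> complex ^ 'a"
  assumes T: "lin T" and C: "lin C" "\<And>\<mu> v. v \<in> gen_eig T \<mu> \<Longrightarrow> C v = g \<mu> *s v" and g: "g 0 = 0"
    and W: "vec.subspace W" "vec.subspace W'" "W' \<subseteq> W" "T ` W \<subseteq> W'"
  shows "C ` W \<subseteq> W'"
proof -
  have st: "T ` W \<subseteq> W" using W by auto
  have "W \<subseteq> vec.span (\<Union>\<mu>. W \<inter> gen_eig T \<mu>)" by (rule span_gen_eig[OF T W(1) st])
  also have "\<dots> \<subseteq> C -` W'"
  proof (rule vec.span_minimal)
    show "vec.subspace (C -` W')" using vec.linear_subspace_vimage[OF C(1) W(2)] .
    have "C v \<in> W'" if v: "v \<in> W" "v \<in> gen_eig T \<mu>" for v \<mu>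
    proof (cases "\<mu> = 0")
      case True
      then show ?thesis using C(2)[OF v(2)] g W(2) vec.subspace_0 by simp
    next
      case False
      have "(\<lambda>v. T v - 0 *s v) ` (W \<inter> gen_eig T \<mu>) = W \<inter> gen_eig T \<mu>"
        using W st T False by (intro gen_eig_shift_surj[of _ _ \<mu>]) (auto intro: vec.subspace_inter subspace_gen_eig gen_eig_stable)
      then have "v \<in> (\<lambda>v. T v - 0 *s v) ` (W \<inter> gen_eig T \<mu>)" using v by blast
      then obtain u where "u \<in> W" "v = T u" by auto
      then show ?thesis using C(2)[OF v(2)] W by (auto intro: vec.subspace_scale)
    qed
    then show "(\<Union>\<mu>. W \<inter> gen_eig T \<mu>) \<subseteq> C -` W'" by auto
  qed
  finally show ?thesis by auto
qed

lemma nilpotent_uniform: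
  fixes N :: "('k::field) ^ 'a \<Rightarrow> 'k ^ 'a"
  assumes N: "lin N" and B: "vec.span B = UNIV" "finite B" and k: "\<And>b. b \<in> B \<Longrightarrow> \<exists>k. (N ^^ k) b = 0"
  shows "\<exists>k. \<forall>v. (N ^^ k) v = 0"
proof -
  obtain f where f: "\<And>b. b \<in> B \<Longrightarrow> (N ^^ f b) b = 0" using k by metis
  define K where "K = (\<Sum>b\<in>B. f b)"
  have "(N ^^ K) b = 0" if "b \<in> B" for b
    using funpow_zero_mono[OF N f[OF that], of K] that B(2) unfolding K_def by (simp add: member_le_sum)
  then have "(N ^^ K) v = 0" for v
    using vec.linear_eq_0_on_span[OF lin_funpow[OF N], of B K v] B(1) by auto
  then show ?thesis by blast
qed

text \<open>With S the semisimple part of T, C \<circ> (T - S) is nilpotent and C \<circ> S acts by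
  \<open>cnj \<mu> * \<mu>\<close>. The trace is therefore a sum of squared moduli of the
  eigenvalues. When it is zero, S vanishes and T = T - S is nilpotent.\<close>

lemma tr_spectral:
  fixes T :: "complex ^ 'a \<Rightarrow> complex ^ 'a"
  assumes T: "lin T" and C: "lin C" "\<And>\<mu> v. v \<in> gen_eig T \<mu> \<Longrightarrow> C v = cnj \<mu> *s v"
    and 0: "tr (\<lambda>v. C (T v)) = 0"
  shows "\<exists>k. \<forall>v. (T ^^ k) v = 0"
proof -
  obtain B m where B: "vec.independent B" "vec.span B = UNIV" and
    "\<forall>g. \<exists>C. lin C \<and> (\<forall>b\<in>B. C b = g (m b) *s b) \<and> (\<forall>\<mu>. \<forall>v\<in>gen_eig T \<mu>. C v = g \<mu> *s v)"
    using spectral_map_exists[OF T] by (elim exE conjE)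
  then have ex: "\<exists>C. lin C \<and> (\<forall>b\<in>B. C b = g (m b) *s b) \<and> (\<forall>\<mu>. \<forall>v\<in>gen_eig T \<mu>. C v = g \<mu> *s v)" for g
    by blast
  have finB: "finite B" using B(1) vec.finiteI_independent by blast
  obtain S where S: "lin S" "\<forall>b\<in>B. S b = m b *s b" "\<And>\<mu> v. v \<in> gen_eig T \<mu> \<Longrightarrow> S v = \<mu> *s v"
    using ex[of "\<lambda>z. z"] by auto
  obtain P where P: "lin P" "\<forall>b\<in>B. P b = (cnj (m b) * m b) *s b" "\<And>\<mu> v. v \<in> gen_eig T \<mu> \<Longrightarrow> P v = (cnj \<mu> * \<mu>) *s v"
    using ex[of "\<lambda>z. cnj z * z"] by auto
  have spg: "vec.span (\<Union>\<mu>. gen_eig T \<mu>) = UNIV"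
    using span_gen_eig[OF T, of UNIV] by auto
  obtain B' where B': "B' \<subseteq> (\<Union>\<mu>. gen_eig T \<mu>)" "vec.independent B'" "(\<Union>\<mu>. gen_eig T \<mu>) \<subseteq> vec.span B'"
    using vec.maximal_independent_subset by metis
  have B'2: "vec.span B' = UNIV" using spg B'(3) vec.span_minimal[OF B'(3)] by auto
  have finB': "finite B'" using B'(2) vec.finiteI_independent by blast
  \<comment> \<open>Applied with D = C to compute the trace, and with D the identity for the
    conclusion.\<close>
  have nil: "\<exists>k. \<forall>v. ((\<lambda>v. D (T v - S v)) ^^ k) v = 0"
    if D: "lin D" "\<And>\<mu> v. v \<in> gen_eig T \<mu> \<Longrightarrow> D v = g \<mu> *s v" for D g
  proof (rule nilpotent_uniform[OF _ B'2 finB'])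
    show "lin (\<lambda>v. D (T v - S v))"
      by (auto intro!: linI simp: lin_add lin_scale lin_diff T S D algebra_simps vec.scale_right_diff_distrib)
    fix b assume "b \<in> B'"
    then obtain \<mu> where b: "b \<in> gen_eig T \<mu>" using B' by auto
    let ?f = "\<lambda>v. T v - \<mu> *s v"
    obtain k where k: "(?f ^^ k) b = 0" using b unfolding gen_eig_def by auto
    have lf: "lin ?f" using lin_shift[OF T] .
    have "((\<lambda>v. D (T v - S v)) ^^ j) b = g \<mu> ^ j *s ((?f ^^ j) b) \<and> (?f ^^ j) b \<in> gen_eig T \<mu>" for j
    proof (induction j)
      case (Suc j)
      let ?w = "(?f ^^ j) b"
      have w: "?w \<in> gen_eig T \<mu>" using Suc by auto
      have fw: "?f ?w \<in> gen_eig T \<mu>" using w gen_eig_stable[OF T w] subspace_gen_eig[OF T]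
        by (intro vec.subspace_diff vec.subspace_scale) auto
      have "T (g \<mu> ^ j *s ?w) - S (g \<mu> ^ j *s ?w) = g \<mu> ^ j *s ?f ?w"
        using S(3)[OF w] by (simp add: lin_scale[OF T] lin_scale[OF S(1)] vec.scale_right_diff_distrib)
      then have "D (T (g \<mu> ^ j *s ?w) - S (g \<mu> ^ j *s ?w)) = g \<mu> ^ j *s D (?f ?w)"
        by (simp only: lin_scale[OF D(1)])
      then show ?case using Suc fw D(2)[OF fw] by (simp add: mult.commute)
    qed (use b in auto)
    from this[of k] k show "\<exists>k. ((\<lambda>v. D (T v - S v)) ^^ k) b = 0" by (auto intro!: exI[of _ k])
  qed
  have CS: "C (S v) = P v" for v
  proof -
    have "(\<Union>\<mu>. gen_eig T \<mu>) \<subseteq> {v. C (S v) = P v}"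
      using C(2) S(3) P(3) lin_scale[OF C(1)] by (auto simp: mult.commute)
    then show ?thesis
      using vec.linear_eq_on_span[OF lin_comp[OF C(1) S(1)] P(1), of "\<Union>\<mu>. gen_eig T \<mu>" v] spg by auto
  qed
  have "tr (\<lambda>v. C (T v - S v)) = 0"
  proof -
    have "lin (\<lambda>v. C (T v - S v))"
      by (auto intro!: linI simp: lin_add lin_scale lin_diff T S(1) C(1) algebra_simps vec.scale_right_diff_distrib)
    moreover obtain k where "\<forall>v. ((\<lambda>v. C (T v - S v)) ^^ k) v = 0" using nil[OF C(1), of cnj] C(2) by blast
    ultimately show ?thesis using tr_nilpotent by blast
  qed
  then have "tr (\<lambda>v. C (T v)) = tr (\<lambda>v. C (S v))"
    using tr_diff[of "\<lambda>v. C (T v)" "\<lambda>v. C (S v)"] by (simp add: lin_diff[OF C(1)])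
  also have "\<dots> = tr P" using CS by simp
  also have "\<dots> = (\<Sum>b\<in>B. vec.representation B (P b) b)" by (rule tr_basis[OF B P(1)])
  also have "\<dots> = (\<Sum>b\<in>B. cnj (m b) * m b)"
    using P(2) B by (intro sum.cong refl) (simp add: vec.representation_scale vec.representation_basis)
  also have "\<dots> = of_real (\<Sum>b\<in>B. (cmod (m b))\<^sup>2)"
    by (simp add: complex_norm_square mult.commute[of "cnj _"] del: of_real_power)
  finally have "(\<Sum>b\<in>B. (cmod (m b))\<^sup>2) = 0" using 0 of_real_eq_0_iff by metis
  then have "\<forall>b\<in>B. m b = 0" using finB by (simp add: sum_nonneg_eq_0_iff)
  then have "S v = 0" for v
    using vec.linear_eq_0_on_span[OF S(1), of B v] S(2) B(2) by auto
  then show ?thesis using nil[OF lin_id, of "\<lambda>_. 1"] by simp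
qed

section \<open>Lie algebras, their representations and invariance of the Killing form\<close>

section \<open>Lie algebras over a field\<close>

text \<open>The analogue of \<open>bracket_span\<close> for any action. Iterating
  \<open>act_span \<tau> a\<close> from \<open>UNIV\<close> gives a descending series; that it
  reaches {0} means that the elements of a act by simultaneously strictly triangular maps.\<close>

definition act_span :: "(('k::field) ^ 'n \<Rightarrow> 'k ^ 'w \<Rightarrow> 'k ^ 'w) \<Rightarrow> ('k ^ 'n) set \<Rightarrow> ('k ^ 'w) set \<Rightarrow> ('k ^ 'w) set" where
  "act_span \<tau> a A = vec.span {\<tau> x v | x v. x \<in> a \<and> v \<in> A}"

lemma bracket_span_act_span: "bracket_span br = act_span br"
  by (simp add: fun_eq_iff bracket_span_def act_span_def)

lemma subspace_act_span: "vec.subspace (act_span \<tau> a A)"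
  by (simp add: act_span_def)

lemma act_spanI: "x \<in> a \<Longrightarrow> v \<in> A \<Longrightarrow> \<tau> x v \<in> act_span \<tau> a A"
  unfolding act_span_def by (rule vec.span_base) auto

lemma act_span_least:
  assumes "vec.subspace V" "\<And>x v. x \<in> a \<Longrightarrow> v \<in> A \<Longrightarrow> \<tau> x v \<in> V"
  shows "act_span \<tau> a A \<subseteq> V"
  unfolding act_span_def by (rule vec.span_minimal) (use assms in auto)

lemma act_span_mono: "a \<subseteq> a' \<Longrightarrow> A \<subseteq> A' \<Longrightarrow> act_span \<tau> a A \<subseteq> act_span \<tau> a' A'"
  unfolding act_span_def by (rule vec.span_mono) blast

lemma act_span_pow_mono: "a \<subseteq> a' \<Longrightarrow> A \<subseteq> A' \<Longrightarrow> (act_span \<tau> a ^^ k) A \<subseteq> (act_span \<tau> a' ^^ k) A'"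
  by (induction k) (simp_all add: act_span_mono)

lemma zero_mem_act_span_pow: "0 \<in> A \<Longrightarrow> 0 \<in> (act_span \<tau> a ^^ k) A"
  by (cases k) (auto simp: vec.subspace_0 subspace_act_span)

lemma bracket_span_mono: "a \<subseteq> a' \<Longrightarrow> A \<subseteq> A' \<Longrightarrow> bracket_span br a A \<subseteq> bracket_span br a' A'"
  unfolding bracket_span_act_span by (rule act_span_mono)

lemma derived_mono: "a \<subseteq> b \<Longrightarrow> ((\<lambda>a. bracket_span br a a) ^^ r) a \<subseteq> ((\<lambda>a. bracket_span br a a) ^^ r) b"
  by (induction r) (simp_all add: bracket_span_mono)

lemma zero_mem_derived: "0 \<in> a \<Longrightarrow> 0 \<in> ((\<lambda>a. bracket_span br a a) ^^ r) a"
  by (cases r) (auto simp: vec.subspace_0 subspace_act_span bracket_span_act_span)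

lemma solvable_mono: 
  assumes "solvable br b" "a \<subseteq> b" "0 \<in> a" shows "solvable br a"
proof -
  obtain r where "((\<lambda>a. bracket_span br a a) ^^ r) b = {0}" using assms(1) unfolding solvable_def by auto
  then have "((\<lambda>a. bracket_span br a a) ^^ r) a = {0}"
    using derived_mono[OF assms(2), where r=r and br=br] zero_mem_derived[OF assms(3), where r=r and br=br] by auto
  then show ?thesis unfolding solvable_def by blast
qed

lemma solvable_if_derived:
  assumes "solvable br b" "bracket_span br a a \<subseteq> b"
  shows "solvable br a"
proof -
  have "solvable br (bracket_span br a a)"
    using assms by (rule solvable_mono) (simp add: vec.subspace_0 subspace_act_span bracket_span_act_span)
  then obtain r where "((\<lambda>a. bracket_span br a a) ^^ r) (bracket_span br a a) = {0}" unfolding solvable_def by auto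
  then have "((\<lambda>a. bracket_span br a a) ^^ Suc r) a = {0}" by (simp only: funpow_Suc_right comp_def)
  then show ?thesis unfolding solvable_def by blast
qed

text \<open>The conditions are restricted to b because the infinitesimal representation has a
  meaning on q only, although it is a total function.\<close>

definition rep_on :: "('k::field, 'n::finite) bracket \<Rightarrow> ('k ^ 'n) set \<Rightarrow> ('k ^ 'n \<Rightarrow> 'k ^ 'w \<Rightarrow> 'k ^ 'w) \<Rightarrow> bool" where
  "rep_on br b \<tau> \<longleftrightarrow> (\<forall>y\<in>b. lin (\<tau> y)) \<and> (\<forall>y\<in>b. \<forall>z\<in>b. \<forall>w. \<tau> (y + z) w = \<tau> y w + \<tau> z w) \<and>
     (\<forall>y\<in>b. \<forall>c w. \<tau> (c *s y) w = c *s \<tau> y w) \<and>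
     (\<forall>y\<in>b. \<forall>z\<in>b. \<forall>w. \<tau> (br y z) w = \<tau> y (\<tau> z w) - \<tau> z (\<tau> y w))"

lemma rep_onD:
  assumes "rep_on br b \<tau>" "y \<in> b"
  shows "lin (\<tau> y)" "\<tau> (c *s y) w = c *s \<tau> y w"
    "z \<in> b \<Longrightarrow> \<tau> (y + z) w = \<tau> y w + \<tau> z w"
    "z \<in> b \<Longrightarrow> \<tau> (br y z) w = \<tau> y (\<tau> z w) - \<tau> z (\<tau> y w)"
  using assms unfolding rep_on_def by auto

lemma rep_on_subset: "rep_on br b \<tau> \<Longrightarrow> b' \<subseteq> b \<Longrightarrow> rep_on br b' \<tau>"
  unfolding rep_on_def by blast

definition perp :: "('k::field, 'n::finite) bracket \<Rightarrow> ('k ^ 'n) set \<Rightarrow> ('k ^ 'n) set" where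
  "perp br S = {x. \<forall>y\<in>S. killing_form br x y = 0}"

lemma perp_antimono: "S \<subseteq> T \<Longrightarrow> perp br T \<subseteq> perp br S"
  unfolding perp_def by auto

locale lie_alg =
  fixes br :: "('k::field, 'n::finite) bracket"
  assumes add_left: "br (x + y) z = br x z + br y z"
    and scale_left: "br (c *s x) z = c *s br x z"
    and add_right: "br z (x + y) = br z x + br z y"
    and scale_right: "br z (c *s x) = c *s br z x"
    and self: "br x x = 0"
    and jacobi: "br x (br y z) = br (br x y) z + br y (br x z)"
begin

abbreviation "K \<equiv> killing_form br"

lemma lin_right: "lin (br x)" by (rule linI) (auto simp: add_right scale_right)
lemma lin_left: "lin (\<lambda>x. br x z)" by (rule linI) (auto simp: add_left scale_left)

lemma anti: "br x y = - br y x"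
proof -
  have "0 = br (x + y) (x + y)" by (rule self[symmetric])
  also have "\<dots> = br x y + br y x" unfolding add_left add_right self[of x] self[of y] by simp
  finally have "br x y + br y x = 0" by simp
  then show ?thesis by (simp add: eq_neg_iff_add_eq_0)
qed

lemma zero_left [simp]: "br 0 x = 0" using lin_0[OF lin_left] .
lemma zero_right [simp]: "br x 0 = 0" using lin_0[OF lin_right] .
lemma diff_left: "br (x - y) z = br x z - br y z" using lin_diff[OF lin_left] .
lemma diff_right: "br z (x - y) = br z x - br z y" using lin_diff[OF lin_right] .

lemma K_alt: "K x y = tr (\<lambda>z. br x (br y z))" by (simp add: killing_form_def)

lemma K_sym: "K x y = K y x"
  unfolding K_alt by (rule tr_comm[OF lin_right lin_right])

lemma K_add_left: "K (x + y) z = K x z + K y z"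
  unfolding K_alt by (simp add: add_left tr_add)

lemma K_scale_left: "K (c *s x) z = c * K x z"
  unfolding K_alt by (simp add: scale_left tr_scale)

lemma K_add_right: "K z (x + y) = K z x + K z y"
  using K_add_left K_sym by metis

lemma K_scale_right: "K z (c *s x) = c * K z x"
  using K_scale_left K_sym by metis

lemma K_diff_left: "K (x - y) z = K x z - K y z"
  unfolding K_alt by (simp add: diff_left tr_diff)

lemma K_diff_right: "K z (x - y) = K z x - K z y"
  using K_diff_left K_sym by metis

lemma K_zero [simp]: "K 0 x = 0" "K x 0 = 0"
  using K_scale_left[of 0 0 x] K_scale_right[of x 0 0] by simp_all

lemma K_minus [simp]: "K (- x) y = - K x y" "K x (- y) = - K x y"
  using K_diff_left[of 0 x y] K_diff_right[of x 0 y] by simp_all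

lemma K_sum_left: "K (\<Sum>i\<in>I. f i) z = (\<Sum>i\<in>I. K (f i) z)"
  by (induction I rule: infinite_finite_induct) (auto simp: K_add_left)

lemma K_sum_right: "K z (\<Sum>i\<in>I. f i) = (\<Sum>i\<in>I. K z (f i))"
  by (induction I rule: infinite_finite_induct) (auto simp: K_add_right)

lemma K_inv: "K (br x y) z = K x (br y z)"
proof -
  have b: "br (br x y) w = br x (br y w) - br y (br x w)" for x y w by (simp add: jacobi[of x y w])
  have "K (br x y) z = tr (\<lambda>w. br x (br y (br z w))) - tr (\<lambda>w. br y (br x (br z w)))"
    unfolding K_alt b tr_diff ..
  moreover have "K x (br y z) = tr (\<lambda>w. br x (br y (br z w))) - tr (\<lambda>w. br x (br z (br y w)))"
    unfolding K_alt b diff_right tr_diff ..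
  moreover have "tr (\<lambda>w. br y (br x (br z w))) = tr (\<lambda>w. br x (br z (br y w)))"
    by (rule tr_comm[OF lin_right lin_comp[OF lin_right lin_right]])
  ultimately show ?thesis by simp
qed

lemma subspace_perp: "vec.subspace (perp br S)"
  by (rule vec.subspaceI) (auto simp: perp_def K_add_left K_scale_left)

lemma perp_span: "perp br (vec.span S) = perp br S"
proof
  show "perp br (vec.span S) \<subseteq> perp br S" by (rule perp_antimono) (rule vec.span_superset)
  show "perp br S \<subseteq> perp br (vec.span S)"
  proof
    fix x assume "x \<in> perp br S"
    then have "S \<subseteq> {y. K x y = 0}" by (auto simp: perp_def)
    moreover have "vec.subspace {y. K x y = 0}"
      by (rule vec.subspaceI) (auto simp: K_add_right K_scale_right)
    ultimately show "x \<in> perp br (vec.span S)" unfolding perp_def using vec.span_minimal by blast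
  qed
qed

lemma perp_stable:
  assumes "x \<in> perp br S" "\<And>y. y \<in> S \<Longrightarrow> br y z \<in> S" shows "br z x \<in> perp br S"
proof -
  have "K (br z x) y = 0" if "y \<in> S" for y
  proof -
    have "K (br z x) y = K x (br y z)" by (metis K_inv K_sym)
    then show ?thesis using assms that by (auto simp: perp_def)
  qed
  then show ?thesis by (auto simp: perp_def)
qed

lemma act_span_stable:
  assumes \<tau>: "rep_on br p \<tau>" and a: "a \<subseteq> p" "\<And>x y. y \<in> p \<Longrightarrow> x \<in> a \<Longrightarrow> br y x \<in> a" and y: "y \<in> p"
    and A: "\<And>v. v \<in> A \<Longrightarrow> \<tau> y v \<in> A" and v: "v \<in> act_span \<tau> a A"
  shows "\<tau> y v \<in> act_span \<tau> a A"
proof -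
  have "{\<tau> x v | x v. x \<in> a \<and> v \<in> A} \<subseteq> \<tau> y -` act_span \<tau> a A"
  proof clarify
    fix x v assume x: "x \<in> a" "v \<in> A"
    have xp: "x \<in> p" using x a by blast
    have eq: "\<tau> y (\<tau> x v) = \<tau> (br y x) v + \<tau> x (\<tau> y v)"
      using rep_onD(4)[OF \<tau> y xp] by (simp add: algebra_simps)
    have "\<tau> (br y x) v \<in> act_span \<tau> a A" "\<tau> x (\<tau> y v) \<in> act_span \<tau> a A"
      using x a(2)[OF y] A by (auto intro: act_spanI)
    then show "\<tau> x v \<in> \<tau> y -` act_span \<tau> a A"
      using vec.subspace_add[OF subspace_act_span] eq by auto
  qed
  moreover have "vec.subspace (\<tau> y -` act_span \<tau> a A)"
    by (rule vec.linear_subspace_vimage[OF rep_onD(1)[OF \<tau> y] subspace_act_span])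
  ultimately have "act_span \<tau> a A \<subseteq> \<tau> y -` act_span \<tau> a A"
    unfolding act_span_def using vec.span_minimal by blast
  then show ?thesis using v by auto
qed

lemma rep_on_br: "rep_on br p br"
proof -
  have "br (br y z) w = br y (br z w) - br z (br y w)" for y z w
    by (simp add: jacobi[of y z w])
  then show ?thesis unfolding rep_on_def by (simp add: add_left scale_left lin_right)
qed

text \<open>The series generated by a is preserved by ad y, since p normalizes a, and ad x moves it
  down by one step. So ad x \<circ> ad y strictly lowers the series and has trace zero.\<close>

lemma K_ideal_nilpotent:
  assumes a: "a \<subseteq> p" "\<And>x y. y \<in> p \<Longrightarrow> x \<in> a \<Longrightarrow> br y x \<in> a"
    and nil: "(bracket_span br a ^^ N) UNIV = {0}" and x: "x \<in> a" and y: "y \<in> p"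
  shows "K x y = 0"
proof -
  let ?F = "\<lambda>i. (act_span br a ^^ i) UNIV"
  have st: "br y v \<in> ?F i" if "v \<in> ?F i" for i v
    using that
  proof (induction i arbitrary: v)
    case (Suc i)
    then show ?case using act_span_stable[OF rep_on_br a y, of "?F i"] by auto
  qed auto
  have "tr (\<lambda>z. br x (br y z)) = 0"
  proof (rule tr_strict_chain[where V="?F" and N=N])
    show "vec.subspace (?F i)" for i by (cases i) (auto simp: subspace_act_span)
    show "?F (Suc i) \<subseteq> ?F i" for i
      by (induction i) (simp_all add: act_span_mono)
    show "(\<lambda>z. br x (br y z)) ` ?F i \<subseteq> ?F (Suc i)" for i
      using st x by (auto intro: act_spanI)
  qed (use nil in \<open>auto simp: bracket_span_act_span intro: lin_comp lin_right\<close>)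
  then show ?thesis unfolding K_alt .
qed

lemma mem_extend: "w \<in> vec.span (insert x m) \<longleftrightarrow> (\<exists>y c. y \<in> m \<and> w = y + c *s x)" if "vec.subspace m"
proof -
  have "w \<in> vec.span (insert x m) \<longleftrightarrow> (\<exists>k. w - k *s x \<in> m)"
    using vec.span_breakdown_eq[of w x m] that by (simp add: vec.span_eq_iff[THEN iffD2])
  also have "\<dots> \<longleftrightarrow> (\<exists>y c. y \<in> m \<and> w = y + c *s x)"
    by (metis add_diff_cancel_right' diff_add_cancel)
  finally show ?thesis .
qed

lemma extend_subalgebra:
  assumes m: "lie_subalgebra br m" and x: "\<And>y. y \<in> m \<Longrightarrow> \<exists>l. br y x - l *s x \<in> m"
  shows "lie_subalgebra br (vec.span (insert x m))"
  unfolding lie_subalgebra_def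
proof (intro conjI ballI)
  have sm: "vec.subspace m" using m by (simp add: lie_subalgebra_def)
  let ?m = "vec.span (insert x m)"
  have yx: "br y x \<in> ?m" if y: "y \<in> m" for y
  proof -
    obtain l where "br y x - l *s x \<in> m" using x[OF y] by auto
    then show ?thesis unfolding mem_extend[OF sm] by (metis diff_add_cancel)
  qed
  fix u v assume "u \<in> ?m" "v \<in> ?m"
  then obtain y c y' c' where u: "y \<in> m" "u = y + c *s x" and v: "y' \<in> m" "v = y' + c' *s x"
    unfolding mem_extend[OF sm] by auto
  have "br u v = br y y' + c' *s br y x - c *s br y' x"
    unfolding u v by (simp add: add_left add_right scale_left scale_right self anti[of x y'])
  moreover have "br y y' \<in> ?m" using m u v by (intro vec.span_base) (auto simp: lie_subalgebra_def)
  ultimately show "br u v \<in> ?m"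
    using yx u v by (auto intro!: vec.span_diff vec.span_add vec.span_scale)
qed simp

text \<open>As [x, x] = 0, the brackets of x with m are the only new ones. Once they land in m, so
  does the derived algebra of the extension, which is then as solvable as m.\<close>

lemma extend_derived:
  assumes m: "lie_subalgebra br m" and x: "\<And>y. y \<in> m \<Longrightarrow> br y x \<in> m"
  shows "bracket_span br (vec.span (insert x m)) (vec.span (insert x m)) \<subseteq> m"
  unfolding bracket_span_act_span
proof (rule act_span_least)
  show sm: "vec.subspace m" using m by (simp add: lie_subalgebra_def)
  let ?m = "vec.span (insert x m)"
  fix u v assume "u \<in> ?m" "v \<in> ?m"
  then obtain y c y' c' where u: "y \<in> m" "u = y + c *s x" and v: "y' \<in> m" "v = y' + c' *s x"
    unfolding mem_extend[OF sm] by auto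
  have "br u v = br y y' + c' *s br y x - c *s br y' x"
    unfolding u v by (simp add: add_left add_right scale_left scale_right self anti[of x y'])
  moreover have "br y y' \<in> m" using m u v by (auto simp: lie_subalgebra_def)
  ultimately show "br u v \<in> m"
    using x u v sm by (auto intro!: vec.subspace_diff vec.subspace_add vec.subspace_scale)
qed

lemma extend_solvable:
  assumes m: "lie_subalgebra br m" "solvable br m" and x: "\<And>y. y \<in> m \<Longrightarrow> br y x \<in> m"
  shows "lie_subalgebra br (vec.span (insert x m))" "solvable br (vec.span (insert x m))"
proof -
  show "lie_subalgebra br (vec.span (insert x m))"
    using m x by (intro extend_subalgebra) (auto intro!: exI[of _ 0])
  show "solvable br (vec.span (insert x m))"
    by (rule solvable_if_derived[OF m(2) extend_derived[OF m(1) x]])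
qed

end

text \<open>The functional is one coordinate of a linear map that kills a basis of S but not x. It
  is given by its coefficients because this form carries over directly to an extension of
  scalars.\<close>

lemma functional_separation:
  fixes S :: "(('k::field) ^ 'n) set"
  assumes S: "vec.subspace S" and x: "x \<notin> S"
  shows "\<exists>a. (\<forall>s\<in>S. (\<Sum>i\<in>UNIV. a i * s $ i) = 0) \<and> (\<Sum>i\<in>UNIV. a i * x $ i) \<noteq> 0"
proof -
  obtain B where B: "B \<subseteq> S" "vec.independent B" "S \<subseteq> vec.span B"
    using vec.maximal_independent_subset by metis
  have spB: "vec.span B = S" using B S by (simp add: vec.span_subspace)
  then have "vec.independent (insert x B)" using B(2) x vec.independent_insertI by blast
  from vec.linear_independent_extend[OF this, of "\<lambda>y. if y = x then vec 1 else 0"]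
  obtain g :: "'k ^ 'n \<Rightarrow> 'k ^ 'n" where g: "lin g" "\<forall>y\<in>insert x B. g y = (if y = x then vec 1 else 0)" by auto
  obtain i0 :: 'n where True by auto
  have gx: "g y $ i0 = (\<Sum>i\<in>UNIV. g (axis i 1) $ i0 * y $ i)" for y
    using linear_componentwise[OF g(1), of y i0] by (simp add: mult.commute)
  have "g s = 0" if "s \<in> S" for s
  proof -
    have "g y = 0" if "y \<in> B" for y using g(2) that x B(1) by (metis insertCI subsetD)
    then show ?thesis using vec.linear_eq_0_on_span[OF g(1), of B s] spB that by auto
  qed
  then show ?thesis
    using gx g(2) by (intro exI[of _ "\<lambda>i. g (axis i 1) $ i0"]) (auto simp flip: gx)
qed

locale nondegenerate_lie_alg = lie_alg +
  assumes nondegenerate: "(\<And>y. killing_form br x y = 0) \<Longrightarrow> x = 0"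
begin

text \<open>The linear map from y to the coefficient vector of K y is injective by non-degeneracy,
  hence surjective by equality of dimensions.\<close>

lemma represent_functional: "\<exists>y. \<forall>x. K x y = (\<Sum>i\<in>UNIV. a i * x $ i)"
proof -
  let ?f = "\<lambda>y. \<chi> i. K y (axis i 1)"
  have exp: "K y z = (\<Sum>i\<in>UNIV. z $ i * K y (axis i 1))" for y z
  proof -
    have "K y z = K y (\<Sum>i\<in>UNIV. z $ i *s axis i 1)" by (simp add: basis_expansion)
    then show ?thesis by (simp add: K_sum_right K_scale_right)
  qed
  have l: "lin ?f" by (rule linI) (auto simp: vec_eq_iff K_add_left K_scale_left)
  have "?f ` UNIV = UNIV"
  proof (rule subspace_inj_surj[OF l])
    show "v = 0" if "?f v = 0" for v
    proof (rule nondegenerate)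
      have z: "K v (axis i 1) = 0" for i using arg_cong[OF that, of "\<lambda>w. w $ i"] by simp
      show "K v y = 0" for y unfolding exp[of v y] by (simp add: z)
    qed
  qed auto
  then have "(\<chi> i. a i) \<in> ?f ` UNIV" by (simp only: UNIV_I)
  then obtain y where y: "?f y = (\<chi> i. a i)" by auto
  have "K y (axis i 1) = a i" for i using arg_cong[OF y, of "\<lambda>w. w $ i"] by simp
  then have "K x y = (\<Sum>i\<in>UNIV. a i * x $ i)" for x
    unfolding K_sym[of x y] exp[of y x] by (simp add: mult.commute)
  then show ?thesis by blast
qed

lemma perp_perp:
  assumes "vec.subspace S" shows "perp br (perp br S) = S"
proof
  show "S \<subseteq> perp br (perp br S)" by (auto simp: perp_def K_sym)
  show "perp br (perp br S) \<subseteq> S"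
  proof (rule subsetI, rule ccontr)
    fix x assume x: "x \<in> perp br (perp br S)" "x \<notin> S"
    obtain a where a: "\<forall>s\<in>S. (\<Sum>i\<in>UNIV. a i * s $ i) = 0" "(\<Sum>i\<in>UNIV. a i * x $ i) \<noteq> 0"
      using functional_separation[OF assms x(2)] by auto
    obtain y where y: "\<And>x. K x y = (\<Sum>i\<in>UNIV. a i * x $ i)" using represent_functional by metis
    then have "y \<in> perp br S" using a(1) by (auto simp: perp_def K_sym[of y])
    then show False using x(1) y a(2) by (auto simp: perp_def)
  qed
qed

end

section \<open>Lie's theorem, Cartan's criterion and Borel subalgebras\<close>

section \<open>Complex Lie algebras: the theorems of Lie and Cartan\<close>

locale complex_lie_alg = lie_alg br for br :: "(complex, 'n::finite) bracket"
begin

text \<open>The invariance lemma behind Lie's theorem, modulo W. On the space spanned by W and the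
  iterates e i of w under z, every y in b1 is triangular modulo W with all diagonal entries wt y.
  The bracket of y and z thus has trace m * wt (br y z) on it, while a commutator has trace
  zero.\<close>

lemma weight_zero:
  fixes \<tau> :: "complex ^ 'n \<Rightarrow> complex ^ 'w \<Rightarrow> complex ^ 'w"
  assumes b1: "b1 \<subseteq> b" and \<tau>: "rep_on br b \<tau>" and z: "z \<in> b" "\<And>y. y \<in> b1 \<Longrightarrow> br y z \<in> b1"
    and W: "vec.subspace W" "\<And>y. y \<in> b \<Longrightarrow> \<tau> y ` W \<subseteq> W"
    and w: "w \<notin> W" "\<And>y. y \<in> b1 \<Longrightarrow> \<tau> y w - wt y *s w \<in> W" and y: "y \<in> b1"
  shows "wt (br y z) = 0"
proof -
  define e where "e i = (\<tau> z ^^ i) w" for i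
  define U where "U k = vec.span (W \<union> e ` {..<k})" for k
  have lz: "lin (\<tau> z)" using rep_onD(1)[OF \<tau> z(1)] .
  have e_Suc: "e (Suc i) = \<tau> z (e i)" for i by (simp add: e_def)
  have U0: "U 0 = W" using W(1) by (simp add: U_def vec.span_eq_iff[THEN iffD2])
  have Umono: "U i \<subseteq> U j" if "i \<le> j" for i j unfolding U_def using that by (intro vec.span_mono) auto
  have subU: "vec.subspace (U i)" for i by (simp add: U_def)
  have eU: "e i \<in> U j" if "i < j" for i j unfolding U_def using that by (intro vec.span_base) auto
  \<comment> \<open>Otherwise the U m would increase strictly forever, against finite
    dimension.\<close>
  have "\<exists>m. e m \<in> U m"
  proof (rule ccontr)
    assume "\<nexists>m. e m \<in> U m"
    then have n: "e m \<notin> U m" for m by blast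
    have "m \<le> vec.dim (U m)" for m
    proof (induction m)
      case (Suc m)
      have "U m \<subset> U (Suc m)" using n[of m] eU[of m "Suc m"] Umono[of m "Suc m"] by auto
      then have "vec.dim (U m) < vec.dim (U (Suc m))"
        using subU by (intro vec.dim_psubset) (simp add: vec.span_eq_iff[THEN iffD2])
      then show ?case using Suc by simp
    qed simp
    from this[of "Suc (CARD('w))"] show False
      using vec.dim_subset_UNIV[of "U (Suc CARD('w))"] by (simp add: vec.dimension_def card_cart_basis)
  qed
  then obtain m where m: "e m \<in> U m" and least: "\<And>i. i < m \<Longrightarrow> e i \<notin> U i"
    using LeastI_ex[of "\<lambda>m. e m \<in> U m"] not_less_Least[of _ "\<lambda>m. e m \<in> U m"] by blast
  have mpos: "m > 0" using m w(1) U0 by (cases m) (auto simp: e_def)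
  have zW: "\<tau> z ` W \<subseteq> W" using W(2) z(1) by blast
  have zU': "\<tau> z ` U i \<subseteq> U (Suc i)" for i
  proof -
    have "\<tau> z ` U i = vec.span (\<tau> z ` (W \<union> e ` {..<i}))"
      unfolding U_def by (rule vec.linear_span_image[OF lz, symmetric])
    also have "\<dots> \<subseteq> U (Suc i)"
      unfolding U_def using zW by (intro vec.span_mono) (auto simp: e_Suc[symmetric])
    finally show ?thesis .
  qed
  \<comment> \<open>The induction runs over all y in b1 at once, because moving y past z produces br
    y z.\<close>
  have yU: "\<tau> y (e i) - wt y *s e i \<in> U i" if "y \<in> b1" for y i using that
  proof (induction i arbitrary: y)
    case 0
    then show ?case using w(2) U0 by (simp add: e_def)
  next
    case (Suc i)
    have yb: "y \<in> b" using Suc.prems b1 by blast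
    have y': "br y z \<in> b1" using z(2) Suc.prems .
    have "\<tau> y (e (Suc i)) = \<tau> z (\<tau> y (e i)) + \<tau> (br y z) (e i)"
      using rep_onD(4)[OF \<tau> yb z(1), of "e i"] by (simp add: e_Suc)
    then have "\<tau> y (e (Suc i)) - wt y *s e (Suc i) = \<tau> z (\<tau> y (e i) - wt y *s e i) + (\<tau> (br y z) (e i) - wt (br y z) *s e i) + wt (br y z) *s e i"
      by (simp add: lin_diff[OF lz] lin_scale[OF lz] e_Suc)
    moreover have "\<tau> z (\<tau> y (e i) - wt y *s e i) \<in> U (Suc i)" using zU'[of i] Suc.IH[OF Suc.prems] by blast
    moreover have "\<tau> (br y z) (e i) - wt (br y z) *s e i \<in> U (Suc i)" using Suc.IH[OF y'] Umono[of i "Suc i"] by auto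
    moreover have "wt (br y z) *s e i \<in> U (Suc i)" using eU subU vec.subspace_scale by blast
    ultimately show ?case using subU vec.subspace_add by metis
  qed
  obtain BW where BW: "BW \<subseteq> W" "vec.independent BW" "W \<subseteq> vec.span BW"
    using vec.maximal_independent_subset by metis
  have spBW: "vec.span BW = W" using BW W(1) by (simp add: vec.span_subspace)
  have spU: "vec.span (BW \<union> e ` {..<k}) = U k" for k
    unfolding U_def vec.span_Un spBW using W(1) by (simp add: vec.span_eq_iff[THEN iffD2])
  have ind: "vec.independent (BW \<union> e ` {..<k})" if "k \<le> m" for k using that
  proof (induction k)
    case (Suc k)
    have "BW \<union> e ` {..<Suc k} = insert (e k) (BW \<union> e ` {..<k})" by (auto simp: lessThan_Suc)
    then show ?case using Suc least[of k] spU[of k] vec.independent_insertI[of "e k" "BW \<union> e ` {..<k}"] by simp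
  qed (use BW in simp)
  \<comment> \<open>A basis of W together with e 0, ..., e (m - 1) is completed to a basis of the
    whole space. The coordinate f i along e i vanishes on W, and so the f i compute traces on U m
    modulo W.\<close>
  define B where "B = vec.extend_basis (BW \<union> e ` {..<m})"
  have B: "vec.independent B" "vec.span B = UNIV" "BW \<union> e ` {..<m} \<subseteq> B"
    unfolding B_def using vec.independent_extend_basis[OF ind[of m]] vec.span_extend_basis[OF ind[of m]]
      vec.extend_basis_superset[OF ind[of m]] by simp_all
  define f where "f i x = vec.representation B x (e i)" for i x
  have f_add: "f i (x + y) = f i x + f i y" and f_scale: "f i (c *s x) = c * f i x" for i x y c
    unfolding f_def using B by (auto simp: vec.representation_add vec.representation_scale)
  have f_zero: "f i 0 = 0" for i by (simp add: f_def vec.representation_zero)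
  have sub_f: "vec.subspace {x. f i x = 0}" for i
  proof (rule vec.subspaceI)
    show "0 \<in> {x. f i x = 0}" by (simp add: f_def vec.representation_zero)
  qed (auto simp: f_add f_scale)
  have enotW: "e i \<notin> W" if "i < m" for i using least[OF that] Umono[of 0 i] U0 by auto
  have fb: "f i b = (if b = e i then 1 else 0)" if "b \<in> B" for i b
    using that B by (auto simp: f_def vec.representation_basis)
  have fW: "f i x = 0" if "i < m" "x \<in> W" for i x
  proof -
    have "BW \<subseteq> {x. f i x = 0}"
    proof clarify
      fix x assume "x \<in> BW"
      then have "x \<in> B" "x \<noteq> e i" using enotW[OF that(1)] BW(1) B(3) by auto
      then show "f i x = 0" by (simp add: fb)
    qed
    then have "W \<subseteq> {x. f i x = 0}" using vec.span_minimal[OF _ sub_f] spBW by metis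
    then show ?thesis using that by auto
  qed
  have e_inj: "e i \<noteq> e j" if "i < j" "j < m" for i j
    using least[OF that(2)] eU[OF that(1)] by metis
  have fe: "f i (e j) = (if i = j then 1 else 0)" if "i < m" "j < m" for i j
  proof -
    have "e j \<in> B" using B(3) that by auto
    then show ?thesis using fb[of "e j" i] that e_inj[of i j] e_inj[of j i]
      by (cases i j rule: linorder_cases) auto
  qed
  have fU: "f i x = 0" if "i < m" "x \<in> U i" for i x
  proof -
    have "W \<union> e ` {..<i} \<subseteq> {x. f i x = 0}" using fW fe that(1) by auto
    then show ?thesis using vec.span_minimal[OF _ sub_f, of "W \<union> e ` {..<i}" i] that unfolding U_def by auto
  qed
  have decomp: "x - (\<Sum>j<m. f j x *s e j) \<in> W" if "x \<in> U m" for x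
  proof -
    have sub: "vec.subspace {x. x - (\<Sum>j<m. f j x *s e j) \<in> W}"
    proof (rule vec.subspaceI)
      show "0 \<in> {x. x - (\<Sum>j<m. f j x *s e j) \<in> W}" using W(1) vec.subspace_0 by (simp add: f_def vec.representation_zero)
    next
      fix x y assume "x \<in> {x. x - (\<Sum>j<m. f j x *s e j) \<in> W}" "y \<in> {x. x - (\<Sum>j<m. f j x *s e j) \<in> W}"
      then have "(x - (\<Sum>j<m. f j x *s e j)) + (y - (\<Sum>j<m. f j y *s e j)) \<in> W" using W(1) vec.subspace_add by blast
      then show "x + y \<in> {x. x - (\<Sum>j<m. f j x *s e j) \<in> W}"
        by (simp add: f_add vec.scale_left_distrib sum.distrib algebra_simps)
    next
      fix x c assume "x \<in> {x. x - (\<Sum>j<m. f j x *s e j) \<in> W}"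
      then have "c *s (x - (\<Sum>j<m. f j x *s e j)) \<in> W" using W(1) vec.subspace_scale by blast
      then show "c *s x \<in> {x. x - (\<Sum>j<m. f j x *s e j) \<in> W}"
        by (simp add: f_scale vec.scale_right_diff_distrib vec.scale_sum_right)
    qed
    have "e i - (\<Sum>j<m. f j (e i) *s e j) = 0" if "i < m" for i
    proof -
      have "(\<Sum>j<m. f j (e i) *s e j) = (\<Sum>j<m. if j = i then e j else 0)"
        using fe that by (intro sum.cong) auto
      then show ?thesis using that by simp
    qed
    then have "W \<union> e ` {..<m} \<subseteq> {x. x - (\<Sum>j<m. f j x *s e j) \<in> W}"
      using fW W(1) vec.subspace_0 by auto
    then show ?thesis using vec.span_minimal[OF _ sub] that unfolding U_def by blast
  qed
  \<comment> \<open>Multiplication of coefficient matrices modulo W. The double sum is symmetric in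
    S and T after exchanging the indices, which is the equality of the traces of both
    products.\<close>
  have trace_comp: "(\<Sum>i<m. f i (S (T (e i)))) = (\<Sum>i<m. \<Sum>j<m. f j (T (e i)) * f i (S (e j)))"
    if T: "\<And>i. i < m \<Longrightarrow> T (e i) \<in> U m" and S: "lin S" "S ` W \<subseteq> W" for S T
  proof (rule sum.cong[OF refl])
    fix i assume "i \<in> {..<m}"
    then have i: "i < m" by simp
    let ?s = "\<Sum>j<m. f j (T (e i)) *s e j"
    have "S (T (e i) - ?s) \<in> W" using decomp[OF T[OF i]] S(2) by blast
    then have "f i (S (T (e i)) - S ?s) = 0" using fW[OF i] by (simp add: lin_diff[OF S(1)])
    then have "f i (S (T (e i))) = f i (S ?s)"
      using f_add[of i "S (T (e i)) - S ?s" "S ?s"] by simp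
    also have "\<dots> = f i (\<Sum>j<m. f j (T (e i)) *s S (e j))" by (simp add: lin_sum[OF S(1)] lin_scale[OF S(1)])
    also have "\<dots> = (\<Sum>j<m. f j (T (e i)) * f i (S (e j)))"
    proof -
      have "f i (sum g A) = (\<Sum>j\<in>A. f i (g j))" if "finite A" for g :: "nat \<Rightarrow> complex ^ 'w" and A
        using that by (induction A) (auto simp: f_add f_zero)
      then show ?thesis by (simp add: f_scale)
    qed
    finally show "f i (S (T (e i))) = (\<Sum>j<m. f j (T (e i)) * f i (S (e j)))" .
  qed
  have yb: "y \<in> b" using y b1 by blast
  have zU: "\<tau> z (e i) \<in> U m" if "i < m" for i
    using that m eU[of "Suc i" m] by (cases "Suc i = m") (auto simp: e_Suc[symmetric])
  have yUm: "\<tau> y (e i) \<in> U m" if "i < m" for i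
  proof -
    have "\<tau> y (e i) - wt y *s e i \<in> U m" using yU[OF y, of i] Umono[of i m] that by auto
    then have "(\<tau> y (e i) - wt y *s e i) + wt y *s e i \<in> U m"
      using eU[OF that] subU vec.subspace_add vec.subspace_scale by metis
    then show ?thesis by simp
  qed
  have "(\<Sum>i<m. f i (\<tau> (br y z) (e i))) = (\<Sum>i<m. f i (\<tau> y (\<tau> z (e i)))) - (\<Sum>i<m. f i (\<tau> z (\<tau> y (e i))))"
  proof -
    have "f i (\<tau> (br y z) (e i)) = f i (\<tau> y (\<tau> z (e i))) - f i (\<tau> z (\<tau> y (e i)))" for i
      using f_add[of i "\<tau> (br y z) (e i)" "\<tau> z (\<tau> y (e i))"] rep_onD(4)[OF \<tau> yb z(1), of "e i"] by simp
    then show ?thesis by (simp add: sum_subtractf)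
  qed
  also have "\<dots> = 0"
  proof -
    have 1: "(\<Sum>i<m. f i (\<tau> y (\<tau> z (e i)))) = (\<Sum>i<m. \<Sum>j<m. f j (\<tau> z (e i)) * f i (\<tau> y (e j)))"
      using zU rep_onD(1)[OF \<tau> yb] W(2)[OF yb] by (rule trace_comp[where T="\<tau> z" and S="\<tau> y"])
    have 2: "(\<Sum>i<m. f i (\<tau> z (\<tau> y (e i)))) = (\<Sum>i<m. \<Sum>j<m. f j (\<tau> y (e i)) * f i (\<tau> z (e j)))"
      using yUm lz zW by (rule trace_comp[where T="\<tau> y" and S="\<tau> z"])
    have "(\<Sum>i<m. \<Sum>j<m. f j (\<tau> y (e i)) * f i (\<tau> z (e j))) = (\<Sum>j<m. \<Sum>i<m. f j (\<tau> y (e i)) * f i (\<tau> z (e j)))"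
      by (rule sum.swap)
    then show ?thesis unfolding 1 2 by (simp add: mult.commute)
  qed
  finally have "(\<Sum>i<m. f i (\<tau> (br y z) (e i))) = 0" .
  moreover have "f i (\<tau> (br y z) (e i)) = wt (br y z)" if "i < m" for i
  proof -
    have "f i (\<tau> (br y z) (e i) - wt (br y z) *s e i) = 0"
      using fU[OF that yU[OF z(2)[OF y]]] .
    then show ?thesis using f_add[of i "\<tau> (br y z) (e i) - wt (br y z) *s e i" "wt (br y z) *s e i"] fe[OF that that]
      by (simp add: f_scale)
  qed
  ultimately have "of_nat m * wt (br y z) = 0" by simp
  then show ?thesis using mpos by simp
qed

end

context complex_lie_alg
begin

text \<open>Lie's theorem for the action on V modulo W, by induction on the dimension of b. An ideal
  b1 of codimension one has a common eigenvector; all vectors of the same weight form a space S,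
  stable under the remaining element z by \<open>weight_zero\<close>. An eigenvector of z in S
  modulo W is then one for b.\<close>

theorem lie_eigenvector:
  fixes \<tau> :: "complex ^ 'n \<Rightarrow> complex ^ 'w \<Rightarrow> complex ^ 'w"
  assumes b: "lie_subalgebra br b" "solvable br b" and \<tau>: "rep_on br b \<tau>"
    and W: "vec.subspace W" "\<And>y. y \<in> b \<Longrightarrow> \<tau> y ` W \<subseteq> W"
    and V: "vec.subspace V" "\<And>y. y \<in> b \<Longrightarrow> \<tau> y ` V \<subseteq> V" "W \<subseteq> V" and v: "v \<in> V" "v \<notin> W"
  shows "\<exists>v\<in>V. v \<notin> W \<and> (\<forall>y\<in>b. \<exists>l. \<tau> y v - l *s v \<in> W)"
  using b \<tau> W(2) V(2)
proof (induction "vec.dim b" arbitrary: b rule: less_induct)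
  case less
  have sb: "vec.subspace b" using less.prems by (simp add: lie_subalgebra_def)
  show ?case
  proof (cases "b = {0}")
    case True
    have "\<tau> 0 v = 0" using rep_onD(2)[OF less.prems(3), of 0 0 v] True by simp
    then show ?thesis using v W(1) True by (auto intro!: bexI[of _ v] exI[of _ 0] simp: vec.subspace_0)
  next
    case False
    let ?D = "bracket_span br b b"
    have Db: "?D \<subseteq> b"
      unfolding bracket_span_act_span using sb less.prems(1)
      by (intro act_span_least) (auto simp: lie_subalgebra_def)
    have "?D \<noteq> b"
    proof
      assume eq: "?D = b"
      have "((\<lambda>a. bracket_span br a a) ^^ r) b = b" for r by (induction r) (auto simp: eq)
      then show False using less.prems(2) False unfolding solvable_def by auto
    qed
    obtain A where A: "A \<subseteq> ?D" "vec.independent A" "?D \<subseteq> vec.span A"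
      using vec.maximal_independent_subset by metis
    have spA: "vec.span A = ?D"
      using A by (intro vec.span_subspace) (auto simp: bracket_span_act_span subspace_act_span)
    obtain B where B: "A \<subseteq> B" "B \<subseteq> b" "vec.independent B" "b \<subseteq> vec.span B"
      using vec.maximal_independent_subset_extend[OF order_trans[OF A(1) Db] A(2)] by metis
    have spB: "vec.span B = b" using B sb by (simp add: vec.span_subspace)
    obtain z where z: "z \<in> B" "z \<notin> A"
    proof -
      have "A \<noteq> B" using spA spB \<open>?D \<noteq> b\<close> by auto
      then show ?thesis using B(1) that by blast
    qed
    \<comment> \<open>A hyperplane of b containing the derived algebra, and therefore an
      ideal.\<close>
    define b1 where "b1 = vec.span (B - {z})"
    have sb1: "vec.subspace b1" by (simp add: b1_def)
    have b1b: "b1 \<subseteq> b" unfolding b1_def using spB vec.span_mono[of "B - {z}" B] by auto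
    have Db1: "?D \<subseteq> b1" unfolding b1_def spA[symmetric] using B(1) z by (intro vec.span_mono) auto
    have zb1: "z \<notin> b1" unfolding b1_def using B(3) z(1) vec.dependent_def by blast
    have zb: "z \<in> b" using z B by auto
    have split: "\<exists>k y. y \<in> b1 \<and> x = y + k *s z" if "x \<in> b" for x
    proof -
      have "x \<in> vec.span (insert z (B - {z}))" using that spB z(1) by (simp add: insert_absorb)
      then obtain k where "x - k *s z \<in> b1" unfolding b1_def vec.span_breakdown_eq by auto
      then show ?thesis by (metis diff_add_cancel)
    qed
    have brD: "br x y \<in> ?D" if "x \<in> b" "y \<in> b" for x y
      unfolding bracket_span_act_span using that by (rule act_spanI)
    have "b1 \<subset> b" using b1b zb zb1 by auto
    then have dim: "vec.dim b1 < vec.dim b"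
      using sb sb1 by (intro vec.dim_psubset) (simp add: vec.span_eq_iff[THEN iffD2])
    have sub1: "lie_subalgebra br b1"
      unfolding lie_subalgebra_def using sb1 brD Db1 b1b by blast
    have sol1: "solvable br b1"
      using solvable_mono[OF less.prems(2) b1b] sb1 vec.subspace_0 by blast
    from less.hyps[OF dim sub1 sol1 rep_on_subset[OF less.prems(3) b1b]] less.prems(4,5) b1b
    obtain v where v: "v \<in> V" "v \<notin> W" "\<forall>y\<in>b1. \<exists>l. \<tau> y v - l *s v \<in> W" by blast
    then obtain l where l: "\<And>y. y \<in> b1 \<Longrightarrow> \<tau> y v - l y *s v \<in> W" by metis
    \<comment> \<open>The weight l is fixed by the vector from the induction hypothesis. W belongs
      to S since it is stable, so the search for an eigenvector modulo W can continue inside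
      S.\<close>
    define S where "S = {w\<in>V. \<forall>y\<in>b1. \<tau> y w - l y *s w \<in> W}"
    have lt: "lin (\<tau> y)" if "y \<in> b" for y using rep_onD(1)[OF less.prems(3) that] .
    have lt1: "lin (\<tau> y)" if "y \<in> b1" for y using lt that b1b by blast
    have subS: "vec.subspace S"
    proof (rule vec.subspaceI)
      show "0 \<in> S" using V(1) W(1) lt1 by (auto simp: S_def vec.subspace_0 lin_0)
    next
      fix x y assume xy: "x \<in> S" "y \<in> S"
      have "\<tau> u (x + y) - l u *s (x + y) \<in> W" if u: "u \<in> b1" for u
      proof -
        have "(\<tau> u x - l u *s x) + (\<tau> u y - l u *s y) \<in> W" using xy u W(1) by (auto simp: S_def intro: vec.subspace_add)
        then show ?thesis by (simp add: lin_add[OF lt1[OF u]] vec.scale_right_distrib algebra_simps)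
      qed
      then show "x + y \<in> S" using xy V(1) by (auto simp: S_def intro: vec.subspace_add)
    next
      fix c x assume xy: "x \<in> S"
      have "\<tau> u (c *s x) - l u *s (c *s x) \<in> W" if u: "u \<in> b1" for u
      proof -
        have "\<tau> u x - l u *s x \<in> W" using xy u by (simp add: S_def)
        then have "c *s (\<tau> u x - l u *s x) \<in> W" using W(1) vec.subspace_scale by blast
        then show ?thesis by (simp add: lin_scale[OF lt1[OF u]] vec.scale_right_diff_distrib mult.commute)
      qed
      then show "c *s x \<in> S" using xy V(1) by (auto simp: S_def intro: vec.subspace_scale)
    qed
    have WS: "W \<subseteq> S"
      using V(3) W(1) less.prems(4) b1b by (auto simp: S_def intro!: vec.subspace_diff vec.subspace_scale)
    have zW: "\<tau> z ` W \<subseteq> W" using less.prems(4) zb by blast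
    have zS: "\<tau> z ` S \<subseteq> S"
    proof clarify
      fix w assume w: "w \<in> S"
      show "\<tau> z w \<in> S"
      proof (cases "w \<in> W")
        case True
        then show ?thesis using WS zW by auto
      next
        case False
        have "\<tau> y (\<tau> z w) - l y *s \<tau> z w \<in> W" if y: "y \<in> b1" for y
        proof -
          have yb: "y \<in> b" using y b1b by blast
          have yz: "br y z \<in> b1" using brD[OF yb zb] Db1 by blast
          have "l (br y z) = 0"
          proof (rule weight_zero[OF b1b less.prems(3) zb _ W(1) _ False])
            show "br y z \<in> b1" if "y \<in> b1" for y using brD[of y z] that zb b1b Db1 by blast
          qed (use less.prems(4) w y in \<open>auto simp: S_def\<close>)
          then have "\<tau> (br y z) w \<in> W" using w yz by (auto simp: S_def dest: bspec[of _ _ "br y z"])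
          moreover have "\<tau> z (\<tau> y w - l y *s w) \<in> W" using w y zW by (auto simp: S_def)
          ultimately have "\<tau> (br y z) w + \<tau> z (\<tau> y w - l y *s w) \<in> W" using W(1) vec.subspace_add by blast
          then show ?thesis
            by (simp add: rep_onD(4)[OF less.prems(3) yb zb] lin_diff[OF lt[OF zb]] lin_scale[OF lt[OF zb]])
        qed
        moreover have "\<tau> z w \<in> V" using w less.prems(5)[OF zb] by (auto simp: S_def)
        ultimately show ?thesis by (simp add: S_def)
      qed
    qed
    have "v \<in> S" using v l by (simp add: S_def)
    from eigenvector_mod[OF lt[OF zb] W(1) zW subS zS this v(2)]
    obtain v' \<mu> where v': "v' \<in> S" "v' \<notin> W" "\<tau> z v' - \<mu> *s v' \<in> W" by auto
    have "\<exists>l. \<tau> x v' - l *s v' \<in> W" if x: "x \<in> b" for x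
    proof -
      obtain k y where y: "y \<in> b1" "x = y + k *s z" using split[OF x] by auto
      have yb: "y \<in> b" using y b1b by blast
      have "\<tau> x v' = \<tau> y v' + k *s \<tau> z v'"
        unfolding y(2) using rep_onD(2,3)[OF less.prems(3)] yb zb sb by (simp add: vec.subspace_scale)
      then have "\<tau> x v' - (l y + k * \<mu>) *s v' = (\<tau> y v' - l y *s v') + k *s (\<tau> z v' - \<mu> *s v')"
        by (simp add: vec.scale_left_distrib vec.scale_right_diff_distrib)
      moreover have "\<tau> y v' - l y *s v' \<in> W" using v' y by (simp add: S_def)
      ultimately show ?thesis using v'(3) W(1) vec.subspace_add vec.subspace_scale by metis
    qed
    then show ?thesis using v' by (auto simp: S_def)
  qed
qed

text \<open>Induction on the codimension of W. A common eigenvector v modulo W enlarges W. Its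
  eigenvalues are scalars and commute, so the derived algebra maps v, and with it the enlarged
  space, into W; this costs one more application of \<open>act_span\<close>.\<close>

theorem lie_strictly_triangular:
  fixes \<tau> :: "complex ^ 'n \<Rightarrow> complex ^ 'w \<Rightarrow> complex ^ 'w"
  assumes b: "lie_subalgebra br b" "solvable br b" and \<tau>: "rep_on br b \<tau>"
  shows "\<exists>k. (act_span \<tau> (bracket_span br b b) ^^ k) UNIV = {0}"
proof -
  let ?D = "bracket_span br b b"
  have sb: "vec.subspace b" using b by (simp add: lie_subalgebra_def)
  have Db: "?D \<subseteq> b"
    unfolding bracket_span_act_span using sb b(1)
    by (intro act_span_least) (auto simp: lie_subalgebra_def)
  have "\<exists>k. (act_span \<tau> ?D ^^ k) UNIV \<subseteq> W"
    if "vec.subspace W" "\<And>y. y \<in> b \<Longrightarrow> \<tau> y ` W \<subseteq> W" for W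
    using that
  proof (induction "CARD('w) - vec.dim W" arbitrary: W rule: less_induct)
    case less
    show ?case
    proof (cases "W = UNIV")
      case True
      then show ?thesis by auto
    next
      case False
      then obtain v0 where "v0 \<notin> W" by auto
      from lie_eigenvector[OF b \<tau> less.prems vec.subspace_UNIV _ _ _ this]
      obtain v where v: "v \<notin> W" "\<And>y. y \<in> b \<Longrightarrow> \<exists>l. \<tau> y v - l *s v \<in> W" by auto
      let ?W = "vec.span (insert v W)"
      have me: "u \<in> ?W \<longleftrightarrow> (\<exists>w c. w \<in> W \<and> u = w + c *s v)" for u
      proof -
        have "u \<in> ?W \<longleftrightarrow> (\<exists>k. u - k *s v \<in> W)"
          using vec.span_breakdown_eq[of u v W] less.prems(1) by (simp add: vec.span_eq_iff[THEN iffD2])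
        also have "\<dots> \<longleftrightarrow> (\<exists>w c. w \<in> W \<and> u = w + c *s v)"
          by (metis add_diff_cancel_right' diff_add_cancel)
        finally show ?thesis .
      qed
      have lt: "lin (\<tau> y)" if "y \<in> b" for y using rep_onD(1)[OF \<tau> that] .
      have st: "\<tau> y ` ?W \<subseteq> ?W" if y: "y \<in> b" for y
      proof -
        have "\<tau> y ` ?W = vec.span (\<tau> y ` insert v W)" by (rule vec.linear_span_image[OF lt[OF y], symmetric])
        also have "\<dots> \<subseteq> ?W"
        proof (rule vec.span_minimal)
          obtain l where "\<tau> y v - l *s v \<in> W" using v(2)[OF y] by auto
          then have "\<tau> y v \<in> ?W" unfolding me by (metis diff_add_cancel)
          then show "\<tau> y ` insert v W \<subseteq> ?W" using less.prems(2)[OF y] vec.span_superset[of "insert v W"] by auto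
        qed simp
        finally show ?thesis .
      qed
      have "W \<subset> ?W" using v(1) vec.span_superset[of "insert v W"] by auto
      then have "vec.dim W < vec.dim ?W"
        using less.prems(1) by (intro vec.dim_psubset) (simp add: vec.span_eq_iff[THEN iffD2] vec.span_span)
      moreover have "vec.dim ?W \<le> CARD('w)"
        using vec.dim_subset_UNIV[of ?W] by (simp add: vec.dimension_def card_cart_basis)
      ultimately have "CARD('w) - vec.dim ?W < CARD('w) - vec.dim W" by linarith
      from less.hyps[OF this vec.subspace_span st]
      obtain k where k: "(act_span \<tau> ?D ^^ k) UNIV \<subseteq> ?W" by auto
      have "\<tau> x u \<in> W" if x: "x \<in> ?D" and u: "u \<in> ?W" for x u
      proof -
        obtain w c where w: "w \<in> W" "u = w + c *s v" using u unfolding me by auto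
        have "?D \<subseteq> {x\<in>b. \<tau> x v \<in> W}"
          unfolding bracket_span_act_span
        proof (rule act_span_least)
          show "vec.subspace {x\<in>b. \<tau> x v \<in> W}"
          proof (rule vec.subspaceI)
            have "\<tau> 0 v = 0" using rep_onD(2)[OF \<tau>, of 0 0 v] sb vec.subspace_0 by auto
            then show "0 \<in> {x\<in>b. \<tau> x v \<in> W}" using sb less.prems(1) by (simp add: vec.subspace_0)
          qed (use sb less.prems(1) rep_onD(2,3)[OF \<tau>] in \<open>auto simp: vec.subspace_add vec.subspace_scale\<close>)
          fix y z assume yz: "y \<in> b" "z \<in> b"
          obtain l l' where l: "\<tau> y v - l *s v \<in> W" "\<tau> z v - l' *s v \<in> W" using v(2) yz by blast
          have "\<tau> (br y z) v = \<tau> y (\<tau> z v - l' *s v) - \<tau> z (\<tau> y v - l *s v) + (l' *s (\<tau> y v - l *s v) - l *s (\<tau> z v - l' *s v))"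
            using yz by (simp add: rep_onD(4)[OF \<tau>] lin_diff[OF lt] lin_scale[OF lt] vec.scale_right_diff_distrib mult.commute)
          also have "\<dots> \<in> W"
            using l less.prems yz by (blast intro: vec.subspace_add vec.subspace_diff vec.subspace_scale)
          finally show "br y z \<in> {x\<in>b. \<tau> x v \<in> W}" using yz b(1) by (auto simp: lie_subalgebra_def)
        qed
        then have "x \<in> b" "\<tau> x v \<in> W" using x by auto
        then show ?thesis
          using w less.prems by (auto simp: lin_add[OF lt] lin_scale[OF lt] intro!: vec.subspace_add vec.subspace_scale)
      qed
      then have "act_span \<tau> ?D ((act_span \<tau> ?D ^^ k) UNIV) \<subseteq> W"
        using k less.prems(1) by (intro act_span_least) auto
      then show ?thesis by (intro exI[of _ "Suc k"]) simp
    qed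
  qed
  from this[of "{0}"] obtain k where "(act_span \<tau> ?D ^^ k) UNIV \<subseteq> {0}"
    using rep_onD(1)[OF \<tau>] by (auto simp: lin_0)
  then show ?thesis using zero_mem_act_span_pow[where A=UNIV and \<tau>=\<tau> and a="?D" and k=k] by auto
qed

end

text \<open>A Leibniz rule for shifts: T - \<mu> - \<nu> applied to br x y is the sum of the
  brackets with T - \<mu> applied to x and with T - \<nu> applied to y. After i + j applications,
  one argument of every term has been killed.\<close>

lemma gen_eig_bracket:
  assumes L: "lie_alg br" and T: "lin T" and der: "\<And>x y. T (br x y) = br (T x) y + br x (T y)"
    and x: "x \<in> gen_eig T \<mu>" and y: "y \<in> gen_eig T \<nu>"
  shows "br x y \<in> gen_eig T (\<mu> + \<nu>)"
proof -
  interpret lie_alg br by fact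
  let ?f = "\<lambda>\<mu> v. T v - \<mu> *s v"
  have eq: "?f (\<mu> + \<nu>) (br x y) = br (?f \<mu> x) y + br x (?f \<nu> y)" for x y
    by (simp add: der diff_left diff_right scale_left scale_right vec.scale_left_distrib algebra_simps)
  have key: "(?f (\<mu> + \<nu>) ^^ n) (br x y) = 0"
    if "(?f \<mu> ^^ i) x = 0" "(?f \<nu> ^^ j) y = 0" "i + j \<le> n" for i j n x y
    using that
  proof (induction n arbitrary: i j x y)
    case 0
    then show ?case by simp
  next
    case (Suc n)
    have l: "lin (?f (\<mu> + \<nu>) ^^ n)" using lin_funpow[OF lin_shift[OF T]] .
    have 1: "(?f (\<mu> + \<nu>) ^^ n) (br (?f \<mu> x) y) = 0"
    proof (cases i)
      case 0
      then have "x = 0" using Suc.prems by simp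
      then show ?thesis using lin_0[OF l] by (simp add: lin_0[OF T])
    next
      case (Suc i')
      then have "(?f \<mu> ^^ i') (?f \<mu> x) = 0" using Suc.prems(1) by (simp only: funpow_Suc_right comp_def)
      then show ?thesis using Suc.IH[of i' "?f \<mu> x" j y] Suc.prems Suc by simp
    qed
    have 2: "(?f (\<mu> + \<nu>) ^^ n) (br x (?f \<nu> y)) = 0"
    proof (cases j)
      case 0
      then have "y = 0" using Suc.prems by simp
      then show ?thesis using lin_0[OF l] by (simp add: lin_0[OF T])
    next
      case (Suc j')
      then have "(?f \<nu> ^^ j') (?f \<nu> y) = 0" using Suc.prems(2) by (simp only: funpow_Suc_right comp_def)
      then show ?thesis using Suc.IH[of i x j' "?f \<nu> y"] Suc.prems Suc by simp
    qed
    have "(?f (\<mu> + \<nu>) ^^ Suc n) (br x y) = (?f (\<mu> + \<nu>) ^^ n) (?f (\<mu> + \<nu>) (br x y))"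
      by (simp only: funpow_Suc_right comp_def)
    also have "\<dots> = 0" unfolding eq lin_add[OF l] 1 2 by simp
    finally show ?case .
  qed
  obtain i j where "(?f \<mu> ^^ i) x = 0" "(?f \<nu> ^^ j) y = 0" using x y unfolding gen_eig_def by auto
  from key[OF this order_refl] show ?thesis unfolding gen_eig_def by blast
qed

context complex_lie_alg
begin

text \<open>Additivity of g matches the addition of eigenvalues under the bracket. The intended g is
  complex conjugation, which is additive without being complex linear.\<close>

lemma spectral_derivation:
  assumes T: "lin T" and der: "\<And>x y. T (br x y) = br (T x) y + br x (T y)"
    and C: "lin C" "\<And>\<mu> v. v \<in> gen_eig T \<mu> \<Longrightarrow> C v = g \<mu> *s v" and g: "\<And>\<mu> \<nu>. g (\<mu> + \<nu>) = g \<mu> + g \<nu>"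
  shows "C (br x y) = br (C x) y + br x (C y)"
proof -
  have sp: "vec.span (\<Union>\<mu>. gen_eig T \<mu>) = UNIV" using span_gen_eig[OF T, of UNIV] by auto
  have 1: "C (br x y) = br (C x) y + br x (C y)" if x: "x \<in> gen_eig T \<mu>" and y: "y \<in> gen_eig T \<nu>" for x y \<mu> \<nu>
    using C(2)[OF x] C(2)[OF y] C(2)[OF gen_eig_bracket[OF lie_alg_axioms T der x y]]
    by (simp add: g scale_left scale_right vec.scale_left_distrib)
  have 2: "C (br x y) = br (C x) y + br x (C y)" if x: "x \<in> gen_eig T \<mu>" for x y \<mu>
  proof -
    have "lin (\<lambda>y. C (br x y))" by (rule lin_comp[OF C(1) lin_right])
    moreover have "lin (\<lambda>y. br (C x) y + br x (C y))"
      by (rule linI) (auto simp: add_right scale_right lin_add[OF C(1)] lin_scale[OF C(1)] vec.scale_right_distrib)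
    ultimately show ?thesis
      using vec.linear_eq_on_span[of "\<lambda>y. C (br x y)" "\<lambda>y. br (C x) y + br x (C y)" "\<Union>\<mu>. gen_eig T \<mu>" y] 1[OF x] sp by auto
  qed
  have "lin (\<lambda>x. C (br x y))" by (rule lin_comp[OF C(1) lin_left])
  moreover have "lin (\<lambda>x. br (C x) y + br x (C y))"
    by (rule linI) (auto simp: add_left scale_left lin_add[OF C(1)] lin_scale[OF C(1)] vec.scale_right_distrib)
  ultimately show ?thesis
    using vec.linear_eq_on_span[of "\<lambda>x. C (br x y)" "\<lambda>x. br (C x) y + br x (C y)" "\<Union>\<mu>. gen_eig T \<mu>" x] 2 sp by auto
qed

text \<open>\<open>C\<close> below acts by \<open>cnj \<mu>\<close> on the generalized eigenspace of \<open>ad x\<close> for \<open>\<mu>\<close>, so that the trace of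
  \<open>C \<circ> ad x\<close> is the sum of the \<open>\<bar>\<mu>\<bar>\<^sup>2\<close>.\<close>

lemma derived_ad_nilpotent:
  assumes h: "lie_subalgebra br h"
    and K0: "\<And>x y z. x \<in> h \<Longrightarrow> y \<in> h \<Longrightarrow> z \<in> h \<Longrightarrow> K x (br y z) = 0"
    and x: "x \<in> bracket_span br h h"
  shows "\<exists>k. \<forall>v. (br x ^^ k) v = 0"
proof -
  let ?D = "bracket_span br h h"
  have sh: "vec.subspace h" using h by (simp add: lie_subalgebra_def)
  have sD: "vec.subspace ?D" by (simp add: bracket_span_act_span subspace_act_span)
  have Dh: "?D \<subseteq> h"
    unfolding bracket_span_act_span using h by (intro act_span_least) (auto simp: lie_subalgebra_def)
  obtain C where C: "lin C" "\<And>\<mu> v. v \<in> gen_eig (br x) \<mu> \<Longrightarrow> C v = cnj \<mu> *s v"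
  proof -
    obtain B m where Bm: "\<forall>g. \<exists>C. lin C \<and> (\<forall>b\<in>B. C b = g (m b) *s b) \<and> (\<forall>\<mu>. \<forall>v\<in>gen_eig (br x) \<mu>. C v = g \<mu> *s v)"
      using spectral_map_exists[OF lin_right[of x]] by (elim exE conjE)
    from spec[OF this, of cnj] show ?thesis using that by blast
  qed
  \<comment> \<open>ad x maps h into the derived algebra and \<open>cnj 0 = 0\<close>, so C inherits
    this from ad x.\<close>
  have CD: "C ` h \<subseteq> ?D"
  proof (rule spectral_map_stable[where T="br x" and C=C and g=cnj and W=h and W'="?D"])
    show "br x ` h \<subseteq> ?D"
      using x Dh unfolding bracket_span_act_span by (auto intro: act_spanI)
  qed (use sh sD Dh C lin_right in auto)
  have dC: "C (br u v) = br (C u) v + br u (C v)" for u v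
    by (rule spectral_derivation[OF lin_right jacobi C]) auto
  have lt: "lin (\<lambda>v. C (br u v))" for u by (rule lin_comp[OF C(1) lin_right])
  have "?D \<subseteq> {u. tr (\<lambda>v. C (br u v)) = 0}"
    unfolding bracket_span_act_span
  proof (rule act_span_least)
    show "vec.subspace {u. tr (\<lambda>v. C (br u v)) = 0}"
    proof (rule vec.subspaceI)
      show "0 \<in> {u. tr (\<lambda>v. C (br u v)) = 0}" using tr_scale[of 0 "\<lambda>v. v"] by (simp add: lin_0[OF C(1)])
    next
      fix u w assume "u \<in> {u. tr (\<lambda>v. C (br u v)) = 0}" "w \<in> {u. tr (\<lambda>v. C (br u v)) = 0}"
      then show "u + w \<in> {u. tr (\<lambda>v. C (br u v)) = 0}" by (simp add: add_left lin_add[OF C(1)] tr_add)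
    next
      fix c u assume "u \<in> {u. tr (\<lambda>v. C (br u v)) = 0}"
      then show "c *s u \<in> {u. tr (\<lambda>v. C (br u v)) = 0}" by (simp add: scale_left lin_scale[OF C(1)] tr_scale)
    qed
    fix y z assume yz: "y \<in> h" "z \<in> h"
    have b: "br (br y z) w = br y (br z w) - br z (br y w)" for w by (simp add: jacobi[of y z w])
    \<comment> \<open>By the derivation property, C \<circ> ad y equals ad (C y) + ad y \<circ> C.
      Cyclicity of the trace cancels the terms with the second summand and leaves K (C y) z, where C
      y is in the derived algebra.\<close>
    have "tr (\<lambda>v. C (br (br y z) v)) = tr (\<lambda>v. C (br y (br z v))) - tr (\<lambda>v. C (br z (br y v)))"
      unfolding b lin_diff[OF C(1)] tr_diff ..
    also have "tr (\<lambda>v. C (br z (br y v))) = tr (\<lambda>v. br y (C (br z v)))"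
      by (rule tr_comm[OF lt lin_right])
    also have "tr (\<lambda>v. C (br y (br z v))) = tr (\<lambda>v. br (C y) (br z v)) + tr (\<lambda>v. br y (C (br z v)))"
      unfolding dC[of y] tr_add ..
    finally have eq: "tr (\<lambda>v. C (br (br y z) v)) = K (C y) z" by (simp add: K_alt)
    have "C y \<in> ?D" using CD yz by auto
    moreover have "?D \<subseteq> {u. K u z = 0}"
      unfolding bracket_span_act_span
    proof (rule act_span_least)
      show "vec.subspace {u. K u z = 0}" by (rule vec.subspaceI) (auto simp: K_add_left K_scale_left)
      fix a b assume "a \<in> h" "b \<in> h"
      then show "br a b \<in> {u. K u z = 0}" using K0[of z a b] yz by (simp add: K_sym[of _ z])
    qed
    ultimately show "br y z \<in> {u. tr (\<lambda>v. C (br u v)) = 0}" using eq by auto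
  qed
  then have "tr (\<lambda>v. C (br x v)) = 0" using x by auto
  from tr_spectral[OF lin_right C this] show ?thesis .
qed

text \<open>A maximal solvable subalgebra \<open>m\<close> of \<open>[h, h]\<close> is everything: otherwise Lie's theorem gives a common
  eigenvector modulo \<open>m\<close>, with eigenvalues zero because \<open>[h, h]\<close> acts nilpotently, and adding it to \<open>m\<close> keeps \<open>m\<close>
  solvable. This replaces Engel's theorem.\<close>

theorem cartan_solvable:
  assumes h: "lie_subalgebra br h"
    and K0: "\<And>x y z. x \<in> h \<Longrightarrow> y \<in> h \<Longrightarrow> z \<in> h \<Longrightarrow> K x (br y z) = 0"
  shows "solvable br h"
proof -
  let ?D = "bracket_span br h h"
  have sD: "vec.subspace ?D" by (simp add: bracket_span_act_span subspace_act_span)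
  have Dh: "?D \<subseteq> h"
    unfolding bracket_span_act_span using h by (intro act_span_least) (auto simp: lie_subalgebra_def)
  have brD: "br u v \<in> ?D" if "u \<in> h" "v \<in> h" for u v
    using that unfolding bracket_span_act_span by (rule act_spanI)
  define P where "P m \<longleftrightarrow> lie_subalgebra br m \<and> solvable br m \<and> m \<subseteq> ?D" for m
  have "P {0}" unfolding P_def using sD
    by (auto simp: lie_subalgebra_def vec.subspace_0 solvable_def intro: exI[of _ 0])
  define d where "d = Max (vec.dim ` {m. P m})"
  have fin: "finite (vec.dim ` {m. P m})"
    by (rule finite_subset[of _ "{..CARD('n)}"])
      (use vec.dim_subset_UNIV in \<open>auto simp: vec.dimension_def card_cart_basis\<close>)
  have "d \<in> vec.dim ` {m. P m}" unfolding d_def using fin \<open>P {0}\<close> by (intro Max_in) auto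
  then obtain m where m: "P m" "vec.dim m = d" by auto
  have max: "vec.dim m' \<le> d" if "P m'" for m' unfolding d_def using fin that by (intro Max_ge) auto
  have sm: "vec.subspace m" using m by (simp add: P_def lie_subalgebra_def)
  have "?D \<subseteq> m"
  proof (rule subsetI, rule ccontr)
    fix v0 assume v0: "v0 \<in> ?D" "v0 \<notin> m"
    have stm: "br y ` m \<subseteq> m" if "y \<in> m" for y using m that by (auto simp: P_def lie_subalgebra_def)
    have stD: "br y ` ?D \<subseteq> ?D" if "y \<in> m" for y using m that Dh by (auto simp: P_def intro!: brD)
    have "lie_subalgebra br m" "solvable br m" "m \<subseteq> ?D" using m by (auto simp: P_def)
    from lie_eigenvector[OF this(1,2) rep_on_br sm stm sD stD this(3) v0]
    obtain v where v: "v \<in> ?D" "v \<notin> m" "\<And>y. y \<in> m \<Longrightarrow> \<exists>l. br y v - l *s v \<in> m" by auto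
    have yv: "br y v \<in> m" if y: "y \<in> m" for y
    proof -
      obtain l where l: "br y v - l *s v \<in> m" using v(3)[OF y] by auto
      \<comment> \<open>The k-th power of ad y sends v to l ^ k times v modulo m. Nilpotency of ad y
        puts this multiple into m, and v \<notin> m leaves only l = 0.\<close>
      have pow: "(br y ^^ k) v - l ^ k *s v \<in> m" for k
      proof (induction k)
        case 0
        then show ?case using sm by (simp add: vec.subspace_0)
      next
        case (Suc k)
        have "br y ((br y ^^ k) v - l ^ k *s v) + l ^ k *s (br y v - l *s v) \<in> m"
          using Suc l stm[OF y] sm by (blast intro: vec.subspace_add vec.subspace_scale)
        then show ?case by (simp add: diff_right scale_right vec.scale_right_diff_distrib mult.commute)
      qed
      have "y \<in> ?D" using y m by (auto simp: P_def)
      from derived_ad_nilpotent[OF h K0 this] obtain k where "\<forall>v. (br y ^^ k) v = 0" by auto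
      then have "- (l ^ k *s v) \<in> m" using pow[of k] by simp
      then have "l ^ k *s v \<in> m" using vec.subspace_neg[OF sm] by fastforce
      then have "inverse (l ^ k) *s (l ^ k *s v) \<in> m" using sm vec.subspace_scale by blast
      then have "l = 0" using v(2) by (cases "l = 0") auto
      then show ?thesis using l by simp
    qed
    have "lie_subalgebra br m" "solvable br m" using m by (auto simp: P_def)
    note ext = extend_solvable[OF this yv]
    have "vec.span (insert v m) \<subseteq> ?D"
      using v(1) m sD by (intro vec.span_minimal) (auto simp: P_def)
    then have "P (vec.span (insert v m))" unfolding P_def using ext by blast
    moreover have "m \<subset> vec.span (insert v m)" using v(2) vec.span_superset[of "insert v m"] by auto
    then have "vec.dim m < vec.dim (vec.span (insert v m))"
      using sm by (intro vec.dim_psubset) (simp add: vec.span_eq_iff[THEN iffD2] vec.span_span)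
    ultimately show False using max m(2) by fastforce
  qed
  then have "bracket_span br h h \<subseteq> m" .
  then show ?thesis using m solvable_if_derived unfolding P_def by blast
qed

text \<open>Invariance turns K (br y x) z into K x (br z y), which is zero; so b maps x into
  \<open>perp br b\<close>, hence into b. Adjoining x keeps b solvable, and maximality gives the
  claim.\<close>

lemma borel_perp_derived:
  assumes b: "borel_subalgebra br b" and x: "x \<in> perp br (bracket_span br b b)"
    and sub: "perp br b \<subseteq> b"
  shows "x \<in> b"
proof -
  have sb: "lie_subalgebra br b" "solvable br b" using b by (auto simp: borel_subalgebra_def)
  have "br y x \<in> b" if y: "y \<in> b" for y
  proof -
    have "br y x \<in> perp br b"
      unfolding perp_def
    proof clarify
      fix z assume z: "z \<in> b"
      have "K (br y x) z = K x (br z y)" by (metis K_inv K_sym)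
      also have "\<dots> = 0" using x y z unfolding perp_def bracket_span_act_span by (auto intro: act_spanI)
      finally show "K (br y x) z = 0" .
    qed
    then show ?thesis using sub by auto
  qed
  from extend_solvable[OF sb this] have "vec.span (insert x b) = b"
    using b vec.span_superset[of "insert x b"] unfolding borel_subalgebra_def by blast
  then show ?thesis using vec.span_superset[of "insert x b"] by auto
qed

text \<open>Otherwise Lie's theorem gives an element \<open>x\<close> of \<open>b\<^sup>\<bottom>\<close> outside \<open>b\<close> that is a common eigenvector modulo \<open>b\<close>,
  and the span of \<open>b\<close> and \<open>x\<close> is solvable by Cartan's criterion.\<close>

lemma borel_perp:
  assumes b: "borel_subalgebra br b"
  shows "perp br b \<subseteq> b"
proof (rule ccontr)
  assume "\<not> perp br b \<subseteq> b"
  then obtain x0 where x0: "x0 \<in> perp br b" "x0 \<notin> b" by auto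
  have lb: "lie_subalgebra br b" "solvable br b" using b by (auto simp: borel_subalgebra_def)
  have sb: "vec.subspace b" using lb by (simp add: lie_subalgebra_def)
  have brb: "br y z \<in> b" if "y \<in> b" "z \<in> b" for y z using lb that by (simp add: lie_subalgebra_def)
  \<comment> \<open>Lie's theorem is applied to the sum of b and its complement, modulo b. The
    b-component u of the eigenvector is subtracted afterwards; this does not affect the eigenvector
    property modulo b.\<close>
  let ?V = "{u + w | u w. u \<in> b \<and> w \<in> perp br b}"
  have sV: "vec.subspace ?V" by (rule vec.subspace_sums[OF sb subspace_perp])
  have stp: "br y w \<in> perp br b" if "y \<in> b" "w \<in> perp br b" for y w
    using perp_stable[OF that(2), of y] that(1) brb by auto
  have stV: "br y ` ?V \<subseteq> ?V" if "y \<in> b" for y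
    using that brb stp by (auto simp: add_right) blast
  have "b \<subseteq> ?V" using subspace_perp vec.subspace_0 by force
  moreover have "x0 \<in> ?V" using x0 sb vec.subspace_0 by force
  ultimately obtain v where v: "v \<in> ?V" "v \<notin> b" "\<forall>y\<in>b. \<exists>l. br y v - l *s v \<in> b"
    using lie_eigenvector[OF lb rep_on_br sb _ sV stV _ _ x0(2)] brb by blast
  then obtain u x where ux: "v = u + x" "u \<in> b" "x \<in> perp br b" by auto
  have xb: "x \<notin> b" using v(2) ux sb vec.subspace_add by blast
  have ev: "\<exists>l. br y x - l *s x \<in> b" if y: "y \<in> b" for y
  proof -
    obtain l where "br y v - l *s v \<in> b" using v(3) y by auto
    moreover have "br y u - l *s u \<in> b" using brb[OF y ux(2)] ux(2) sb by (auto intro: vec.subspace_diff vec.subspace_scale)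
    ultimately have "(br y v - l *s v) - (br y u - l *s u) \<in> b" using sb vec.subspace_diff by blast
    then show ?thesis by (auto simp: ux(1) add_right vec.scale_right_distrib algebra_simps intro!: exI[of _ l])
  qed
  let ?m = "vec.span (insert x b)"
  have lm: "lie_subalgebra br ?m" by (rule extend_subalgebra[OF lb(1) ev])
  have Db: "bracket_span br b b \<subseteq> b"
    unfolding bracket_span_act_span using sb brb by (intro act_span_least) auto
  have brD: "br u v \<in> bracket_span br b b" if "u \<in> b" "v \<in> b" for u v
    using that unfolding bracket_span_act_span by (rule act_spanI)
  obtain N where N: "(bracket_span br (bracket_span br b b) ^^ N) UNIV = {0}"
    using lie_strictly_triangular[OF lb rep_on_br] unfolding bracket_span_act_span by auto
  \<comment> \<open>[b, b] is an ideal of b and, by Lie's theorem for the adjoint action, acts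
    nilpotently; hence it is orthogonal to b.\<close>
  have KD: "K d y = 0" if "d \<in> bracket_span br b b" "y \<in> b" for d y
    by (rule K_ideal_nilpotent[OF Db _ N that]) (use Db in \<open>auto intro: brD\<close>)
  have Kx: "K x y = 0" "K y x = 0" if "y \<in> b" for y
    using ux(3) that K_sym by (auto simp: perp_def)
  have "K u1 (br u2 u3) = 0" if u: "u1 \<in> ?m" "u2 \<in> ?m" "u3 \<in> ?m" for u1 u2 u3
  proof -
    obtain y1 c1 where y1: "y1 \<in> b" "u1 = y1 + c1 *s x" using u(1) unfolding mem_extend[OF sb] by auto
    obtain y2 c2 where y2: "y2 \<in> b" "u2 = y2 + c2 *s x" using u(2) unfolding mem_extend[OF sb] by auto
    obtain y3 c3 where y3: "y3 \<in> b" "u3 = y3 + c3 *s x" using u(3) unfolding mem_extend[OF sb] by auto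
    note y = y1(1) y2(1) y3(1) y1(2) y2(2) y3(2)
    have b23: "br u2 u3 = br y2 y3 + c3 *s br y2 x - c2 *s br y3 x"
      unfolding y by (simp add: add_left add_right scale_left scale_right self anti[of x y3])
    have z1: "K y (br w x) = 0" if "y \<in> b" "w \<in> b" for y w
      using Kx(2)[of "br y w"] brb that K_inv by simp
    \<comment> \<open>By invariance and antisymmetry the value equals its own negative.\<close>
    have z2: "K x (br w x) = 0" if "w \<in> b" for w
    proof -
      have "K x (br w x) = K (br x w) x" by (simp add: K_inv)
      also have "\<dots> = - K x (br w x)" by (simp add: anti[of x w] K_sym)
      finally show ?thesis by simp
    qed
    have z3: "K y (br y2 y3) = 0" if "y \<in> b" for y using KD[OF brD[OF y(2,3)] that] K_sym by metis
    have z4: "K x (br y2 y3) = 0" using Kx(1) brb y by blast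
    show ?thesis
      unfolding b23 y(4)
      by (simp add: K_add_left K_add_right K_diff_right K_scale_left K_scale_right z1 z2 z3 z4 y)
  qed
  from cartan_solvable[OF lm this] have "?m = b"
    using b lm vec.span_superset[of "insert x b"] unfolding borel_subalgebra_def by blast
  then show False using xb vec.span_superset[of "insert x b"] by auto
qed

end

locale nondegenerate_complex_lie_alg = complex_lie_alg br + nondegenerate_lie_alg br
  for br :: "(complex, 'n::finite) bracket"
begin

text \<open>The dual form of \<open>borel_perp_derived\<close>: complements reverse the inclusion of
  \<open>perp\<close> of the derived algebra in b.\<close>

lemma borel_perp_subset_derived:
  assumes b: "borel_subalgebra br b"
  shows "perp br b \<subseteq> bracket_span br b b"
proof -
  have "perp br (bracket_span br b b) \<subseteq> b" using borel_perp_derived[OF b _ borel_perp[OF b]] by auto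
  then have "perp br b \<subseteq> perp br (perp br (bracket_span br b b))" by (rule perp_antimono)
  also have "\<dots> = bracket_span br b b"
    by (rule perp_perp) (simp add: bracket_span_act_span subspace_act_span)
  finally show ?thesis .
qed

end

section \<open>Complexification, and parabolic subalgebras of semisimple Lie algebras\<close>

section \<open>Extension of scalars and parabolic subalgebras\<close>

lemma to_complex_zero [simp]: "to_complex (0 :: 'k::real_or_complex) = 0"
  using to_complex_add[of "0 :: 'k" 0] by simp

lemma to_complex_eq_0_iff [simp]: "to_complex (x :: 'k::real_or_complex) = 0 \<longleftrightarrow> x = 0"
  using norm_to_complex[of x] by auto

lemma to_complex_sum: "to_complex (\<Sum>i\<in>I. f i) = (\<Sum>i\<in>I. to_complex (f i :: 'k::real_or_complex))"
  by (induction I rule: infinite_finite_induct) (auto simp: to_complex_add)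

lemma vec_to_complex_add: "vec_to_complex (x + y) = vec_to_complex x + vec_to_complex y"
  by (simp add: vec_to_complex_def vec_eq_iff to_complex_add)

lemma vec_to_complex_scale: "vec_to_complex (c *s x) = to_complex c *s vec_to_complex x"
  by (simp add: vec_to_complex_def vec_eq_iff to_complex_mult)

lemma vec_to_complex_eq_0_iff [simp]: "vec_to_complex x = 0 \<longleftrightarrow> x = 0"
  by (simp add: vec_to_complex_def vec_eq_iff)

lemma vec_to_complex_0 [simp]: "vec_to_complex 0 = 0"
  by simp

lemma vec_to_complex_diff: "vec_to_complex (x - y) = vec_to_complex x - vec_to_complex y"
  using vec_to_complex_add[of "x - y" y] by (simp add: algebra_simps)

lemma vec_to_complex_sum: "vec_to_complex (\<Sum>i\<in>I. f i) = (\<Sum>i\<in>I. vec_to_complex (f i))"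
  by (induction I rule: infinite_finite_induct) (auto simp: vec_to_complex_add)

lemma vec_to_complex_axis: "vec_to_complex (axis i 1) = axis i 1"
  by (auto simp: vec_to_complex_def vec_eq_iff axis_def to_complex_one)

lemma lin_eq_on_span_vec_to_complex:
  assumes "lin f" "lin g" "\<And>x. x \<in> S \<Longrightarrow> f (vec_to_complex x) = g (vec_to_complex x)"
    and "X \<in> vec.span (vec_to_complex ` S)"
  shows "f X = g X"
  using vec.linear_eq_on_span[OF assms(1,2), of "vec_to_complex ` S" X] assms(3,4) by auto

lemma span_vec_to_complex_UNIV: "vec.span (range (vec_to_complex :: 'k::real_or_complex ^ 'n \<Rightarrow> _)) = UNIV"
proof -
  have "cart_basis \<subseteq> range (vec_to_complex :: 'k ^ 'n \<Rightarrow> _)"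
  proof
    fix x :: "complex ^ 'n" assume "x \<in> cart_basis"
    then obtain i where "x = axis i 1" unfolding cart_basis_def by auto
    then have "x = vec_to_complex (axis i 1 :: 'k ^ 'n)" by (simp add: vec_to_complex_axis)
    then show "x \<in> range (vec_to_complex :: 'k ^ 'n \<Rightarrow> _)" by blast
  qed
  then have "vec.span cart_basis \<subseteq> vec.span (range (vec_to_complex :: 'k ^ 'n \<Rightarrow> _))" by (rule vec.span_mono)
  then show ?thesis by auto
qed

lemma lin_eq_vec_to_complex:
  fixes f g :: "complex ^ 'n \<Rightarrow> complex ^ 'w"
  assumes "lin f" "lin g" "\<And>x :: 'k::real_or_complex ^ 'n. f (vec_to_complex x) = g (vec_to_complex x)"
  shows "f X = g X"
  using lin_eq_on_span_vec_to_complex[OF assms(1,2), of "UNIV :: ('k ^ 'n) set" X] assms(3)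
    span_vec_to_complex_UNIV[where 'k='k and 'n='n] by auto

text \<open>A functional that vanishes on S but not at x extends to the complex space with the same
  coefficients and still separates.\<close>

lemma mem_of_vec_to_complex_mem_span:
  fixes S :: "('k::real_or_complex ^ 'n) set"
  assumes S: "vec.subspace S" and x: "vec_to_complex x \<in> vec.span (vec_to_complex ` S)"
  shows "x \<in> S"
proof (rule ccontr)
  assume "x \<notin> S"
  then obtain a where a: "\<forall>s\<in>S. (\<Sum>i\<in>UNIV. a i * s $ i) = 0" "(\<Sum>i\<in>UNIV. a i * x $ i) \<noteq> 0"
    using functional_separation[OF S] by metis
  let ?V = "{Y. (\<Sum>i\<in>UNIV. to_complex (a i) * Y $ i) = 0}"
  have v: "(\<Sum>i\<in>UNIV. to_complex (a i) * vec_to_complex y $ i) = to_complex (\<Sum>i\<in>UNIV. a i * y $ i)" for y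
    by (simp add: vec_to_complex_def to_complex_sum to_complex_mult)
  have "vec.subspace ?V"
    by (rule vec.subspaceI) (auto simp: distrib_left sum.distrib mult.left_commute simp flip: sum_distrib_left)
  then have "vec.span (vec_to_complex ` S) \<subseteq> ?V"
    using a(1) v by (intro vec.span_minimal) auto
  then show False using x a(2) v[of x] by auto
qed

definition bilin :: "('k::field ^ 'n \<Rightarrow> 'k ^ 'w \<Rightarrow> 'k ^ 'v) \<Rightarrow> bool" where
  "bilin \<tau> \<longleftrightarrow> (\<forall>x. lin (\<tau> x)) \<and> (\<forall>w. lin (\<lambda>x. \<tau> x w))"

text \<open>The construction of \<open>complexified_bracket\<close> for any bilinear map, so that
  representations can be extended together with the bracket. Only values on standard basis vectors
  enter; it extends \<tau> once \<tau> is bilinear on the whole space.\<close>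

definition complexify :: "('k::real_or_complex ^ 'n \<Rightarrow> 'k ^ 'w \<Rightarrow> 'k ^ 'v) \<Rightarrow> complex ^ 'n \<Rightarrow> complex ^ 'w \<Rightarrow> complex ^ 'v" where
  "complexify \<tau> X Y = (\<Sum>i\<in>UNIV. \<Sum>j\<in>UNIV. (X $ i * Y $ j) *s vec_to_complex (\<tau> (axis i 1) (axis j 1)))"

lemma complexified_bracket_eq: "complexified_bracket br = complexify br"
  by (simp add: fun_eq_iff complexified_bracket_def complexify_def)

lemma bilin_complexify: "bilin (complexify \<tau>)"
  unfolding bilin_def
  by (auto intro!: linI simp: complexify_def vec.scale_left_distrib sum.distrib vec.scale_sum_right
      algebra_simps)

lemma complexify_vec_to_complex:
  assumes "bilin \<tau>"
  shows "complexify \<tau> (vec_to_complex x) (vec_to_complex y) = vec_to_complex (\<tau> x y)"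
proof -
  have l: "lin (\<tau> x)" "lin (\<lambda>x. \<tau> x y)" for x y using assms by (auto simp: bilin_def)
  have "\<tau> x y = \<tau> (\<Sum>i\<in>UNIV. x $ i *s axis i 1) y" by (simp add: basis_expansion)
  also have "\<dots> = (\<Sum>i\<in>UNIV. x $ i *s \<tau> (axis i 1) y)"
    by (simp only: lin_sum[OF l(2)] lin_scale[OF l(2)])
  also have "\<dots> = (\<Sum>i\<in>UNIV. x $ i *s \<tau> (axis i 1) (\<Sum>j\<in>UNIV. y $ j *s axis j 1))"
    by (simp add: basis_expansion)
  also have "\<dots> = (\<Sum>i\<in>UNIV. \<Sum>j\<in>UNIV. (x $ i * y $ j) *s \<tau> (axis i 1) (axis j 1))"
    by (simp add: lin_sum[OF l(1)] lin_scale[OF l(1)] vec.scale_sum_right)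
  finally have "vec_to_complex (\<tau> x y) = vec_to_complex (\<Sum>i\<in>UNIV. \<Sum>j\<in>UNIV. (x $ i * y $ j) *s \<tau> (axis i 1) (axis j 1))"
    by simp
  then show ?thesis
    by (simp add: vec_to_complex_sum vec_to_complex_scale complexify_def to_complex_mult)
      (simp add: vec_to_complex_def)
qed

lemma bilin_eq_on_vec_to_complex:
  assumes f: "\<And>Y. lin (\<lambda>X. f X Y)" "\<And>X. lin (f X)" and g: "\<And>Y. lin (\<lambda>X. g X Y)" "\<And>X. lin (g X)"
    and "\<And>x y. x \<in> S \<Longrightarrow> y \<in> T \<Longrightarrow> f (vec_to_complex x) (vec_to_complex y) = g (vec_to_complex x) (vec_to_complex y)"
    and "X \<in> vec.span (vec_to_complex ` S)" "Y \<in> vec.span (vec_to_complex ` T)"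
  shows "f X Y = g X Y"
proof -
  have "f (vec_to_complex x) Y = g (vec_to_complex x) Y" if "x \<in> S" for x
    by (rule lin_eq_on_span_vec_to_complex[OF f(2) g(2) _ assms(7)]) (use that assms(5) in auto)
  then show ?thesis
    by (rule lin_eq_on_span_vec_to_complex[OF f(1) g(1) _ assms(6)])
qed

text \<open>The representation identity is linear in each of its three arguments, so it may be
  checked on vectors coming from \<open>'k\<close>, the first two in q and the third
  arbitrary.\<close>

lemma rep_on_complexify:
  fixes br :: "('k::real_or_complex, 'n::finite) bracket" and \<tau> :: "'k ^ 'n \<Rightarrow> 'k ^ 'w \<Rightarrow> 'k ^ 'w"
  assumes br: "bilin br" and \<tau>: "bilin \<tau>" "rep_on br q \<tau>"
  shows "rep_on (complexify br) (vec.span (vec_to_complex ` q)) (complexify \<tau>)"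
proof -
  let ?t = "complexify \<tau>" and ?b = "complexify br" and ?Q = "vec.span (vec_to_complex ` q)"
  have t: "lin (?t X)" "lin (\<lambda>X. ?t X w)" for X w using bilin_complexify[of \<tau>] by (auto simp: bilin_def)
  have b: "lin (?b X)" "lin (\<lambda>X. ?b X Y)" for X Y using bilin_complexify[of br] by (auto simp: bilin_def)
  have 1: "?t (?b Y Z) (vec_to_complex w) = ?t Y (?t Z (vec_to_complex w)) - ?t Z (?t Y (vec_to_complex w))"
    if "Y \<in> ?Q" "Z \<in> ?Q" for Y Z and w :: "'k ^ 'w"
  proof (rule bilin_eq_on_vec_to_complex[OF _ _ _ _ _ that, where f="\<lambda>Y Z. ?t (?b Y Z) (vec_to_complex w)"
       and g="\<lambda>Y Z. ?t Y (?t Z (vec_to_complex w)) - ?t Z (?t Y (vec_to_complex w))"])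
    show "lin (\<lambda>X. ?t (?b X Y) (vec_to_complex w))" for Y by (rule lin_comp[OF t(2) b(2)])
    show "lin (\<lambda>Y. ?t (?b X Y) (vec_to_complex w))" for X by (rule lin_comp[OF t(2) b(1)])
    show "lin (\<lambda>X. ?t X (?t Y (vec_to_complex w)) - ?t Y (?t X (vec_to_complex w)))" for Y
      by (rule linI) (auto simp: lin_add[OF t(1)] lin_add[OF t(2)] lin_scale[OF t(1)] lin_scale[OF t(2)] vec.scale_right_diff_distrib)
    show "lin (\<lambda>Y. ?t X (?t Y (vec_to_complex w)) - ?t Y (?t X (vec_to_complex w)))" for X
      by (rule linI) (auto simp: lin_add[OF t(1)] lin_add[OF t(2)] lin_scale[OF t(1)] lin_scale[OF t(2)] vec.scale_right_diff_distrib)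
    fix y z assume "y \<in> q" "z \<in> q"
    then show "?t (?b (vec_to_complex y) (vec_to_complex z)) (vec_to_complex w) =
      ?t (vec_to_complex y) (?t (vec_to_complex z) (vec_to_complex w)) - ?t (vec_to_complex z) (?t (vec_to_complex y) (vec_to_complex w))"
      using rep_onD(4)[OF \<tau>(2)]
      by (simp add: complexify_vec_to_complex[OF br] complexify_vec_to_complex[OF \<tau>(1)] vec_to_complex_diff)
  qed
  have "?t (?b Y Z) W = ?t Y (?t Z W) - ?t Z (?t Y W)" if "Y \<in> ?Q" "Z \<in> ?Q" for Y Z W
  proof (rule lin_eq_vec_to_complex[where f="\<lambda>W. ?t (?b Y Z) W" and g="\<lambda>W. ?t Y (?t Z W) - ?t Z (?t Y W)"])
    show "lin (\<lambda>W. ?t Y (?t Z W) - ?t Z (?t Y W))"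
      by (rule linI) (auto simp: lin_add[OF t(1)] lin_scale[OF t(1)] vec.scale_right_diff_distrib)
  qed (use t 1[OF that] in auto)
  then show ?thesis
    unfolding rep_on_def using t by (simp add: lin_add[OF t(2)] lin_scale[OF t(2)])
qed

text \<open>Pulls nilpotency back: if the complex series ends in {0}, so does the original
  one.\<close>

lemma act_span_pow_complexify:
  assumes \<tau>: "bilin \<tau>" and a: "vec_to_complex ` a \<subseteq> b"
  shows "vec_to_complex ` ((act_span \<tau> a ^^ k) UNIV) \<subseteq> (act_span (complexify \<tau>) b ^^ k) UNIV"
proof (induction k)
  case (Suc k)
  let ?A = "(act_span \<tau> a ^^ k) UNIV" and ?B = "(act_span (complexify \<tau>) b ^^ k) UNIV"
  have "act_span \<tau> a ?A \<subseteq> {x. vec_to_complex x \<in> act_span (complexify \<tau>) b ?B}"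
  proof (rule act_span_least)
    show "vec.subspace {x. vec_to_complex x \<in> act_span (complexify \<tau>) b ?B}"
      using subspace_act_span[of "complexify \<tau>" b ?B]
      by (intro vec.subspaceI) (auto simp: vec.subspace_0 vec_to_complex_add vec_to_complex_scale intro: vec.subspace_add vec.subspace_scale)
    fix x v assume "x \<in> a" "v \<in> ?A"
    then show "\<tau> x v \<in> {x. vec_to_complex x \<in> act_span (complexify \<tau>) b ?B}"
      using Suc a by (auto simp flip: complexify_vec_to_complex[OF \<tau>] intro!: act_spanI)
  qed
  then show ?case by auto
qed auto

context lie_alg
begin

lemma bilin_br: "bilin br" by (simp add: bilin_def lin_left lin_right)

end

text \<open>Antisymmetry and the Jacobi identity are multilinear and pass to the complex span. The
  identity [X, X] = 0 is quadratic and is recovered from antisymmetry.\<close>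

lemma lie_alg_complexify:
  fixes br :: "('k::real_or_complex, 'n::finite) bracket"
  assumes "lie_alg br" shows "complex_lie_alg (complexified_bracket br)"
proof -
  interpret lie_alg br by fact
  let ?b = "complexify br"
  have b: "lin (?b X)" "lin (\<lambda>X. ?b X Y)" for X Y using bilin_complexify[of br] by (auto simp: bilin_def)
  have U: "X \<in> vec.span (range (vec_to_complex :: 'k ^ 'n \<Rightarrow> _))" for X :: "complex ^ 'n"
    using span_vec_to_complex_UNIV by auto
  have an: "?b X Y = - ?b Y X" for X Y
  proof (rule bilin_eq_on_vec_to_complex[OF _ _ _ _ _ U U, where f="?b" and g="\<lambda>X Y. - ?b Y X"])
    show "lin (\<lambda>X. - ?b Y X)" for Y by (rule linI) (auto simp: lin_add[OF b(1)] lin_scale[OF b(1)])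
    show "lin (\<lambda>X. - ?b X Y)" for Y by (rule linI) (auto simp: lin_add[OF b(2)] lin_scale[OF b(2)])
    show "?b (vec_to_complex x) (vec_to_complex y) = - ?b (vec_to_complex y) (vec_to_complex x)" for x y :: "'k ^ 'n"
      using vec_to_complex_diff[of 0 "br y x"] anti[of x y] by (simp add: complexify_vec_to_complex[OF bilin_br])
  qed (use b in auto)
  have "rep_on br UNIV br" by (rule rep_on_br)
  from rep_on_complexify[OF bilin_br bilin_br this]
  have r: "?b (?b X Y) Z = ?b X (?b Y Z) - ?b Y (?b X Z)" for X Y Z
    using U by (auto simp: rep_on_def)
  show ?thesis
    unfolding complexified_bracket_eq
  proof
    show "?b X X = 0" for X using an[of X X] by (simp add: vec_eq_iff)
    show "?b X (?b Y Z) = ?b (?b X Y) Z + ?b Y (?b X Z)" for X Y Z by (simp add: r)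
  qed (auto simp: lin_add[OF b(1)] lin_scale[OF b(1)] lin_add[OF b(2)] lin_scale[OF b(2)])
qed

lemma killing_form_complexify:
  assumes "lie_alg br"
  shows "killing_form (complexified_bracket br) (vec_to_complex x) (vec_to_complex y) = to_complex (killing_form br x y)"
proof -
  interpret lie_alg br by fact
  have "complexify br (vec_to_complex x) (complexify br (vec_to_complex y) (axis i 1)) = vec_to_complex (br x (br y (axis i 1)))" for i
    using complexify_vec_to_complex[OF bilin_br] vec_to_complex_axis by metis
  then show ?thesis
    by (simp add: killing_form_def tr_alt complexified_bracket_eq to_complex_sum vec_to_complex_def)
qed

locale semisimple_lie_alg = lie_alg br for br :: "('k::real_or_complex, 'n::finite) bracket" +
  assumes semisimple: "semisimple br"
begin

abbreviation "cbr \<equiv> complexified_bracket br"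

sublocale C: complex_lie_alg cbr
  by (rule lie_alg_complexify[OF lie_alg_axioms])

lemma cbr_vec_to_complex: "cbr (vec_to_complex x) (vec_to_complex y) = vec_to_complex (br x y)"
  by (simp add: complexified_bracket_eq complexify_vec_to_complex[OF bilin_br])

lemma K_vec_to_complex: "killing_form cbr (vec_to_complex x) (vec_to_complex y) = to_complex (K x y)"
  by (rule killing_form_complexify[OF lie_alg_axioms])

lemma span_bracket_mem:
  assumes "\<And>x y. x \<in> S \<Longrightarrow> y \<in> T \<Longrightarrow> cbr (vec_to_complex x) (vec_to_complex y) \<in> V" "vec.subspace V"
    and "X \<in> vec.span (vec_to_complex ` S)" "Y \<in> vec.span (vec_to_complex ` T)"
  shows "cbr X Y \<in> V"
proof -
  have 1: "cbr (vec_to_complex x) Y \<in> V" if "x \<in> S" for x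
  proof -
    have "vec.span (vec_to_complex ` T) \<subseteq> cbr (vec_to_complex x) -` V"
      using assms(1) that by (intro vec.span_minimal vec.linear_subspace_vimage[OF C.lin_right assms(2)]) auto
    then show ?thesis using assms(4) by auto
  qed
  have "vec.span (vec_to_complex ` S) \<subseteq> (\<lambda>X. cbr X Y) -` V"
    using 1 by (intro vec.span_minimal vec.linear_subspace_vimage[OF C.lin_left assms(2)]) auto
  then show ?thesis using assms(3) by auto
qed

lemma lie_subalgebra_span:
  assumes "lie_subalgebra br h" shows "lie_subalgebra cbr (vec.span (vec_to_complex ` h))"
  unfolding lie_subalgebra_def
proof (intro conjI ballI)
  fix X Y assume XY: "X \<in> vec.span (vec_to_complex ` h)" "Y \<in> vec.span (vec_to_complex ` h)"
  show "cbr X Y \<in> vec.span (vec_to_complex ` h)"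
    by (rule span_bracket_mem[OF _ _ XY])
      (use assms in \<open>auto simp: cbr_vec_to_complex lie_subalgebra_def intro!: vec.span_base\<close>)
qed simp

lemma perp_vec_to_complex:
  assumes "x \<in> perp br S" shows "vec_to_complex x \<in> perp cbr (vec.span (vec_to_complex ` S))"
  using assms unfolding C.perp_span by (auto simp: perp_def K_vec_to_complex)

lemma solvable_of_complexified:
  assumes h: "vec.subspace h" and s: "solvable cbr (vec.span (vec_to_complex ` h))"
  shows "solvable br h"
proof -
  obtain r where r: "((\<lambda>a. bracket_span cbr a a) ^^ r) (vec.span (vec_to_complex ` h)) = {0}"
    using s unfolding solvable_def by auto
  have "vec_to_complex ` (((\<lambda>a. bracket_span br a a) ^^ k) h) \<subseteq> ((\<lambda>a. bracket_span cbr a a) ^^ k) (vec.span (vec_to_complex ` h))" for k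
  proof (induction k)
    case 0
    then show ?case by (auto intro: vec.span_base)
  next
    case (Suc k)
    let ?A = "((\<lambda>a. bracket_span br a a) ^^ k) h"
    let ?B = "((\<lambda>a. bracket_span cbr a a) ^^ k) (vec.span (vec_to_complex ` h))"
    have "act_span br ?A ?A \<subseteq> {x. vec_to_complex x \<in> act_span cbr ?B ?B}"
    proof (rule act_span_least)
      show "vec.subspace {x. vec_to_complex x \<in> act_span cbr ?B ?B}"
        using subspace_act_span[of cbr ?B ?B]
        by (intro vec.subspaceI) (auto simp: vec.subspace_0 vec_to_complex_add vec_to_complex_scale intro: vec.subspace_add vec.subspace_scale)
      fix x v assume "x \<in> ?A" "v \<in> ?A"
      then show "br x v \<in> {x. vec_to_complex x \<in> act_span cbr ?B ?B}"
        using Suc by (auto simp flip: cbr_vec_to_complex intro!: act_spanI)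
    qed
    then show ?case by (auto simp: bracket_span_act_span)
  qed
  from this[of r] have "((\<lambda>a. bracket_span br a a) ^^ r) h \<subseteq> {0}" unfolding r by auto
  moreover have "0 \<in> ((\<lambda>a. bracket_span br a a) ^^ r) h"
    using zero_mem_derived h vec.subspace_0 by blast
  ultimately show ?thesis unfolding solvable_def by blast
qed

text \<open>The radical of the Killing form is an ideal, solvable by Cartan's criterion for its
  complexification; semisimplicity makes it zero.\<close>

lemma nondegenerate: assumes "\<And>y. K x y = 0" shows "x = 0"
proof -
  let ?h = "perp br UNIV"
  have st: "br y z \<in> ?h" if "z \<in> ?h" for y z using perp_stable[OF that] by auto
  have id: "lie_ideal br UNIV ?h" using st by (auto simp: lie_ideal_def subspace_perp)
  have sub: "lie_subalgebra br ?h" using st by (auto simp: lie_subalgebra_def subspace_perp)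
  let ?H = "vec.span (vec_to_complex ` ?h)"
  have Hperp: "?H \<subseteq> perp cbr UNIV"
    using perp_vec_to_complex[of _ UNIV] span_vec_to_complex_UNIV[where 'k='k and 'n='n]
    by (intro vec.span_minimal C.subspace_perp) auto
  have "solvable cbr ?H"
    by (rule C.cartan_solvable[OF lie_subalgebra_span[OF sub]]) (use Hperp in \<open>auto simp: perp_def\<close>)
  then have "solvable br ?h" by (rule solvable_of_complexified[OF subspace_perp])
  then have "?h = {0}" using semisimple id unfolding semisimple_def by blast
  then show ?thesis using assms by (auto simp: perp_def)
qed

sublocale nondegenerate_lie_alg br
  by unfold_locales (rule nondegenerate)

sublocale C: nondegenerate_complex_lie_alg cbr
proof unfold_locales
  fix X assume X: "\<And>Y. killing_form cbr X Y = 0"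
  have "X $ j = 0" for j
  proof -
    \<comment> \<open>y represents the j-th coordinate over \<open>'k\<close>; by linearity its
      image represents the j-th complex coordinate. The constant vectors below only package
      functionals as vector-valued maps, to which \<open>lin\<close> applies.\<close>
    obtain y where y: "\<And>x. K x y = (\<Sum>i\<in>UNIV. (if i = j then 1 else 0) * x $ i)"
      using represent_functional[of "\<lambda>i. if i = j then 1 else 0"] by auto
    have y': "K x y = x $ j" for x unfolding y by (simp add: if_distrib[of "\<lambda>c. c * _"] cong: if_cong)
    have "(\<chi> i::'n. killing_form cbr X (vec_to_complex y)) = (\<chi> i::'n. X $ j)"
    proof (rule lin_eq_vec_to_complex[where f="\<lambda>X. \<chi> i::'n. killing_form cbr X (vec_to_complex y)" and g="\<lambda>X. \<chi> i::'n. X $ j"])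
      show "lin (\<lambda>X. \<chi> i::'n. killing_form cbr X (vec_to_complex y))"
        by (rule linI) (auto simp: vec_eq_iff C.K_add_left C.K_scale_left)
      show "lin (\<lambda>X::complex ^ 'n. \<chi> i::'n. X $ j)"
        by (rule linI) (auto simp: vec_eq_iff)
      show "(\<chi> i::'n. killing_form cbr (vec_to_complex x) (vec_to_complex y)) = (\<chi> i::'n. vec_to_complex x $ j)" for x :: "'k ^ 'n"
        by (simp only: K_vec_to_complex y') (simp add: vec_to_complex_def)
    qed
    then have "killing_form cbr X (vec_to_complex y) = X $ j" by (simp add: vec_eq_iff)
    then show ?thesis using X by simp
  qed
  then show "X = 0" by (simp add: vec_eq_iff)
qed

context
  fixes p assumes p: "parabolic_subalgebra br p"
begin

lemma parabolic_subalgebra: "lie_subalgebra br p" using p by (simp add: parabolic_subalgebra_def)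

lemma parabolic_subspace: "vec.subspace p" using parabolic_subalgebra by (simp add: lie_subalgebra_def)

text \<open>The complement of p becomes orthogonal to the complexified p, hence to b, and so lands
  in [b, b]. There Lie's theorem makes it act strictly triangularly, and [b, b] \<subseteq> b puts
  it back into p.\<close>

lemma parabolic_borel:
  obtains b where "borel_subalgebra cbr b" "b \<subseteq> vec.span (vec_to_complex ` p)"
    "vec_to_complex ` perp br p \<subseteq> bracket_span cbr b b" "bracket_span cbr b b \<subseteq> b"
proof -
  obtain b where b: "borel_subalgebra cbr b" "b \<subseteq> vec.span (vec_to_complex ` p)"
    using p by (auto simp: parabolic_subalgebra_def)
  have "vec_to_complex ` perp br p \<subseteq> perp cbr (vec.span (vec_to_complex ` p))" using perp_vec_to_complex by auto
  also have "\<dots> \<subseteq> perp cbr b" by (rule perp_antimono[OF b(2)])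
  also have "\<dots> \<subseteq> bracket_span cbr b b" by (rule C.borel_perp_subset_derived[OF b(1)])
  finally have 1: "vec_to_complex ` perp br p \<subseteq> bracket_span cbr b b" .
  have "bracket_span cbr b b \<subseteq> b"
    using b(1) unfolding bracket_span_act_span
    by (intro act_span_least) (auto simp: borel_subalgebra_def lie_subalgebra_def)
  then show ?thesis using that b 1 by blast
qed

lemma parabolic_perp_subset: "perp br p \<subseteq> p"
proof
  fix x assume x: "x \<in> perp br p"
  obtain b where b: "borel_subalgebra cbr b" "b \<subseteq> vec.span (vec_to_complex ` p)"
    "vec_to_complex ` perp br p \<subseteq> bracket_span cbr b b" "bracket_span cbr b b \<subseteq> b"
    by (rule parabolic_borel)
  then have "vec_to_complex x \<in> vec.span (vec_to_complex ` p)" using x by blast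
  then show "x \<in> p" by (rule mem_of_vec_to_complex_mem_span[OF parabolic_subspace])
qed

lemma parabolic_perp_nilpotent_rep:
  fixes \<tau> :: "'k ^ 'n \<Rightarrow> 'k ^ 'w \<Rightarrow> 'k ^ 'w"
  assumes \<tau>: "bilin \<tau>" "rep_on br p \<tau>"
  shows "\<exists>k. (act_span \<tau> (perp br p) ^^ k) UNIV = {0}"
proof -
  obtain b where b: "borel_subalgebra cbr b" "b \<subseteq> vec.span (vec_to_complex ` p)"
    "vec_to_complex ` perp br p \<subseteq> bracket_span cbr b b" "bracket_span cbr b b \<subseteq> b"
    by (rule parabolic_borel)
  have "rep_on cbr (vec.span (vec_to_complex ` p)) (complexify \<tau>)"
    unfolding complexified_bracket_eq by (rule rep_on_complexify[OF bilin_br \<tau>])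
  then have r: "rep_on cbr b (complexify \<tau>)" by (rule rep_on_subset[OF _ b(2)])
  have "lie_subalgebra cbr b" "solvable cbr b" using b(1) by (auto simp: borel_subalgebra_def)
  from C.lie_strictly_triangular[OF this r]
  obtain k where k: "(act_span (complexify \<tau>) (bracket_span cbr b b) ^^ k) UNIV = {0}" by auto
  have "(act_span \<tau> (perp br p) ^^ k) UNIV \<subseteq> {0}"
    using act_span_pow_complexify[OF \<tau>(1) b(3), of k] unfolding k by auto
  then show ?thesis using zero_mem_act_span_pow[where A=UNIV and \<tau>=\<tau> and a="perp br p" and k=k] by auto
qed

lemma parabolic_perp_ideal: "y \<in> p \<Longrightarrow> x \<in> perp br p \<Longrightarrow> br y x \<in> perp br p"
  using perp_stable[of x p y] parabolic_subalgebra by (auto simp: lie_subalgebra_def)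

text \<open>Every ad z with z in a is skew for K, so the k factors that produce u can be moved one
  at a time to x, where they give zero.\<close>

lemma nilpotent_ideal_pow:
  "(act_span br a ^^ k) X \<subseteq> {0} \<Longrightarrow> u \<in> (act_span br a ^^ k) UNIV \<Longrightarrow> x \<in> X \<Longrightarrow> K u x = 0"
proof (induction k arbitrary: u x X)
  case 0
  then show ?case by auto
next
  case (Suc k)
  have "act_span br a ((act_span br a ^^ k) UNIV) \<subseteq> {u. K u x = 0}"
  proof (rule act_span_least)
    show "vec.subspace {u. K u x = 0}" by (rule vec.subspaceI) (auto simp: K_add_left K_scale_left)
    fix z v assume z: "z \<in> a" "v \<in> (act_span br a ^^ k) UNIV"
    have "(act_span br a ^^ k) (act_span br a X) \<subseteq> {0}"
      using Suc.prems(1) by (simp only: funpow_Suc_right comp_def)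
    then have "K v (br z x) = 0" using Suc.IH z act_spanI[OF z(1) Suc.prems(3)] by blast
    then have "K (br z v) x = 0" using K_inv[of v z x] anti[of z v] by simp
    then show "br z v \<in> {u. K u x = 0}" by simp
  qed
  then show ?case using Suc.prems(2) by auto
qed

text \<open>If \<open>a\<close> is a nilpotent ideal of \<open>p\<close>, a power of \<open>ad a\<close> kills \<open>p\<close> and hence \<open>p\<^sup>\<bottom>\<close>; by duality it maps the
  whole algebra into \<open>p\<^sup>\<bottom>\<^sup>\<bottom> = p\<close>. So \<open>ad a\<close> is nilpotent on the whole algebra and \<open>a \<subseteq> p\<^sup>\<bottom>\<close>.\<close>

theorem nilradical_parabolic: "nilradical br p = perp br p"
proof
  obtain k where k: "(act_span br (perp br p) ^^ k) UNIV = {0}"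
    using parabolic_perp_nilpotent_rep[OF bilin_br rep_on_br] by auto
  have "(act_span br (perp br p) ^^ k) (perp br p) \<subseteq> {0}"
    using act_span_pow_mono[OF order_refl, where A="perp br p" and A'=UNIV and \<tau>=br and a="perp br p" and k=k] k by auto
  then have "(bracket_span br (perp br p) ^^ k) (perp br p) = {0}"
    using zero_mem_act_span_pow[where \<tau>=br and A="perp br p" and k=k and a="perp br p"] subspace_perp vec.subspace_0
    unfolding bracket_span_act_span by blast
  then have "nilpotent br (perp br p)" unfolding nilpotent_def by blast
  moreover have "lie_ideal br p (perp br p)"
    using parabolic_perp_ideal parabolic_perp_subset subspace_perp by (auto simp: lie_ideal_def)
  ultimately show "perp br p \<subseteq> nilradical br p"
    unfolding nilradical_def by (intro order_trans[OF _ vec.span_superset]) auto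
next
  show "nilradical br p \<subseteq> perp br p"
    unfolding nilradical_def
  proof (rule vec.span_minimal[OF _ subspace_perp], safe)
    fix a x assume a: "lie_ideal br p a" "nilpotent br a" and x: "x \<in> a"
    have id: "vec.subspace a" "a \<subseteq> p" "\<And>x y. y \<in> p \<Longrightarrow> x \<in> a \<Longrightarrow> br y x \<in> a" using a(1) by (auto simp: lie_ideal_def)
    let ?F = "act_span br a"
    obtain r where r: "(?F ^^ r) a = {0}" using a(2) by (auto simp: nilpotent_def bracket_span_act_span)
    have "?F p \<subseteq> a"
    proof (rule act_span_least[OF id(1)])
      fix x v assume "x \<in> a" "v \<in> p"
      then have "br v x \<in> a" using id by auto
      then show "br x v \<in> a" using anti[of x v] vec.subspace_neg[OF id(1)] by simp
    qed
    \<comment> \<open>One application of a takes p into a, and r further ones annihilate a; this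
      accounts for \<open>Suc r\<close>.\<close>
    then have "(?F ^^ Suc r) p \<subseteq> {0}"
      using act_span_pow_mono[OF order_refl, where A="?F p" and A'=a and \<tau>=br and a=a and k=r] r by (simp only: funpow_Suc_right comp_def)
    moreover have "(?F ^^ Suc r) (perp br p) \<subseteq> (?F ^^ Suc r) p"
      using act_span_pow_mono[OF order_refl parabolic_perp_subset] .
    ultimately have p0: "(?F ^^ Suc r) p \<subseteq> {0}" "(?F ^^ Suc r) (perp br p) \<subseteq> {0}" by auto
    have "(?F ^^ Suc r) UNIV \<subseteq> perp br (perp br p)"
      using nilpotent_ideal_pow[OF p0(2)] by (auto simp only: perp_def)
    also have "\<dots> = p" by (rule perp_perp[OF parabolic_subspace])
    finally have "(?F ^^ Suc r) ((?F ^^ Suc r) UNIV) \<subseteq> {0}"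
      using act_span_pow_mono[OF order_refl, where A="(?F ^^ Suc r) UNIV" and A'=p and \<tau>=br and a=a and k="Suc r"] p0(1) by blast
    then have "(?F ^^ (Suc r + Suc r)) UNIV \<subseteq> {0}" by (simp only: funpow_add comp_def)
    then have "(bracket_span br a ^^ (Suc r + Suc r)) UNIV = {0}"
      using zero_mem_act_span_pow[of UNIV] unfolding bracket_span_act_span by blast
    from K_ideal_nilpotent[OF id(2,3) this x]
    show "x \<in> perp br p" by (auto simp: perp_def)
  qed
qed

end

end

section \<open>Differentiability over the ground field and symmetry of second derivatives\<close>

section \<open>Calculus over the ground field\<close>

text \<open>Fixes one choice of the partial derivatives over which \<open>Ck_on\<close> quantifies
  existentially, so that they can be iterated and compared.\<close>

definition pd :: "'n \<Rightarrow> (('k::real_or_complex) ^ ('n::finite) \<Rightarrow> 'k) \<Rightarrow> 'k ^ 'n \<Rightarrow> 'k" where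
  "pd i f x = frechet_derivative f (at x) (axis i 1)"

text \<open>The real derivative has to be the \<open>'k\<close>-linear map given by the partial
  derivatives; over the complex numbers this contains the Cauchy-Riemann equations.\<close>

definition kdiff :: "(('k::real_or_complex) ^ ('n::finite) \<Rightarrow> 'k) \<Rightarrow> 'k ^ 'n \<Rightarrow> bool" where
  "kdiff f x \<longleftrightarrow> (f has_derivative (\<lambda>v. \<Sum>i\<in>UNIV. pd i f x * v $ i)) (at x)"

lemma kdiffI:
  assumes "(f has_derivative (\<lambda>v. \<Sum>i\<in>UNIV. g i * v $ i)) (at x)"
  shows "kdiff f x" "pd i f x = g i"
proof -
  have eq: "frechet_derivative f (at x) = (\<lambda>v. \<Sum>i\<in>UNIV. g i * v $ i)"
    by (rule frechet_derivative_at[OF assms, symmetric])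
  have g: "pd i f x = g i" for i
    unfolding pd_def eq by (simp add: axis_def if_distrib[of "\<lambda>c. _ * c"] cong: if_cong)
  then show "pd i f x = g i" .
  show "kdiff f x" unfolding kdiff_def g by (rule assms)
qed

lemma kdiffD: "kdiff f x \<Longrightarrow> (f has_derivative (\<lambda>v. \<Sum>i\<in>UNIV. pd i f x * v $ i)) (at x)"
  by (simp add: kdiff_def)

lemma kdiff_isCont: "kdiff f x \<Longrightarrow> isCont f x"
  using kdiffD has_derivative_continuous continuous_at by blast

lemma pd_cong:
  assumes "open S" "x \<in> S" "\<And>y. y \<in> S \<Longrightarrow> f y = g y"
  shows "kdiff f x \<longleftrightarrow> kdiff g x" "pd i f x = pd i g x"
proof -
  have t: "(f has_derivative D) (at x) \<longleftrightarrow> (g has_derivative D) (at x)" for D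
  proof
    assume "(f has_derivative D) (at x)"
    then show "(g has_derivative D) (at x)"
      by (rule has_derivative_transform_within_open[OF _ assms(1,2)]) (use assms(3) in auto)
  next
    assume "(g has_derivative D) (at x)"
    then show "(f has_derivative D) (at x)"
      by (rule has_derivative_transform_within_open[OF _ assms(1,2)]) (use assms(3) in auto)
  qed
  have p: "pd i f x = pd i g x" for i
    unfolding pd_def frechet_derivative_def t ..
  then show "pd i f x = pd i g x" .
  show "kdiff f x \<longleftrightarrow> kdiff g x" unfolding kdiff_def p t ..
qed

lemma kdiff_nth: "kdiff (\<lambda>y. y $ j) x" and pd_nth: "pd i (\<lambda>y. y $ j) x = (if i = j then 1 else 0)"
proof -
  have "(\<lambda>v::'a ^ 'b. \<Sum>i\<in>UNIV. (if i = j then 1 else 0) * v $ i) = (\<lambda>v. v $ j)"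
    by (simp add: if_distrib[of "\<lambda>c. c * _"] cong: if_cong)
  then have "((\<lambda>y. y $ j) has_derivative (\<lambda>v. \<Sum>i\<in>UNIV. (if i = j then 1 else 0) * v $ i)) (at x)"
    using bounded_linear_imp_has_derivative[OF bounded_linear_vec_nth] by simp
  from kdiffI[OF this] show "kdiff (\<lambda>y. y $ j) x" "pd i (\<lambda>y. y $ j) x = (if i = j then 1 else 0)" by auto
qed

lemma assumes "kdiff f x" "kdiff g x"
  shows kdiff_add: "kdiff (\<lambda>y. f y + g y) x" and pd_add: "pd i (\<lambda>y. f y + g y) x = pd i f x + pd i g x"
proof -
  have "((\<lambda>y. f y + g y) has_derivative (\<lambda>v. \<Sum>i\<in>UNIV. (pd i f x + pd i g x) * v $ i)) (at x)"
    using has_derivative_add[OF kdiffD[OF assms(1)] kdiffD[OF assms(2)]]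
    by (simp add: distrib_right sum.distrib)
  from kdiffI[OF this] show "kdiff (\<lambda>y. f y + g y) x" "pd i (\<lambda>y. f y + g y) x = pd i f x + pd i g x" by auto
qed

lemma assumes "kdiff f x" "kdiff g x"
  shows kdiff_mult: "kdiff (\<lambda>y. f y * g y) x" and pd_mult: "pd i (\<lambda>y. f y * g y) x = f x * pd i g x + pd i f x * g x"
proof -
  have "((\<lambda>y. f y * g y) has_derivative (\<lambda>v. \<Sum>i\<in>UNIV. (f x * pd i g x + pd i f x * g x) * v $ i)) (at x)"
  proof -
    have "(\<lambda>v. \<Sum>i\<in>UNIV. (f x * pd i g x + pd i f x * g x) * v $ i) =
      (\<lambda>v. f x * (\<Sum>i\<in>UNIV. pd i g x * v $ i) + (\<Sum>i\<in>UNIV. pd i f x * v $ i) * g x)"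
      by (simp add: fun_eq_iff sum_distrib_left sum_distrib_right algebra_simps flip: sum.distrib)
    then show ?thesis using has_derivative_mult[OF kdiffD[OF assms(1)] kdiffD[OF assms(2)]] by simp
  qed
  from kdiffI[OF this] show "kdiff (\<lambda>y. f y * g y) x" "pd i (\<lambda>y. f y * g y) x = f x * pd i g x + pd i f x * g x" by auto
qed

lemma assumes "kdiff f x" "f x \<noteq> 0"
  shows kdiff_inverse: "kdiff (\<lambda>y. inverse (f y)) x"
    and pd_inverse: "pd i (\<lambda>y. inverse (f y)) x = - (inverse (f x) * inverse (f x)) * pd i f x"
proof -
  have "((\<lambda>y. inverse (f y)) has_derivative (\<lambda>v. \<Sum>i\<in>UNIV. (- (inverse (f x) * inverse (f x)) * pd i f x) * v $ i)) (at x)"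
    using Deriv.has_derivative_inverse[OF assms(2) kdiffD[OF assms(1)]]
    by (simp add: sum_distrib_left sum_distrib_right sum_negf mult.assoc mult.left_commute mult.commute)
  from kdiffI[OF this] show "kdiff (\<lambda>y. inverse (f y)) x" "pd i (\<lambda>y. inverse (f y)) x = - (inverse (f x) * inverse (f x)) * pd i f x" by auto
qed

lemma norm_axis: "norm (axis i x) = norm x"
proof -
  have "norm (axis i x) = sqrt (\<Sum>j\<in>UNIV. if j = i then (norm x)\<^sup>2 else 0)"
    unfolding norm_vec_def L2_set_def by (intro arg_cong[of _ _ sqrt] sum.cong) (auto simp: axis_def)
  then show ?thesis by simp
qed

lemma bounded_linear_axis: "bounded_linear (axis i :: 'k::real_normed_vector \<Rightarrow> 'k ^ 'n)"
proof (rule bounded_linear_intro[where K=1])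
  show "axis i (x + y) = axis i x + axis i y" for x y :: 'k by (auto simp: axis_def vec_eq_iff)
  show "axis i (r *\<^sub>R x) = r *\<^sub>R axis i x" for r and x :: 'k by (auto simp: axis_def vec_eq_iff)
  show "norm (axis i x :: 'k ^ 'n) \<le> norm x * 1" for x
    by (simp add: norm_axis)
qed

lemma has_derivative_vec:
  fixes f :: "'a::real_normed_vector \<Rightarrow> ('k::real_normed_vector) ^ ('n::finite)"
  assumes "\<And>i. ((\<lambda>x. f x $ i) has_derivative (\<lambda>v. f' v $ i)) F"
  shows "(f has_derivative f') F"
proof -
  have e: "y = (\<Sum>i\<in>UNIV. axis i (y $ i))" for y :: "'k ^ 'n"
    by (simp add: vec_eq_iff axis_def sum.delta cong: if_cong)
  have "((\<lambda>x. \<Sum>i\<in>UNIV. axis i (f x $ i)) has_derivative (\<lambda>v. \<Sum>i\<in>UNIV. axis i (f' v $ i))) F"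
    by (intro has_derivative_sum bounded_linear.has_derivative[OF bounded_linear_axis] assms)
  then show ?thesis unfolding e[symmetric] .
qed

lemma
  fixes h :: "('k::real_or_complex) ^ ('n::finite) \<Rightarrow> 'k ^ ('m::finite)"
  assumes h: "\<And>j. kdiff (\<lambda>y. h y $ j) x" and f: "kdiff f (h x)"
  shows kdiff_compose: "kdiff (\<lambda>y. f (h y)) x"
    and pd_compose: "pd i (\<lambda>y. f (h y)) x = (\<Sum>j\<in>UNIV. pd j f (h x) * pd i (\<lambda>y. h y $ j) x)"
proof -
  have "(h has_derivative (\<lambda>v. \<chi> j. \<Sum>i\<in>UNIV. pd i (\<lambda>y. h y $ j) x * v $ i)) (at x)"
    by (rule has_derivative_vec) (simp add: kdiffD[OF h])
  from has_derivative_compose[OF this kdiffD[OF f]]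
  have "((\<lambda>y. f (h y)) has_derivative (\<lambda>v. \<Sum>j\<in>UNIV. \<Sum>i\<in>UNIV. pd j f (h x) * pd i (\<lambda>y. h y $ j) x * v $ i)) (at x)"
    by (simp add: sum_distrib_left mult.assoc)
  then have "((\<lambda>y. f (h y)) has_derivative (\<lambda>v. \<Sum>i\<in>UNIV. (\<Sum>j\<in>UNIV. pd j f (h x) * pd i (\<lambda>y. h y $ j) x) * v $ i)) (at x)"
    by (subst (asm) sum.swap) (simp add: sum_distrib_right)
  from kdiffI[OF this] show "kdiff (\<lambda>y. f (h y)) x"
    "pd i (\<lambda>y. f (h y)) x = (\<Sum>j\<in>UNIV. pd j f (h x) * pd i (\<lambda>y. h y $ j) x)" by auto
qed

lemma Ck_on_subset: "Ck_on r S f \<Longrightarrow> T \<subseteq> S \<Longrightarrow> Ck_on r T f"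
proof (induction r arbitrary: f)
  case 0
  then show ?case using continuous_on_subset by auto
next
  case (Suc r)
  then obtain g where "\<forall>x\<in>S. (f has_derivative (\<lambda>v. \<Sum>i\<in>UNIV. g i x * v $ i)) (at x)" "\<forall>i. Ck_on r S (g i)" by auto
  then show ?case using Suc.IH Suc.prems(2) by (auto intro!: exI[of _ g])
qed

lemma Ck_on_cong: "open S \<Longrightarrow> (\<And>x. x \<in> S \<Longrightarrow> f x = g x) \<Longrightarrow> Ck_on r S f \<Longrightarrow> Ck_on r S g"
proof (cases r)
  case 0
  assume "open S" "\<And>x. x \<in> S \<Longrightarrow> f x = g x" "Ck_on r S f"
  then show ?thesis using 0 by (simp cong: continuous_on_cong)
next
  case (Suc n)
  assume *: "open S" "\<And>x. x \<in> S \<Longrightarrow> f x = g x" "Ck_on r S f"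
  then obtain h where h: "\<forall>x\<in>S. (f has_derivative (\<lambda>v. \<Sum>i\<in>UNIV. h i x * v $ i)) (at x)" "\<forall>i. Ck_on n S (h i)"
    using Suc by auto
  have "(g has_derivative (\<lambda>v. \<Sum>i\<in>UNIV. h i x * v $ i)) (at x)" if "x \<in> S" for x
    using has_derivative_transform_within_open[OF bspec[OF h(1) that] *(1) that] *(2) by blast
  then show ?thesis using h(2) Suc by auto
qed

text \<open>The derivative determines its coefficients, so any witness in \<open>Ck_on\<close>
  agrees with \<open>pd\<close> at the points of S. As S is open, this agreement carries the higher
  derivatives along.\<close>

lemma Ck_on_Suc:
  assumes "open S"
  shows "Ck_on (Suc r) S f \<longleftrightarrow> (\<forall>x\<in>S. kdiff f x) \<and> (\<forall>i. Ck_on r S (pd i f))"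
proof
  assume "Ck_on (Suc r) S f"
  then obtain g where g: "\<And>x. x \<in> S \<Longrightarrow> (f has_derivative (\<lambda>v. \<Sum>i\<in>UNIV. g i x * v $ i)) (at x)" "\<And>i. Ck_on r S (g i)" by auto
  have "\<forall>x\<in>S. kdiff f x" using kdiffI(1)[OF g(1)] by blast
  moreover have "Ck_on r S (pd i f)" for i
    by (rule Ck_on_cong[OF assms _ g(2)[of i]]) (simp add: kdiffI(2)[OF g(1)])
  ultimately show "(\<forall>x\<in>S. kdiff f x) \<and> (\<forall>i. Ck_on r S (pd i f))" by simp
next
  assume "(\<forall>x\<in>S. kdiff f x) \<and> (\<forall>i. Ck_on r S (pd i f))"
  then show "Ck_on (Suc r) S f" by (auto simp: kdiff_def intro!: exI[of _ "\<lambda>i. pd i f"])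
qed

lemma Ck_on_SucD: "open S \<Longrightarrow> Ck_on (Suc r) S f \<Longrightarrow> Ck_on r S f"
proof (induction r arbitrary: f)
  case 0
  then have "\<forall>x\<in>S. kdiff f x" unfolding Ck_on_Suc[OF 0(1)] by auto
  then show ?case by (simp add: continuous_at_imp_continuous_on kdiff_isCont)
next
  case (Suc r)
  then have "\<forall>x\<in>S. kdiff f x" "\<forall>i. Ck_on (Suc r) S (pd i f)" using Ck_on_Suc[OF Suc.prems(1)] by blast+
  then show ?case using Suc.IH[OF Suc.prems(1)] Ck_on_Suc[OF Suc.prems(1)] by blast
qed

lemma Ck_on_local:
  assumes "open S" "\<And>x. x \<in> S \<Longrightarrow> \<exists>T. open T \<and> x \<in> T \<and> Ck_on r T f"
  shows "Ck_on r S f"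
  using assms
proof (induction r arbitrary: f)
  case 0
  have "isCont f x" if "x \<in> S" for x
    using 0(2)[OF that] continuous_on_eq_continuous_at by auto
  then show ?case by (simp add: continuous_at_imp_continuous_on)
next
  case (Suc r)
  have "kdiff f x" "\<exists>T. open T \<and> x \<in> T \<and> Ck_on r T (pd i f)" if x: "x \<in> S" for x i
  proof -
    obtain T where "open T" "x \<in> T" "Ck_on (Suc r) T f" using Suc.prems(2)[OF x] by auto
    then show "kdiff f x" "\<exists>T. open T \<and> x \<in> T \<and> Ck_on r T (pd i f)" using Ck_on_Suc by blast+
  qed
  then show ?case unfolding Ck_on_Suc[OF Suc.prems(1)] using Suc.IH[OF Suc.prems(1)] by blast
qed

lemma Ck_on_const: "Ck_on r S (\<lambda>_. c)"
proof (induction r arbitrary: c)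
  case (Suc r)
  then show ?case by (auto intro!: exI[of _ "\<lambda>_ _. 0"])
qed auto

lemma Ck_on_nth: "open S \<Longrightarrow> Ck_on r S (\<lambda>y. y $ j)"
proof (cases r)
  case 0
  then show ?thesis by (simp add: continuous_intros)
next
  case (Suc n)
  assume "open S"
  then show ?thesis unfolding Suc Ck_on_Suc[OF \<open>open S\<close>] by (auto simp: kdiff_nth pd_nth[abs_def] Ck_on_const)
qed

lemma Ck_on_add: "open S \<Longrightarrow> Ck_on r S f \<Longrightarrow> Ck_on r S g \<Longrightarrow> Ck_on r S (\<lambda>y. f y + g y)"
proof (induction r arbitrary: f g)
  case 0
  then show ?case by (auto intro: continuous_intros)
next
  case (Suc r)
  note k = Suc.prems(2,3)[unfolded Ck_on_Suc[OF Suc.prems(1)]]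
  have "Ck_on r S (pd i (\<lambda>y. f y + g y))" for i
    by (rule Ck_on_cong[OF Suc.prems(1) _ Suc.IH[OF Suc.prems(1)], of "pd i f" "pd i g"])
      (use k in \<open>auto simp: pd_add\<close>)
  then show ?case unfolding Ck_on_Suc[OF Suc.prems(1)] using k by (auto intro: kdiff_add)
qed

lemma Ck_on_mult: "open S \<Longrightarrow> Ck_on r S f \<Longrightarrow> Ck_on r S g \<Longrightarrow> Ck_on r S (\<lambda>y. f y * g y)"
proof (induction r arbitrary: f g)
  case 0
  then show ?case by (auto intro: continuous_intros)
next
  case (Suc r)
  note k = Suc.prems(2,3)[unfolded Ck_on_Suc[OF Suc.prems(1)]]
  have "Ck_on r S f" "Ck_on r S g" using Suc.prems Ck_on_SucD by blast+
  then have "Ck_on r S (\<lambda>y. f y * pd i g y + pd i f y * g y)" for i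
    using k by (intro Ck_on_add Suc.IH Suc.prems(1)) auto
  then have "Ck_on r S (pd i (\<lambda>y. f y * g y))" for i
    by (rule Ck_on_cong[OF Suc.prems(1), rotated]) (use k in \<open>auto simp: pd_mult\<close>)
  then show ?case unfolding Ck_on_Suc[OF Suc.prems(1)] using k by (auto intro: kdiff_mult)
qed

lemma Ck_on_sum:
  assumes "open S" "\<And>i. i \<in> I \<Longrightarrow> Ck_on r S (f i)"
  shows "Ck_on r S (\<lambda>y. \<Sum>i\<in>I. f i y)"
  using assms(2) by (induction I rule: infinite_finite_induct) (auto intro: Ck_on_add assms(1) Ck_on_const)

lemma Ck_on_inverse: "open S \<Longrightarrow> (\<And>x. x \<in> S \<Longrightarrow> f x \<noteq> 0) \<Longrightarrow> Ck_on r S f \<Longrightarrow> Ck_on r S (\<lambda>y. inverse (f y))"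
proof (induction r)
  case 0
  then show ?case by (auto intro: continuous_intros)
next
  case (Suc r)
  note k = Suc.prems(3)[unfolded Ck_on_Suc[OF Suc.prems(1)]]
  have "Ck_on r S f" using Suc.prems Ck_on_SucD by blast
  then have "Ck_on r S (\<lambda>y. (- 1) * (inverse (f y) * inverse (f y)) * pd i f y)" for i
    using k Suc.prems by (intro Ck_on_mult Ck_on_const Suc.IH) auto
  then have "Ck_on r S (pd i (\<lambda>y. inverse (f y)))" for i
    by (rule Ck_on_cong[OF Suc.prems(1), rotated]) (use k Suc.prems(2) in \<open>auto simp: pd_inverse\<close>)
  then show ?case unfolding Ck_on_Suc[OF Suc.prems(1)] using k Suc.prems(2) by (auto intro: kdiff_inverse)
qed

lemma Ck_on_compose:
  fixes h :: "('k::real_or_complex) ^ ('n::finite) \<Rightarrow> 'k ^ ('m::finite)"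
  assumes "open S" "open T" and "\<And>j. Ck_on r S (\<lambda>y. h y $ j)" and "h ` S \<subseteq> T" and "Ck_on r T f"
  shows "Ck_on r S (\<lambda>y. f (h y))"
  using assms(3,5)
proof (induction r arbitrary: f)
  case 0
  then have "continuous_on S h" using continuous_on_vec_lambda[of S "\<lambda>i x. h x $ i"] by simp
  then show ?case using 0 assms(4) by (auto intro: continuous_on_compose2)
next
  case (Suc r)
  note k = Suc.prems(2)[unfolded Ck_on_Suc[OF assms(2)]]
  have kh: "\<forall>x\<in>S. kdiff (\<lambda>y. h y $ j) x" "\<forall>i. Ck_on r S (pd i (\<lambda>y. h y $ j))" for j
    using Suc.prems(1)[of j] unfolding Ck_on_Suc[OF assms(1)] by auto
  have h: "Ck_on r S (\<lambda>y. h y $ j)" for j using Suc.prems(1) Ck_on_SucD assms(1) by blast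
  have "Ck_on r S (\<lambda>y. \<Sum>j\<in>UNIV. pd j f (h y) * pd i (\<lambda>y. h y $ j) y)" for i
    using Suc.IH[OF h] k kh(2) by (intro Ck_on_sum Ck_on_mult assms(1)) auto
  then have "Ck_on r S (pd i (\<lambda>y. f (h y)))" for i
    by (rule Ck_on_cong[OF assms(1), rotated]) (use k kh assms(4) in \<open>auto simp: pd_compose image_subset_iff\<close>)
  then show ?case unfolding Ck_on_Suc[OF assms(1)] using k kh assms(4) by (auto simp: image_subset_iff intro: kdiff_compose)
qed

definition cinf :: "('k::real_or_complex ^ 'n::finite) set \<Rightarrow> ('k ^ 'n \<Rightarrow> 'k) \<Rightarrow> bool" where
  "cinf S f \<longleftrightarrow> open S \<and> (\<forall>r. Ck_on r S f)"

lemma cinf_open: "cinf S f \<Longrightarrow> open S" by (simp add: cinf_def)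
lemma cinf_kdiff: "cinf S f \<Longrightarrow> x \<in> S \<Longrightarrow> kdiff f x"
  unfolding cinf_def using Ck_on_Suc by blast
lemma cinf_pd: "cinf S f \<Longrightarrow> cinf S (pd i f)"
  unfolding cinf_def using Ck_on_Suc by blast
lemma cinf_continuous: "cinf S f \<Longrightarrow> continuous_on S f"
  unfolding cinf_def using Ck_on.simps(1) by blast
lemma cinf_subset: "cinf S f \<Longrightarrow> open T \<Longrightarrow> T \<subseteq> S \<Longrightarrow> cinf T f"
  unfolding cinf_def using Ck_on_subset by blast
lemma cinf_cong: "cinf S f \<Longrightarrow> (\<And>x. x \<in> S \<Longrightarrow> f x = g x) \<Longrightarrow> cinf S g"
  unfolding cinf_def using Ck_on_cong by blast
lemma cinf_local: "open S \<Longrightarrow> (\<And>x. x \<in> S \<Longrightarrow> \<exists>T. x \<in> T \<and> cinf T f) \<Longrightarrow> cinf S f"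
  unfolding cinf_def by (auto intro!: Ck_on_local)
lemma cinf_const: "open S \<Longrightarrow> cinf S (\<lambda>_. c)" by (simp add: cinf_def Ck_on_const)
lemma cinf_nth: "open S \<Longrightarrow> cinf S (\<lambda>y. y $ j)" by (simp add: cinf_def Ck_on_nth)
lemma cinf_add: "cinf S f \<Longrightarrow> cinf S g \<Longrightarrow> cinf S (\<lambda>y. f y + g y)" by (simp add: cinf_def Ck_on_add)
lemma cinf_mult: "cinf S f \<Longrightarrow> cinf S g \<Longrightarrow> cinf S (\<lambda>y. f y * g y)" by (simp add: cinf_def Ck_on_mult)
lemma cinf_sum: "open S \<Longrightarrow> (\<And>i. i \<in> I \<Longrightarrow> cinf S (f i)) \<Longrightarrow> cinf S (\<lambda>y. \<Sum>i\<in>I. f i y)"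
  by (simp add: cinf_def Ck_on_sum)
lemma cinf_inverse: "cinf S f \<Longrightarrow> (\<And>x. x \<in> S \<Longrightarrow> f x \<noteq> 0) \<Longrightarrow> cinf S (\<lambda>y. inverse (f y))"
  by (simp add: cinf_def Ck_on_inverse)
lemma cinf_compose:
  fixes h :: "('k::real_or_complex) ^ ('n::finite) \<Rightarrow> 'k ^ ('m::finite)"
  assumes "cinf T f" "open S" "\<And>j. cinf S (\<lambda>y. h y $ j)" "h ` S \<subseteq> T"
  shows "cinf S (\<lambda>y. f (h y))"
proof -
  have "Ck_on r S (\<lambda>y. f (h y))" for r
    by (rule Ck_on_compose[where S=S and T=T and h=h and f=f]) (use assms in \<open>simp_all add: cinf_def\<close>)
  then show ?thesis using \<open>open S\<close> by (simp add: cinf_def)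
qed

text \<open>The second difference over a square of side h, evaluated by two applications of the mean
  value theorem. Increments are real, and the inner product with b makes the function real-valued,
  as that theorem demands.\<close>

lemma mixed_difference:
  fixes f :: "('k::real_or_complex) ^ ('n::finite) \<Rightarrow> 'k" and b :: 'k
  assumes f: "cinf S f" and h: "h > 0"
    and S: "\<And>s t. 0 \<le> s \<Longrightarrow> s \<le> h \<Longrightarrow> 0 \<le> t \<Longrightarrow> t \<le> h \<Longrightarrow> x + s *\<^sub>R axis i 1 + t *\<^sub>R axis j 1 \<in> S"
  shows "\<exists>\<xi> \<eta>. 0 < \<xi> \<and> \<xi> < h \<and> 0 < \<eta> \<and> \<eta> < h \<and>
    (f (x + h *\<^sub>R axis i 1 + h *\<^sub>R axis j 1) - f (x + h *\<^sub>R axis i 1) - f (x + h *\<^sub>R axis j 1) + f x) \<bullet> b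
     = h * (h * (pd j (pd i f) (x + \<xi> *\<^sub>R axis i 1 + \<eta> *\<^sub>R axis j 1) \<bullet> b))"
proof -
  have dir: "((\<lambda>s. g (y + s *\<^sub>R axis k 1) \<bullet> b) has_real_derivative pd k g (y + s *\<^sub>R axis k 1) \<bullet> b) (at s)"
    if "kdiff g (y + s *\<^sub>R axis k 1)" for g :: "'k ^ 'n \<Rightarrow> 'k" and y k s
  proof -
    have "((\<lambda>s. y + s *\<^sub>R axis k 1) has_derivative (\<lambda>s. s *\<^sub>R axis k 1)) (at s)"
      by (auto intro!: derivative_eq_intros)
    from has_derivative_compose[OF this kdiffD[OF that]]
    have "((\<lambda>s. g (y + s *\<^sub>R axis k 1)) has_derivative (\<lambda>s'. s' *\<^sub>R pd k g (y + s *\<^sub>R axis k 1))) (at s)"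
    proof -
      have "(\<Sum>i\<in>UNIV. pd i g z * (s' *\<^sub>R axis k 1) $ i) = s' *\<^sub>R pd k g z" for s' z
      proof -
        have "pd i g z * (s' *\<^sub>R axis k (1::'k)) $ i = (if i = k then s' *\<^sub>R pd k g z else 0)" for i
          by (simp add: axis_def)
        then show ?thesis by simp
      qed
      then show ?thesis
        using \<open>((\<lambda>s. g (y + s *\<^sub>R axis k 1)) has_derivative _) (at s)\<close> by simp
    qed
    from has_derivative_inner_left[OF this, of b]
    show ?thesis by (simp add: has_field_derivative_def mult_commute_abs)
  qed
  define \<phi> where "\<phi> s = f (x + h *\<^sub>R axis j 1 + s *\<^sub>R axis i 1) \<bullet> b - f (x + s *\<^sub>R axis i 1) \<bullet> b" for s
  have k: "kdiff f (x + s *\<^sub>R axis i 1 + t *\<^sub>R axis j 1)" "kdiff (pd i f) (x + s *\<^sub>R axis i 1 + t *\<^sub>R axis j 1)"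
    if "0 \<le> s" "s \<le> h" "0 \<le> t" "t \<le> h" for s t
    using S[OF that] cinf_kdiff f cinf_pd by blast+
  have "\<exists>\<xi>>0. \<xi> < h \<and> \<phi> h - \<phi> 0 = (h - 0) * (pd i f (x + h *\<^sub>R axis j 1 + \<xi> *\<^sub>R axis i 1) \<bullet> b - pd i f (x + \<xi> *\<^sub>R axis i 1) \<bullet> b)"
  proof (rule MVT2[OF h])
    fix s assume s: "0 \<le> s" "s \<le> h"
    have "kdiff f (x + h *\<^sub>R axis j 1 + s *\<^sub>R axis i 1)" using k(1)[OF s, of h] h by (simp add: algebra_simps)
    moreover have "kdiff f (x + s *\<^sub>R axis i 1)" using k(1)[OF s, of 0] h by simp
    ultimately show "(\<phi> has_real_derivative (pd i f (x + h *\<^sub>R axis j 1 + s *\<^sub>R axis i 1) \<bullet> b - pd i f (x + s *\<^sub>R axis i 1) \<bullet> b)) (at s)"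
      unfolding \<phi>_def by (intro DERIV_diff dir)
  qed
  then obtain \<xi> where \<xi>: "0 < \<xi>" "\<xi> < h"
    "\<phi> h - \<phi> 0 = h * (pd i f (x + h *\<^sub>R axis j 1 + \<xi> *\<^sub>R axis i 1) \<bullet> b - pd i f (x + \<xi> *\<^sub>R axis i 1) \<bullet> b)" by auto
  have "\<exists>\<eta>>0. \<eta> < h \<and> pd i f (x + \<xi> *\<^sub>R axis i 1 + h *\<^sub>R axis j 1) \<bullet> b - pd i f (x + \<xi> *\<^sub>R axis i 1 + 0 *\<^sub>R axis j 1) \<bullet> b
     = (h - 0) * (pd j (pd i f) (x + \<xi> *\<^sub>R axis i 1 + \<eta> *\<^sub>R axis j 1) \<bullet> b)"
    by (rule MVT2[OF h]) (intro dir k(2), use \<xi> in auto)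
  then obtain \<eta> where \<eta>: "0 < \<eta>" "\<eta> < h" "pd i f (x + \<xi> *\<^sub>R axis i 1 + h *\<^sub>R axis j 1) \<bullet> b - pd i f (x + \<xi> *\<^sub>R axis i 1) \<bullet> b
     = h * (pd j (pd i f) (x + \<xi> *\<^sub>R axis i 1 + \<eta> *\<^sub>R axis j 1) \<bullet> b)" by auto
  have "(f (x + h *\<^sub>R axis i 1 + h *\<^sub>R axis j 1) - f (x + h *\<^sub>R axis i 1) - f (x + h *\<^sub>R axis j 1) + f x) \<bullet> b = \<phi> h - \<phi> 0"
    unfolding \<phi>_def by (simp add: inner_diff_left inner_add_left algebra_simps)
  also have "\<dots> = h * (h * (pd j (pd i f) (x + \<xi> *\<^sub>R axis i 1 + \<eta> *\<^sub>R axis j 1) \<bullet> b))"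
    unfolding \<xi>(3) \<eta>(3)[symmetric] by (simp add: algebra_simps)
  finally show ?thesis using \<xi> \<eta> by blast
qed

lemma isCont_dist_less:
  fixes f :: "'a::metric_space \<Rightarrow> 'b::metric_space"
  assumes "isCont f x" "e > 0"
  shows "\<exists>d>0. \<forall>y. dist y x < d \<longrightarrow> dist (f y) (f x) < e"
  using assms unfolding isCont_def LIM_def by (metis dist_self)

text \<open>The second difference is symmetric in i and j. Both mixed derivatives therefore take a
  common value, at points as close to x as desired, and continuity forces equality at x.\<close>

lemma pd_commute:
  fixes f :: "('k::real_or_complex) ^ ('n::finite) \<Rightarrow> 'k"
  assumes f: "cinf S f" and x: "x \<in> S"
  shows "pd i (pd j f) x = pd j (pd i f) x"
proof (rule euclidean_eqI)
  fix b :: 'k assume "b \<in> Basis"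
  let ?A = "\<lambda>y. pd j (pd i f) y \<bullet> b" and ?B = "\<lambda>y. pd i (pd j f) y \<bullet> b"
  have "open S" using f cinf_open by blast
  then obtain e0 where e0: "e0 > 0" "ball x e0 \<subseteq> S" using x openE by blast
  have cA: "isCont ?A x" "isCont ?B x"
    using cinf_kdiff[OF cinf_pd[OF cinf_pd[OF f]] x] by (auto intro!: continuous_intros kdiff_isCont)
  have near: "dist (x + s *\<^sub>R axis k 1 + t *\<^sub>R axis l 1) x \<le> 2 * h"
    if "0 \<le> s" "s \<le> h" "0 \<le> t" "t \<le> h" for s t h and k l :: 'n
  proof -
    have "dist (x + s *\<^sub>R axis k 1 + t *\<^sub>R axis l 1) x = norm (s *\<^sub>R axis k (1::'k) + t *\<^sub>R axis l 1)"
      by (simp add: dist_norm algebra_simps)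
    also have "\<dots> \<le> norm (s *\<^sub>R axis k (1::'k)) + norm (t *\<^sub>R axis l (1::'k))" by (rule norm_triangle_ineq)
    also have "\<dots> \<le> 2 * h" using that by (simp add: norm_axis)
    finally show ?thesis .
  qed
  show "pd i (pd j f) x \<bullet> b = pd j (pd i f) x \<bullet> b"
  proof (rule ccontr)
    assume ne: "?B x \<noteq> ?A x"
    define e where "e = \<bar>?B x - ?A x\<bar> / 2"
    have "e > 0" using ne by (simp add: e_def)
    obtain d1 where d1: "d1 > 0" "\<And>y. dist y x < d1 \<Longrightarrow> dist (?A y) (?A x) < e"
      using isCont_dist_less[OF cA(1) \<open>e > 0\<close>] by blast
    obtain d2 where d2: "d2 > 0" "\<And>y. dist y x < d2 \<Longrightarrow> dist (?B y) (?B x) < e"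
      using isCont_dist_less[OF cA(2) \<open>e > 0\<close>] by blast
    define h where "h = min e0 (min d1 d2) / 4"
    have h: "h > 0" "2 * h < e0" "2 * h < d1" "2 * h < d2" using e0 d1 d2 by (auto simp: h_def)
    have inS: "x + s *\<^sub>R axis k 1 + t *\<^sub>R axis l 1 \<in> S" if "0 \<le> s" "s \<le> h" "0 \<le> t" "t \<le> h" for s t and k l :: 'n
      using near[OF that, of k l] h(2) e0(2) by (auto simp: dist_commute)
    obtain \<xi> \<eta> where 1: "0 < \<xi>" "\<xi> < h" "0 < \<eta>" "\<eta> < h"
      "(f (x + h *\<^sub>R axis i 1 + h *\<^sub>R axis j 1) - f (x + h *\<^sub>R axis i 1) - f (x + h *\<^sub>R axis j 1) + f x) \<bullet> b
     = h * (h * ?A (x + \<xi> *\<^sub>R axis i 1 + \<eta> *\<^sub>R axis j 1))"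
      using mixed_difference[OF f h(1) inS, of i j b] by blast
    obtain \<xi>' \<eta>' where 2: "0 < \<xi>'" "\<xi>' < h" "0 < \<eta>'" "\<eta>' < h"
      "(f (x + h *\<^sub>R axis j 1 + h *\<^sub>R axis i 1) - f (x + h *\<^sub>R axis j 1) - f (x + h *\<^sub>R axis i 1) + f x) \<bullet> b
     = h * (h * ?B (x + \<xi>' *\<^sub>R axis j 1 + \<eta>' *\<^sub>R axis i 1))"
      using mixed_difference[OF f h(1) inS, of j i b] by blast
    have "f (x + h *\<^sub>R axis j 1 + h *\<^sub>R axis i 1) - f (x + h *\<^sub>R axis j 1) - f (x + h *\<^sub>R axis i 1) + f x
       = f (x + h *\<^sub>R axis i 1 + h *\<^sub>R axis j 1) - f (x + h *\<^sub>R axis i 1) - f (x + h *\<^sub>R axis j 1) + f x"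
      by (simp add: algebra_simps)
    then have "?A (x + \<xi> *\<^sub>R axis i 1 + \<eta> *\<^sub>R axis j 1) = ?B (x + \<xi>' *\<^sub>R axis j 1 + \<eta>' *\<^sub>R axis i 1)"
    proof -
      assume eq: "f (x + h *\<^sub>R axis j 1 + h *\<^sub>R axis i 1) - f (x + h *\<^sub>R axis j 1) - f (x + h *\<^sub>R axis i 1) + f x
       = f (x + h *\<^sub>R axis i 1 + h *\<^sub>R axis j 1) - f (x + h *\<^sub>R axis i 1) - f (x + h *\<^sub>R axis j 1) + f x"
      have "h * (h * ?A (x + \<xi> *\<^sub>R axis i 1 + \<eta> *\<^sub>R axis j 1)) = h * (h * ?B (x + \<xi>' *\<^sub>R axis j 1 + \<eta>' *\<^sub>R axis i 1))"
        unfolding 1(5)[symmetric] 2(5)[symmetric] eq ..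
      then show ?thesis using h(1) by simp
    qed
    moreover have "dist (?A (x + \<xi> *\<^sub>R axis i 1 + \<eta> *\<^sub>R axis j 1)) (?A x) < e"
      using near[of \<xi> h \<eta> i j] 1 h by (intro d1(2)) auto
    moreover have "dist (?B (x + \<xi>' *\<^sub>R axis j 1 + \<eta>' *\<^sub>R axis i 1)) (?B x) < e"
      using near[of \<xi>' h \<eta>' j i] 2 h by (intro d2(2)) auto
    ultimately have "\<bar>?B x - ?A x\<bar> < 2 * e" by (simp add: dist_real_def)
    then show False by (simp add: e_def)
  qed
qed

lemma deriv_compose:
  fixes c :: "'k::real_or_complex \<Rightarrow> 'k ^ ('n::finite)"
  assumes g: "kdiff g (c 0)" and c: "\<And>i. ((\<lambda>t. c t $ i) has_field_derivative w $ i) (at 0)"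
  shows "((\<lambda>t. g (c t)) has_field_derivative (\<Sum>i\<in>UNIV. pd i g (c 0) * w $ i)) (at 0)"
proof -
  have "(c has_derivative (\<lambda>t. t *s w)) (at 0)"
    by (rule has_derivative_vec) (use c in \<open>simp add: has_field_derivative_def mult_commute_abs\<close>)
  from has_derivative_compose[OF this kdiffD[OF g]]
  have "((\<lambda>t. g (c t)) has_derivative (\<lambda>t. \<Sum>i\<in>UNIV. pd i g (c 0) * (t *s w) $ i)) (at 0)" .
  moreover have "(\<lambda>t. \<Sum>i\<in>UNIV. pd i g (c 0) * (t *s w) $ i) = (*) (\<Sum>i\<in>UNIV. pd i g (c 0) * w $ i)"
    by (simp add: fun_eq_iff sum_distrib_left mult_ac)
  ultimately show ?thesis by (simp add: has_field_derivative_def)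
qed

lemma det_cinf:
  assumes "open S" "\<And>i j. cinf S (\<lambda>y. M y $ i $ j)"
  shows "cinf S (\<lambda>y. det (M y :: ('k::real_or_complex) ^ ('m::finite) ^ 'm))"
proof -
  have prod: "cinf S (\<lambda>y. \<Prod>i\<in>I. M y $ i $ p i)" if "finite I" for I and p :: "'m \<Rightarrow> 'm"
    using that by (induction I) (auto intro: cinf_const cinf_mult assms)
  show ?thesis unfolding det_def
    using assms prod by (intro cinf_sum cinf_mult cinf_const) auto
qed

section \<open>Smooth functions on manifolds, tested in charts\<close>

section \<open>Manifolds\<close>

lemma chartD:
  assumes "manifold A" "(U, \<phi>) \<in> A"
  shows "open U" "open (\<phi> ` U)" "continuous_on U \<phi>" "continuous_on (\<phi> ` U) (inv_into U \<phi>)"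
    "x \<in> U \<Longrightarrow> inv_into U \<phi> (\<phi> x) = x" "y \<in> \<phi> ` U \<Longrightarrow> \<phi> (inv_into U \<phi> y) = y"
    "y \<in> \<phi> ` U \<Longrightarrow> inv_into U \<phi> y \<in> U"
proof -
  have h: "open U" "open (\<phi> ` U)" "homeomorphism U (\<phi> ` U) \<phi> (inv_into U \<phi>)"
    using assms unfolding manifold_def by auto
  then show "open U" "open (\<phi> ` U)" "continuous_on U \<phi>" "continuous_on (\<phi> ` U) (inv_into U \<phi>)"
    "x \<in> U \<Longrightarrow> inv_into U \<phi> (\<phi> x) = x" "y \<in> \<phi> ` U \<Longrightarrow> \<phi> (inv_into U \<phi> y) = y"
    "y \<in> \<phi> ` U \<Longrightarrow> inv_into U \<phi> y \<in> U"
    unfolding homeomorphism_def by auto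
qed

lemma chart_exists: assumes "manifold A" obtains U \<phi> where "(U, \<phi>) \<in> A" "x \<in> U"
proof -
  have "x \<in> (\<Union>(U, \<phi>)\<in>A. U)" using assms by (simp add: manifold_def)
  then show thesis using that by auto
qed

lemma chart_image_inverse:
  assumes "manifold A" "(U, \<phi>) \<in> A"
  shows "\<phi> ` (V \<inter> U) = inv_into U \<phi> -` V \<inter> \<phi> ` U"
  using chartD(5,6,7)[OF assms] by (force simp: image_iff)

lemma chart_open_image:
  assumes "manifold A" "(U, \<phi>) \<in> A" "open V" shows "open (\<phi> ` (V \<inter> U))"
  unfolding chart_image_inverse[OF assms(1,2)]
  using continuous_on_open_vimage[OF chartD(2)[OF assms(1,2)], of "inv_into U \<phi>"] chartD(4)[OF assms(1,2)] assms(3)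
  by blast

lemma transition_cinf:
  assumes "manifold A" "(U, \<phi>) \<in> A" "(V, \<psi>) \<in> A"
  shows "cinf (\<phi> ` (V \<inter> U)) (\<lambda>y. \<psi> (inv_into U \<phi> y) $ j)"
proof -
  have "Ck_on r (\<phi> ` (U \<inter> V)) (\<lambda>y. \<psi> (inv_into U \<phi> y) $ j)" for r
    using assms unfolding manifold_def by fast
  then show ?thesis
    unfolding cinf_def using chart_open_image[OF assms(1,2) chartD(1)[OF assms(1,3)]] by (simp add: Int_commute)
qed

lemma smooth_fun_iff:
  assumes "manifold A"
  shows "smooth_fun A V f \<longleftrightarrow> open V \<and> (\<forall>(U, \<phi>)\<in>A. cinf (\<phi> ` (V \<inter> U)) (\<lambda>y. f (inv_into U \<phi> y)))"
  unfolding smooth_fun_def cinf_def using chart_open_image[OF assms] by blast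

lemma smooth_fun_open: "smooth_fun A V f \<Longrightarrow> open V" by (simp add: smooth_fun_def)

lemma smooth_fun_chart:
  assumes "manifold A" "smooth_fun A V f" "(U, \<phi>) \<in> A"
  shows "cinf (\<phi> ` (V \<inter> U)) (\<lambda>y. f (inv_into U \<phi> y))"
  using assms unfolding smooth_fun_iff[OF assms(1)] by blast

lemma smooth_fun_subset: "smooth_fun A V f \<Longrightarrow> open W \<Longrightarrow> W \<subseteq> V \<Longrightarrow> smooth_fun A W f"
  unfolding smooth_fun_def by (fast intro: Ck_on_subset)

text \<open>\<open>smooth_fun\<close> refers to all charts at once; smoothness of the transition
  maps reduces it to one chart around each point.\<close>

lemma smooth_fun_chartI:
  assumes A: "manifold A" and "open V"
    and ex: "\<And>x. x \<in> V \<Longrightarrow> \<exists>U \<phi> W. (U, \<phi>) \<in> A \<and> x \<in> W \<and> open W \<and> W \<subseteq> U \<and> cinf (\<phi> ` W) (\<lambda>y. f (inv_into U \<phi> y))"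
  shows "smooth_fun A V f"
  unfolding smooth_fun_iff[OF A]
proof (intro conjI ballI, fact, clarify)
  fix U' \<psi> assume c': "(U', \<psi>) \<in> A"
  show "cinf (\<psi> ` (V \<inter> U')) (\<lambda>y. f (inv_into U' \<psi> y))"
  proof (rule cinf_local[OF chart_open_image[OF A c' \<open>open V\<close>]])
    fix y assume "y \<in> \<psi> ` (V \<inter> U')"
    then obtain x where x: "x \<in> V" "x \<in> U'" "y = \<psi> x" by auto
    obtain U \<phi> W where c: "(U, \<phi>) \<in> A" and W: "x \<in> W" "open W" "W \<subseteq> U" "cinf (\<phi> ` W) (\<lambda>y. f (inv_into U \<phi> y))"
      using ex[OF x(1)] by blast
    let ?T = "\<psi> ` (W \<inter> U')"
    have oT: "open ?T" by (rule chart_open_image[OF A c' W(2)])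
    have "cinf ?T (\<lambda>y. f (inv_into U \<phi> (\<phi> (inv_into U' \<psi> y))))"
    proof (rule cinf_compose[OF W(4) oT])
      show "cinf ?T (\<lambda>y. \<phi> (inv_into U' \<psi> y) $ j)" for j
        by (rule cinf_subset[OF transition_cinf[OF A c' c] oT]) (use W in auto)
      show "(\<lambda>y. \<phi> (inv_into U' \<psi> y)) ` ?T \<subseteq> \<phi> ` W"
        using chartD(5)[OF A c'] by auto
    qed
    then have "cinf ?T (\<lambda>y. f (inv_into U' \<psi> y))"
      by (rule cinf_cong) (use chartD(5)[OF A c'] chartD(5)[OF A c] W(3) in auto)
    moreover have "y \<in> ?T" using x W(1) by auto
    ultimately show "\<exists>T. y \<in> T \<and> cinf T (\<lambda>y. f (inv_into U' \<psi> y))" by (intro exI[of _ ?T] conjI)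
  qed
qed

lemma smooth_fun_local:
  assumes A: "manifold A" and "open V" and ex: "\<And>x. x \<in> V \<Longrightarrow> smooth_near A x f"
  shows "smooth_fun A V f"
proof (rule smooth_fun_chartI[OF A \<open>open V\<close>])
  fix x assume "x \<in> V"
  then obtain W where W: "x \<in> W" "smooth_fun A W f" using ex unfolding smooth_near_def by auto
  obtain U \<phi> where c: "(U, \<phi>) \<in> A" "x \<in> U" using chart_exists[OF A] by blast
  show "\<exists>U \<phi> W. (U, \<phi>) \<in> A \<and> x \<in> W \<and> open W \<and> W \<subseteq> U \<and> cinf (\<phi> ` W) (\<lambda>y. f (inv_into U \<phi> y))"
    using smooth_fun_chart[OF A W(2) c(1)] c W smooth_fun_open[OF W(2)] chartD(1)[OF A c(1)]
    by (intro exI[of _ U] exI[of _ \<phi>] exI[of _ "W \<inter> U"]) auto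
qed

lemma smooth_nearI: "smooth_fun A V f \<Longrightarrow> x \<in> V \<Longrightarrow> smooth_near A x f"
  unfolding smooth_near_def by blast

lemma smooth_nearE:
  assumes "smooth_near A x f" obtains V where "open V" "x \<in> V" "smooth_fun A V f"
  using assms smooth_fun_open unfolding smooth_near_def by blast

lemma smooth_fun_cong: "smooth_fun A V f \<Longrightarrow> manifold A \<Longrightarrow> (\<And>x. x \<in> V \<Longrightarrow> f x = g x) \<Longrightarrow> smooth_fun A V g"
proof -
  assume *: "smooth_fun A V f" and A: "manifold A" and eq: "\<And>x. x \<in> V \<Longrightarrow> f x = g x"
  have "cinf (\<phi> ` (V \<inter> U)) (\<lambda>y. g (inv_into U \<phi> y))" if c: "(U, \<phi>) \<in> A" for U \<phi>
    by (rule cinf_cong[OF smooth_fun_chart[OF A * c]]) (use eq chartD(5)[OF A c] in auto)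
  then show ?thesis using smooth_fun_open[OF *] unfolding smooth_fun_iff[OF A] by auto
qed

lemma smooth_near_cong:
  assumes "manifold A" "open W" "x \<in> W" "\<And>y. y \<in> W \<Longrightarrow> f y = g y"
  shows "smooth_near A x f \<longleftrightarrow> smooth_near A x g"
proof -
  have "smooth_near A x g" if f: "smooth_near A x f" and eq: "\<And>y. y \<in> W \<Longrightarrow> f y = g y" for f g
  proof -
    obtain V where V: "open V" "x \<in> V" "smooth_fun A V f" using f by (rule smooth_nearE)
    have "smooth_fun A (V \<inter> W) f" using V assms(2) by (intro smooth_fun_subset[OF V(3)]) auto
    then have "smooth_fun A (V \<inter> W) g" by (rule smooth_fun_cong[OF _ assms(1)]) (use eq in auto)
    then show ?thesis by (rule smooth_nearI) (use V assms in auto)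
  qed
  then show ?thesis using assms(4) by metis
qed

lemma smooth_near_open:
  assumes "smooth_near A x f" obtains V where "open V" "x \<in> V" "\<And>y. y \<in> V \<Longrightarrow> smooth_near A y f"
  using assms smooth_nearI by (metis smooth_nearE)

lemma smooth_near_chart_iff:
  assumes A: "manifold A" and c: "(U, \<phi>) \<in> A" "x \<in> U"
  shows "smooth_near A x f \<longleftrightarrow> (\<exists>T. \<phi> x \<in> T \<and> T \<subseteq> \<phi> ` U \<and> cinf T (\<lambda>y. f (inv_into U \<phi> y)))"
proof
  assume "smooth_near A x f"
  then obtain V where V: "open V" "x \<in> V" "smooth_fun A V f" by (rule smooth_nearE)
  show "\<exists>T. \<phi> x \<in> T \<and> T \<subseteq> \<phi> ` U \<and> cinf T (\<lambda>y. f (inv_into U \<phi> y))"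
    using smooth_fun_chart[OF A V(3) c(1)] V(2) c(2) by (intro exI[of _ "\<phi> ` (V \<inter> U)"]) auto
next
  assume "\<exists>T. \<phi> x \<in> T \<and> T \<subseteq> \<phi> ` U \<and> cinf T (\<lambda>y. f (inv_into U \<phi> y))"
  then obtain T where T: "\<phi> x \<in> T" "T \<subseteq> \<phi> ` U" "cinf T (\<lambda>y. f (inv_into U \<phi> y))" by auto
  let ?W = "\<phi> -` T \<inter> U"
  have oW: "open ?W"
    using continuous_on_open_vimage[OF chartD(1)[OF A c(1)], of \<phi>] chartD(3)[OF A c(1)] cinf_open[OF T(3)] by blast
  have im: "\<phi> ` ?W = T" using T(2) by auto
  have "smooth_fun A ?W f"
  proof (rule smooth_fun_chartI[OF A oW])
    fix x assume "x \<in> ?W"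
    then show "\<exists>U \<phi> W. (U, \<phi>) \<in> A \<and> x \<in> W \<and> open W \<and> W \<subseteq> U \<and> cinf (\<phi> ` W) (\<lambda>y. f (inv_into U \<phi> y))"
      using c T(3) oW im by (intro exI[of _ U] exI[of _ \<phi>] exI[of _ ?W]) auto
  qed
  then show "smooth_near A x f" by (rule smooth_nearI) (use c T in auto)
qed

lemma smooth_near_kdiff:
  assumes A: "manifold A" and c: "(U, \<phi>) \<in> A" "x \<in> U" and f: "smooth_near A x f"
  shows "kdiff (\<lambda>y. f (inv_into U \<phi> y)) (\<phi> x)"
  using f unfolding smooth_near_chart_iff[OF A c] using cinf_kdiff by blast

lemma smooth_near_compose_cinf:
  fixes h :: "'x::topological_space \<Rightarrow> ('k::real_or_complex) ^ ('m::finite)"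
  assumes A: "manifold (A :: ('x, 'k, 'n::finite) atlas)" and g: "cinf T g" "h x \<in> T"
    and h: "\<And>j. smooth_near A x (\<lambda>x. h x $ j)"
  shows "smooth_near A x (\<lambda>x. g (h x))"
proof -
  obtain U \<phi> where c: "(U, \<phi>) \<in> A" "x \<in> U" using chart_exists[OF A] by blast
  have "\<forall>j. \<exists>S. \<phi> x \<in> S \<and> S \<subseteq> \<phi> ` U \<and> cinf S (\<lambda>y. h (inv_into U \<phi> y) $ j)"
    using h unfolding smooth_near_chart_iff[OF A c] by auto
  then obtain S where S: "\<And>j. \<phi> x \<in> S j" "\<And>j. S j \<subseteq> \<phi> ` U" "\<And>j. cinf (S j) (\<lambda>y. h (inv_into U \<phi> y) $ j)" by metis
  let ?S = "\<Inter>j. S j"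
  have oS: "open ?S" using S(3) cinf_open by (intro open_INT) auto
  have hS: "cinf ?S (\<lambda>y. h (inv_into U \<phi> y) $ j)" for j by (rule cinf_subset[OF S(3) oS]) auto
  have "continuous_on ?S (\<lambda>y. h (inv_into U \<phi> y))"
    using continuous_on_vec_lambda[of ?S "\<lambda>j y. h (inv_into U \<phi> y) $ j"] cinf_continuous[OF hS] by simp
  then have o2: "open ((\<lambda>y. h (inv_into U \<phi> y)) -` T \<inter> ?S)"
    using continuous_on_open_vimage[OF oS] cinf_open[OF g(1)] by blast
  let ?R = "(\<lambda>y. h (inv_into U \<phi> y)) -` T \<inter> ?S"
  have "cinf ?R (\<lambda>y. g (h (inv_into U \<phi> y)))"
    by (rule cinf_compose[OF g(1) o2, where h="\<lambda>y. h (inv_into U \<phi> y)"]) (auto intro: cinf_subset[OF hS o2])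
  moreover have "\<phi> x \<in> ?R" using S(1) g(2) chartD(5)[OF A c] c(2) by auto
  moreover have "?R \<subseteq> \<phi> ` U" using S(2)[of undefined] by blast
  ultimately show ?thesis unfolding smooth_near_chart_iff[OF A c] by (intro exI[of _ ?R] conjI)
qed

lemma smooth_near_const: "manifold A \<Longrightarrow> smooth_near A x (\<lambda>_. a)"
  by (rule smooth_nearI[of _ UNIV]) (auto simp: smooth_fun_iff chart_open_image[where V=UNIV, simplified] chartD(2) intro!: cinf_const)

lemma
  assumes A: "manifold A" and f: "smooth_near A x f" and g: "smooth_near A x g"
  shows smooth_near_add: "smooth_near A x (\<lambda>x. f x + g x)"
    and smooth_near_mult: "smooth_near A x (\<lambda>x. f x * g x)"
proof -
  obtain U \<phi> where c: "(U, \<phi>) \<in> A" "x \<in> U" using chart_exists[OF A] by blast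
  obtain S T where S: "\<phi> x \<in> S" "S \<subseteq> \<phi> ` U" "cinf S (\<lambda>y. f (inv_into U \<phi> y))"
    and T: "\<phi> x \<in> T" "T \<subseteq> \<phi> ` U" "cinf T (\<lambda>y. g (inv_into U \<phi> y))"
    using f g unfolding smooth_near_chart_iff[OF A c] by auto
  have o: "open (S \<inter> T)" using S T cinf_open by blast
  have "cinf (S \<inter> T) (\<lambda>y. f (inv_into U \<phi> y))" "cinf (S \<inter> T) (\<lambda>y. g (inv_into U \<phi> y))"
    using cinf_subset[OF S(3) o] cinf_subset[OF T(3) o] by auto
  note fg = this
  have "\<phi> x \<in> S \<inter> T" "S \<inter> T \<subseteq> \<phi> ` U" using S T by auto
  then show "smooth_near A x (\<lambda>x. f x + g x)"
    unfolding smooth_near_chart_iff[OF A c]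
    by (intro exI[of _ "S \<inter> T"] conjI cinf_add[OF fg])
  show "smooth_near A x (\<lambda>x. f x * g x)"
    unfolding smooth_near_chart_iff[OF A c]
    by (intro exI[of _ "S \<inter> T"] conjI cinf_mult[OF fg]) fact+
qed

lemma smooth_near_sum:
  assumes "manifold A" "\<And>i. i \<in> I \<Longrightarrow> smooth_near A x (f i)"
  shows "smooth_near A x (\<lambda>x. \<Sum>i\<in>I. f i x)"
  using assms(2) by (induction I rule: infinite_finite_induct) (auto intro: smooth_near_add smooth_near_const assms(1))

lemma smooth_near_diff:
  assumes "manifold A" "smooth_near A x f" "smooth_near A x g"
  shows "smooth_near A x (\<lambda>x. f x - g x)"
  using smooth_near_add[OF assms(1,2) smooth_near_mult[OF assms(1) smooth_near_const[OF assms(1), of x "-1"] assms(3)]] by simp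

lemma smooth_near_chart: "manifold A \<Longrightarrow> (U, \<phi>) \<in> A \<Longrightarrow> x \<in> U \<Longrightarrow> smooth_near A x (\<lambda>x. \<phi> x $ i)"
  unfolding smooth_near_chart_iff
  by (rule exI[of _ "\<phi> ` U"]) (auto intro!: cinf_cong[OF cinf_nth[of _ i]] simp: chartD)

lemma smooth_near_isCont:
  assumes A: "manifold A" and f: "smooth_near A x f"
  shows "\<exists>V. open V \<and> x \<in> V \<and> continuous_on V f"
proof -
  obtain U \<phi> where c: "(U, \<phi>) \<in> A" "x \<in> U" using chart_exists[OF A] by blast
  obtain V where V: "open V" "x \<in> V" "smooth_fun A V f" using f by (rule smooth_nearE)
  have "continuous_on (V \<inter> U) (\<lambda>x. f (inv_into U \<phi> (\<phi> x)))"
    by (rule continuous_on_compose2[OF cinf_continuous[OF smooth_fun_chart[OF A V(3) c(1)]]])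
      (auto intro: continuous_on_subset[OF chartD(3)[OF A c(1)]])
  then have "continuous_on (V \<inter> U) f"
    by (rule continuous_on_eq) (use chartD(5)[OF A c(1)] in auto)
  then show ?thesis using V c chartD(1)[OF A c(1)] by (intro exI[of _ "V \<inter> U"]) auto
qed

lemma continuous_on_local:
  assumes "\<And>x. x \<in> S \<Longrightarrow> \<exists>V. open V \<and> x \<in> V \<and> continuous_on V f"
  shows "continuous_on S f"
proof -
  have "\<exists>V. open V \<and> x \<in> V \<and> continuous_on V f" if "x \<in> S" for x using assms that .
  then obtain V where V: "\<And>x. x \<in> S \<Longrightarrow> open (V x) \<and> x \<in> V x \<and> continuous_on (V x) f" by metis
  have "continuous_on (\<Union>x\<in>S. V x) f" using V by (intro continuous_on_open_UN) auto
  then show ?thesis by (rule continuous_on_subset) (use V in auto)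
qed

lemma smooth_fun_continuous:
  assumes "manifold A" "smooth_fun A V f" shows "continuous_on V f"
proof (rule continuous_on_local)
  show "\<exists>V. open V \<and> x \<in> V \<and> continuous_on V f" if "x \<in> V" for x
    by (rule smooth_near_isCont[OF assms(1) smooth_nearI[OF assms(2) that]])
qed

section \<open>Tangent vectors as velocities of curves\<close>

subsection \<open>Curves and tangent vectors\<close>

text \<open>Differentiability is asked at parameter 0 only, and only after composition with smooth
  functions. This is enough for a velocity and is preserved by smooth maps and pairing. As every
  tangent vector is such a velocity, the rules for tangent vectors reduce to those for functions of
  one variable.\<close>

definition curve_at :: "('x::topological_space, 'k::real_or_complex, 'n::finite) atlas \<Rightarrow> ('k \<Rightarrow> 'x) \<Rightarrow> bool" where
  "curve_at A c \<longleftrightarrow> isCont c 0 \<and> (\<forall>f. smooth_near A (c 0) f \<longrightarrow> (\<lambda>t. f (c t)) field_differentiable (at 0))"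

lemma isCont_eventually:
  "isCont c (0::'k::real_or_complex) \<Longrightarrow> open U \<Longrightarrow> c 0 \<in> U \<Longrightarrow> eventually (\<lambda>t. c t \<in> U) (nhds 0)"
  using topological_tendstoD[of c "c 0" "nhds 0" U] unfolding continuous_at tendsto_at_iff_tendsto_nhds by blast

lemma DERIV_eventually_eq:
  assumes "(f has_field_derivative D) (at x)" "eventually (\<lambda>t. f t = g t) (nhds x)"
  shows "(g has_field_derivative D) (at x)"
  using DERIV_cong_ev[OF refl assms(2) refl] assms(1) by blast

lemma curve_chain:
  assumes A: "manifold A" and c: "(U, \<phi>) \<in> A" "c 0 \<in> U" and cont: "isCont c 0"
    and d: "\<And>i. ((\<lambda>t. \<phi> (c t) $ i) has_field_derivative w $ i) (at 0)" and f: "smooth_near A (c 0) f"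
  shows "((\<lambda>t. f (c t)) has_field_derivative (\<Sum>i\<in>UNIV. pd i (\<lambda>y. f (inv_into U \<phi> y)) (\<phi> (c 0)) * w $ i)) (at 0)"
proof -
  have "((\<lambda>t. f (inv_into U \<phi> (\<phi> (c t)))) has_field_derivative (\<Sum>i\<in>UNIV. pd i (\<lambda>y. f (inv_into U \<phi> y)) (\<phi> (c 0)) * w $ i)) (at 0)"
    by (rule deriv_compose[OF smooth_near_kdiff[OF A c f] d])
  moreover have "eventually (\<lambda>t. f (inv_into U \<phi> (\<phi> (c t))) = f (c t)) (nhds 0)"
    using isCont_eventually[OF cont chartD(1)[OF A c(1)] c(2)] by eventually_elim (use chartD(5)[OF A c(1)] in simp)
  ultimately show ?thesis by (rule DERIV_eventually_eq)
qed

lemma curveI: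
  assumes A: "manifold A" and c: "(U, \<phi>) \<in> A" "c 0 \<in> U" and cont: "isCont c 0"
    and d: "\<And>i. ((\<lambda>t. \<phi> (c t) $ i) has_field_derivative w $ i) (at 0)"
  shows "curve_at A c"
  unfolding curve_at_def using curve_chain[OF A c cont d] cont field_differentiable_def by blast

text \<open>The vectors of \<open>tangent_space\<close>, written with partial derivatives instead of
  a derivative along a line; linearity in w is then evident.\<close>

definition tvec :: "('x::topological_space, 'k::real_or_complex, 'n::finite) atlas \<Rightarrow> 'x set \<Rightarrow> ('x \<Rightarrow> 'k ^ 'n) \<Rightarrow> 'x \<Rightarrow> 'k ^ 'n \<Rightarrow> ('x \<Rightarrow> 'k) \<Rightarrow> 'k" where
  "tvec A U \<phi> x w = (\<lambda>f. if smooth_near A x f then \<Sum>i\<in>UNIV. pd i (\<lambda>y. f (inv_into U \<phi> y)) (\<phi> x) * w $ i else 0)"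

lemma velocity_tvec:
  assumes A: "manifold A" and c: "(U, \<phi>) \<in> A" "c 0 \<in> U" and cont: "isCont c 0"
    and d: "\<And>i. ((\<lambda>t. \<phi> (c t) $ i) has_field_derivative w $ i) (at 0)"
  shows "velocity A c = tvec A U \<phi> (c 0) w"
  unfolding velocity_def tvec_def using DERIV_imp_deriv[OF curve_chain[OF A c cont d]] by auto

lemma line_curve:
  fixes w :: "'k::real_or_complex ^ 'n::finite"
  assumes A: "manifold A" and c: "(U, \<phi>) \<in> A" "x \<in> U"
  defines "l \<equiv> (\<lambda>t. inv_into U \<phi> (\<phi> x + t *s w))"
  shows "l 0 = x" "isCont l 0" "((\<lambda>t. \<phi> (l t) $ i) has_field_derivative w $ i) (at 0)"
    "curve_at A l" "velocity A l = tvec A U \<phi> x w"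
proof -
  let ?m = "\<lambda>t. \<phi> x + t *s w"
  show l0: "l 0 = x" using chartD(5)[OF A c(1)] c(2) by (simp add: l_def)
  have cm: "isCont ?m t" for t
  proof -
    have "continuous_on UNIV (\<lambda>t. \<chi> i. \<phi> x $ i + t * w $ i)"
      by (intro continuous_on_vec_lambda continuous_intros)
    moreover have "(\<lambda>t. \<chi> i. \<phi> x $ i + t * w $ i) = ?m" by (auto simp: vec_eq_iff fun_eq_iff)
    ultimately show ?thesis by (simp add: continuous_on_eq_continuous_at)
  qed
  have "isCont (inv_into U \<phi>) (?m 0)"
    using chartD(2,4)[OF A c(1)] c(2) by (simp add: continuous_on_eq_continuous_at)
  then show cont: "isCont l 0" unfolding l_def using isCont_o2[OF cm] by blast
  have ev: "eventually (\<lambda>t. ?m t \<in> \<phi> ` U) (nhds 0)"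
    by (rule isCont_eventually[OF cm chartD(2)[OF A c(1)]]) (use c in auto)
  show d: "((\<lambda>t. \<phi> (l t) $ i) has_field_derivative w $ i) (at 0)" for i
  proof -
    have "((\<lambda>t. \<phi> x $ i + t * w $ i) has_field_derivative w $ i) (at 0)" by (auto intro!: derivative_eq_intros)
    moreover have "eventually (\<lambda>t. \<phi> x $ i + t * w $ i = \<phi> (l t) $ i) (nhds 0)"
      using ev by eventually_elim (use chartD(6)[OF A c(1)] in \<open>simp add: l_def\<close>)
    ultimately show ?thesis by (rule DERIV_eventually_eq)
  qed
  show "curve_at A l" by (rule curveI[OF A c(1) _ cont d]) (simp add: l0 c)
  show "velocity A l = tvec A U \<phi> x w"
    using velocity_tvec[OF A c(1) _ cont d] l0 c by simp
qed

lemma curve_coords: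
  assumes A: "manifold A" and c: "(U, \<phi>) \<in> A" "c 0 \<in> U" and cu: "curve_at A c"
  obtains w where "\<And>i. ((\<lambda>t. \<phi> (c t) $ i) has_field_derivative w $ i) (at 0)" "velocity A c = tvec A U \<phi> (c 0) w"
proof -
  let ?w = "\<chi> i. deriv (\<lambda>t. \<phi> (c t) $ i) 0"
  have cont: "isCont c 0" using cu by (simp add: curve_at_def)
  have d: "((\<lambda>t. \<phi> (c t) $ i) has_field_derivative ?w $ i) (at 0)" for i
    using spec[OF conjunct2[OF cu[unfolded curve_at_def]], of "\<lambda>x. \<phi> x $ i"] smooth_near_chart[OF A c]
    by (simp add: field_differentiable_derivI)
  from that[OF d velocity_tvec[OF A c cont d]] show thesis .
qed

text \<open>In \<open>tangent_space\<close> the chart may vary with the vector. A line in one chart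
  is a differentiable curve in any other, where the chain rule computes its velocity; hence one
  chart yields all vectors.\<close>

lemma tangent_space_eq:
  assumes A: "manifold A" and c: "(U, \<phi>) \<in> A" "x \<in> U"
  shows "tangent_space A x = range (tvec A U \<phi> x)"
proof -
  have eq: "(\<lambda>f. if smooth_near A x f then deriv (\<lambda>t. f (inv_into V \<psi> (\<psi> x + t *s w))) 0 else 0) = tvec A V \<psi> x w"
    if "(V, \<psi>) \<in> A" "x \<in> V" for V \<psi> w
    using line_curve(1,5)[OF A that, of w] unfolding velocity_def by simp
  have "tvec A V \<psi> x w \<in> range (tvec A U \<phi> x)" if c': "(V, \<psi>) \<in> A" "x \<in> V" for V \<psi> w
  proof -
    note l = line_curve[OF A c', of w]
    show ?thesis
      using curve_coords[OF A c(1) _ l(4)] l(1,5) c(2) by (metis rangeI)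
  qed
  note tv = this
  show ?thesis
  proof (rule equalityI; rule subsetI)
    fix v assume "v \<in> tangent_space A x"
    then obtain V \<psi> w where V: "(V, \<psi>) \<in> A" "x \<in> V"
      "v = (\<lambda>f. if smooth_near A x f then deriv (\<lambda>t. f (inv_into V \<psi> (\<psi> x + t *s w))) 0 else 0)"
      unfolding tangent_space_def by auto
    then show "v \<in> range (tvec A U \<phi> x)" using eq[OF V(1,2), of w] tv[OF V(1,2), of w] by simp
  next
    fix v assume "v \<in> range (tvec A U \<phi> x)"
    then obtain w where "v = tvec A U \<phi> x w" by auto
    then have "v = (\<lambda>f. if smooth_near A x f then deriv (\<lambda>t. f (inv_into U \<phi> (\<phi> x + t *s w))) 0 else 0)"
      using eq[OF c, of w] by simp
    then have "\<exists>w. v = (\<lambda>f. if smooth_near A x f then deriv (\<lambda>t. f (inv_into U \<phi> (\<phi> x + t *s w))) 0 else 0)"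
      by (rule exI)
    then show "v \<in> tangent_space A x"
      unfolding tangent_space_def using c by (intro CollectI bexI[of _ "(U, \<phi>)"]) simp_all
  qed
qed

lemma velocity_tangent:
  assumes A: "manifold A" and cu: "curve_at A c" shows "velocity A c \<in> tangent_space A (c 0)"
proof -
  obtain U \<phi> where c: "(U, \<phi>) \<in> A" "c 0 \<in> U" using chart_exists[OF A] by blast
  show ?thesis using curve_coords[OF A c cu] tangent_space_eq[OF A c] by (metis rangeI)
qed

lemma tangent_velocity:
  assumes A: "manifold A" and v: "v \<in> tangent_space A x"
  obtains c where "curve_at A c" "c 0 = x" "v = velocity A c"
proof -
  obtain U \<phi> where c: "(U, \<phi>) \<in> A" "x \<in> U" using chart_exists[OF A] by blast
  then obtain w where "v = tvec A U \<phi> x w" using v tangent_space_eq[OF A c] by auto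
  then show thesis using that line_curve[OF A c, of w] by metis
qed

lemma velocity_deriv:
  "curve_at A c \<Longrightarrow> smooth_near A (c 0) f \<Longrightarrow> ((\<lambda>t. f (c t)) has_field_derivative velocity A c f) (at 0)"
  unfolding curve_at_def velocity_def by (auto simp: field_differentiable_derivI)

lemma velocity_eqI:
  "curve_at A c \<Longrightarrow> smooth_near A (c 0) f \<Longrightarrow> ((\<lambda>t. f (c t)) has_field_derivative D) (at 0) \<Longrightarrow> velocity A c f = D"
  using velocity_deriv DERIV_unique by blast

lemma tangent_not_smooth: "v \<in> tangent_space A x \<Longrightarrow> \<not> smooth_near A x f \<Longrightarrow> v f = 0"
  unfolding tangent_space_def by auto

context
  fixes A :: "('x::topological_space, 'k::real_or_complex, 'n::finite) atlas" and x v
  assumes A: "manifold A" and v: "v \<in> tangent_space A x"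
begin

lemma tangent_const: "v (\<lambda>_. a) = 0"
proof -
  obtain c where c: "curve_at A c" "c 0 = x" "v = velocity A c" using tangent_velocity[OF A v] .
  have "velocity A c (\<lambda>_. a) = 0"
    by (rule velocity_eqI[OF c(1) smooth_near_const[OF A]]) simp
  then show ?thesis using c by simp
qed

lemma
  assumes f: "smooth_near A x f" and g: "smooth_near A x g"
  shows tangent_add: "v (\<lambda>x. f x + g x) = v f + v g"
    and tangent_mult: "v (\<lambda>x. f x * g x) = f x * v g + v f * g x"
    and tangent_diff: "v (\<lambda>x. f x - g x) = v f - v g"
proof -
  obtain c where c: "curve_at A c" "c 0 = x" "v = velocity A c" using tangent_velocity[OF A v] .
  have df: "((\<lambda>t. f (c t)) has_field_derivative v f) (at 0)" and dg: "((\<lambda>t. g (c t)) has_field_derivative v g) (at 0)"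
    using velocity_deriv[OF c(1)] f g c by auto
  show "v (\<lambda>x. f x + g x) = v f + v g"
    using velocity_eqI[OF c(1) _ DERIV_add[OF df dg]] smooth_near_add[OF A f g] c by simp
  show "v (\<lambda>x. f x - g x) = v f - v g"
    using velocity_eqI[OF c(1) _ DERIV_diff[OF df dg]] smooth_near_diff[OF A f g] c by simp
  show "v (\<lambda>x. f x * g x) = f x * v g + v f * g x"
    using velocity_eqI[OF c(1) _ DERIV_mult[OF df dg]] smooth_near_mult[OF A f g] c by (simp add: mult.commute add.commute)
qed

lemma tangent_scale: "smooth_near A x f \<Longrightarrow> v (\<lambda>x. a * f x) = a * v f"
  using tangent_mult[OF smooth_near_const[OF A, of x a]] tangent_const by simp

lemma tangent_sum:
  "(\<And>i. i \<in> I \<Longrightarrow> smooth_near A x (f i)) \<Longrightarrow> v (\<lambda>x. \<Sum>i\<in>I. f i x) = (\<Sum>i\<in>I. v (f i))"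
  by (induction I rule: infinite_finite_induct) (auto simp: tangent_const tangent_add smooth_near_sum[OF A])

text \<open>Smoothness near x is itself local, so either both functions are smooth near x and agree
  along a curve, or both values are the conventional zero.\<close>

lemma tangent_cong:
  assumes "open W" "x \<in> W" "\<And>y. y \<in> W \<Longrightarrow> f y = g y" shows "v f = v g"
proof (cases "smooth_near A x f")
  case True
  have g: "smooth_near A x g" using True smooth_near_cong[OF A assms] by simp
  obtain c where c: "curve_at A c" "c 0 = x" "v = velocity A c" using tangent_velocity[OF A v] .
  have "eventually (\<lambda>t. c t \<in> W) (nhds 0)" using c assms by (intro isCont_eventually) (auto simp: curve_at_def)
  then have "eventually (\<lambda>t. g (c t) = f (c t)) (nhds 0)" by eventually_elim (simp add: assms(3))
  moreover have "((\<lambda>t. g (c t)) has_field_derivative v g) (at 0)" using velocity_deriv[OF c(1)] g c by auto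
  ultimately have "((\<lambda>t. f (c t)) has_field_derivative v g) (at 0)" by (rule DERIV_eventually_eq[rotated])
  then show ?thesis using velocity_eqI[OF c(1)] True c by auto
next
  case False
  then have "\<not> smooth_near A x g" using smooth_near_cong[OF A assms] by simp
  then show ?thesis using tangent_not_smooth[OF v False] tangent_not_smooth[OF v, of g] by simp
qed

lemma tangent_expand:
  assumes c: "(U, \<phi>) \<in> A" "x \<in> U" and f: "smooth_near A x f"
  shows "v f = (\<Sum>i\<in>UNIV. pd i (\<lambda>y. f (inv_into U \<phi> y)) (\<phi> x) * v (\<lambda>x. \<phi> x $ i))"
proof -
  obtain w where w: "v = tvec A U \<phi> x w" using v tangent_space_eq[OF A c] by auto
  have "pd i (\<lambda>y. \<phi> (inv_into U \<phi> y) $ j) (\<phi> x) = (if i = j then 1 else 0)" for i j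
    using pd_cong(2)[OF chartD(2)[OF A c(1)], of "\<phi> x" "\<lambda>y. \<phi> (inv_into U \<phi> y) $ j" "\<lambda>y. y $ j" i] chartD(6)[OF A c(1)] c(2)
    by (simp add: pd_nth)
  then have "v (\<lambda>x. \<phi> x $ j) = w $ j" for j
    unfolding w tvec_def using smooth_near_chart[OF A c]
    by (simp add: if_distrib[of "\<lambda>c. c * _"] cong: if_cong)
  then show ?thesis unfolding w using f by (simp add: tvec_def)
qed

end

lemma tangent_eqI:
  assumes A: "manifold A" and v: "v \<in> tangent_space A x" "w \<in> tangent_space A x"
    and eq: "\<And>f. smooth_near A x f \<Longrightarrow> v f = w f"
  shows "v = w"
proof (rule ext)
  show "v f = w f" for f
    by (cases "smooth_near A x f") (simp_all add: eq tangent_not_smooth[OF v(1)] tangent_not_smooth[OF v(2)])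
qed

lemma
  assumes A: "manifold A" and v: "v \<in> tangent_space A x" "w \<in> tangent_space A x"
  shows tangent_space_add: "(\<lambda>f. v f + w f) \<in> tangent_space A x"
    and tangent_space_scale: "(\<lambda>f. a * v f) \<in> tangent_space A x"
proof -
  obtain U \<phi> where c: "(U, \<phi>) \<in> A" "x \<in> U" using chart_exists[OF A] by blast
  obtain v' w' where v': "v = tvec A U \<phi> x v'" "w = tvec A U \<phi> x w'" using v tangent_space_eq[OF A c] by auto
  have "(\<lambda>f. v f + w f) = tvec A U \<phi> x (v' + w')"
    unfolding v' tvec_def by (rule ext) (simp add: distrib_left sum.distrib)
  moreover have "(\<lambda>f. a * v f) = tvec A U \<phi> x (a *s v')"
    unfolding v' tvec_def by (rule ext) (simp add: sum_distrib_left mult.left_commute)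
  ultimately show "(\<lambda>f. v f + w f) \<in> tangent_space A x" "(\<lambda>f. a * v f) \<in> tangent_space A x"
    using tangent_space_eq[OF A c] by auto
qed

section \<open>Smooth maps and their effect on curves and tangent vectors\<close>

subsection \<open>Smooth maps\<close>

lemma smooth_map_near:
  assumes F: "smooth_map A B U F" "x \<in> U" and f: "smooth_near B (F x) f"
  shows "smooth_near A x (\<lambda>x. f (F x))"
proof -
  obtain V where "F x \<in> V" "smooth_fun B V f" using f unfolding smooth_near_def by auto
  then have "smooth_fun A (U \<inter> F -` V) (\<lambda>x. f (F x))" using F unfolding smooth_map_def by blast
  then show ?thesis by (rule smooth_nearI) (use F \<open>F x \<in> V\<close> in auto)
qed

lemma smooth_mapI:
  assumes A: "manifold A" and U: "open U" "continuous_on U F"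
    and near: "\<And>x f. x \<in> U \<Longrightarrow> smooth_near B (F x) f \<Longrightarrow> smooth_near A x (\<lambda>x. f (F x))"
  shows "smooth_map A B U F"
  unfolding smooth_map_def
proof (intro conjI allI impI U)
  fix V f assume f: "smooth_fun B V f"
  have "open (F -` V \<inter> U)" using continuous_on_open_vimage[OF U(1)] U(2) smooth_fun_open[OF f] by blast
  then show "smooth_fun A (U \<inter> F -` V) (\<lambda>x. f (F x))"
    by (intro smooth_fun_local[OF A]) (auto simp: Int_commute intro: near smooth_nearI[OF f])
qed

lemma smooth_mapI_chart:
  assumes A: "manifold A" and B: "manifold B" and U: "open U" "continuous_on U F"
    and ex: "\<And>x. x \<in> U \<Longrightarrow> \<exists>V \<psi>. (V, \<psi>) \<in> B \<and> F x \<in> V \<and> (\<forall>j. smooth_near A x (\<lambda>x. \<psi> (F x) $ j))"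
  shows "smooth_map A B U F"
proof (rule smooth_mapI[OF A U])
  fix x f assume x: "x \<in> U" and f: "smooth_near B (F x) f"
  obtain V \<psi> where c: "(V, \<psi>) \<in> B" "F x \<in> V" and j: "\<And>j. smooth_near A x (\<lambda>x. \<psi> (F x) $ j)" using ex[OF x] by blast
  obtain T where T: "\<psi> (F x) \<in> T" "T \<subseteq> \<psi> ` V" "cinf T (\<lambda>y. f (inv_into V \<psi> y))"
    using f unfolding smooth_near_chart_iff[OF B c] by auto
  have 1: "smooth_near A x (\<lambda>x. f (inv_into V \<psi> (\<psi> (F x))))"
    by (rule smooth_near_compose_cinf[OF A T(3,1) j])
  have o: "open (F -` V \<inter> U)" using continuous_on_open_vimage[OF U(1)] U(2) chartD(1)[OF B c(1)] by blast
  show "smooth_near A x (\<lambda>x. f (F x))"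
    using 1 smooth_near_cong[OF A o, of x "\<lambda>x. f (inv_into V \<psi> (\<psi> (F x)))" "\<lambda>x. f (F x)"] x c(2) chartD(5)[OF B c(1)] by auto
qed

lemma smooth_map_isCont:
  fixes c :: "'k::real_or_complex \<Rightarrow> 'x::topological_space" and A :: "('x, 'k, 'n::finite) atlas"
  assumes F: "smooth_map A B U F" and c: "c 0 \<in> U" "isCont c 0"
  shows "isCont (\<lambda>t. F (c t)) 0"
  unfolding continuous_at
proof (rule topological_tendstoI)
  fix W assume W: "open W" "F (c 0) \<in> W"
  have "open (F -` W \<inter> U)"
    using F W continuous_on_open_vimage[of U F] unfolding smooth_map_def by blast
  then have "eventually (\<lambda>t. c t \<in> F -` W \<inter> U) (nhds 0)" by (rule isCont_eventually[OF c(2)]) (use c W in auto)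
  then show "eventually (\<lambda>t. F (c t) \<in> W) (at 0)"
    unfolding eventually_at_filter by eventually_elim auto
qed

lemma smooth_map_curve:
  assumes "smooth_map A B U F" "curve_at A c" "c 0 \<in> U"
  shows "curve_at B (\<lambda>t. F (c t))"
  unfolding curve_at_def
proof (intro conjI allI impI)
  have c: "isCont c 0" "\<And>f. smooth_near A (c 0) f \<Longrightarrow> (\<lambda>t. f (c t)) field_differentiable (at 0)"
    using assms(2) by (simp_all add: curve_at_def)
  show "isCont (\<lambda>t. F (c t)) 0" by (rule smooth_map_isCont[where c=c, OF assms(1,3) c(1)])
  show "(\<lambda>t. f (F (c t))) field_differentiable (at 0)" if "smooth_near B (F (c 0)) f" for f
    by (rule c(2)[OF smooth_map_near[OF assms(1,3) that]])
qed

lemma smooth_map_compose: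
  assumes "manifold A" "smooth_map A B U F" "smooth_map B C V H" "F ` U \<subseteq> V"
  shows "smooth_map A C U (\<lambda>x. H (F x))"
proof (rule smooth_mapI[OF assms(1)])
  show "open U" using assms(2) by (simp add: smooth_map_def)
  show "continuous_on U (\<lambda>x. H (F x))"
    using assms(2,3,4) continuous_on_compose2 unfolding smooth_map_def by blast
  show "smooth_near A x (\<lambda>x. f (H (F x)))" if "x \<in> U" "smooth_near C (H (F x)) f" for x f
    using that assms(4) by (intro smooth_map_near[OF assms(2)] smooth_map_near[OF assms(3)]) auto
qed

lemma smooth_map_subset: "smooth_map A B U F \<Longrightarrow> manifold A \<Longrightarrow> open W \<Longrightarrow> W \<subseteq> U \<Longrightarrow> smooth_map A B W F"
  by (rule smooth_mapI) (auto simp: smooth_map_def intro: continuous_on_subset smooth_map_near[unfolded smooth_map_def])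

lemma pushforward_velocity:
  assumes F: "smooth_map A B U F" and c: "curve_at A c" "c 0 = x" "x \<in> U"
  shows "pushforward B F x (velocity A c) = velocity B (\<lambda>t. F (c t))"
  unfolding pushforward_def velocity_def using smooth_map_near[OF F c(3)] c by auto

lemma pushforward_tangent:
  assumes A: "manifold A" and B: "manifold B" and F: "smooth_map A B U F" "x \<in> U" and v: "v \<in> tangent_space A x"
  shows "pushforward B F x v \<in> tangent_space B (F x)"
proof -
  obtain c where c: "curve_at A c" "c 0 = x" "v = velocity A c" using tangent_velocity[OF A v] .
  show ?thesis
    using velocity_tangent[OF B smooth_map_curve[OF F(1) c(1)]] pushforward_velocity[OF F(1) c(1,2) F(2)] c F(2) by simp
qed

section \<open>Product manifolds and differentiation in one factor\<close>

subsection \<open>Vector spaces, the ground field and products\<close>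

lemma manifold_vec: "manifold (vec_atlas :: ('k::real_or_complex ^ 'n::finite, 'k, 'n) atlas)"
proof -
  have "Ck_on r (id ` (UNIV \<inter> UNIV)) (\<lambda>y :: 'k ^ 'n. id (inv_into UNIV id y) $ j)" for r and j :: 'n
    using Ck_on_nth[of "UNIV :: ('k ^ 'n) set" r j] by simp
  then show ?thesis
    unfolding manifold_def vec_atlas_def by (simp add: homeomorphism_def)
qed

lemma smooth_near_vec_iff: "smooth_near vec_atlas x f \<longleftrightarrow> (\<exists>T. x \<in> T \<and> cinf T f)"
  using smooth_near_chart_iff[OF manifold_vec, of UNIV id x f] by (simp add: vec_atlas_def)

lemma smooth_map_vecD:
  assumes A: "manifold A" and F: "smooth_map A vec_atlas U F"
  shows "smooth_fun A U (\<lambda>x. F x $ j)"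
proof (rule smooth_fun_local[OF A])
  show "open U" using F by (simp add: smooth_map_def)
  show "smooth_near A x (\<lambda>x. F x $ j)" if "x \<in> U" for x
    by (rule smooth_map_near[OF F that, of "\<lambda>y. y $ j"])
      (auto simp: smooth_near_vec_iff intro!: exI[of _ UNIV] cinf_nth)
qed

lemma smooth_map_vecI:
  assumes A: "manifold A" and U: "open U" and F: "\<And>x j. x \<in> U \<Longrightarrow> smooth_near A x (\<lambda>x. F x $ j)"
  shows "smooth_map A vec_atlas U F"
proof (rule smooth_mapI[OF A U])
  have "smooth_fun A U (\<lambda>x. F x $ j)" for j by (rule smooth_fun_local[OF A U F])
  then have "continuous_on U (\<lambda>x. F x $ j)" for j by (rule smooth_fun_continuous[OF A])
  then show "continuous_on U F" using continuous_on_vec_lambda[of U "\<lambda>j x. F x $ j"] by simp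
  fix x f assume x: "x \<in> U" and "smooth_near vec_atlas (F x) f"
  then obtain T where T: "F x \<in> T" "cinf T f" unfolding smooth_near_vec_iff by auto
  show "smooth_near A x (\<lambda>x. f (F x))" by (rule smooth_near_compose_cinf[OF A T(2,1) F[OF x]])
qed

lemma manifold_scalar: "manifold (scalar_atlas :: ('k::real_or_complex, 'k, 1) atlas)"
proof -
  let ?c = "\<lambda>t::'k. (\<chi> i::1. t)"
  have inv: "inv_into UNIV ?c y = y $ 1" for y
    by (rule inv_into_f_eq) (auto simp: inj_on_def vec_eq_iff)
  have im: "range ?c = UNIV" by (auto simp: image_iff vec_eq_iff intro!: exI[of _ "_ $ 1"])
  have cc: "continuous_on UNIV ?c" by (intro continuous_on_vec_lambda continuous_intros)
  have ci: "continuous_on UNIV (\<lambda>y::'k ^ 1. y $ 1)" by (intro continuous_intros)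
  have i2: "inv_into UNIV ?c = (\<lambda>y. y $ 1)" using inv by (rule ext)
  have "homeomorphism UNIV UNIV ?c (\<lambda>y. y $ 1)"
    unfolding homeomorphism_def using cc ci im by (auto simp: vec_eq_iff intro!: range_eqI[of _ _ "\<chi> i. _"])
  then show ?thesis
    unfolding manifold_def scalar_atlas_def using im by (auto simp: i2 intro: Ck_on_nth)
qed

lemma curve_at_scalar:
  fixes c :: "'k::real_or_complex \<Rightarrow> 'k"
  assumes "(c has_field_derivative D) (at 0)" shows "curve_at scalar_atlas c"
proof (rule curveI[OF manifold_scalar, of UNIV "\<lambda>t. \<chi> i. t"])
  show "(UNIV, \<lambda>t. \<chi> i. t) \<in> scalar_atlas" by (simp add: scalar_atlas_def)
  show "isCont c 0" by (rule DERIV_isCont[OF assms])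
  show "((\<lambda>t. (\<chi> i. c t) $ i) has_field_derivative (\<chi> i. D) $ i) (at 0)" for i :: 1 using assms by simp
qed simp

lemma smooth_map_id: "manifold A \<Longrightarrow> open U \<Longrightarrow> smooth_map A A U (\<lambda>x. x)"
  by (rule smooth_mapI) auto

lemma smooth_map_const: "manifold A \<Longrightarrow> open U \<Longrightarrow> smooth_map A B U (\<lambda>_. y)"
  by (rule smooth_mapI) (auto intro: smooth_near_const)

definition vjoin :: "'k ^ 'n \<Rightarrow> 'k ^ 'l \<Rightarrow> 'k ^ ('n + 'l)" where
  "vjoin y z = (\<chi> i. case i of Inl a \<Rightarrow> y $ a | Inr b \<Rightarrow> z $ b)"

lemma vjoin_nth [simp]: "vjoin y z $ Inl a = y $ a" "vjoin y z $ Inr b = z $ b"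
  by (simp_all add: vjoin_def)

lemma vjoin_eq_iff: "u = vjoin y z \<longleftrightarrow> (\<chi> a. u $ Inl a) = y \<and> (\<chi> b. u $ Inr b) = z"
  by (auto simp: vec_eq_iff vjoin_def split: sum.split)

lemma vjoin_parts: "vjoin (\<chi> a. u $ Inl a) (\<chi> b. u $ Inr b) = u"
  using vjoin_eq_iff[of u "\<chi> a. u $ Inl a" "\<chi> b. u $ Inr b"] by simp

definition prod_chart :: "('x \<Rightarrow> 'k ^ 'n) \<Rightarrow> ('y \<Rightarrow> 'k ^ 'l) \<Rightarrow> 'x \<times> 'y \<Rightarrow> 'k ^ ('n + 'l)" where
  "prod_chart \<phi> \<psi> = (\<lambda>(x, y). vjoin (\<phi> x) (\<psi> y))"

lemma prod_chart_apply [simp]: "prod_chart \<phi> \<psi> (x, y) = vjoin (\<phi> x) (\<psi> y)"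
  by (simp add: prod_chart_def)

lemma prod_atlas_eq: "prod_atlas A B = {(U \<times> V, prod_chart \<phi> \<psi>) | U \<phi> V \<psi>. (U, \<phi>) \<in> A \<and> (V, \<psi>) \<in> B}"
  by (simp add: prod_atlas_def prod_chart_def vjoin_def)

lemma prod_chart_mem: "(U, \<phi>) \<in> A \<Longrightarrow> (V, \<psi>) \<in> B \<Longrightarrow> (U \<times> V, prod_chart \<phi> \<psi>) \<in> prod_atlas A B"
  unfolding prod_atlas_eq by blast

context
  fixes A :: "('x::topological_space, 'k::real_or_complex, 'n::finite) atlas"
    and B :: "('y::topological_space, 'k, 'l::finite) atlas"
  assumes A: "manifold A" and B: "manifold B"
begin

lemma prod_chart_image:
  "prod_chart \<phi> \<psi> ` (U \<times> V) = {u. (\<chi> a. u $ Inl a) \<in> \<phi> ` U \<and> (\<chi> b. u $ Inr b) \<in> \<psi> ` V}"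
proof (intro equalityI subsetI)
  fix u assume "u \<in> prod_chart \<phi> \<psi> ` (U \<times> V)"
  then obtain x y where xy: "x \<in> U" "y \<in> V" "u = vjoin (\<phi> x) (\<psi> y)" by auto
  then show "u \<in> {u. (\<chi> a. u $ Inl a) \<in> \<phi> ` U \<and> (\<chi> b. u $ Inr b) \<in> \<psi> ` V}"
    using vjoin_eq_iff[of u "\<phi> x" "\<psi> y"] by auto
next
  fix u assume "u \<in> {u. (\<chi> a. u $ Inl a) \<in> \<phi> ` U \<and> (\<chi> b. u $ Inr b) \<in> \<psi> ` V}"
  then obtain x y where xy: "x \<in> U" "y \<in> V" "(\<chi> a. u $ Inl a) = \<phi> x" "(\<chi> b. u $ Inr b) = \<psi> y" by auto
  then have "u = prod_chart \<phi> \<psi> (x, y)" using vjoin_eq_iff[of u "\<phi> x" "\<psi> y"] by simp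
  then show "u \<in> prod_chart \<phi> \<psi> ` (U \<times> V)" using xy by blast
qed

lemma prod_chart_inv:
  assumes c: "(U, \<phi>) \<in> A" "(V, \<psi>) \<in> B" and u: "(\<chi> a. u $ Inl a) \<in> \<phi> ` U" "(\<chi> b. u $ Inr b) \<in> \<psi> ` V"
  shows "inv_into (U \<times> V) (prod_chart \<phi> \<psi>) u = (inv_into U \<phi> (\<chi> a. u $ Inl a), inv_into V \<psi> (\<chi> b. u $ Inr b))"
proof (rule inv_into_f_eq)
  show "inj_on (prod_chart \<phi> \<psi>) (U \<times> V)"
  proof (rule inj_on_inverseI[where g="\<lambda>u. (inv_into U \<phi> (\<chi> a. u $ Inl a), inv_into V \<psi> (\<chi> b. u $ Inr b))"])
    fix p assume "p \<in> U \<times> V"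
    then obtain x y where p: "p = (x, y)" and "x \<in> U" "y \<in> V" by auto
    moreover have "(\<chi> a. vjoin (\<phi> x) (\<psi> y) $ Inl a) = \<phi> x" "(\<chi> b. vjoin (\<phi> x) (\<psi> y) $ Inr b) = \<psi> y" by (simp_all add: vec_eq_iff)
    ultimately show "(inv_into U \<phi> (\<chi> a. prod_chart \<phi> \<psi> p $ Inl a), inv_into V \<psi> (\<chi> b. prod_chart \<phi> \<psi> p $ Inr b)) = p"
      using chartD(5)[OF A c(1)] chartD(5)[OF B c(2)] by simp
  qed
  show "(inv_into U \<phi> (\<chi> a. u $ Inl a), inv_into V \<psi> (\<chi> b. u $ Inr b)) \<in> U \<times> V"
    using chartD(7)[OF A c(1) u(1)] chartD(7)[OF B c(2) u(2)] by simp
  show "prod_chart \<phi> \<psi> (inv_into U \<phi> (\<chi> a. u $ Inl a), inv_into V \<psi> (\<chi> b. u $ Inr b)) = u"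
    using chartD(6)[OF A c(1) u(1)] chartD(6)[OF B c(2) u(2)] by (simp add: vjoin_parts)
qed

lemma continuous_parts:
  "continuous_on S (\<lambda>u::'k ^ ('n + 'l). \<chi> a. u $ Inl a)" "continuous_on S (\<lambda>u::'k ^ ('n + 'l). \<chi> b. u $ Inr b)"
  by (intro continuous_on_vec_lambda continuous_intros)+

lemma manifold_prod: "manifold (prod_atlas A B)"
  unfolding manifold_def
proof (intro conjI)
  show "\<forall>(W, ch)\<in>prod_atlas A B. open W \<and> open (ch ` W) \<and> homeomorphism W (ch ` W) ch (inv_into W ch)"
  proof (clarify)
    fix W ch' assume "(W, ch') \<in> prod_atlas A B"
    then obtain U \<phi> V \<psi> where W: "W = U \<times> V" "ch' = prod_chart \<phi> \<psi>" and c: "(U, \<phi>) \<in> A" "(V, \<psi>) \<in> B"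
      unfolding prod_atlas_eq by blast
    let ?S = "prod_chart \<phi> \<psi> ` (U \<times> V)"
    have o: "open W" unfolding W using chartD(1)[OF A c(1)] chartD(1)[OF B c(2)] by (rule open_Times)
    have eq: "?S = (\<lambda>u. \<chi> a. u $ Inl a) -` (\<phi> ` U) \<inter> (\<lambda>u. \<chi> b. u $ Inr b) -` (\<psi> ` V)"
      unfolding prod_chart_image by auto
    have o2: "open ?S" unfolding eq
      using open_vimage[OF chartD(2)[OF A c(1)] continuous_parts(1)] open_vimage[OF chartD(2)[OF B c(2)] continuous_parts(2)] by (rule open_Int)
    have cont: "continuous_on (U \<times> V) (prod_chart \<phi> \<psi>)"
    proof -
      have f: "continuous_on (U \<times> V) (\<lambda>p. \<phi> (fst p))" "continuous_on (U \<times> V) (\<lambda>p. \<psi> (snd p))"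
        by (rule continuous_on_compose2[OF chartD(3)[OF A c(1)] continuous_on_fst[OF continuous_on_id]], force)
          (rule continuous_on_compose2[OF chartD(3)[OF B c(2)] continuous_on_snd[OF continuous_on_id]], force)
      have "continuous_on (U \<times> V) (\<lambda>p. \<chi> i. case i of Inl a \<Rightarrow> \<phi> (fst p) $ a | Inr b \<Rightarrow> \<psi> (snd p) $ b)"
        
      proof (rule continuous_on_vec_lambda)
        show "continuous_on (U \<times> V) (\<lambda>p. case i of Inl a \<Rightarrow> \<phi> (fst p) $ a | Inr b \<Rightarrow> \<psi> (snd p) $ b)" for i
          by (cases i) (auto intro!: continuous_intros f)
      qed
      then show ?thesis by (simp add: prod_chart_def vjoin_def case_prod_unfold)
    qed
    have ci: "continuous_on ?S (inv_into (U \<times> V) (prod_chart \<phi> \<psi>))"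
    proof (rule continuous_on_eq)
      show "continuous_on ?S (\<lambda>u. (inv_into U \<phi> (\<chi> a. u $ Inl a), inv_into V \<psi> (\<chi> b. u $ Inr b)))"
        by (intro continuous_on_Pair continuous_on_compose2[OF chartD(4)[OF A c(1)] continuous_parts(1)]
            continuous_on_compose2[OF chartD(4)[OF B c(2)] continuous_parts(2)]) (auto simp: prod_chart_image)
    qed (use prod_chart_inv[OF c] in \<open>auto simp: prod_chart_image\<close>)
    have inj: "inj_on (prod_chart \<phi> \<psi>) (U \<times> V)"
    proof (rule inj_on_inverseI[where g="inv_into (U \<times> V) (prod_chart \<phi> \<psi>)"])
      fix p assume "p \<in> U \<times> V"
      then obtain x y where p: "p = (x, y)" and xy: "x \<in> U" "y \<in> V" by auto
      have e: "(\<chi> a. vjoin (\<phi> x) (\<psi> y) $ Inl a) = \<phi> x" "(\<chi> b. vjoin (\<phi> x) (\<psi> y) $ Inr b) = \<psi> y" by (simp_all add: vec_eq_iff)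
      show "inv_into (U \<times> V) (prod_chart \<phi> \<psi>) (prod_chart \<phi> \<psi> p) = p"
        unfolding p using prod_chart_inv[OF c, of "vjoin (\<phi> x) (\<psi> y)"] xy chartD(5)[OF A c(1)] chartD(5)[OF B c(2)] unfolding e by simp
    qed
    have "homeomorphism W (ch' ` W) ch' (inv_into W ch')"
      unfolding homeomorphism_def W using inj cont ci
      by (simp add: inv_into_f_f f_inv_into_f)
    then show "open W \<and> open (ch' ` W) \<and> homeomorphism W (ch' ` W) ch' (inv_into W ch')"
      using o o2 W by simp
  qed
  show "(\<Union>(W, ch)\<in>prod_atlas A B. W) = UNIV"
  proof (intro equalityI subsetI)
    fix p :: "'x \<times> 'y"
    obtain U \<phi> where U: "(U, \<phi>) \<in> A" "fst p \<in> U" using chart_exists[OF A] by blast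
    obtain V \<psi> where V: "(V, \<psi>) \<in> B" "snd p \<in> V" using chart_exists[OF B] by blast
    show "p \<in> (\<Union>(W, ch)\<in>prod_atlas A B. W)"
      using prod_chart_mem[OF U(1) V(1)] U(2) V(2) by (intro UN_I) (auto simp: mem_Times_iff)
  qed simp
  show "\<forall>(W, ch)\<in>prod_atlas A B. \<forall>(W', ch')\<in>prod_atlas A B. \<forall>j r. Ck_on r (ch ` (W \<inter> W')) (\<lambda>y. ch' (inv_into W ch y) $ j)"
  proof (clarify)
    fix W ch' W2 ch2 j r assume "(W, ch') \<in> prod_atlas A B" "(W2, ch2) \<in> prod_atlas A B"
    then obtain U \<phi> V \<psi> U2 \<phi>2 V2 \<psi>2 where W: "W = U \<times> V" "ch' = prod_chart \<phi> \<psi>" "W2 = U2 \<times> V2" "ch2 = prod_chart \<phi>2 \<psi>2"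
      and c: "(U, \<phi>) \<in> A" "(V, \<psi>) \<in> B" "(U2, \<phi>2) \<in> A" "(V2, \<psi>2) \<in> B"
      unfolding prod_atlas_eq by blast
    let ?U = "\<phi> ` (U2 \<inter> U)" and ?V = "\<psi> ` (V2 \<inter> V)"
    let ?S = "(\<lambda>u. \<chi> a. u $ Inl a) -` ?U \<inter> (\<lambda>u. \<chi> b. u $ Inr b) -` ?V"
    have S: "ch' ` (W \<inter> W2) = ?S"
    proof -
      have "W \<inter> W2 = (U2 \<inter> U) \<times> (V2 \<inter> V)" unfolding W by auto
      then show ?thesis unfolding W(2) by (simp add: prod_chart_image) auto
    qed
    have cU: "cinf ?U (\<lambda>y. \<phi>2 (inv_into U \<phi> y) $ a)" for a by (rule transition_cinf[OF A c(1,3)])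
    have cV: "cinf ?V (\<lambda>y. \<psi>2 (inv_into V \<psi> y) $ b)" for b by (rule transition_cinf[OF B c(2,4)])
    have oS: "open ?S"
      using open_vimage[OF cinf_open[OF cU] continuous_parts(1)] open_vimage[OF cinf_open[OF cV] continuous_parts(2)] by (rule open_Int)
    have inv: "inv_into W ch' u = (inv_into U \<phi> (\<chi> a. u $ Inl a), inv_into V \<psi> (\<chi> b. u $ Inr b))" if "u \<in> ?S" for u
      unfolding W using that by (intro prod_chart_inv[OF c(1,2)]) auto
    have "cinf ?S (\<lambda>y. ch2 (inv_into W ch' y) $ j)"
    proof (cases j)
      case (Inl a)
      have "cinf ?S (\<lambda>u. \<phi>2 (inv_into U \<phi> (\<chi> a. u $ Inl a)) $ a)"
        by (rule cinf_compose[OF cU[of a] oS, where h="\<lambda>u. \<chi> a. u $ Inl a"]) (auto intro: cinf_nth[OF oS])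
      then show ?thesis by (rule cinf_cong) (simp only: inv, simp add: W Inl)
    next
      case (Inr b)
      have "cinf ?S (\<lambda>u. \<psi>2 (inv_into V \<psi> (\<chi> b. u $ Inr b)) $ b)"
        by (rule cinf_compose[OF cV[of b] oS, where h="\<lambda>u. \<chi> b. u $ Inr b"]) (auto intro: cinf_nth[OF oS])
      then show ?thesis by (rule cinf_cong) (simp only: inv, simp add: W Inr)
    qed
    then show "Ck_on r (ch' ` (W \<inter> W2)) (\<lambda>y. ch2 (inv_into W ch' y) $ j)" unfolding S by (simp add: cinf_def)
  qed
qed

lemma smooth_map_fst: "open W \<Longrightarrow> smooth_map (prod_atlas A B) A W fst"
proof (rule smooth_mapI_chart[OF manifold_prod A])
  fix p assume "p \<in> W"
  obtain U \<phi> where U: "(U, \<phi>) \<in> A" "fst p \<in> U" using chart_exists[OF A] by blast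
  obtain V \<psi> where V: "(V, \<psi>) \<in> B" "snd p \<in> V" using chart_exists[OF B] by blast
  have p: "p \<in> U \<times> V" using U V by (simp add: mem_Times_iff)
  have "smooth_near (prod_atlas A B) p (\<lambda>p. \<phi> (fst p) $ j)" for j
    using smooth_near_chart[OF manifold_prod prod_chart_mem[OF U(1) V(1)] p, of "Inl j"]
    by (simp add: prod_chart_def case_prod_unfold)
  then show "\<exists>V \<psi>. (V, \<psi>) \<in> A \<and> fst p \<in> V \<and> (\<forall>j. smooth_near (prod_atlas A B) p (\<lambda>p. \<psi> (fst p) $ j))"
    using U by (intro exI[of _ U] exI[of _ \<phi>]) simp
qed (auto intro: continuous_intros)

lemma smooth_map_snd: "open W \<Longrightarrow> smooth_map (prod_atlas A B) B W snd"
proof (rule smooth_mapI_chart[OF manifold_prod B])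
  fix p assume "p \<in> W"
  obtain U \<phi> where U: "(U, \<phi>) \<in> A" "fst p \<in> U" using chart_exists[OF A] by blast
  obtain V \<psi> where V: "(V, \<psi>) \<in> B" "snd p \<in> V" using chart_exists[OF B] by blast
  have p: "p \<in> U \<times> V" using U V by (simp add: mem_Times_iff)
  have "smooth_near (prod_atlas A B) p (\<lambda>p. \<psi> (snd p) $ j)" for j
    using smooth_near_chart[OF manifold_prod prod_chart_mem[OF U(1) V(1)] p, of "Inr j"]
    by (simp add: prod_chart_def case_prod_unfold)
  then show "\<exists>U \<phi>. (U, \<phi>) \<in> B \<and> snd p \<in> U \<and> (\<forall>j. smooth_near (prod_atlas A B) p (\<lambda>p. \<phi> (snd p) $ j))"
    using V by (intro exI[of _ V] exI[of _ \<psi>]) simp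
qed (auto intro: continuous_intros)

lemma smooth_map_Pair:
  assumes C: "manifold C" and F: "smooth_map C A W F" and H: "smooth_map C B W H"
  shows "smooth_map C (prod_atlas A B) W (\<lambda>z. (F z, H z))"
proof (rule smooth_mapI_chart[OF C manifold_prod])
  show "open W" "continuous_on W (\<lambda>z. (F z, H z))"
    using F H by (auto simp: smooth_map_def intro!: continuous_on_Pair)
  fix z assume z: "z \<in> W"
  obtain U \<phi> where U: "(U, \<phi>) \<in> A" "F z \<in> U" using chart_exists[OF A] by blast
  obtain V \<psi> where V: "(V, \<psi>) \<in> B" "H z \<in> V" using chart_exists[OF B] by blast
  have "smooth_near C z (\<lambda>z. prod_chart \<phi> \<psi> (F z, H z) $ j)" for j
  proof (cases j)
    case (Inl a)
    then show ?thesis using smooth_map_near[OF F z smooth_near_chart[OF A U, of a]] by simp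
  next
    case (Inr b)
    then show ?thesis using smooth_map_near[OF H z smooth_near_chart[OF B V, of b]] by simp
  qed
  then show "\<exists>V \<psi>. (V, \<psi>) \<in> prod_atlas A B \<and> (F z, H z) \<in> V \<and> (\<forall>j. smooth_near C z (\<lambda>z. \<psi> (F z, H z) $ j))"
    using prod_chart_mem[OF U(1) V(1)] U(2) V(2) by (intro exI[of _ "U \<times> V"] exI[of _ "prod_chart \<phi> \<psi>"]) simp
qed

lemma curve_at_Pair:
  assumes c: "curve_at A c" and d: "curve_at B d"
  shows "curve_at (prod_atlas A B) (\<lambda>t. (c t, d t))"
proof -
  obtain U \<phi> where U: "(U, \<phi>) \<in> A" "c 0 \<in> U" using chart_exists[OF A] by blast
  obtain V \<psi> where V: "(V, \<psi>) \<in> B" "d 0 \<in> V" using chart_exists[OF B] by blast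
  obtain w where w: "\<And>i. ((\<lambda>t. \<phi> (c t) $ i) has_field_derivative w $ i) (at 0)" using curve_coords[OF A U c] by blast
  obtain w' where w': "\<And>i. ((\<lambda>t. \<psi> (d t) $ i) has_field_derivative w' $ i) (at 0)" using curve_coords[OF B V d] by blast
  show ?thesis
  proof (rule curveI[OF manifold_prod prod_chart_mem[OF U(1) V(1)], where w="vjoin w w'"])
    show "isCont (\<lambda>t. (c t, d t)) 0" using c d by (simp add: curve_at_def continuous_Pair)
    show "((\<lambda>t. prod_chart \<phi> \<psi> (c t, d t) $ i) has_field_derivative vjoin w w' $ i) (at 0)" for i
      using w w' by (cases i) simp_all
  qed (use U V in simp)
qed

lemma slice_left: "smooth_map A (prod_atlas A B) UNIV (\<lambda>x. (x, y))"
  by (rule smooth_map_Pair[OF A smooth_map_id[OF A] smooth_map_const[OF A]]) auto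

lemma slice_right: "smooth_map B (prod_atlas A B) UNIV (\<lambda>y. (x, y))"
  by (rule smooth_map_Pair[OF B smooth_map_const[OF B] smooth_map_id[OF B]]) auto

lemma smooth_near_slice_left: "smooth_near (prod_atlas A B) (x, y) f \<Longrightarrow> smooth_near A x (\<lambda>x. f (x, y))"
  using smooth_map_near[OF slice_left, of x y f] by simp

lemma smooth_near_slice_right: "smooth_near (prod_atlas A B) (x, y) f \<Longrightarrow> smooth_near B y (\<lambda>y. f (x, y))"
  using smooth_map_near[OF slice_right, of y x f] by simp

lemma sum_Plus_UNIV: "(\<Sum>i\<in>(UNIV :: ('n + 'l) set). g i) = (\<Sum>a\<in>UNIV. g (Inl a)) + (\<Sum>b\<in>UNIV. g (Inr b))"
  using sum.Plus[of "UNIV :: 'n set" "UNIV :: 'l set" g] by (simp add: UNIV_Plus_UNIV o_def)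

text \<open>w is pushed forward along the slice y \<mapsto> (x, y) to a tangent vector of the
  product. The coordinates of the first factor are constant along the slice and drop out.\<close>

lemma tangent_slice_right:
  assumes c: "(U, \<phi>) \<in> A" "x \<in> U" "(V, \<psi>) \<in> B" "y \<in> V" and f: "smooth_near (prod_atlas A B) (x, y) f"
    and w: "w \<in> tangent_space B y"
  shows "w (\<lambda>y. f (x, y)) = (\<Sum>b\<in>UNIV. pd (Inr b) (\<lambda>u. f (inv_into (U \<times> V) (prod_chart \<phi> \<psi>) u)) (vjoin (\<phi> x) (\<psi> y)) * w (\<lambda>y. \<psi> y $ b))"
proof -
  let ?p = "pushforward (prod_atlas A B) (\<lambda>y. (x, y)) y w"
  have p: "?p \<in> tangent_space (prod_atlas A B) (x, y)"
    by (rule pushforward_tangent[OF B manifold_prod slice_right UNIV_I w])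
  have c': "(U \<times> V, prod_chart \<phi> \<psi>) \<in> prod_atlas A B" "(x, y) \<in> U \<times> V" using prod_chart_mem[OF c(1,3)] c by auto
  have co: "?p (\<lambda>p. prod_chart \<phi> \<psi> p $ i) = w (\<lambda>y'. prod_chart \<phi> \<psi> (x, y') $ i)" for i
    using smooth_near_chart[OF manifold_prod c', of i] by (simp add: pushforward_def)
  have "w (\<lambda>y. f (x, y)) = ?p f" using f by (simp add: pushforward_def)
  also have "\<dots> = (\<Sum>i\<in>UNIV. pd i (\<lambda>u. f (inv_into (U \<times> V) (prod_chart \<phi> \<psi>) u)) (prod_chart \<phi> \<psi> (x, y)) * ?p (\<lambda>p. prod_chart \<phi> \<psi> p $ i))"
    by (rule tangent_expand[OF manifold_prod p c' f])
  finally show ?thesis unfolding co sum_Plus_UNIV by (simp add: tangent_const[OF B w])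
qed

lemma tangent_slice_left:
  assumes c: "(U, \<phi>) \<in> A" "x \<in> U" "(V, \<psi>) \<in> B" "y \<in> V" and f: "smooth_near (prod_atlas A B) (x, y) f"
    and v: "v \<in> tangent_space A x"
  shows "v (\<lambda>x. f (x, y)) = (\<Sum>a\<in>UNIV. pd (Inl a) (\<lambda>u. f (inv_into (U \<times> V) (prod_chart \<phi> \<psi>) u)) (vjoin (\<phi> x) (\<psi> y)) * v (\<lambda>x. \<phi> x $ a))"
proof -
  let ?p = "pushforward (prod_atlas A B) (\<lambda>x. (x, y)) x v"
  have p: "?p \<in> tangent_space (prod_atlas A B) (x, y)"
    by (rule pushforward_tangent[OF A manifold_prod slice_left UNIV_I v])
  have c': "(U \<times> V, prod_chart \<phi> \<psi>) \<in> prod_atlas A B" "(x, y) \<in> U \<times> V" using prod_chart_mem[OF c(1,3)] c by auto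
  have co: "?p (\<lambda>p. prod_chart \<phi> \<psi> p $ i) = v (\<lambda>x'. prod_chart \<phi> \<psi> (x', y) $ i)" for i
    using smooth_near_chart[OF manifold_prod c', of i] by (simp add: pushforward_def)
  have "v (\<lambda>x. f (x, y)) = ?p f" using f by (simp add: pushforward_def)
  also have "\<dots> = (\<Sum>i\<in>UNIV. pd i (\<lambda>u. f (inv_into (U \<times> V) (prod_chart \<phi> \<psi>) u)) (prod_chart \<phi> \<psi> (x, y)) * ?p (\<lambda>p. prod_chart \<phi> \<psi> p $ i))"
    by (rule tangent_expand[OF manifold_prod p c' f])
  finally show ?thesis unfolding co sum_Plus_UNIV by (simp add: tangent_const[OF A v])
qed

text \<open>Differentiating in one factor gives a combination, with constant coefficients, of
  partial derivatives in the product chart, and these are smooth in the other factor. Commutation is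
  the symmetry of the mixed partials with one index from each factor.\<close>

lemma
  assumes f: "smooth_near (prod_atlas A B) (x0, y0) f"
  shows smooth_near_partial_right: "w \<in> tangent_space B y0 \<Longrightarrow> smooth_near A x0 (\<lambda>x. w (\<lambda>y. f (x, y)))"
    and smooth_near_partial_left: "v \<in> tangent_space A x0 \<Longrightarrow> smooth_near B y0 (\<lambda>y. v (\<lambda>x. f (x, y)))"
    and partial_commute: "v \<in> tangent_space A x0 \<Longrightarrow> w \<in> tangent_space B y0 \<Longrightarrow>
      v (\<lambda>x. w (\<lambda>y. f (x, y))) = w (\<lambda>y. v (\<lambda>x. f (x, y)))"
proof -
  obtain U \<phi> where U: "(U, \<phi>) \<in> A" "x0 \<in> U" using chart_exists[OF A] by blast
  obtain V \<psi> where V: "(V, \<psi>) \<in> B" "y0 \<in> V" using chart_exists[OF B] by blast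
  have c': "(U \<times> V, prod_chart \<phi> \<psi>) \<in> prod_atlas A B" "(x0, y0) \<in> U \<times> V" using prod_chart_mem[OF U(1) V(1)] U V by auto
  let ?f = "\<lambda>u. f (inv_into (U \<times> V) (prod_chart \<phi> \<psi>) u)" and ?p = "vjoin (\<phi> x0) (\<psi> y0)"
  obtain T where T: "?p \<in> T" "T \<subseteq> prod_chart \<phi> \<psi> ` (U \<times> V)" "cinf T ?f"
    using f unfolding smooth_near_chart_iff[OF manifold_prod c'] by auto
  obtain W where W: "open W" "(x0, y0) \<in> W" "\<And>p. p \<in> W \<Longrightarrow> smooth_near (prod_atlas A B) p f"
    using smooth_near_open[OF f] by blast
  have oT: "open T" by (rule cinf_open[OF T(3)])
  let ?WA = "(\<lambda>x. (x, y0)) -` W \<inter> U" and ?WB = "(\<lambda>y. (x0, y)) -` W \<inter> V"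
  have oA: "open ?WA" using chartD(1)[OF A U(1)] by (intro open_Int open_vimage[OF W(1)] continuous_intros)
  have oB: "open ?WB" using chartD(1)[OF B V(1)] by (intro open_Int open_vimage[OF W(1)] continuous_intros)
  define GB where "GB b x = pd (Inr b) ?f (vjoin (\<phi> x) (\<psi> y0))" for b x
  define GA where "GA a y = pd (Inl a) ?f (vjoin (\<phi> x0) (\<psi> y))" for a y
  have eqA: "w (\<lambda>y. f (x, y)) = (\<Sum>b\<in>UNIV. GB b x * w (\<lambda>y. \<psi> y $ b))"
    if "w \<in> tangent_space B y0" "x \<in> ?WA" for w x
    unfolding GB_def using that V W(3) by (intro tangent_slice_right[OF U(1)]) auto
  have eqB: "v (\<lambda>x. f (x, y)) = (\<Sum>a\<in>UNIV. GA a y * v (\<lambda>x. \<phi> x $ a))"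
    if "v \<in> tangent_space A x0" "y \<in> ?WB" for v y
    unfolding GA_def using that U W(3) by (intro tangent_slice_left[OF U(1) _ V(1)]) auto
  have cc: "smooth_near (prod_atlas A B) (x0, y0) (\<lambda>p. prod_chart \<phi> \<psi> p $ i)" for i
    by (rule smooth_near_chart[OF manifold_prod c'])
  have G: "smooth_near (prod_atlas A B) (x0, y0) (\<lambda>p. pd i ?f (prod_chart \<phi> \<psi> p))" for i
    by (rule smooth_near_compose_cinf[OF manifold_prod cinf_pd[OF T(3)], where h="prod_chart \<phi> \<psi>"]) (use T cc in auto)
  have GB: "smooth_near A x0 (GB b)" for b
    using smooth_near_slice_left[OF G[of "Inr b"]] by (simp add: GB_def[abs_def])
  have GA: "smooth_near B y0 (GA a)" for a
    using smooth_near_slice_right[OF G[of "Inl a"]] by (simp add: GA_def[abs_def])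
  have GBc: "smooth_near A x0 (\<lambda>x. GB b x * k)" for b k by (rule smooth_near_mult[OF A GB smooth_near_const[OF A]])
  have GAc: "smooth_near B y0 (\<lambda>y. GA a y * k)" for a k by (rule smooth_near_mult[OF B GA smooth_near_const[OF B]])
  have x0: "x0 \<in> ?WA" and y0: "y0 \<in> ?WB" using U V W by auto
  show 1: "smooth_near A x0 (\<lambda>x. w (\<lambda>y. f (x, y)))" if w: "w \<in> tangent_space B y0" for w
    using smooth_near_cong[OF A oA x0, of "\<lambda>x. w (\<lambda>y. f (x, y))"] eqA[OF w] smooth_near_sum[OF A GBc] by auto
  show 2: "smooth_near B y0 (\<lambda>y. v (\<lambda>x. f (x, y)))" if v: "v \<in> tangent_space A x0" for v
    using smooth_near_cong[OF B oB y0, of "\<lambda>y. v (\<lambda>x. f (x, y))"] eqB[OF v] smooth_near_sum[OF B GAc] by auto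
  \<comment> \<open>Passing to the manifold and back through the chart does not change a partial
    derivative near the base point, so second derivatives are iterated \<open>pd\<close>.\<close>
  have hat: "pd j (\<lambda>u. pd i ?f (prod_chart \<phi> \<psi> (inv_into (U \<times> V) (prod_chart \<phi> \<psi>) u))) ?p = pd j (pd i ?f) ?p" for i j
  proof (rule pd_cong(2)[OF oT T(1)])
    fix u assume "u \<in> T"
    then show "pd i ?f (prod_chart \<phi> \<psi> (inv_into (U \<times> V) (prod_chart \<phi> \<psi>) u)) = pd i ?f u"
      by (simp only: chartD(6)[OF manifold_prod c'(1) subsetD[OF T(2)]])
  qed
  show "v (\<lambda>x. w (\<lambda>y. f (x, y))) = w (\<lambda>y. v (\<lambda>x. f (x, y)))" if v: "v \<in> tangent_space A x0" and w: "w \<in> tangent_space B y0" for v w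
  proof -
    have "v (\<lambda>x. w (\<lambda>y. f (x, y))) = v (\<lambda>x. \<Sum>b\<in>UNIV. GB b x * w (\<lambda>y. \<psi> y $ b))"
      by (rule tangent_cong[OF A v oA x0]) (rule eqA[OF w])
    also have "\<dots> = (\<Sum>b\<in>UNIV. v (\<lambda>x. GB b x * w (\<lambda>y. \<psi> y $ b)))" by (rule tangent_sum[OF A v GBc])
    also have "\<dots> = (\<Sum>b\<in>UNIV. v (GB b) * w (\<lambda>y. \<psi> y $ b))"
      using tangent_mult[OF A v GB smooth_near_const[OF A]] tangent_const[OF A v] by simp
    also have "\<dots> = (\<Sum>b\<in>UNIV. (\<Sum>a\<in>UNIV. pd (Inl a) (pd (Inr b) ?f) ?p * v (\<lambda>x. \<phi> x $ a)) * w (\<lambda>y. \<psi> y $ b))"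
      using tangent_slice_left[OF U V G v] unfolding hat by (simp add: GB_def[abs_def])
    finally have l: "v (\<lambda>x. w (\<lambda>y. f (x, y))) = (\<Sum>b\<in>UNIV. \<Sum>a\<in>UNIV. pd (Inl a) (pd (Inr b) ?f) ?p * v (\<lambda>x. \<phi> x $ a) * w (\<lambda>y. \<psi> y $ b))"
      by (simp add: sum_distrib_right)
    have "w (\<lambda>y. v (\<lambda>x. f (x, y))) = w (\<lambda>y. \<Sum>a\<in>UNIV. GA a y * v (\<lambda>x. \<phi> x $ a))"
      by (rule tangent_cong[OF B w oB y0]) (rule eqB[OF v])
    also have "\<dots> = (\<Sum>a\<in>UNIV. w (\<lambda>y. GA a y * v (\<lambda>x. \<phi> x $ a)))" by (rule tangent_sum[OF B w GAc])
    also have "\<dots> = (\<Sum>a\<in>UNIV. w (GA a) * v (\<lambda>x. \<phi> x $ a))"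
      using tangent_mult[OF B w GA smooth_near_const[OF B]] tangent_const[OF B w] by simp
    also have "\<dots> = (\<Sum>a\<in>UNIV. (\<Sum>b\<in>UNIV. pd (Inr b) (pd (Inl a) ?f) ?p * w (\<lambda>y. \<psi> y $ b)) * v (\<lambda>x. \<phi> x $ a))"
      using tangent_slice_right[OF U V G w] unfolding hat by (simp add: GA_def[abs_def])
    also have "\<dots> = (\<Sum>a\<in>UNIV. \<Sum>b\<in>UNIV. pd (Inl a) (pd (Inr b) ?f) ?p * v (\<lambda>x. \<phi> x $ a) * w (\<lambda>y. \<psi> y $ b))"
      using pd_commute[OF T(3,1)] by (simp add: sum_distrib_right mult.assoc mult.commute[of "w _"])
    also have "\<dots> = (\<Sum>b\<in>UNIV. \<Sum>a\<in>UNIV. pd (Inl a) (pd (Inr b) ?f) ?p * v (\<lambda>x. \<phi> x $ a) * w (\<lambda>y. \<psi> y $ b))"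
      by (rule sum.swap)
    finally show ?thesis using l by simp
  qed
qed

end

section \<open>The Lie algebra of a Lie group via left-invariant derivatives\<close>

section \<open>Lie groups\<close>

text \<open>The product rule in two variables: the diagonal sends v to the sum of its images under
  the two slices. It differentiates expressions in which the variable occurs twice, such as g
  \<otimes> h \<otimes> inv g.\<close>

lemma tangent_diagonal:
  assumes A: "manifold A" and f: "smooth_near (prod_atlas A A) (x, x) f" and v: "v \<in> tangent_space A x"
  shows "v (\<lambda>y. f (y, y)) = v (\<lambda>y. f (y, x)) + v (\<lambda>y. f (x, y))"
proof -
  obtain U \<phi> where U: "(U, \<phi>) \<in> A" "x \<in> U" using chart_exists[OF A] by blast
  have c': "(U \<times> U, prod_chart \<phi> \<phi>) \<in> prod_atlas A A" "(x, x) \<in> U \<times> U" using prod_chart_mem[OF U(1) U(1)] U by auto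
  have d: "smooth_map A (prod_atlas A A) UNIV (\<lambda>y. (y, y))"
    by (rule smooth_map_Pair[OF A A A smooth_map_id[OF A] smooth_map_id[OF A]]) auto
  let ?p = "pushforward (prod_atlas A A) (\<lambda>y. (y, y)) x v"
  have p: "?p \<in> tangent_space (prod_atlas A A) (x, x)"
    by (rule pushforward_tangent[OF A manifold_prod[OF A A] d UNIV_I v])
  have co: "?p (\<lambda>p. prod_chart \<phi> \<phi> p $ i) = v (\<lambda>y. prod_chart \<phi> \<phi> (y, y) $ i)" for i
    using smooth_near_chart[OF manifold_prod[OF A A] c', of i] by (simp add: pushforward_def)
  have "v (\<lambda>y. f (y, y)) = ?p f" using f by (simp add: pushforward_def)
  also have "\<dots> = (\<Sum>i\<in>UNIV. pd i (\<lambda>u. f (inv_into (U \<times> U) (prod_chart \<phi> \<phi>) u)) (prod_chart \<phi> \<phi> (x, x)) * ?p (\<lambda>p. prod_chart \<phi> \<phi> p $ i))"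
    by (rule tangent_expand[OF manifold_prod[OF A A] p c' f])
  finally show ?thesis
    unfolding co sum_Plus_UNIV[OF A A]
    using tangent_slice_left[OF A A U U f v] tangent_slice_right[OF A A U U f v] by simp
qed

locale lie_grp =
  fixes G :: "('g::topological_space, 'k::real_or_complex, 'n::finite, 'z) lie_group_scheme" (structure)
  assumes lg: "lie_group G"
begin

abbreviation "At \<equiv> lie_atlas G"
abbreviation "T \<equiv> lie_tangent G"
abbreviation "br \<equiv> lie_bracket G"

sublocale group G using lg by (simp add: lie_group_def)

lemma carrier [simp]: "carrier G = UNIV" using lg by (simp add: lie_group_def)

lemma A: "manifold At" using lg by (simp add: lie_group_def)

lemma AA: "manifold (prod_atlas At At)" by (rule manifold_prod[OF A A])

lemma T_tangent: "T X \<in> tangent_space At \<one>"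
  using lg by (auto simp: lie_group_def bij_betw_def)

lemma T_add: "T (X + Y) f = T X f + T Y f" and T_scale: "T (c *s X) f = c * T X f"
  using lg by (auto simp: lie_group_def)

lemma T_zero: "T 0 f = 0" using T_scale[of 0 0 f] by simp

lemma T_minus: "T (- X) f = - T X f" using T_scale[of "- 1" X f] by simp

lemma T_diff: "T (X - Y) f = T X f - T Y f" using T_add[of X "- Y" f] T_minus by simp

lemma T_inv: "v \<in> tangent_space At \<one> \<Longrightarrow> T (inv_into UNIV T v) = v"
  using lg by (auto simp: lie_group_def bij_betw_def f_inv_into_f)

lemma T_eqI: assumes "\<And>f. smooth_near At \<one> f \<Longrightarrow> T X f = T Y f" shows "X = Y"
proof -
  have "T X = T Y" by (rule tangent_eqI[OF A T_tangent T_tangent assms])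
  then show ?thesis using lg by (auto simp: lie_group_def bij_betw_def inj_on_def)
qed

lemma mult_smooth: "smooth_map (prod_atlas At At) At UNIV (\<lambda>p. fst p \<otimes> snd p)"
  using lg by (simp add: lie_group_def case_prod_unfold)

lemma inv_smooth: "smooth_map At At UNIV (m_inv G)"
  using lg by (simp add: lie_group_def)

lemma smooth_mult:
  assumes C: "manifold C" and F: "smooth_map C At W F" and H: "smooth_map C At W H"
  shows "smooth_map C At W (\<lambda>z. F z \<otimes> H z)"
  using smooth_map_compose[OF C smooth_map_Pair[OF A A C F H] mult_smooth] by simp

lemma smooth_inv:
  assumes C: "manifold C" and F: "smooth_map C At W F"
  shows "smooth_map C At W (\<lambda>z. inv (F z))"
  using smooth_map_compose[OF C F inv_smooth] by simp

lemmas smooth_intros = smooth_mult smooth_inv smooth_map_fst[OF A A] smooth_map_snd[OF A A] smooth_map_id[OF A]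
  smooth_map_const A AA open_UNIV

lemma mult_near: "smooth_near At (g \<otimes> h) f \<Longrightarrow> smooth_near (prod_atlas At At) (g, h) (\<lambda>p. f (fst p \<otimes> snd p))"
  using smooth_map_near[OF mult_smooth, of "(g, h)" f] by simp

lemma lmult_near: "smooth_near At (g \<otimes> h) f \<Longrightarrow> smooth_near At h (\<lambda>h. f (g \<otimes> h))"
  using smooth_near_slice_right[OF A A mult_near] by simp

text \<open>The function is f differentiated along the left-invariant vector field of X; its
  smoothness allows such derivatives to be iterated.\<close>

lemma L_near: assumes "smooth_near At g f" shows "smooth_near At g (\<lambda>g. T X (\<lambda>h. f (g \<otimes> h)))"
  using smooth_near_partial_right[OF A A mult_near[of g \<one> f] T_tangent] assms by simp

lemma R_near: assumes "smooth_near At g f" shows "smooth_near At g (\<lambda>g. T X (\<lambda>h. f (h \<otimes> g)))"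
  using smooth_near_partial_left[OF A A mult_near[of \<one> g f] T_tangent] assms by simp

text \<open>A priori this is a second-order operator. In a chart, the terms with second derivatives
  of f are symmetric in X and Y and cancel. What remains is a tangent vector, whose coordinates are
  the values of the operator on the coordinate functions.\<close>

lemma bracket_tangent:
  "(\<lambda>f. if smooth_near At \<one> f then T X (\<lambda>g. T Y (\<lambda>h. f (g \<otimes> h))) - T Y (\<lambda>g. T X (\<lambda>h. f (g \<otimes> h))) else 0)
    \<in> tangent_space At \<one>"
proof -
  obtain U \<phi> where U: "(U, \<phi>) \<in> At" "\<one> \<in> U" using chart_exists[OF A] by blast
  let ?a = "\<lambda>X i g. T X (\<lambda>h. \<phi> (g \<otimes> h) $ i)"
  have a_near: "smooth_near At \<one> (?a X i)" for X i by (rule L_near[OF smooth_near_chart[OF A U]])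
  let ?w = "\<chi> i. T X (?a Y i) - T Y (?a X i)"
  have "T X (\<lambda>g. T Y (\<lambda>h. f (g \<otimes> h))) - T Y (\<lambda>g. T X (\<lambda>h. f (g \<otimes> h))) =
    (\<Sum>i\<in>UNIV. pd i (\<lambda>y. f (inv_into U \<phi> y)) (\<phi> \<one>) * ?w $ i)" if f: "smooth_near At \<one> f" for f
  proof -
    let ?f = "\<lambda>y. f (inv_into U \<phi> y)"
    obtain S where S: "\<phi> \<one> \<in> S" "S \<subseteq> \<phi> ` U" "cinf S ?f" using f unfolding smooth_near_chart_iff[OF A U] by auto
    obtain W where W: "open W" "\<one> \<in> W" "\<And>g. g \<in> W \<Longrightarrow> smooth_near At g f" using smooth_near_open[OF f] by blast
    have oW: "open (W \<inter> U)" using W chartD(1)[OF A U(1)] by blast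
    have expand: "T Y (\<lambda>h. f (g \<otimes> h)) = (\<Sum>i\<in>UNIV. pd i ?f (\<phi> g) * ?a Y i g)" if g: "g \<in> W \<inter> U" for g Y
    proof -
      let ?p = "pushforward At (\<lambda>h. g \<otimes> h) \<one> (T Y)"
      have sm: "smooth_map At At UNIV (\<lambda>h. g \<otimes> h)" by (intro smooth_intros)
      have p: "?p \<in> tangent_space At g"
        using pushforward_tangent[OF A A sm UNIV_I T_tangent] by simp
      have "?p f = (\<Sum>i\<in>UNIV. pd i ?f (\<phi> g) * ?p (\<lambda>x. \<phi> x $ i))"
        by (rule tangent_expand[OF A p U(1)]) (use g W(3) in auto)
      moreover have "smooth_near At g (\<lambda>x. \<phi> x $ i)" for i using smooth_near_chart[OF A U(1)] g by blast
      ultimately show ?thesis using g W(3)[of g] by (simp add: pushforward_def)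
    qed
    have P: "smooth_near At \<one> (\<lambda>g. pd i ?f (\<phi> g))" for i
      by (rule smooth_near_compose_cinf[OF A cinf_pd[OF S(3)] S(1) smooth_near_chart[OF A U]])
    have second: "T X (\<lambda>g. pd i ?f (\<phi> g)) = (\<Sum>j\<in>UNIV. pd j (pd i ?f) (\<phi> \<one>) * T X (\<lambda>x. \<phi> x $ j))" for X i
    proof -
      have "pd j (\<lambda>y. pd i ?f (\<phi> (inv_into U \<phi> y))) (\<phi> \<one>) = pd j (pd i ?f) (\<phi> \<one>)" for j
        by (rule pd_cong(2)[OF cinf_open[OF S(3)] S(1)]) (simp only: chartD(6)[OF A U(1) subsetD[OF S(2)]])
      then show ?thesis using tangent_expand[OF A T_tangent U P] by simp
    qed
    have prod: "T X (\<lambda>g. T Y (\<lambda>h. f (g \<otimes> h))) =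
      (\<Sum>i\<in>UNIV. pd i ?f (\<phi> \<one>) * T X (?a Y i)) +
      (\<Sum>i\<in>UNIV. \<Sum>j\<in>UNIV. pd j (pd i ?f) (\<phi> \<one>) * T X (\<lambda>x. \<phi> x $ j) * T Y (\<lambda>x. \<phi> x $ i))" for X Y
    proof -
      have "T X (\<lambda>g. T Y (\<lambda>h. f (g \<otimes> h))) = T X (\<lambda>g. \<Sum>i\<in>UNIV. pd i ?f (\<phi> g) * ?a Y i g)"
        by (rule tangent_cong[OF A T_tangent oW]) (use U W expand in auto)
      also have "\<dots> = (\<Sum>i\<in>UNIV. T X (\<lambda>g. pd i ?f (\<phi> g) * ?a Y i g))"
        by (rule tangent_sum[OF A T_tangent]) (rule smooth_near_mult[OF A P a_near])
      also have "\<dots> = (\<Sum>i\<in>UNIV. pd i ?f (\<phi> \<one>) * T X (?a Y i) + T X (\<lambda>g. pd i ?f (\<phi> g)) * T Y (\<lambda>h. \<phi> h $ i))"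
        using tangent_mult[OF A T_tangent P a_near] by simp
      finally show ?thesis by (simp add: second sum.distrib sum_distrib_right)
    qed
    have "(\<Sum>i\<in>UNIV. \<Sum>j\<in>UNIV. pd j (pd i ?f) (\<phi> \<one>) * T Y (\<lambda>x. \<phi> x $ j) * T X (\<lambda>x. \<phi> x $ i)) =
      (\<Sum>j\<in>UNIV. \<Sum>i\<in>UNIV. pd j (pd i ?f) (\<phi> \<one>) * T Y (\<lambda>x. \<phi> x $ j) * T X (\<lambda>x. \<phi> x $ i))"
      by (rule sum.swap)
    also have "\<dots> = (\<Sum>i\<in>UNIV. \<Sum>j\<in>UNIV. pd j (pd i ?f) (\<phi> \<one>) * T X (\<lambda>x. \<phi> x $ j) * T Y (\<lambda>x. \<phi> x $ i))"
      using pd_commute[OF S(3,1)] by (simp add: mult_ac)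
    finally have sym: "(\<Sum>i\<in>UNIV. \<Sum>j\<in>UNIV. pd j (pd i ?f) (\<phi> \<one>) * T Y (\<lambda>x. \<phi> x $ j) * T X (\<lambda>x. \<phi> x $ i)) =
      (\<Sum>i\<in>UNIV. \<Sum>j\<in>UNIV. pd j (pd i ?f) (\<phi> \<one>) * T X (\<lambda>x. \<phi> x $ j) * T Y (\<lambda>x. \<phi> x $ i))" .
    show ?thesis
      unfolding prod[of X Y] prod[of Y X] sym by (simp add: right_diff_distrib sum_subtractf)
  qed
  then have "(\<lambda>f. if smooth_near At \<one> f then T X (\<lambda>g. T Y (\<lambda>h. f (g \<otimes> h))) - T Y (\<lambda>g. T X (\<lambda>h. f (g \<otimes> h))) else 0)
    = tvec At U \<phi> \<one> ?w"
    unfolding tvec_def by auto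
  then show ?thesis unfolding tangent_space_eq[OF A U] by (simp only: rangeI)
qed

lemma bracket_apply:
  "smooth_near At \<one> f \<Longrightarrow> T (br X Y) f = T X (\<lambda>g. T Y (\<lambda>h. f (g \<otimes> h))) - T Y (\<lambda>g. T X (\<lambda>h. f (g \<otimes> h)))"
  unfolding lie_bracket_def using T_inv[OF bracket_tangent[of X Y]] by simp

lemma L_bracket:
  assumes f: "smooth_near At g f"
  shows "T (br X Y) (\<lambda>h. f (g \<otimes> h)) = T X (\<lambda>k. T Y (\<lambda>h. f (g \<otimes> k \<otimes> h))) - T Y (\<lambda>k. T X (\<lambda>h. f (g \<otimes> k \<otimes> h)))"
proof -
  have "smooth_near At \<one> (\<lambda>h. f (g \<otimes> h))" using lmult_near[of g \<one> f] f by simp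
  from bracket_apply[OF this] show ?thesis by (simp add: m_assoc)
qed

text \<open>Turns the Jacobi identity into a cancellation among threefold left-invariant
  derivatives.\<close>

lemma triple:
  assumes f: "smooth_near At \<one> f"
  shows "T (br X (br Y Z)) f =
    T X (\<lambda>g. T Y (\<lambda>k. T Z (\<lambda>h. f (g \<otimes> k \<otimes> h)))) - T X (\<lambda>g. T Z (\<lambda>k. T Y (\<lambda>h. f (g \<otimes> k \<otimes> h))))
    - T Y (\<lambda>g. T Z (\<lambda>k. T X (\<lambda>h. f (g \<otimes> k \<otimes> h)))) + T Z (\<lambda>g. T Y (\<lambda>k. T X (\<lambda>h. f (g \<otimes> k \<otimes> h))))"
proof -
  obtain W where W: "open W" "\<one> \<in> W" "\<And>g. g \<in> W \<Longrightarrow> smooth_near At g f" using smooth_near_open[OF f] by blast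
  have LL: "smooth_near At \<one> (\<lambda>g. T Y (\<lambda>k. T Z (\<lambda>h. f (g \<otimes> k \<otimes> h))))" for Y Z
    by (rule L_near[OF L_near[OF f]])
  have "T X (\<lambda>g. T (br Y Z) (\<lambda>h. f (g \<otimes> h))) =
    T X (\<lambda>g. T Y (\<lambda>k. T Z (\<lambda>h. f (g \<otimes> k \<otimes> h))) - T Z (\<lambda>k. T Y (\<lambda>h. f (g \<otimes> k \<otimes> h))))"
    by (rule tangent_cong[OF A T_tangent W(1,2)]) (rule L_bracket[OF W(3)])
  also have "\<dots> = T X (\<lambda>g. T Y (\<lambda>k. T Z (\<lambda>h. f (g \<otimes> k \<otimes> h)))) - T X (\<lambda>g. T Z (\<lambda>k. T Y (\<lambda>h. f (g \<otimes> k \<otimes> h))))"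
    by (rule tangent_diff[OF A T_tangent LL LL])
  finally show ?thesis
    unfolding bracket_apply[OF f] using bracket_apply[OF L_near[OF f, of X], of Y Z] by simp
qed

sublocale lie_alg br
proof
  fix X Y Z :: "'k ^ 'n" and c
  have L2: "smooth_near At \<one> f \<Longrightarrow> smooth_near At \<one> (\<lambda>g. T X (\<lambda>h. f (g \<otimes> h)))" for X f by (rule L_near)
  show addl: "br (X + Y) Z = br X Z + br Y Z" for X Y Z
    by (rule T_eqI) (simp add: bracket_apply T_add tangent_add[OF A T_tangent L2 L2])
  show scl: "br (c *s X) Z = c *s br X Z" for X Z
    by (rule T_eqI) (simp add: bracket_apply T_scale tangent_scale[OF A T_tangent L2] right_diff_distrib)
  have anti: "br X Y = - br Y X" for X Y
    by (rule T_eqI) (simp add: bracket_apply T_minus)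
  show "br X X = 0" by (rule T_eqI) (simp add: bracket_apply T_zero)
  show "br Z (X + Y) = br Z X + br Z Y"
    unfolding anti[of Z] addl by simp
  show "br Z (c *s X) = c *s br Z X"
    unfolding anti[of Z] scl by simp
  show "br X (br Y Z) = br (br X Y) Z + br Y (br X Z)"
    unfolding anti[of "br X Y"] by (rule T_eqI) (simp add: triple T_diff)
qed

section \<open>The adjoint action and its derivative\<close>

subsection \<open>The adjoint action\<close>

definition cj :: "'g \<Rightarrow> 'g \<Rightarrow> 'g" where "cj g h = g \<otimes> h \<otimes> inv g"

lemma cj_one [simp]: "cj g \<one> = \<one>" by (simp add: cj_def)
lemma cj_mult: "cj g (h \<otimes> k) = cj g h \<otimes> cj g k"
proof -
  have "inv g \<otimes> (g \<otimes> x) = x" for x using m_assoc[of "inv g" g x] by simp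
  then show ?thesis by (simp add: cj_def m_assoc)
qed
lemma cj_cj: "cj g (cj h k) = cj (g \<otimes> h) k"
  by (simp add: cj_def m_assoc inv_mult_group)

lemma cj_smooth: "smooth_map At At UNIV (cj g)"
  unfolding cj_def[abs_def] by (intro smooth_intros)

lemma cj_near: "smooth_near At (cj g h) f \<Longrightarrow> smooth_near At h (\<lambda>h. f (cj g h))"
  using smooth_map_near[OF cj_smooth UNIV_I, where f=f] by simp

lemma Ad_apply: "smooth_near At \<one> f \<Longrightarrow> T (Ad G g X) f = T X (\<lambda>h. f (cj g h))"
proof -
  assume f: "smooth_near At \<one> f"
  have eq: "(\<lambda>h. g \<otimes> h \<otimes> inv g) = cj g" by (simp add: cj_def fun_eq_iff)
  have "pushforward At (cj g) \<one> (T X) \<in> tangent_space At \<one>"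
    using pushforward_tangent[OF A A cj_smooth UNIV_I T_tangent] by simp
  from T_inv[OF this] show ?thesis unfolding Ad_def eq using f by (simp add: pushforward_def)
qed

lemma lin_Ad: "lin (Ad G g)"
  by (intro linI T_eqI) (simp_all add: Ad_apply T_add T_scale)

lemma Ad_one: "Ad G \<one> X = X"
  by (rule T_eqI) (simp add: Ad_apply cj_def)

lemma Ad_mult: "Ad G (g \<otimes> h) X = Ad G g (Ad G h X)"
proof (rule T_eqI)
  fix f assume f: "smooth_near At \<one> f"
  have "smooth_near At \<one> (\<lambda>h. f (cj g h))" using cj_near[of g \<one> f] f by simp
  then show "T (Ad G (g \<otimes> h) X) f = T (Ad G g (Ad G h X)) f" using f by (simp add: Ad_apply cj_cj)
qed

lemma Ad_inv: "Ad G g (Ad G (inv g) X) = X" "Ad G (inv g) (Ad G g X) = X"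
  by (simp_all add: Ad_mult[symmetric] Ad_one)

lemma Ad_bracket: "Ad G g (br X Y) = br (Ad G g X) (Ad G g Y)"
proof (rule T_eqI)
  fix f assume f: "smooth_near At \<one> f"
  obtain W where W: "open W" "\<one> \<in> W" "\<And>g. g \<in> W \<Longrightarrow> smooth_near At g f" using smooth_near_open[OF f] by blast
  \<comment> \<open>\<open>Ad_apply\<close> needs smoothness at the identity after translation by cj
    g k, so k is confined to the points whose conjugates stay where f is smooth.\<close>
  let ?W = "cj g -` W"
  have oW: "open ?W"
    using continuous_on_open_vimage[OF open_UNIV, of "cj g"] cj_smooth[of g] W(1) unfolding smooth_map_def by auto
  have W1: "\<one> \<in> ?W" using W by simp
  have fc: "smooth_near At \<one> (\<lambda>h. f (cj g h))" using cj_near[of g \<one> f] f by simp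
  have half: "T (Ad G g X) (\<lambda>k. T (Ad G g Y) (\<lambda>h. f (k \<otimes> h))) = T X (\<lambda>k. T Y (\<lambda>h. f (cj g (k \<otimes> h))))" for X Y
  proof -
    have "T (Ad G g X) (\<lambda>k. T (Ad G g Y) (\<lambda>h. f (k \<otimes> h))) = T X (\<lambda>k. T (Ad G g Y) (\<lambda>h. f (cj g k \<otimes> h)))"
      by (rule Ad_apply[OF L_near[OF f]])
    also have "\<dots> = T X (\<lambda>k. T Y (\<lambda>h. f (cj g (k \<otimes> h))))"
    proof (rule tangent_cong[OF A T_tangent oW W1])
      fix k assume "k \<in> ?W"
      then have "smooth_near At (cj g k \<otimes> \<one>) f" using W(3) by simp
      from Ad_apply[OF lmult_near[OF this]]
      show "T (Ad G g Y) (\<lambda>h. f (cj g k \<otimes> h)) = T Y (\<lambda>h. f (cj g (k \<otimes> h)))" by (simp add: cj_mult)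
    qed
    finally show ?thesis .
  qed
  show "T (Ad G g (br X Y)) f = T (br (Ad G g X) (Ad G g Y)) f"
    unfolding Ad_apply[OF f] bracket_apply[OF fc] bracket_apply[OF f] half ..
qed

text \<open>\<open>tangent_diagonal\<close> applied to the constant function y \<mapsto> f (y
  \<otimes> inv y).\<close>

lemma tangent_inv:
  assumes f: "smooth_near At \<one> f" shows "T X (\<lambda>g. f (inv g)) = - T X f"
proof -
  have sm: "smooth_map (prod_atlas At At) At UNIV (\<lambda>p. fst p \<otimes> inv (snd p))"
    by (intro smooth_intros)
  have "smooth_near (prod_atlas At At) (\<one>, \<one>) (\<lambda>p. f (fst p \<otimes> inv (snd p)))"
    using smooth_map_near[OF sm UNIV_I, of "(\<one>, \<one>)" f] f by simp
  from tangent_diagonal[OF A this T_tangent, of X]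
  have "T X (\<lambda>y. f (y \<otimes> inv y)) = T X (\<lambda>y. f (y \<otimes> inv \<one>)) + T X (\<lambda>y. f (\<one> \<otimes> inv y))" by simp
  then show ?thesis using tangent_const[OF A T_tangent] by (simp add: eq_neg_iff_add_eq_0 add.commute)
qed

text \<open>The derivative of Ad is ad, before components are taken. The two derivatives are
  exchanged; for fixed h, differentiating f (g \<otimes> h \<otimes> inv g) in g at the identity
  gives the term for g \<otimes> h minus the term for h \<otimes> g, and these produce the two
  halves of the bracket.\<close>

lemma conj_bracket:
  assumes f: "smooth_near At \<one> f"
  shows "T Z (\<lambda>g. T X (\<lambda>h. f (cj g h))) = T (br Z X) f" and "smooth_near At \<one> (\<lambda>g. T X (\<lambda>h. f (cj g h)))"
proof -
  have sm: "smooth_map (prod_atlas At At) At UNIV (\<lambda>p. cj (fst p) (snd p))"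
    unfolding cj_def by (intro smooth_intros)
  have F: "smooth_near (prod_atlas At At) (\<one>, \<one>) (\<lambda>p. f (cj (fst p) (snd p)))"
    using smooth_map_near[OF sm UNIV_I, of "(\<one>, \<one>)" f] f by simp
  show "smooth_near At \<one> (\<lambda>g. T X (\<lambda>h. f (cj g h)))"
    using smooth_near_partial_right[OF A A F T_tangent] by simp
  obtain W where W: "open W" "\<one> \<in> W" "\<And>g. g \<in> W \<Longrightarrow> smooth_near At g f" using smooth_near_open[OF f] by blast
  have diag: "T Z (\<lambda>g. f (cj g h)) = T Z (\<lambda>g. f (g \<otimes> h)) - T Z (\<lambda>g. f (h \<otimes> g))" if h: "h \<in> W" for h
  proof -
    have sm2: "smooth_map (prod_atlas At At) At UNIV (\<lambda>p. fst p \<otimes> h \<otimes> inv (snd p))"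
      by (intro smooth_intros)
    have "smooth_near (prod_atlas At At) (\<one>, \<one>) (\<lambda>p. f (fst p \<otimes> h \<otimes> inv (snd p)))"
      using smooth_map_near[OF sm2 UNIV_I, of "(\<one>, \<one>)" f] W(3)[OF h] by simp
    from tangent_diagonal[OF A this T_tangent, of Z]
    have "T Z (\<lambda>y. f (y \<otimes> h \<otimes> inv y)) = T Z (\<lambda>y. f (y \<otimes> h)) + T Z (\<lambda>y. f (h \<otimes> inv y))" by simp
    moreover have "smooth_near At \<one> (\<lambda>g. f (h \<otimes> g))" using lmult_near[of h \<one> f] W(3)[OF h] by simp
    from tangent_inv[OF this] have "T Z (\<lambda>y. f (h \<otimes> inv y)) = - T Z (\<lambda>g. f (h \<otimes> g))" .
    ultimately show ?thesis by (simp add: cj_def)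
  qed
  have M: "smooth_near (prod_atlas At At) (\<one>, \<one>) (\<lambda>p. f (fst p \<otimes> snd p))" using mult_near[of \<one> \<one> f] f by simp
  have "T Z (\<lambda>g. T X (\<lambda>h. f (cj g h))) = T X (\<lambda>h. T Z (\<lambda>g. f (cj g h)))"
    using partial_commute[OF A A F T_tangent T_tangent, of Z X] by simp
  also have "\<dots> = T X (\<lambda>h. T Z (\<lambda>g. f (g \<otimes> h)) - T Z (\<lambda>g. f (h \<otimes> g)))"
    by (rule tangent_cong[OF A T_tangent W(1,2)]) (rule diag)
  also have "\<dots> = T X (\<lambda>h. T Z (\<lambda>g. f (g \<otimes> h))) - T X (\<lambda>h. T Z (\<lambda>g. f (h \<otimes> g)))"
    by (rule tangent_diff[OF A T_tangent R_near[OF f] L_near[OF f]])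
  also have "T X (\<lambda>h. T Z (\<lambda>g. f (g \<otimes> h))) = T Z (\<lambda>g. T X (\<lambda>h. f (g \<otimes> h)))"
    using partial_commute[OF A A M T_tangent T_tangent, of Z X] by simp
  finally show "T Z (\<lambda>g. T X (\<lambda>h. f (cj g h))) = T (br Z X) f" unfolding bracket_apply[OF f] .
qed

lemma one_parameter_subgroupD:
  assumes "one_parameter_subgroup G X \<gamma>"
  shows "\<gamma> 0 = \<one>" "\<gamma> (s + t) = \<gamma> s \<otimes> \<gamma> t" "inv (\<gamma> t) = \<gamma> (- t)" "curve_at At \<gamma>" "velocity At \<gamma> = T X"
proof -
  have sm: "smooth_map scalar_atlas At UNIV \<gamma>" and add: "\<And>s t. \<gamma> (s + t) = \<gamma> s \<otimes> \<gamma> t"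
    and v: "velocity At \<gamma> = T X" using assms by (auto simp: one_parameter_subgroup_def)
  have "\<gamma> 0 \<otimes> \<gamma> 0 = \<gamma> 0 \<otimes> \<one>" using add[of 0 0] by simp
  then show 0: "\<gamma> 0 = \<one>" by (simp del: r_one)
  show "\<gamma> (s + t) = \<gamma> s \<otimes> \<gamma> t" by (rule add)
  have "\<gamma> t \<otimes> \<gamma> (- t) = \<one>" using add[of t "- t"] 0 by simp
  then have "\<gamma> (- t) \<otimes> \<gamma> t = \<one>" using add[of "- t" t] 0 by simp
  then show "inv (\<gamma> t) = \<gamma> (- t)" by (intro inv_equality) simp_all
  have "curve_at scalar_atlas (\<lambda>t::'k. t)" by (rule curve_at_scalar) (rule DERIV_ident)
  from smooth_map_curve[OF sm this] show "curve_at At \<gamma>" by simp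
  show "velocity At \<gamma> = T X" by (rule v)
qed

lemma one_parameter_subgroup_scale:
  assumes "one_parameter_subgroup G X \<gamma>"
  shows "one_parameter_subgroup G (c *s X) (\<lambda>t. \<gamma> (c * t))"
  unfolding one_parameter_subgroup_def
proof (intro conjI allI)
  have sm: "smooth_map scalar_atlas At UNIV \<gamma>" using assms by (simp add: one_parameter_subgroup_def)
  have ch: "(UNIV, \<lambda>t::'k. \<chi> i::1. t) \<in> scalar_atlas" by (simp add: scalar_atlas_def)
  have "smooth_map scalar_atlas scalar_atlas UNIV (\<lambda>t. c * t)"
  proof (rule smooth_mapI_chart[OF manifold_scalar manifold_scalar open_UNIV])
    show "continuous_on UNIV (\<lambda>t. c * t)" by (intro continuous_intros)
    fix x :: 'k
    have "smooth_near scalar_atlas x (\<lambda>t. c * (\<chi> i::1. t) $ j)" for j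
      by (intro smooth_near_mult smooth_near_const smooth_near_chart[OF manifold_scalar ch] manifold_scalar) simp
    then have "smooth_near scalar_atlas x (\<lambda>t. (\<chi> i::1. c * t) $ j)" for j by simp
    then show "\<exists>V \<psi>. (V, \<psi>) \<in> scalar_atlas \<and> c * x \<in> V \<and> (\<forall>j. smooth_near scalar_atlas x (\<lambda>t. \<psi> (c * t) $ j))"
      using ch by (intro exI[of _ UNIV] exI[of _ "\<lambda>t::'k. \<chi> i::1. t"]) simp
  qed
  from smooth_map_compose[OF manifold_scalar this sm]
  show "smooth_map scalar_atlas At UNIV (\<lambda>t. \<gamma> (c * t))" by simp
  show "\<gamma> (c * (s + t)) = \<gamma> (c * s) \<otimes> \<gamma> (c * t)" for s t
    using one_parameter_subgroupD(2)[OF assms] by (simp add: distrib_left)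
  show "velocity At (\<lambda>t. \<gamma> (c * t)) = T (c *s X)"
  proof (rule ext)
    fix f
    show "velocity At (\<lambda>t. \<gamma> (c * t)) f = T (c *s X) f"
    proof (cases "smooth_near At \<one> f")
      case True
      have "((\<lambda>t. f (\<gamma> t)) has_field_derivative T X f) (at (c * 0))"
        using velocity_deriv[OF one_parameter_subgroupD(4)[OF assms], of f] True one_parameter_subgroupD(1,5)[OF assms] by simp
      moreover have "((\<lambda>t. c * t) has_field_derivative c) (at 0)" by (auto intro!: derivative_eq_intros)
      ultimately have "((\<lambda>t. f (\<gamma> (c * t))) has_field_derivative T X f * c) (at 0)"
        using DERIV_chain2[of "\<lambda>t. f (\<gamma> t)" "T X f" "\<lambda>t. c * t" 0 c UNIV] by simp
      then show ?thesis
        using True one_parameter_subgroupD(1)[OF assms] by (simp add: velocity_def DERIV_imp_deriv T_scale mult.commute)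
    next
      case False
      then show ?thesis
        using one_parameter_subgroupD(1)[OF assms] tangent_not_smooth[OF T_tangent] by (simp add: velocity_def)
    qed
  qed
qed

text \<open>Reads off the components of a Lie algebra element from its derivatives of finitely many
  functions, so that derivatives computed for \<open>T X f\<close> carry over to curves in
  \<open>'k ^ 'n\<close>.\<close>

lemma T_coordinates: "\<exists>N F. (\<forall>j. smooth_near At \<one> (F j)) \<and> (\<forall>X i. X $ i = (\<Sum>j\<in>UNIV. N i j * T X (F (j::'n))))"
proof -
  obtain U \<phi> where U: "(U, \<phi>) \<in> At" "\<one> \<in> U" using chart_exists[OF A] by blast
  let ?M = "\<lambda>X. \<chi> j. T X (\<lambda>x. \<phi> x $ j)"
  have l: "lin ?M" by (rule linI) (auto simp: vec_eq_iff T_add T_scale)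
  have "inj ?M"
  proof (rule injI, rule T_eqI)
    fix X Y f assume eq: "?M X = ?M Y" and f: "smooth_near At \<one> f"
    have "T X (\<lambda>x. \<phi> x $ j) = T Y (\<lambda>x. \<phi> x $ j)" for j using arg_cong[OF eq, of "\<lambda>v. v $ j"] by simp
    then show "T X f = T Y f"
      using tangent_expand[OF A T_tangent U f, of X] tangent_expand[OF A T_tangent U f, of Y] by simp
  qed
  then obtain g where g: "lin g" "g \<circ> ?M = id" using vec.linear_injective_left_inverse[OF l] by auto
  have "X $ i = (\<Sum>j\<in>UNIV. g (axis j 1) $ i * T X (\<lambda>x. \<phi> x $ j))" for X i
  proof -
    have "X = g (?M X)" using fun_cong[OF g(2), of X] by simp
    then have "X $ i = (\<Sum>j\<in>UNIV. ?M X $ j * g (axis j 1) $ i)" using linear_componentwise[OF g(1), of "?M X" i] by simp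
    then show ?thesis by (simp add: mult.commute)
  qed
  then show ?thesis
    by (intro exI[of _ "\<lambda>i j. g (axis j 1) $ i"] exI[of _ "\<lambda>j x. \<phi> x $ j"] conjI allI smooth_near_chart[OF A U])
qed

lemma Ad_deriv:
  assumes \<gamma>: "one_parameter_subgroup G Z \<gamma>"
  shows "((\<lambda>t. Ad G (\<gamma> t) X $ i) has_field_derivative br Z X $ i) (at 0)"
proof -
  obtain N F where NF: "\<forall>j. smooth_near At \<one> (F j)" "\<forall>X i. X $ i = (\<Sum>j\<in>UNIV. N i j * T X (F (j::'n)))"
    using T_coordinates by (elim exE conjE)
  have F: "smooth_near At \<one> (F j)" for j using NF(1) ..
  have N: "X $ i = (\<Sum>j\<in>UNIV. N i j * T X (F j))" for X i using NF(2) by blast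
  have "((\<lambda>t. T (Ad G (\<gamma> t) X) (F j)) has_field_derivative T (br Z X) (F j)) (at 0)" for j
  proof -
    have "((\<lambda>t. T X (\<lambda>h. F j (cj (\<gamma> t) h))) has_field_derivative T Z (\<lambda>g. T X (\<lambda>h. F j (cj g h)))) (at 0)"
      using velocity_deriv[OF one_parameter_subgroupD(4)[OF \<gamma>], of "\<lambda>g. T X (\<lambda>h. F j (cj g h))"]
        conj_bracket(2)[OF F] one_parameter_subgroupD(1,5)[OF \<gamma>] by simp
    then show ?thesis unfolding Ad_apply[OF F] conj_bracket(1)[OF F] .
  qed
  then have "((\<lambda>t. \<Sum>j\<in>UNIV. N i j * T (Ad G (\<gamma> t) X) (F j)) has_field_derivative (\<Sum>j\<in>UNIV. N i j * T (br Z X) (F j))) (at 0)"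
    by (intro DERIV_sum DERIV_cmult)
  then show ?thesis unfolding N[symmetric] .
qed

end

section \<open>Nested parabolics and the infinitesimal representation of q\<close>

section \<open>Nested parabolics and representations\<close>

lemma lin_deriv:
  fixes f :: "'k::real_or_complex ^ 'm::finite \<Rightarrow> 'k ^ 'l::finite"
  assumes f: "lin f" and c: "\<And>i. ((\<lambda>t. c t $ i) has_field_derivative w $ i) (at 0)"
  shows "((\<lambda>t. f (c t) $ j) has_field_derivative f w $ j) (at 0)"
proof -
  have "((\<lambda>t. \<Sum>i\<in>UNIV. c t $ i * f (axis i 1) $ j) has_field_derivative (\<Sum>i\<in>UNIV. w $ i * f (axis i 1) $ j)) (at 0)"
    by (intro DERIV_sum DERIV_cmult_right c)
  then show ?thesis unfolding linear_componentwise[OF f, symmetric] .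
qed

lemma bilin_expand:
  assumes "bilin \<tau>"
  shows "\<tau> x y $ j = (\<Sum>i\<in>UNIV. \<Sum>l\<in>UNIV. x $ i * (y $ l * \<tau> (axis i 1) (axis l 1) $ j))"
proof -
  have "\<tau> x y $ j = (\<Sum>i\<in>UNIV. x $ i * \<tau> (axis i 1) y $ j)"
    using linear_componentwise[of "\<lambda>x. \<tau> x y" x j] assms by (simp add: bilin_def)
  also have "\<dots> = (\<Sum>i\<in>UNIV. x $ i * (\<Sum>l\<in>UNIV. y $ l * \<tau> (axis i 1) (axis l 1) $ j))"
    using linear_componentwise[of "\<tau> (axis _ 1)" y j] assms by (simp add: bilin_def)
  finally show ?thesis by (simp add: sum_distrib_left)
qed

lemma bilin_deriv:
  fixes \<tau> :: "'k::real_or_complex ^ 'm::finite \<Rightarrow> 'k ^ 'l::finite \<Rightarrow> 'k ^ 'v::finite"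
  assumes \<tau>: "bilin \<tau>" and c: "\<And>i. ((\<lambda>t. c t $ i) has_field_derivative w $ i) (at 0)"
    and d: "\<And>i. ((\<lambda>t. d t $ i) has_field_derivative z $ i) (at 0)"
  shows "((\<lambda>t. \<tau> (c t) (d t) $ j) has_field_derivative (\<tau> w (d 0) + \<tau> (c 0) z) $ j) (at 0)"
proof -
  have "((\<lambda>t. \<Sum>i\<in>UNIV. \<Sum>l\<in>UNIV. c t $ i * (d t $ l * \<tau> (axis i 1) (axis l 1) $ j)) has_field_derivative
    (\<Sum>i\<in>UNIV. \<Sum>l\<in>UNIV. w $ i * (d 0 $ l * \<tau> (axis i 1) (axis l 1) $ j) + (z $ l * \<tau> (axis i 1) (axis l 1) $ j) * c 0 $ i)) (at 0)"
    by (intro DERIV_sum DERIV_mult DERIV_cmult_right c d)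
  moreover have "(\<Sum>i\<in>UNIV. \<Sum>l\<in>UNIV. w $ i * (d 0 $ l * \<tau> (axis i 1) (axis l 1) $ j) + (z $ l * \<tau> (axis i 1) (axis l 1) $ j) * c 0 $ i)
    = (\<tau> w (d 0) + \<tau> (c 0) z) $ j"
    unfolding vector_add_component bilin_expand[OF \<tau>, of w "d 0" j] bilin_expand[OF \<tau>, of "c 0" z j] sum.distrib
    by (simp only: mult.commute)
  moreover have "(\<lambda>t. \<tau> (c t) (d t) $ j) = (\<lambda>t. \<Sum>i\<in>UNIV. \<Sum>l\<in>UNIV. c t $ i * (d t $ l * \<tau> (axis i 1) (axis l 1) $ j))"
    by (rule ext) (rule bilin_expand[OF \<tau>])
  ultimately show ?thesis by (simp only:)
qed

lemma projection_exists:
  fixes S :: "('k::field ^ 'n) set"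
  assumes "vec.subspace S"
  shows "\<exists>P. lin P \<and> (\<forall>x. P x \<in> S) \<and> (\<forall>x\<in>S. P x = x)"
proof -
  obtain B where B: "B \<subseteq> S" "vec.independent B" "S \<subseteq> vec.span B"
    using vec.maximal_independent_subset by metis
  have sp: "vec.span B = S" using B assms by (simp add: vec.span_subspace)
  obtain P where P: "lin P" "\<forall>x\<in>B. P x = x" "range P = vec.span ((\<lambda>x. x) ` B)"
    using vec.linear_independent_extend_subspace[OF B(2), of "\<lambda>x. x"] by blast
  have "P x = x" if "x \<in> S" for x
    using vec.linear_eq_on_span[OF P(1) lin_id, of B x] P(2) sp that by auto
  then show ?thesis using P sp by (intro exI[of _ P]) auto
qed

locale nested_par =
  fixes G :: "('g::topological_space, 'k::real_or_complex, 'n::finite, 'z) nested_parabolics_scheme" (structure)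
  assumes np: "nested_parabolics G"
begin

abbreviation "Q \<equiv> grp_Q G"
abbreviation "\<pp> \<equiv> alg_p G"
abbreviation "\<qq> \<equiv> alg_q G"

sublocale lie_grp G using np by unfold_locales (simp add: nested_parabolics_def)

sublocale semisimple_lie_alg "lie_bracket G" using np by unfold_locales (simp add: nested_parabolics_def)

lemma par_p: "parabolic_subalgebra br \<pp>" and par_q: "parabolic_subalgebra br \<qq>" and qp: "\<qq> \<subseteq> \<pp>"
  using np by (auto simp: nested_parabolics_def)

lemma p_plus_perp: "p_plus G = perp br \<pp>" and q_plus_perp: "q_plus G = perp br \<qq>"
  unfolding p_plus_def q_plus_def using nilradical_parabolic par_p par_q by auto

lemma sub_p: "vec.subspace \<pp>" and sub_q: "vec.subspace \<qq>"
  using parabolic_subspace par_p par_q by auto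

lemma sub_p_plus: "vec.subspace (p_plus G)" and sub_q_plus: "vec.subspace (q_plus G)"
  by (simp_all add: p_plus_perp q_plus_perp subspace_perp)

lemma p_plus_q_plus: "p_plus G \<subseteq> q_plus G"
  unfolding p_plus_perp q_plus_perp by (rule perp_antimono[OF qp])

lemma q_plus_q: "q_plus G \<subseteq> \<qq>"
  unfolding q_plus_perp by (rule parabolic_perp_subset[OF par_q])

lemma p_plus_q: "p_plus G \<subseteq> \<qq>" and p_plus_p: "p_plus G \<subseteq> \<pp>" and q_plus_p: "q_plus G \<subseteq> \<pp>"
  using p_plus_q_plus q_plus_q qp by auto

lemma br_q: "X \<in> \<qq> \<Longrightarrow> Y \<in> \<qq> \<Longrightarrow> br X Y \<in> \<qq>"
  using parabolic_subalgebra[OF par_q] by (auto simp: lie_subalgebra_def)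

lemma br_p_plus: "X \<in> \<pp> \<Longrightarrow> Y \<in> p_plus G \<Longrightarrow> br X Y \<in> p_plus G"
  and br_q_plus: "X \<in> \<qq> \<Longrightarrow> Y \<in> q_plus G \<Longrightarrow> br X Y \<in> q_plus G"
  unfolding p_plus_perp q_plus_perp using parabolic_perp_ideal par_p par_q by auto

lemma K_p_plus: "X \<in> \<pp> \<Longrightarrow> Y \<in> p_plus G \<Longrightarrow> K X Y = 0" "X \<in> \<pp> \<Longrightarrow> Y \<in> p_plus G \<Longrightarrow> K Y X = 0"
  using K_sym[of X Y] by (auto simp: p_plus_perp perp_def)

lemma mem_p_plus_iff: "X \<in> p_plus G \<longleftrightarrow> (\<forall>Y\<in>\<pp>. K X Y = 0)" and mem_q_plus_iff: "X \<in> q_plus G \<longleftrightarrow> (\<forall>Y\<in>\<qq>. K X Y = 0)"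
  by (auto simp: p_plus_perp q_plus_perp perp_def)

lemma mem_q_iff: "X \<in> \<qq> \<longleftrightarrow> (\<forall>Y\<in>q_plus G. K X Y = 0)"
  using perp_perp[OF sub_q] by (auto simp: q_plus_perp perp_def)

lemma Q_subgroup: "subgroup Q G" and Q_Ad_q: "g \<in> Q \<Longrightarrow> Ad G g ` \<qq> = \<qq>" and Q_Ad_p: "g \<in> Q \<Longrightarrow> Ad G g ` \<pp> = \<pp>"
proof -
  have P: "subgroup (grp_P G) G" "grp_P G \<subseteq> normalizer_in G UNIV \<pp>"
    using np by (auto simp: nested_parabolics_def parabolic_subgroup_def)
  have im: "Ad G (g \<otimes> h) ` S = Ad G g ` (Ad G h ` S)" for g h S by (simp add: image_image Ad_mult)
  show Qq: "g \<in> Q \<Longrightarrow> Ad G g ` \<qq> = \<qq>" for g by (simp add: grp_Q_def normalizer_in_def)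
  show "g \<in> Q \<Longrightarrow> Ad G g ` \<pp> = \<pp>" using P(2) by (auto simp: grp_Q_def normalizer_in_def)
  show "subgroup Q G"
  proof (rule subgroupI)
    have "\<one> \<in> Q" using subgroup.one_closed[OF P(1)] by (simp add: grp_Q_def normalizer_in_def Ad_one)
    then show "Q \<noteq> {}" by auto
    fix a assume a: "a \<in> Q"
    have "Ad G (inv a) ` \<qq> = Ad G (inv a) ` (Ad G a ` \<qq>)" using Qq[OF a] by simp
    also have "\<dots> = \<qq>" by (simp add: image_image Ad_inv)
    finally show "inv a \<in> Q"
      using a subgroup.m_inv_closed[OF P(1)] by (simp add: grp_Q_def normalizer_in_def)
    fix b assume b: "b \<in> Q"
    have "Ad G (a \<otimes> b) ` \<qq> = \<qq>" by (simp only: im Qq[OF a] Qq[OF b])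
    moreover have "a \<in> grp_P G" "b \<in> grp_P G" using a b by (simp_all add: grp_Q_def normalizer_in_def)
    then have "a \<otimes> b \<in> grp_P G" by (rule subgroup.m_closed[OF P(1)])
    ultimately show "a \<otimes> b \<in> Q" by (simp only: grp_Q_def normalizer_in_def mem_Collect_eq)
  qed simp
qed

lemma Q_one: "\<one> \<in> Q" and Q_inv: "g \<in> Q \<Longrightarrow> inv g \<in> Q" and Q_mult: "g \<in> Q \<Longrightarrow> h \<in> Q \<Longrightarrow> g \<otimes> h \<in> Q"
  using subgroup.one_closed[OF Q_subgroup] subgroup.m_inv_closed[OF Q_subgroup] subgroup.m_closed[OF Q_subgroup] by auto

text \<open>Ad g is an automorphism of the bracket, so it conjugates ad X \<circ> ad Y without
  changing the trace.\<close>

lemma K_Ad: "K (Ad G g X) (Ad G g Y) = K X Y"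
proof -
  have b: "br (Ad G g X) Z = Ad G g (br X (Ad G (inv g) Z))" for X Z
    by (simp add: Ad_bracket Ad_inv)
  have "K (Ad G g X) (Ad G g Y) = tr (\<lambda>z. Ad G g ((\<lambda>z. br X (br Y (Ad G (inv g) z))) z))"
    unfolding K_alt b by (simp add: Ad_inv)
  also have "\<dots> = tr (\<lambda>z. (\<lambda>z. br X (br Y (Ad G (inv g) z))) (Ad G g z))"
    by (rule tr_comm[OF lin_Ad lin_comp[OF lin_right lin_comp[OF lin_right lin_Ad]]])
  also have "\<dots> = K X Y" by (simp add: Ad_inv K_alt)
  finally show ?thesis .
qed

lemma Ad_mem_p: "g \<in> Q \<Longrightarrow> X \<in> \<pp> \<Longrightarrow> Ad G g X \<in> \<pp>" and Ad_mem_q: "g \<in> Q \<Longrightarrow> X \<in> \<qq> \<Longrightarrow> Ad G g X \<in> \<qq>"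
  using Q_Ad_p Q_Ad_q by blast+

lemma Ad_mem_p_plus: "g \<in> Q \<Longrightarrow> X \<in> p_plus G \<Longrightarrow> Ad G g X \<in> p_plus G"
  and Ad_mem_q_plus: "g \<in> Q \<Longrightarrow> X \<in> q_plus G \<Longrightarrow> Ad G g X \<in> q_plus G"
proof -
  have e: "K (Ad G g X) Y = K X (Ad G (inv g) Y)" for Y using K_Ad[of g X "Ad G (inv g) Y"] by (simp add: Ad_inv)
  show "g \<in> Q \<Longrightarrow> X \<in> p_plus G \<Longrightarrow> Ad G g X \<in> p_plus G"
    unfolding mem_p_plus_iff e using Ad_mem_p[OF Q_inv] by blast
  show "g \<in> Q \<Longrightarrow> X \<in> q_plus G \<Longrightarrow> Ad G g X \<in> q_plus G"
    unfolding mem_q_plus_iff e using Ad_mem_q[OF Q_inv] by blast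
qed

lemma q_one_parameter:
  assumes "X \<in> \<qq>" obtains \<gamma> where "one_parameter_subgroup G X \<gamma>" "\<And>t. \<gamma> t \<in> Q"
proof -
  have "lie_algebra_of G Q = \<qq>" using np by (simp add: nested_parabolics_def)
  then obtain \<gamma> where "one_parameter_subgroup G X \<gamma>" "range \<gamma> \<subseteq> Q" using assms unfolding lie_algebra_of_def by blast
  then show thesis using that by blast
qed

text \<open>Smoothness on Q means local smooth extensions to the group. Along a curve staying in Q
  near 0 the extension agrees with R, so derivatives may be taken with the extension.\<close>

lemma smooth_on_Q_curve:
  fixes R :: "'g \<Rightarrow> 'k ^ 'w::finite"
  assumes R: "smooth_map_on_subset At vec_atlas Q R" and g: "curve_at At g" "eventually (\<lambda>t. g t \<in> Q) (nhds 0)" "g 0 \<in> Q"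
  shows "\<exists>F. smooth_near At (g 0) F \<and> eventually (\<lambda>t. F (g t) = R (g t) $ j) (nhds 0)"
proof -
  obtain U F where F: "g 0 \<in> U" "smooth_map At vec_atlas U F" "\<forall>y\<in>Q \<inter> U. F y = R y"
    using R g(3) unfolding smooth_map_on_subset_def by blast
  have "smooth_near At (g 0) (\<lambda>x. F x $ j)" by (rule smooth_nearI[OF smooth_map_vecD[OF A F(2)] F(1)])
  moreover have "eventually (\<lambda>t. g t \<in> U) (nhds 0)"
    using g(1) F by (intro isCont_eventually) (auto simp: curve_at_def smooth_map_def)
  then have "eventually (\<lambda>t. F (g t) $ j = R (g t) $ j) (nhds 0)"
    using g(2) by eventually_elim (use F(3) in auto)
  ultimately show ?thesis by (intro exI[of _ "\<lambda>x. F x $ j"] conjI)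
qed

end

locale rel_rep = nested_par G
  for G :: "('g::topological_space, 'k::real_or_complex, 'n::finite, 'z) nested_parabolics_scheme" (structure) +
  fixes \<rho> :: "'g \<Rightarrow> 'k ^ ('w::finite) \<Rightarrow> 'k ^ 'w"
  assumes rep: "relative_representation G \<rho>"
begin

abbreviation "d\<rho> \<equiv> inf_rep G \<rho>"

lemma rho_lin: "g \<in> Q \<Longrightarrow> lin (\<rho> g)" and rho_one: "\<rho> \<one> w = w"
  and rho_mult: "g \<in> Q \<Longrightarrow> h \<in> Q \<Longrightarrow> \<rho> (g \<otimes> h) w = \<rho> g (\<rho> h w)"
  and rho_smooth: "smooth_map_on_subset At vec_atlas Q (\<lambda>g. \<rho> g w)"
  and rho_p_plus: "h \<in> exp_image G (p_plus G) \<Longrightarrow> \<rho> h = id"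
  using rep by (auto simp: relative_representation_def Q_representation_def)

lemma rho_inv: "g \<in> Q \<Longrightarrow> \<rho> g (\<rho> (inv g) w) = w" "g \<in> Q \<Longrightarrow> \<rho> (inv g) (\<rho> g w) = w"
  by (simp_all add: rho_mult[symmetric] Q_inv rho_one)

lemma rho_curve_differentiable:
  assumes g: "curve_at At g" "eventually (\<lambda>t. g t \<in> Q) (nhds 0)" "g 0 \<in> Q"
  shows "(\<lambda>t. \<rho> (g t) w $ j) field_differentiable (at 0)"
proof -
  obtain F where F: "smooth_near At (g 0) F" "eventually (\<lambda>t. F (g t) = \<rho> (g t) w $ j) (nhds 0)"
    using smooth_on_Q_curve[OF rho_smooth g] by blast
  from DERIV_eventually_eq[OF velocity_deriv[OF g(1) F(1)] F(2)]
  show ?thesis unfolding field_differentiable_def by blast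
qed

text \<open>One extension serves all curves in Q through the identity. Hence the derivative of
  \<rho> along such a curve depends on the velocity alone.\<close>

lemma inf_rep_extension: "\<exists>F. (\<forall>j. smooth_near At \<one> (F j)) \<and>
  (\<forall>g. curve_at At g \<longrightarrow> eventually (\<lambda>t. g t \<in> Q) (nhds 0) \<longrightarrow> g 0 = \<one> \<longrightarrow>
    (\<forall>j. ((\<lambda>t. \<rho> (g t) w $ j) has_field_derivative velocity At g (F j)) (at 0)))"
proof -
  obtain U F where F: "\<one> \<in> U" "smooth_map At vec_atlas U F" "\<forall>y\<in>Q \<inter> U. F y = \<rho> y w"
    using rho_smooth[of w] Q_one unfolding smooth_map_on_subset_def by blast
  have s: "smooth_near At \<one> (\<lambda>x. F x $ j)" for j by (rule smooth_nearI[OF smooth_map_vecD[OF A F(2)] F(1)])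
  have "((\<lambda>t. \<rho> (g t) w $ j) has_field_derivative velocity At g (\<lambda>x. F x $ j)) (at 0)"
    if g: "curve_at At g" "eventually (\<lambda>t. g t \<in> Q) (nhds 0)" "g 0 = \<one>" for g j
  proof -
    have "eventually (\<lambda>t. g t \<in> U) (nhds 0)"
      using g F by (intro isCont_eventually) (auto simp: curve_at_def smooth_map_def)
    then have ev: "eventually (\<lambda>t. F (g t) $ j = \<rho> (g t) w $ j) (nhds 0)"
      using g(2) by eventually_elim (use F(3) in auto)
    show ?thesis
      by (rule DERIV_eventually_eq[OF velocity_deriv[OF g(1)] ev]) (use s g(3) in simp)
  qed
  then show ?thesis using s by (intro exI[of _ "\<lambda>j x. F x $ j"] conjI allI impI)
qed

text \<open>Justifies the definite description in \<open>inf_rep\<close>: existence of a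
  one-parameter subgroup uses that q is the Lie algebra of Q, uniqueness uses
  \<open>inf_rep_extension\<close>. The formula with \<open>T X\<close> also exhibits linearity in
  X, which the definition hides.\<close>

lemma inf_rep_formula: "\<exists>F. (\<forall>j. smooth_near At \<one> (F j)) \<and> (\<forall>X\<in>\<qq>. \<forall>j. d\<rho> X w $ j = T X (F j)) \<and>
  (\<forall>X\<in>\<qq>. \<forall>g. curve_at At g \<longrightarrow> eventually (\<lambda>t. g t \<in> Q) (nhds 0) \<longrightarrow> g 0 = \<one> \<longrightarrow> velocity At g = T X \<longrightarrow>
    (\<forall>j. ((\<lambda>t. \<rho> (g t) w $ j) has_field_derivative d\<rho> X w $ j) (at 0)))"
proof -
  obtain F where F: "\<forall>j. smooth_near At \<one> (F j)" "\<forall>g. curve_at At g \<longrightarrow> eventually (\<lambda>t. g t \<in> Q) (nhds 0) \<longrightarrow> g 0 = \<one> \<longrightarrow>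
    (\<forall>j. ((\<lambda>t. \<rho> (g t) w $ j) has_field_derivative velocity At g (F j)) (at 0))"
    using inf_rep_extension[of w] by (elim exE conjE)
  have der: "((\<lambda>t. \<rho> (\<gamma> t) w $ j) has_field_derivative T X (F j)) (at 0)"
    if \<gamma>: "one_parameter_subgroup G X \<gamma>" "\<And>t. \<gamma> t \<in> Q" for X \<gamma> j
    using F(2)[rule_format, OF one_parameter_subgroupD(4)[OF \<gamma>(1)] _ one_parameter_subgroupD(1)[OF \<gamma>(1)], of j] \<gamma>(2)
      one_parameter_subgroupD(5)[OF \<gamma>(1)] by simp
  have eq: "d\<rho> X w = (\<chi> j. T X (F j))" if X: "X \<in> \<qq>" for X
  proof -
    obtain \<gamma> where \<gamma>: "one_parameter_subgroup G X \<gamma>" "\<And>t. \<gamma> t \<in> Q" using q_one_parameter[OF X] by blast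
    show ?thesis
      unfolding inf_rep_def
    proof (rule the_equality)
      show "\<exists>\<gamma>. one_parameter_subgroup G X \<gamma> \<and> range \<gamma> \<subseteq> Q \<and>
        (\<forall>j. ((\<lambda>t. \<rho> (\<gamma> t) w $ j) has_field_derivative (\<chi> j. T X (F j)) $ j) (at 0))"
        using \<gamma> der[OF \<gamma>] by (intro exI[of _ \<gamma>] conjI allI) auto
      fix y assume "\<exists>\<gamma>. one_parameter_subgroup G X \<gamma> \<and> range \<gamma> \<subseteq> Q \<and>
        (\<forall>j. ((\<lambda>t. \<rho> (\<gamma> t) w $ j) has_field_derivative y $ j) (at 0))"
      then obtain \<gamma>' where \<gamma>': "one_parameter_subgroup G X \<gamma>'" "range \<gamma>' \<subseteq> Q"
        "\<forall>j. ((\<lambda>t. \<rho> (\<gamma>' t) w $ j) has_field_derivative y $ j) (at 0)" by (elim exE conjE)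
      have "\<gamma>' t \<in> Q" for t using \<gamma>'(2) by blast
      from der[OF \<gamma>'(1) this] have "y $ j = T X (F j)" for j using \<gamma>'(3) DERIV_unique by blast
      then show "y = (\<chi> j. T X (F j))" by (simp add: vec_eq_iff)
    qed
  qed
  show ?thesis
  proof (intro exI[of _ F] conjI ballI allI impI)
    show "smooth_near At \<one> (F j)" for j using F(1) ..
    show "d\<rho> X w $ j = T X (F j)" if "X \<in> \<qq>" for X j using eq[OF that] by simp
    fix X g j assume X: "X \<in> \<qq>" and g: "curve_at At g" "eventually (\<lambda>t. g t \<in> Q) (nhds 0)" "g 0 = \<one>" "velocity At g = T X"
    show "((\<lambda>t. \<rho> (g t) w $ j) has_field_derivative d\<rho> X w $ j) (at 0)"
      using F(2)[rule_format, OF g(1,2,3), of j] g(4) eq[OF X] by simp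
  qed
qed

lemma inf_rep_curve:
  assumes "X \<in> \<qq>" "curve_at At g" "\<And>t. g t \<in> Q" "g 0 = \<one>" "velocity At g = T X"
  shows "((\<lambda>t. \<rho> (g t) w $ j) has_field_derivative d\<rho> X w $ j) (at 0)"
proof -
  have "eventually (\<lambda>t. g t \<in> Q) (nhds 0)" using assms(3) by simp
  moreover obtain F where "\<forall>X\<in>\<qq>. \<forall>j. d\<rho> X w $ j = T X (F j)"
    and F: "\<forall>X\<in>\<qq>. \<forall>g. curve_at At g \<longrightarrow> eventually (\<lambda>t. g t \<in> Q) (nhds 0) \<longrightarrow> g 0 = \<one> \<longrightarrow> velocity At g = T X \<longrightarrow>
      (\<forall>j. ((\<lambda>t. \<rho> (g t) w $ j) has_field_derivative d\<rho> X w $ j) (at 0))"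
    using inf_rep_formula[of w] by (elim exE conjE)
  ultimately show ?thesis using assms by (intro F[rule_format])
qed

lemma inf_rep_deriv:
  assumes "X \<in> \<qq>" "one_parameter_subgroup G X \<gamma>" "\<And>t. \<gamma> t \<in> Q"
  shows "((\<lambda>t. \<rho> (\<gamma> t) w $ j) has_field_derivative d\<rho> X w $ j) (at 0)"
  by (rule inf_rep_curve) (use assms one_parameter_subgroupD[OF assms(2)] in auto)

lemma inf_rep_unique:
  assumes "X \<in> \<qq>" "one_parameter_subgroup G X \<gamma>" "\<And>t. \<gamma> t \<in> Q"
    "\<And>j. ((\<lambda>t. \<rho> (\<gamma> t) w $ j) has_field_derivative y $ j) (at 0)"
  shows "d\<rho> X w = y"
  using DERIV_unique[OF inf_rep_deriv[OF assms(1,2,3)] assms(4)] by (simp add: vec_eq_iff)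

lemma inf_rep_add: "X \<in> \<qq> \<Longrightarrow> Y \<in> \<qq> \<Longrightarrow> d\<rho> (X + Y) w = d\<rho> X w + d\<rho> Y w"
  and inf_rep_scale: "X \<in> \<qq> \<Longrightarrow> d\<rho> (c *s X) w = c *s d\<rho> X w"
proof -
  obtain F where "\<forall>X\<in>\<qq>. \<forall>j. d\<rho> X w $ j = T X (F j)" using inf_rep_formula[of w] by (elim exE conjE)
  then have F: "d\<rho> X w $ j = T X (F j)" if "X \<in> \<qq>" for X j using that by blast
  show "X \<in> \<qq> \<Longrightarrow> Y \<in> \<qq> \<Longrightarrow> d\<rho> (X + Y) w = d\<rho> X w + d\<rho> Y w"
    using sub_q by (simp add: vec_eq_iff F T_add vec.subspace_add)
  show "X \<in> \<qq> \<Longrightarrow> d\<rho> (c *s X) w = c *s d\<rho> X w"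
    using sub_q by (simp add: vec_eq_iff F T_scale vec.subspace_scale)
qed

lemma inf_rep_lin: assumes X: "X \<in> \<qq>" shows "lin (d\<rho> X)"
proof -
  obtain \<gamma> where \<gamma>: "one_parameter_subgroup G X \<gamma>" "\<And>t. \<gamma> t \<in> Q" using q_one_parameter[OF X] by blast
  note d = inf_rep_deriv[OF X \<gamma>] and l = rho_lin[OF \<gamma>(2)]
  show ?thesis
  proof (rule linI)
    show "d\<rho> X (v + w) = d\<rho> X v + d\<rho> X w" for v w
      by (rule inf_rep_unique[OF X \<gamma>]) (simp add: lin_add[OF l] DERIV_add[OF d d])
    show "d\<rho> X (c *s v) = c *s d\<rho> X v" for c v
      by (rule inf_rep_unique[OF X \<gamma>]) (simp add: lin_scale[OF l] DERIV_cmult[OF d])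
  qed
qed

text \<open>Every value of the one-parameter subgroup of X is the exponential of a multiple of X, so
  \<rho> is the identity along it.\<close>

lemma inf_rep_p_plus: assumes X: "X \<in> p_plus G" shows "d\<rho> X w = 0"
proof -
  have Xq: "X \<in> \<qq>" using X p_plus_q by auto
  obtain \<gamma> where \<gamma>: "one_parameter_subgroup G X \<gamma>" "\<And>t. \<gamma> t \<in> Q" using q_one_parameter[OF Xq] by blast
  have "\<gamma> t \<in> exp_image G (p_plus G)" for t
    unfolding exp_image_def using one_parameter_subgroup_scale[OF \<gamma>(1), of t] X sub_p_plus
    by (intro CollectI exI[of _ "\<lambda>s. \<gamma> (t * s)"] exI[of _ "t *s X"]) (auto intro: vec.subspace_scale)
  then have "\<rho> (\<gamma> t) w = w" for t using rho_p_plus by simp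
  then show ?thesis by (intro inf_rep_unique[OF Xq \<gamma>]) simp
qed

lemma inf_rep_cong: assumes "X \<in> \<qq>" "Y \<in> \<qq>" "X - Y \<in> p_plus G" shows "d\<rho> X w = d\<rho> Y w"
proof -
  have "X = Y + (X - Y)" by simp
  then have "d\<rho> X w = d\<rho> Y w + d\<rho> (X - Y) w" using inf_rep_add[OF assms(2), of "X - Y"] assms(3) p_plus_q by auto
  then show ?thesis using inf_rep_p_plus[OF assms(3)] by simp
qed

text \<open>With \<gamma> generating X, both sides are the derivative at 0 of the curve \<rho> g
  (\<rho> (\<gamma> t) w). The conjugated curve enters only through its velocity.\<close>

lemma inf_rep_Ad: assumes X: "X \<in> \<qq>" and g: "g \<in> Q" shows "d\<rho> (Ad G g X) (\<rho> g w) = \<rho> g (d\<rho> X w)"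
proof -
  obtain \<gamma> where \<gamma>: "one_parameter_subgroup G X \<gamma>" "\<And>t. \<gamma> t \<in> Q" using q_one_parameter[OF X] by blast
  have AX: "Ad G g X \<in> \<qq>" using Ad_mem_q[OF g X] .
  let ?c = "\<lambda>t. cj g (\<gamma> t)"
  have cu: "curve_at At ?c" by (rule smooth_map_curve[OF cj_smooth one_parameter_subgroupD(4)[OF \<gamma>(1)] UNIV_I])
  have c0: "?c 0 = \<one>" using one_parameter_subgroupD(1)[OF \<gamma>(1)] by simp
  have cQ: "?c t \<in> Q" for t using g \<gamma>(2) by (simp add: cj_def Q_mult Q_inv)
  have vel: "velocity At ?c = T (Ad G g X)"
  proof (rule tangent_eqI[OF A _ T_tangent])
    show "velocity At ?c \<in> tangent_space At \<one>" using velocity_tangent[OF A cu] c0 by simp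
    fix f assume f: "smooth_near At \<one> f"
    have f': "smooth_near At (\<gamma> 0) (\<lambda>h. f (cj g h))" using cj_near[of g \<one> f] f one_parameter_subgroupD(1)[OF \<gamma>(1)] by simp
    have "velocity At ?c f = velocity At \<gamma> (\<lambda>h. f (cj g h))"
      unfolding velocity_def using f f' c0 by simp
    then show "velocity At ?c f = T (Ad G g X) f" using one_parameter_subgroupD(5)[OF \<gamma>(1)] Ad_apply[OF f] by simp
  qed
  have "\<rho> (?c t) (\<rho> g w) = \<rho> g (\<rho> (\<gamma> t) w)" for t
    using g \<gamma>(2) by (simp add: cj_def rho_mult Q_mult Q_inv rho_inv)
  then have d: "((\<lambda>t. \<rho> g (\<rho> (\<gamma> t) w) $ j) has_field_derivative d\<rho> (Ad G g X) (\<rho> g w) $ j) (at 0)" for j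
    using inf_rep_curve[OF AX cu cQ c0 vel, of "\<rho> g w" j] by simp
  have "((\<lambda>t. \<rho> g (\<rho> (\<gamma> t) w) $ j) has_field_derivative \<rho> g (d\<rho> X w) $ j) (at 0)" for j
    by (rule lin_deriv[OF rho_lin[OF g] inf_rep_deriv[OF X \<gamma>]])
  then show ?thesis using DERIV_unique[OF d] by (simp add: vec_eq_iff)
qed

text \<open>\<open>complexify\<close> asks for a bilinear map on all of g. Precomposition with a
  linear projection onto q provides one.\<close>

lemma inf_rep_extend: "\<exists>\<tau>. bilin \<tau> \<and> (\<forall>X\<in>\<qq>. \<tau> X = d\<rho> X)"
proof -
  obtain P where P: "lin P" "\<And>x. P x \<in> \<qq>" "\<And>x. x \<in> \<qq> \<Longrightarrow> P x = x" using projection_exists[OF sub_q] by blast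
  have "bilin (\<lambda>X. d\<rho> (P X))"
    unfolding bilin_def using inf_rep_lin[OF P(2)]
    by (auto intro!: linI simp: lin_add[OF P(1)] lin_scale[OF P(1)] inf_rep_add[OF P(2) P(2)] inf_rep_scale[OF P(2)])
  then show ?thesis using P(3) by (intro exI[of _ "\<lambda>X. d\<rho> (P X)"]) simp
qed

text \<open>The equation \<rho> (\<gamma> t) (d\<rho> Y w) = d\<rho> (Ad (\<gamma> t) Y) (\<rho>
  (\<gamma> t) w) is differentiated at t = 0, with br X Y as the derivative of Ad (\<gamma> t)
  Y.\<close>

lemma inf_rep_bracket:
  assumes X: "X \<in> \<qq>" and Y: "Y \<in> \<qq>"
  shows "d\<rho> (br X Y) w = d\<rho> X (d\<rho> Y w) - d\<rho> Y (d\<rho> X w)"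
proof -
  obtain \<gamma> where \<gamma>: "one_parameter_subgroup G X \<gamma>" "\<And>t. \<gamma> t \<in> Q" using q_one_parameter[OF X] by blast
  obtain \<tau> where \<tau>: "bilin \<tau>" "\<And>X. X \<in> \<qq> \<Longrightarrow> \<tau> X = d\<rho> X" using inf_rep_extend by blast
  have "((\<lambda>t. \<tau> (Ad G (\<gamma> t) Y) (\<rho> (\<gamma> t) w) $ j) has_field_derivative
    (\<tau> (br X Y) (\<rho> (\<gamma> 0) w) + \<tau> (Ad G (\<gamma> 0) Y) (d\<rho> X w)) $ j) (at 0)" for j
    by (rule bilin_deriv[OF \<tau>(1) Ad_deriv[OF \<gamma>(1)] inf_rep_deriv[OF X \<gamma>]])
  moreover have "\<tau> (Ad G (\<gamma> t) Y) (\<rho> (\<gamma> t) w) = \<rho> (\<gamma> t) (d\<rho> Y w)" for t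
    using inf_rep_Ad[OF Y \<gamma>(2)] \<tau>(2)[OF Ad_mem_q[OF \<gamma>(2) Y]] by simp
  ultimately have "d\<rho> X (d\<rho> Y w) = \<tau> (br X Y) (\<rho> (\<gamma> 0) w) + \<tau> (Ad G (\<gamma> 0) Y) (d\<rho> X w)"
    by (intro inf_rep_unique[OF X \<gamma>]) simp
  then show ?thesis
    using one_parameter_subgroupD(1)[OF \<gamma>(1)] \<tau>(2)[OF br_q[OF X Y]] \<tau>(2)[OF Y] by (simp add: rho_one Ad_one)
qed

text \<open>A functional vanishing on S is zero along the curve \<rho> (\<gamma> t) v and hence on
  its derivative. Separation by functionals takes the place of closedness of S.\<close>

lemma inf_rep_mem:
  assumes S: "vec.subspace S" "\<And>g v. g \<in> Q \<Longrightarrow> v \<in> S \<Longrightarrow> \<rho> g v \<in> S" and X: "X \<in> \<qq>" and v: "v \<in> S"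
  shows "d\<rho> X v \<in> S"
proof (rule ccontr)
  obtain \<gamma> where \<gamma>: "one_parameter_subgroup G X \<gamma>" "\<And>t. \<gamma> t \<in> Q" using q_one_parameter[OF X] by blast
  assume "d\<rho> X v \<notin> S"
  then obtain a where a: "\<forall>s\<in>S. (\<Sum>i\<in>UNIV. a i * s $ i) = 0" "(\<Sum>i\<in>UNIV. a i * d\<rho> X v $ i) \<noteq> 0"
    using functional_separation[OF S(1)] by blast
  have "((\<lambda>t. \<Sum>i\<in>UNIV. a i * \<rho> (\<gamma> t) v $ i) has_field_derivative (\<Sum>i\<in>UNIV. a i * d\<rho> X v $ i)) (at 0)"
    by (intro DERIV_sum DERIV_cmult inf_rep_deriv[OF X \<gamma>])
  moreover have "(\<lambda>t. \<Sum>i\<in>UNIV. a i * \<rho> (\<gamma> t) v $ i) = (\<lambda>t. 0)" using a(1) S(2)[OF \<gamma>(2) v] by auto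
  ultimately have "((\<lambda>t. 0) has_field_derivative (\<Sum>i\<in>UNIV. a i * d\<rho> X v $ i)) (at (0::'k))" by (simp only:)
  then show False using a(2) DERIV_unique[OF _ DERIV_const] by blast
qed

text \<open>The vectors killed by \<open>q_plus\<close> form an invariant subspace \<open>S\<close>. On an invariant complement \<open>q_plus\<close> acts
  nilpotently, so a nonzero complement would meet \<open>S\<close>.\<close>

lemma completely_reducible_q_plus:
  assumes cr: "completely_reducible G \<rho>" and z: "z \<in> q_plus G"
  shows "d\<rho> z w = 0"
proof -
  define S where "S = {w. \<forall>z\<in>q_plus G. d\<rho> z w = 0}"
  have zq: "z \<in> \<qq>" if "z \<in> q_plus G" for z using that q_plus_q by auto
  have sS: "vec.subspace S"
    by (rule vec.subspaceI) (auto simp: S_def lin_0[OF inf_rep_lin[OF zq]] lin_add[OF inf_rep_lin[OF zq]] lin_scale[OF inf_rep_lin[OF zq]])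
  have iS: "\<rho> g w \<in> S" if g: "g \<in> Q" and w: "w \<in> S" for g w
    unfolding S_def
  proof clarify
    fix z assume z: "z \<in> q_plus G"
    have z': "Ad G (inv g) z \<in> q_plus G" by (rule Ad_mem_q_plus[OF Q_inv[OF g] z])
    have "d\<rho> z (\<rho> g w) = \<rho> g (d\<rho> (Ad G (inv g) z) w)"
      using inf_rep_Ad[OF zq[OF z'] g, of w] by (simp add: Ad_inv)
    also have "\<dots> = 0" using w z' lin_0[OF rho_lin[OF g]] by (simp add: S_def)
    finally show "d\<rho> z (\<rho> g w) = 0" .
  qed
  have "vec.subspace S \<and> (\<forall>g\<in>Q. \<rho> g ` S \<subseteq> S)" using sS iS by auto
  from cr[unfolded completely_reducible_def Let_def, THEN spec, THEN mp, OF this]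
  obtain R where R: "vec.subspace R" "\<forall>g\<in>Q. \<rho> g ` R \<subseteq> R" "S \<inter> R = {0}" "{x + y | x y. x \<in> S \<and> y \<in> R} = UNIV"
    by (elim exE conjE)
  have Rm: "d\<rho> X v \<in> R" if "X \<in> \<qq>" "v \<in> R" for X v
    by (rule inf_rep_mem[OF R(1) _ that]) (use R(2) in blast)
  obtain \<tau> where \<tau>: "bilin \<tau>" "\<And>X. X \<in> \<qq> \<Longrightarrow> \<tau> X = d\<rho> X" using inf_rep_extend by blast
  have "rep_on br \<qq> \<tau>"
    unfolding rep_on_def using sub_q
    by (simp add: \<tau>(2) inf_rep_lin inf_rep_add inf_rep_scale inf_rep_bracket br_q vec.subspace_add vec.subspace_scale)
  from parabolic_perp_nilpotent_rep[OF par_q \<tau>(1) this]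
  obtain k where k: "(act_span \<tau> (q_plus G) ^^ k) UNIV = {0}" unfolding q_plus_perp by auto
  let ?R = "\<lambda>i. (act_span \<tau> (q_plus G) ^^ i) R"
  have RR: "?R i \<subseteq> R" for i
  proof (induction i)
    case (Suc i)
    have "act_span \<tau> (q_plus G) (?R i) \<subseteq> R"
      by (rule act_span_least[OF R(1)]) (use Suc Rm zq \<tau>(2) in auto)
    then show ?case by simp
  qed simp
  \<comment> \<open>Descent through the series of R: if the next member is {0}, then q_plus kills
    the current one, which therefore lies in S \<inter> R.\<close>
  have "?R i = {0} \<Longrightarrow> R = {0}" for i
  proof (induction i)
    case (Suc i)
    have "?R i \<subseteq> S"
    proof
      fix u assume u: "u \<in> ?R i"
      show "u \<in> S"
        unfolding S_def
      proof clarify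
        fix z assume z: "z \<in> q_plus G"
        have "\<tau> z u \<in> act_span \<tau> (q_plus G) (?R i)" by (rule act_spanI[OF z u])
        then show "d\<rho> z u = 0" using Suc.prems \<tau>(2)[OF zq[OF z]] by simp
      qed
    qed
    then have "?R i \<subseteq> {0}" using RR[of i] R(3) by blast
    moreover have "0 \<in> ?R i" by (rule zero_mem_act_span_pow) (use R(1) vec.subspace_0 in blast)
    ultimately show ?case using Suc.IH by blast
  qed simp
  moreover have "?R k \<subseteq> {0}"
    using act_span_pow_mono[OF order_refl, where A=R and A'=UNIV and \<tau>=\<tau> and a="q_plus G" and k=k] k by simp
  moreover have "0 \<in> ?R k" by (rule zero_mem_act_span_pow) (use R(1) vec.subspace_0 in blast)
  ultimately have "R = {0}" by blast
  have "w \<in> {x + y | x y. x \<in> S \<and> y \<in> R}" unfolding R(4) by simp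
  then obtain x y where "x \<in> S" "y \<in> R" "w = x + y" by blast
  then have "w \<in> S" using \<open>R = {0}\<close> by simp
  then show ?thesis using z by (simp add: S_def)
qed

end

section \<open>Derivatives along the constant vector fields of a Cartan connection\<close>

section \<open>Derivatives along a Cartan connection\<close>

lemma curve_at_cong:
  assumes A: "manifold A" and c: "curve_at A c" and ev: "eventually (\<lambda>t. c t = d t) (nhds 0)"
  shows "curve_at A d"
  unfolding curve_at_def
proof (intro conjI allI impI)
  have d0: "d 0 = c 0" using eventually_nhds_x_imp_x[OF ev] by simp
  have "isCont c 0" using c by (simp add: curve_at_def)
  then show "isCont d 0" using isCont_cong[OF ev] by simp
  fix f assume "smooth_near A (d 0) f"
  then have "((\<lambda>t. f (c t)) has_field_derivative velocity A c f) (at 0)"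
    using velocity_deriv[OF c, of f] d0 by simp
  moreover have "eventually (\<lambda>t. f (c t) = f (d t)) (nhds 0)" using ev by eventually_elim simp
  ultimately have "((\<lambda>t. f (d t)) has_field_derivative velocity A c f) (at 0)" by (rule DERIV_eventually_eq)
  then show "(\<lambda>t. f (d t)) field_differentiable (at 0)" unfolding field_differentiable_def by blast
qed

locale cartan_geo = rel_rep G \<rho>
  for G :: "('g::topological_space, 'k::real_or_complex, 'n::finite, 'z) nested_parabolics_scheme" (structure)
    and \<rho> :: "'g \<Rightarrow> 'k ^ ('w::finite) \<Rightarrow> 'k ^ 'w" +
  fixes M :: "('e::topological_space, 'm::topological_space, 'g, 'k, 'n, 'b::finite, 'y) cartan_geometry_scheme"
  assumes pg: "parabolic_geometry G M"
begin

abbreviation "Et \<equiv> tot_atlas M"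
abbreviation "Bt \<equiv> base_atlas M"
abbreviation "act' \<equiv> act M"
abbreviation "\<pi> \<equiv> proj M"

lemma E: "manifold Et" and B: "manifold Bt" and proj_smooth: "smooth_map Et Bt UNIV \<pi>"
  and act_one: "act' u \<one> = u"
  and act_smooth: "smooth_map_on_subset (prod_atlas Et At) Et (UNIV \<times> Q) (\<lambda>(u, g). act' u g)"
  and proj_act: "g \<in> Q \<Longrightarrow> \<pi> (act' u g) = \<pi> u"
  using pg by (auto simp: parabolic_geometry_def principal_bundle_def)

lemma trivialization:
  "\<exists>U \<Phi> \<Psi>. open U \<and> x \<in> U \<and> smooth_map Et At (\<pi> -` U) \<Phi> \<and>
     (\<forall>u. \<pi> u \<in> U \<longrightarrow> \<Phi> u \<in> Q) \<and> (\<forall>u. \<pi> u \<in> U \<longrightarrow> \<Psi> (\<pi> u, \<Phi> u) = u) \<and>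
     (\<forall>u g. \<pi> u \<in> U \<longrightarrow> g \<in> Q \<longrightarrow> \<Phi> (act' u g) = \<Phi> u \<otimes> g)"
proof -
  have "\<exists>U \<Phi> \<Psi>. open U \<and> x \<in> U \<and>
        smooth_map Et At (\<pi> -` U) \<Phi> \<and>
        smooth_map_on_subset (prod_atlas Bt At) Et (U \<times> Q) \<Psi> \<and>
        (\<forall>u\<in>\<pi> -` U. \<Phi> u \<in> Q \<and> \<Psi> (\<pi> u, \<Phi> u) = u) \<and>
        (\<forall>y\<in>U. \<forall>g\<in>Q. \<pi> (\<Psi> (y, g)) = y \<and> \<Phi> (\<Psi> (y, g)) = g) \<and>
        (\<forall>u\<in>\<pi> -` U. \<forall>g\<in>Q. \<Phi> (act' u g) = \<Phi> u \<otimes> g)"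
    by (rule pg[unfolded parabolic_geometry_def principal_bundle_def, THEN conjunct1, THEN conjunct2, THEN conjunct2,
        THEN conjunct2, THEN conjunct2, THEN conjunct2, THEN conjunct2, THEN conjunct2, THEN spec])
  then obtain U \<Phi> \<Psi> where *: "open U" "x \<in> U" "smooth_map Et At (\<pi> -` U) \<Phi>"
        "\<forall>u\<in>\<pi> -` U. \<Phi> u \<in> Q \<and> \<Psi> (\<pi> u, \<Phi> u) = u"
        "\<forall>u\<in>\<pi> -` U. \<forall>g\<in>Q. \<Phi> (act' u g) = \<Phi> u \<otimes> g"
    by (elim exE conjE)
  show ?thesis by (rule exI[of _ U], rule exI[of _ \<Phi>], rule exI[of _ \<Psi>]) (use * in auto)
qed

lemmas connection = pg[unfolded parabolic_geometry_def cartan_connection_def, THEN conjunct2]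

lemma conn_bij: "bij_betw (conn M u) (tangent_space Et u) UNIV"
  using connection[THEN conjunct1] by (rule spec)

lemma conn_add: "v \<in> tangent_space Et u \<Longrightarrow> w \<in> tangent_space Et u \<Longrightarrow> conn M u (\<lambda>f. v f + w f) = conn M u v + conn M u w"
  by (rule connection[THEN conjunct2, THEN conjunct1, rule_format])

lemma conn_scale: "v \<in> tangent_space Et u \<Longrightarrow> conn M u (\<lambda>f. c * v f) = c *s conn M u v"
  by (rule connection[THEN conjunct2, THEN conjunct2, THEN conjunct1, rule_format])

lemma conn_smooth: "smooth_vector_field Et U \<xi> \<Longrightarrow> smooth_map Et vec_atlas U (\<lambda>u. conn M u (\<xi> u))"
  by (rule connection[THEN conjunct2, THEN conjunct2, THEN conjunct2, THEN conjunct1, rule_format])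

lemma conn_equivariant: "g \<in> Q \<Longrightarrow> v \<in> tangent_space Et u \<Longrightarrow>
    conn M (act' u g) (pushforward Et (\<lambda>u'. act' u' g) u v) = Ad G (inv g) (conn M u v)"
  by (rule connection[THEN conjunct2, THEN conjunct2, THEN conjunct2, THEN conjunct2, THEN conjunct1, rule_format])

lemma conn_vertical: "X \<in> \<qq> \<Longrightarrow> one_parameter_subgroup G X \<gamma> \<Longrightarrow> range \<gamma> \<subseteq> Q \<Longrightarrow>
    conn M u (velocity Et (\<lambda>t. act' u (\<gamma> t))) = X"
  by (rule connection[THEN conjunct2, THEN conjunct2, THEN conjunct2, THEN conjunct2, THEN conjunct2, rule_format]) auto

text \<open>The value at u of the constant vector field generated by X, that is, of the inverse of
  the connection.\<close>

definition W :: "'e \<Rightarrow> 'k ^ 'n \<Rightarrow> ('e \<Rightarrow> 'k) \<Rightarrow> 'k" where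
  "W u X = inv_into (tangent_space Et u) (conn M u) X"

lemma W_tangent: "W u X \<in> tangent_space Et u" and conn_W: "conn M u (W u X) = X"
proof -
  have "X \<in> conn M u ` tangent_space Et u" using conn_bij[of u] by (simp add: bij_betw_def)
  then show "W u X \<in> tangent_space Et u" "conn M u (W u X) = X"
    unfolding W_def by (rule inv_into_into, rule f_inv_into_f)
qed

lemma W_eqI: "v \<in> tangent_space Et u \<Longrightarrow> conn M u v = X \<Longrightarrow> W u X = v"
  using conn_bij[of u] W_tangent[of u X] conn_W[of u X] by (auto simp: bij_betw_def inj_on_def)

lemma W_add: "W u (X + Y) f = W u X f + W u Y f"
proof -
  have "W u (X + Y) = (\<lambda>f. W u X f + W u Y f)"
    by (intro W_eqI tangent_space_add[OF E] W_tangent) (simp only: conn_add[OF W_tangent W_tangent] conn_W)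
  then show ?thesis by simp
qed

lemma W_scale: "W u (c *s X) f = c * W u X f"
proof -
  have "W u (c *s X) = (\<lambda>f. c * W u X f)"
    by (intro W_eqI tangent_space_scale[OF E W_tangent W_tangent]) (simp only: conn_scale[OF W_tangent] conn_W)
  then show ?thesis by simp
qed

text \<open>The derivative with a fixed direction X. Its iterates express
  \<open>D_rho_D_rho\<close>, where the arguments are held fixed as well; in return,
  \<open>D X \<sigma>\<close> is equivariant only up to moving X by Ad.\<close>

definition D :: "'k ^ 'n \<Rightarrow> ('e \<Rightarrow> 'k ^ 'v::finite) \<Rightarrow> 'e \<Rightarrow> 'k ^ 'v" where
  "D X \<sigma> u = (\<chi> j. W u X (\<lambda>u'. \<sigma> u' $ j))"

lemma D_nth: "D X \<sigma> u $ j = W u X (\<lambda>u'. \<sigma> u' $ j)" by (simp add: D_def)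

definition smooth_at :: "'e \<Rightarrow> ('e \<Rightarrow> 'k ^ 'v::finite) \<Rightarrow> bool" where
  "smooth_at u \<sigma> \<longleftrightarrow> (\<forall>j. smooth_near Et u (\<lambda>u'. \<sigma> u' $ j))"

lemma D_add_left: "D (X + Y) \<sigma> u = D X \<sigma> u + D Y \<sigma> u" and D_scale_left: "D (c *s X) \<sigma> u = c *s D X \<sigma> u"
  by (simp_all add: vec_eq_iff D_nth W_add W_scale)

lemma lin_D: "lin (\<lambda>X. D X \<sigma> u)" by (rule linI) (simp_all add: D_add_left D_scale_left)

lemma smooth_at_lin: assumes f: "lin f" and s: "smooth_at u \<sigma>" shows "smooth_at u (\<lambda>u'. f (\<sigma> u'))"
  unfolding smooth_at_def
proof
  fix j
  have e: "(\<lambda>u'. f (\<sigma> u') $ j) = (\<lambda>u'. \<Sum>i\<in>UNIV. \<sigma> u' $ i * f (axis i 1) $ j)"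
    by (rule ext) (rule linear_componentwise[OF f])
  have s': "smooth_near Et u (\<lambda>u'. \<sigma> u' $ i)" for i using s by (simp add: smooth_at_def)
  show "smooth_near Et u (\<lambda>u'. f (\<sigma> u') $ j)"
    unfolding e by (intro smooth_near_sum[OF E] smooth_near_mult[OF E s'] smooth_near_const[OF E])
qed

lemma D_lin:
  assumes f: "lin f" and s: "smooth_at u \<sigma>" shows "D X (\<lambda>u'. f (\<sigma> u')) u = f (D X \<sigma> u)"
proof -
  have s': "smooth_near Et u (\<lambda>u'. \<sigma> u' $ i)" for i using s by (simp add: smooth_at_def)
  have sm: "smooth_near Et u (\<lambda>u'. \<sigma> u' $ i * a)" for i a by (rule smooth_near_mult[OF E s' smooth_near_const[OF E]])
  have "D X (\<lambda>u'. f (\<sigma> u')) u $ j = f (D X \<sigma> u) $ j" for j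
  proof -
    have "D X (\<lambda>u'. f (\<sigma> u')) u $ j = W u X (\<lambda>u'. \<Sum>i\<in>UNIV. \<sigma> u' $ i * f (axis i 1) $ j)"
      unfolding D_nth by (rule arg_cong[of _ _ "W u X"]) (rule ext, rule linear_componentwise[OF f])
    also have "\<dots> = (\<Sum>i\<in>UNIV. W u X (\<lambda>u'. \<sigma> u' $ i * f (axis i 1) $ j))" by (rule tangent_sum[OF E W_tangent sm])
    also have "\<dots> = (\<Sum>i\<in>UNIV. D X \<sigma> u $ i * f (axis i 1) $ j)"
      using tangent_mult[OF E W_tangent s' smooth_near_const[OF E]] tangent_const[OF E W_tangent] by (simp add: D_nth)
    also have "\<dots> = f (D X \<sigma> u) $ j" by (rule linear_componentwise[OF f, symmetric])
    finally show ?thesis .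
  qed
  then show ?thesis by (simp add: vec_eq_iff)
qed

lemma D_add: "smooth_at u \<sigma> \<Longrightarrow> smooth_at u \<tau> \<Longrightarrow> D X (\<lambda>u'. \<sigma> u' + \<tau> u') u = D X \<sigma> u + D X \<tau> u"
  by (simp add: vec_eq_iff D_nth smooth_at_def tangent_add[OF E W_tangent])

lemma D_cong: "open V \<Longrightarrow> u \<in> V \<Longrightarrow> (\<And>u'. u' \<in> V \<Longrightarrow> \<sigma> u' = \<tau> u') \<Longrightarrow> D X \<sigma> u = D X \<tau> u"
  unfolding D_def by (intro arg_cong[of _ _ vec_lambda] ext tangent_cong[OF E W_tangent, of V]) simp_all

lemma smooth_at_cong: "open V \<Longrightarrow> u \<in> V \<Longrightarrow> (\<And>u'. u' \<in> V \<Longrightarrow> \<sigma> u' = \<tau> u') \<Longrightarrow> smooth_at u \<sigma> \<Longrightarrow> smooth_at u \<tau>"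
  unfolding smooth_at_def
proof
  fix j assume a: "open V" "u \<in> V" "\<And>u'. u' \<in> V \<Longrightarrow> \<sigma> u' = \<tau> u'" and s: "\<forall>j. smooth_near Et u (\<lambda>u'. \<sigma> u' $ j)"
  have "smooth_near Et u (\<lambda>u'. \<sigma> u' $ j) = smooth_near Et u (\<lambda>u'. \<tau> u' $ j)"
    by (rule smooth_near_cong[OF E a(1,2)]) (simp add: a(3))
  then show "smooth_near Et u (\<lambda>u'. \<tau> u' $ j)" using s by simp
qed

lemma smooth_at_add: "smooth_at u \<sigma> \<Longrightarrow> smooth_at u \<tau> \<Longrightarrow> smooth_at u (\<lambda>u'. \<sigma> u' + \<tau> u')"
  by (simp add: smooth_at_def smooth_near_add[OF E])

text \<open>In a chart, the components of the constant vector field are obtained from the matrix of the connection by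
  Cramer's rule.\<close>

lemma W_smooth:
  assumes f: "smooth_near Et u f" shows "smooth_near Et u (\<lambda>u'. W u' X f)"
proof -
  obtain U \<phi> where U: "(U, \<phi>) \<in> Et" "u \<in> U" using chart_exists[OF E] by blast
  let ?\<xi> = "\<lambda>i u'. tvec Et U \<phi> u' (axis i 1)"
  have oU: "open U" by (rule chartD(1)[OF E U(1)])
  have "smooth_vector_field Et U (?\<xi> i)" for i
    unfolding smooth_vector_field_def
  proof (intro conjI ballI allI impI oU)
    show "?\<xi> i x \<in> tangent_space Et x" if "x \<in> U" for x using tangent_space_eq[OF E U(1) that] by auto
    fix V f assume V: "V \<subseteq> U \<and> smooth_fun Et V f"
    show "smooth_fun Et V (\<lambda>x. ?\<xi> i x f)"
    proof (rule smooth_fun_local[OF E])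
      show oV: "open V" using V smooth_fun_open by blast
      fix x assume x: "x \<in> V"
      then have xU: "x \<in> U" using V by blast
      have "cinf (\<phi> ` (V \<inter> U)) (pd i (\<lambda>y. f (inv_into U \<phi> y)))"
        by (rule cinf_pd) (use smooth_fun_chart[OF E _ U(1)] V in blast)
      then have "smooth_near Et x (\<lambda>x. pd i (\<lambda>y. f (inv_into U \<phi> y)) (\<phi> x))"
        by (rule smooth_near_compose_cinf[OF E _ _ smooth_near_chart[OF E U(1) xU]]) (use x xU in auto)
      moreover have "?\<xi> i y f = pd i (\<lambda>y. f (inv_into U \<phi> y)) (\<phi> y)" if "y \<in> V" for y
        using smooth_nearI[of Et V f y] V that by (simp add: tvec_def axis_def if_distrib[of "\<lambda>c. _ * c"] cong: if_cong)
      ultimately show "smooth_near Et x (\<lambda>x. ?\<xi> i x f)"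
        using smooth_near_cong[OF E oV x, of "\<lambda>x. ?\<xi> i x f"] by simp
    qed
  qed
  from conn_smooth[OF this]
  have a: "smooth_fun Et U (\<lambda>u. conn M u (?\<xi> i u) $ j)" for i j by (rule smooth_map_vecD[OF E])
  define Mt where "Mt u' = (\<chi> j i. conn M u' (?\<xi> i u') $ j)" for u'
  have conn_tvec: "conn M u' (tvec Et U \<phi> u' w) = Mt u' *v w" if u': "u' \<in> U" for u' w
  proof -
    have tw: "tvec Et U \<phi> u' w \<in> tangent_space Et u'" for w using tangent_space_eq[OF E U(1) u'] by auto
    let ?c = "\<lambda>w. conn M u' (tvec Et U \<phi> u' w)"
    have "lin ?c"
    proof (rule linI)
      have "tvec Et U \<phi> u' (x + y) = (\<lambda>f. tvec Et U \<phi> u' x f + tvec Et U \<phi> u' y f)" for x y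
        by (rule ext) (simp add: tvec_def distrib_left sum.distrib)
      then show "?c (x + y) = ?c x + ?c y" for x y by (simp add: conn_add tw)
      have "tvec Et U \<phi> u' (c *s x) = (\<lambda>f. c * tvec Et U \<phi> u' x f)" for c x
        by (rule ext) (simp add: tvec_def sum_distrib_left mult.left_commute)
      then show "?c (c *s x) = c *s ?c x" for c x by (simp add: conn_scale tw)
    qed
    from linear_componentwise[OF this, of w]
    show ?thesis by (simp add: vec_eq_iff Mt_def matrix_vector_mult_def mult.commute)
  qed
  \<comment> \<open>The connection is onto, and every tangent vector is a combination of the
    coordinate fields; so its matrix is surjective.\<close>
  have det: "det (Mt u') \<noteq> 0" if u': "u' \<in> U" for u'
  proof -
    have "surj ((*v) (Mt u'))"
      unfolding surj_def
    proof
      fix y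
      obtain w where "W u' y = tvec Et U \<phi> u' w" using W_tangent[of u' y] tangent_space_eq[OF E U(1) u'] by auto
      then have "Mt u' *v w = y" using conn_W[of u' y] conn_tvec[OF u', of w] by simp
      then show "\<exists>w. y = Mt u' *v w" by (intro exI[of _ w]) simp
    qed
    then show ?thesis
      using matrix_right_invertible_surjective[of "Mt u'"] invertible_right_inverse[of "Mt u'"] invertible_det_nz by metis
  qed
  define w where "w u' = (\<chi> k. det (\<chi> i j. if j = k then X $ i else Mt u' $ i $ j) / det (Mt u'))" for u'
  have Ww: "W u' X = tvec Et U \<phi> u' (w u')" if u': "u' \<in> U" for u'
  proof (rule W_eqI)
    show "tvec Et U \<phi> u' (w u') \<in> tangent_space Et u'" using tangent_space_eq[OF E U(1) u'] by auto
    have "Mt u' *v w u' = X" using cramer[OF det[OF u'], of "w u'" X] by (simp add: w_def)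
    then show "conn M u' (tvec Et U \<phi> u' (w u')) = X" using conn_tvec[OF u'] by simp
  qed
  have UU: "\<phi> ` (U \<inter> U) = \<phi> ` U" by simp
  have oS: "open (\<phi> ` U)" by (rule chartD(2)[OF E U(1)])
  have cM: "cinf (\<phi> ` U) (\<lambda>y. Mt (inv_into U \<phi> y) $ j $ i)" for i j
    using smooth_fun_chart[OF E a U(1)] by (simp add: Mt_def)
  have cw: "cinf (\<phi> ` U) (\<lambda>y. w (inv_into U \<phi> y) $ k)" for k
  proof -
    have "cinf (\<phi> ` U) (\<lambda>y. (\<chi> i j. if j = k then X $ i else Mt (inv_into U \<phi> y) $ i $ j) $ i $ j)" for i j
      by (cases "j = k") (simp_all add: cM cinf_const[OF oS])
    from det_cinf[OF oS this] have 1: "cinf (\<phi> ` U) (\<lambda>y. det (\<chi> i j. if j = k then X $ i else Mt (inv_into U \<phi> y) $ i $ j))" .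
    have 2: "cinf (\<phi> ` U) (\<lambda>y. inverse (det (Mt (inv_into U \<phi> y))))"
      by (rule cinf_inverse[OF det_cinf[OF oS cM]]) (use det chartD(7)[OF E U(1)] in blast)
    show ?thesis using cinf_mult[OF 1 2] by (simp add: w_def divide_inverse)
  qed
  obtain V where V: "open V" "u \<in> V" "smooth_fun Et V f" using f by (rule smooth_nearE)
  let ?S = "\<phi> ` (V \<inter> U)"
  have oS': "open ?S" by (rule chart_open_image[OF E U(1) V(1)])
  have cf: "cinf ?S (pd i (\<lambda>y. f (inv_into U \<phi> y)))" for i by (rule cinf_pd[OF smooth_fun_chart[OF E V(3) U(1)]])
  have "cinf ?S (\<lambda>y. \<Sum>i\<in>UNIV. pd i (\<lambda>y. f (inv_into U \<phi> y)) y * w (inv_into U \<phi> y) $ i)"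
    by (intro cinf_sum[OF oS'] cinf_mult[OF cf] cinf_subset[OF cw oS']) auto
  then have "cinf ?S (\<lambda>y. W (inv_into U \<phi> y) X f)"
  proof (rule cinf_cong)
    fix y assume "y \<in> ?S"
    then obtain x where x: "x \<in> V" "x \<in> U" "y = \<phi> x" by auto
    have "smooth_near Et x f" by (rule smooth_nearI[OF V(3) x(1)])
    then show "(\<Sum>i\<in>UNIV. pd i (\<lambda>y. f (inv_into U \<phi> y)) y * w (inv_into U \<phi> y) $ i) = W (inv_into U \<phi> y) X f"
      using Ww[OF x(2)] chartD(5)[OF E U(1) x(2)] x(3) by (simp add: tvec_def)
  qed
  then show ?thesis
    unfolding smooth_near_chart_iff[OF E U] using U(2) V(2) by (intro exI[of _ ?S] conjI) auto
qed

lemma D_smooth: "smooth_at u \<sigma> \<Longrightarrow> smooth_at u (D X \<sigma>)"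
  unfolding smooth_at_def D_nth using W_smooth by blast

text \<open>The action is smooth on the product with Q through local extensions. The pair of curves
  is mapped by such an extension, which agrees with the action along it.\<close>

lemma act_curve:
  assumes c: "curve_at Et c" and g: "curve_at At g" "\<And>t. g t \<in> Q"
  shows "curve_at Et (\<lambda>t. act' (c t) (g t))"
proof -
  obtain N F where F: "(c 0, g 0) \<in> N" "smooth_map (prod_atlas Et At) Et N F" "\<forall>y\<in>(UNIV \<times> Q) \<inter> N. F y = (\<lambda>(u, g). act' u g) y"
    using act_smooth g(2)[of 0] unfolding smooth_map_on_subset_def by blast
  have cg: "curve_at (prod_atlas Et At) (\<lambda>t. (c t, g t))" by (rule curve_at_Pair[OF E A c g(1)])
  have "eventually (\<lambda>t. (c t, g t) \<in> N) (nhds 0)"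
    using cg F(1,2) by (intro isCont_eventually) (auto simp: curve_at_def smooth_map_def)
  then have "eventually (\<lambda>t. F (c t, g t) = act' (c t) (g t)) (nhds 0)"
    by eventually_elim (use F(3) g(2) in auto)
  then show ?thesis
    by (rule curve_at_cong[OF E smooth_map_curve[OF F(2) cg F(1)]])
qed

lemma act_right_smooth: assumes g: "g \<in> Q" shows "smooth_map Et Et UNIV (\<lambda>u. act' u g)"
proof (rule smooth_mapI[OF E open_UNIV])
  have loc: "\<exists>V F. open V \<and> u \<in> V \<and> smooth_map Et Et V F \<and> (\<forall>u'\<in>V. F u' = act' u' g)" for u
  proof -
    obtain N F where F: "(u, g) \<in> N" "smooth_map (prod_atlas Et At) Et N F" "\<forall>y\<in>(UNIV \<times> Q) \<inter> N. F y = (\<lambda>(u, g). act' u g) y"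
      using act_smooth g unfolding smooth_map_on_subset_def by blast
    let ?V = "(\<lambda>u. (u, g)) -` N"
    have oV: "open ?V" using F(2) by (intro open_vimage continuous_intros) (simp add: smooth_map_def)
    have "smooth_map Et Et ?V (\<lambda>u. F (u, g))"
      by (rule smooth_map_compose[OF E smooth_map_subset[OF slice_left[OF E A] E oV subset_UNIV] F(2)]) auto
    then show ?thesis using oV F g by (intro exI[of _ ?V] exI[of _ "\<lambda>u. F (u, g)"]) auto
  qed
  show "continuous_on UNIV (\<lambda>u. act' u g)"
  proof (rule continuous_on_local)
    fix u
    obtain V F where V: "open V" "u \<in> V" "smooth_map Et Et V F" "\<forall>u'\<in>V. F u' = act' u' g" using loc[of u] by (elim exE conjE)
    have "continuous_on V (\<lambda>u. act' u g)"
      by (rule continuous_on_eq[of _ F]) (use V in \<open>auto simp: smooth_map_def\<close>)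
    then show "\<exists>V. open V \<and> u \<in> V \<and> continuous_on V (\<lambda>u. act' u g)" using V by blast
  qed
  fix u f assume f: "smooth_near Et (act' u g) f"
  obtain V F where V: "open V" "u \<in> V" "smooth_map Et Et V F" "\<forall>u'\<in>V. F u' = act' u' g" using loc[of u] by (elim exE conjE)
  have "smooth_near Et u (\<lambda>u. f (F u))" using smooth_map_near[OF V(3,2)] f V(2,4) by simp
  then show "smooth_near Et u (\<lambda>u. f (act' u g))"
    using smooth_near_cong[OF E V(1,2), of "\<lambda>u. f (F u)" "\<lambda>u. f (act' u g)"] V(4) by simp
qed

lemma W_act: assumes g: "g \<in> Q" shows "W (act' u g) X = pushforward Et (\<lambda>u'. act' u' g) u (W u (Ad G g X))"
proof (rule W_eqI)
  show "pushforward Et (\<lambda>u'. act' u' g) u (W u (Ad G g X)) \<in> tangent_space Et (act' u g)"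
    by (rule pushforward_tangent[OF E E act_right_smooth[OF g] UNIV_I W_tangent])
  show "conn M (act' u g) (pushforward Et (\<lambda>u'. act' u' g) u (W u (Ad G g X))) = X"
    by (simp add: conn_equivariant[OF g W_tangent] conn_W Ad_inv)
qed

lemma D_act: assumes g: "g \<in> Q" and s: "smooth_at (act' u g) \<sigma>" shows "D X \<sigma> (act' u g) = D (Ad G g X) (\<lambda>u'. \<sigma> (act' u' g)) u"
  using s by (simp add: vec_eq_iff D_nth W_act[OF g] smooth_at_def pushforward_def)

text \<open>Sections of E described on a Q-stable open set of the total space; for preimages of open
  sets of the base this amounts to \<open>E_sections\<close>.\<close>

definition sec :: "'e set \<Rightarrow> ('e \<Rightarrow> 'k ^ 'w) \<Rightarrow> bool" where
  "sec V \<sigma> \<longleftrightarrow> open V \<and> (\<forall>u\<in>V. \<forall>g\<in>Q. act' u g \<in> V) \<and> (\<forall>u\<in>V. smooth_at u \<sigma>) \<and>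
     (\<forall>u\<in>V. \<forall>g\<in>Q. \<sigma> (act' u g) = \<rho> (inv g) (\<sigma> u))"

lemma secD: assumes "sec V \<sigma>"
  shows "open V" "u \<in> V \<Longrightarrow> g \<in> Q \<Longrightarrow> act' u g \<in> V" "u \<in> V \<Longrightarrow> smooth_at u \<sigma>"
    "u \<in> V \<Longrightarrow> g \<in> Q \<Longrightarrow> \<sigma> (act' u g) = \<rho> (inv g) (\<sigma> u)"
  using assms by (auto simp: sec_def)

text \<open>The connection reproduces the generators of the fundamental vector fields, so for X in q
  the constant field is the velocity of the orbit under \<gamma>.\<close>

lemma vertical_W:
  assumes X: "X \<in> \<qq>" and \<gamma>: "one_parameter_subgroup G X \<gamma>" "\<And>t. \<gamma> t \<in> Q" and f: "smooth_near Et u f"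
  shows "((\<lambda>t. f (act' u (\<gamma> t))) has_field_derivative W u X f) (at 0)"
proof -
  have cc: "curve_at Et (\<lambda>_. u)" unfolding curve_at_def by simp
  have c: "curve_at Et (\<lambda>t. act' u (\<gamma> t))"
    by (rule act_curve[OF cc one_parameter_subgroupD(4)[OF \<gamma>(1)] \<gamma>(2)])
  have c0: "act' u (\<gamma> 0) = u" by (simp add: one_parameter_subgroupD(1)[OF \<gamma>(1)] act_one)
  have "velocity Et (\<lambda>t. act' u (\<gamma> t)) = W u X"
  proof -
    have "velocity Et (\<lambda>t. act' u (\<gamma> t)) \<in> tangent_space Et u" using velocity_tangent[OF E c] c0 by simp
    moreover have "range \<gamma> \<subseteq> Q" using \<gamma>(2) by auto
    ultimately show ?thesis using W_eqI[OF _ conn_vertical[OF X \<gamma>(1)]] by simp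
  qed
  then show ?thesis using velocity_deriv[OF c, of f] f c0 by simp
qed

lemma inv_deriv:
  assumes X: "X \<in> \<qq>" and \<gamma>: "one_parameter_subgroup G X \<gamma>" "\<And>t. \<gamma> t \<in> Q"
  shows "((\<lambda>t. \<rho> (inv (\<gamma> t)) w $ j) has_field_derivative (- d\<rho> X w) $ j) (at 0)"
proof -
  have g: "one_parameter_subgroup G ((- 1) *s X) (\<lambda>t. \<gamma> (- 1 * t))" by (rule one_parameter_subgroup_scale[OF \<gamma>(1)])
  have m: "(- 1) *s X \<in> \<qq>" using X sub_q vec.subspace_scale by blast
  have "((\<lambda>t. \<rho> (\<gamma> (- 1 * t)) w $ j) has_field_derivative d\<rho> ((- 1) *s X) w $ j) (at 0)"
    by (rule inf_rep_deriv[OF m g \<gamma>(2)])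
  moreover have "d\<rho> ((- 1) *s X) w = - d\<rho> X w" using inf_rep_scale[OF X, of "- 1" w] by simp
  ultimately show ?thesis by (simp add: one_parameter_subgroupD(3)[OF \<gamma>(1)])
qed

lemma D_vertical:
  assumes s: "sec V \<sigma>" "u \<in> V" and X: "X \<in> \<qq>" shows "D X \<sigma> u = - d\<rho> X (\<sigma> u)"
proof -
  obtain \<gamma> where \<gamma>: "one_parameter_subgroup G X \<gamma>" "\<And>t. \<gamma> t \<in> Q" using q_one_parameter[OF X] by blast
  have "D X \<sigma> u $ j = (- d\<rho> X (\<sigma> u)) $ j" for j
  proof -
    have "((\<lambda>t. \<sigma> (act' u (\<gamma> t)) $ j) has_field_derivative W u X (\<lambda>u'. \<sigma> u' $ j)) (at 0)"
      by (rule vertical_W[OF X \<gamma>]) (use secD(3)[OF s] in \<open>simp add: smooth_at_def\<close>)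
    then have "((\<lambda>t. \<rho> (inv (\<gamma> t)) (\<sigma> u) $ j) has_field_derivative D X \<sigma> u $ j) (at 0)"
      by (simp add: secD(4)[OF s(1,2) \<gamma>(2)] D_nth)
    from DERIV_unique[OF this inv_deriv[OF X \<gamma>]] show ?thesis .
  qed
  then show ?thesis by (simp add: vec_eq_iff)
qed

lemma D_equivariant:
  assumes s: "sec V \<sigma>" "u \<in> V" and g: "g \<in> Q"
  shows "D X \<sigma> (act' u g) = \<rho> (inv g) (D (Ad G g X) \<sigma> u)"
proof -
  have "D X \<sigma> (act' u g) = D (Ad G g X) (\<lambda>u'. \<sigma> (act' u' g)) u"
    by (rule D_act[OF g secD(3)[OF s(1) secD(2)[OF s g]]])
  also have "\<dots> = D (Ad G g X) (\<lambda>u'. \<rho> (inv g) (\<sigma> u')) u"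
    by (rule D_cong[OF secD(1)[OF s(1)] s(2)]) (rule secD(4)[OF s(1) _ g])
  also have "\<dots> = \<rho> (inv g) (D (Ad G g X) \<sigma> u)" by (rule D_lin[OF rho_lin[OF Q_inv[OF g]] secD(3)[OF s]])
  finally show ?thesis .
qed

lemma D2_equivariant:
  assumes s: "sec V \<sigma>" "u \<in> V" and g: "g \<in> Q"
  shows "D X (D Y \<sigma>) (act' u g) = \<rho> (inv g) (D (Ad G g X) (D (Ad G g Y) \<sigma>) u)"
proof -
  have "D X (D Y \<sigma>) (act' u g) = D (Ad G g X) (\<lambda>u'. D Y \<sigma> (act' u' g)) u"
    by (rule D_act[OF g D_smooth[OF secD(3)[OF s(1) secD(2)[OF s g]]]])
  also have "\<dots> = D (Ad G g X) (\<lambda>u'. \<rho> (inv g) (D (Ad G g Y) \<sigma> u')) u"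
    by (rule D_cong[OF secD(1)[OF s(1)] s(2)]) (rule D_equivariant[OF s(1) _ g])
  also have "\<dots> = \<rho> (inv g) (D (Ad G g X) (D (Ad G g Y) \<sigma>) u)"
    by (rule D_lin[OF rho_lin[OF Q_inv[OF g]] D_smooth[OF secD(3)[OF s]]])
  finally show ?thesis .
qed

text \<open>For Y in q, \<open>D Y \<sigma>\<close> arises from \<sigma> by a constant linear map on
  a whole neighbourhood, and differentiation along X commutes with that map.\<close>

lemma D2_second:
  assumes s: "sec V \<sigma>" "u \<in> V" and Y: "Y \<in> \<qq>"
  shows "D X (D Y \<sigma>) u = - d\<rho> Y (D X \<sigma> u)"
proof -
  have l: "lin (\<lambda>w. - d\<rho> Y w)" using inf_rep_lin[OF Y] by (auto intro!: linI simp: lin_add lin_scale)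
  have "D X (D Y \<sigma>) u = D X (\<lambda>u'. - d\<rho> Y (\<sigma> u')) u"
    by (rule D_cong[OF secD(1)[OF s(1)] s(2)]) (rule D_vertical[OF s(1) _ Y])
  also have "\<dots> = - d\<rho> Y (D X \<sigma> u)" by (rule D_lin[OF l secD(3)[OF s]])
  finally show ?thesis .
qed

text \<open>Along the orbit of \<gamma>, the value of \<open>D Y \<sigma>\<close> varies through
  \<rho> and through Ad acting on Y. The product rule gives one term for each; the second is the
  derivative in direction br X Y.\<close>

lemma D2_first:
  assumes s: "sec V \<sigma>" "u \<in> V" and X: "X \<in> \<qq>"
  shows "D X (D Y \<sigma>) u = - d\<rho> X (D Y \<sigma> u) + D (br X Y) \<sigma> u"
proof -
  obtain \<gamma> where \<gamma>: "one_parameter_subgroup G X \<gamma>" "\<And>t. \<gamma> t \<in> Q" using q_one_parameter[OF X] by blast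
  have \<gamma>0: "\<gamma> 0 = \<one>" by (rule one_parameter_subgroupD(1)[OF \<gamma>(1)])
  have "D X (D Y \<sigma>) u $ j = (- d\<rho> X (D Y \<sigma> u) + D (br X Y) \<sigma> u) $ j" for j
  proof -
    let ?z = "\<lambda>t. D (Ad G (\<gamma> t) Y) \<sigma> u"
    have z: "((\<lambda>t. ?z t $ l) has_field_derivative D (br X Y) \<sigma> u $ l) (at 0)" for l
      by (rule lin_deriv[OF lin_D Ad_deriv[OF \<gamma>(1)]])
    have "((\<lambda>t. D Y \<sigma> (act' u (\<gamma> t)) $ j) has_field_derivative W u X (\<lambda>u'. D Y \<sigma> u' $ j)) (at 0)"
      by (rule vertical_W[OF X \<gamma>]) (use D_smooth[OF secD(3)[OF s]] in \<open>simp add: smooth_at_def\<close>)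
    moreover have "D Y \<sigma> (act' u (\<gamma> t)) $ j = (\<Sum>l\<in>UNIV. ?z t $ l * \<rho> (inv (\<gamma> t)) (axis l 1) $ j)" for t
      unfolding D_equivariant[OF s \<gamma>(2)] by (rule linear_componentwise[OF rho_lin[OF Q_inv[OF \<gamma>(2)]]])
    ultimately have 1: "((\<lambda>t. \<Sum>l\<in>UNIV. ?z t $ l * \<rho> (inv (\<gamma> t)) (axis l 1) $ j) has_field_derivative D X (D Y \<sigma>) u $ j) (at 0)"
      by (simp add: D_nth)
    have 2: "((\<lambda>t. \<Sum>l\<in>UNIV. ?z t $ l * \<rho> (inv (\<gamma> t)) (axis l 1) $ j) has_field_derivative
      (\<Sum>l\<in>UNIV. D (br X Y) \<sigma> u $ l * \<rho> (inv (\<gamma> 0)) (axis l 1) $ j + (- d\<rho> X (axis l 1)) $ j * ?z 0 $ l)) (at 0)"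
      by (intro DERIV_sum DERIV_mult z inv_deriv[OF X \<gamma>])
    have "D X (D Y \<sigma>) u $ j = (\<Sum>l\<in>UNIV. D (br X Y) \<sigma> u $ l * \<rho> (inv (\<gamma> 0)) (axis l 1) $ j + (- d\<rho> X (axis l 1)) $ j * ?z 0 $ l)"
      by (rule DERIV_unique[OF 1 2])
    also have "\<dots> = (\<Sum>l\<in>UNIV. D (br X Y) \<sigma> u $ l * axis l 1 $ j) - (\<Sum>l\<in>UNIV. D Y \<sigma> u $ l * d\<rho> X (axis l 1) $ j)"
      by (simp add: \<gamma>0 rho_one Ad_one sum_subtractf mult.commute)
    also have "(\<Sum>l\<in>UNIV. D (br X Y) \<sigma> u $ l * axis l 1 $ j) = D (br X Y) \<sigma> u $ j"
      by (rule linear_componentwise[OF lin_id, symmetric])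
    also have "(\<Sum>l\<in>UNIV. D Y \<sigma> u $ l * d\<rho> X (axis l 1) $ j) = d\<rho> X (D Y \<sigma> u) $ j"
      by (rule linear_componentwise[OF inf_rep_lin[OF X], symmetric])
    finally show ?thesis by simp
  qed
  then show ?thesis by (simp add: vec_eq_iff)
qed

lemma sec_E_sections:
  assumes "\<sigma> \<in> E_sections G M \<rho> U" shows "sec (\<pi> -` U) \<sigma>"
proof -
  have s: "smooth_map Et vec_atlas (\<pi> -` U) \<sigma>" and eq: "\<forall>u\<in>\<pi> -` U. \<forall>g\<in>Q. \<sigma> (act' u g) = \<rho> (inv g) (\<sigma> u)"
    using assms by (simp_all add: E_sections_def)
  have "smooth_at u \<sigma>" if "u \<in> \<pi> -` U" for u
    unfolding smooth_at_def using smooth_nearI[OF smooth_map_vecD[OF E s] that] by blast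
  then show ?thesis
    unfolding sec_def using eq s proj_act by (simp add: smooth_map_def)
qed

lemma E_sections_sec:
  assumes "sec (\<pi> -` U) \<sigma>" shows "\<sigma> \<in> E_sections G M \<rho> U"
  unfolding E_sections_def using smooth_map_vecI[OF E secD(1)[OF assms]] secD(3,4)[OF assms]
  by (auto simp: smooth_at_def)

lemma D_rho_eq: "D_rho M s \<sigma> u = D (rep (s u)) \<sigma> u"
  by (simp add: D_rho_def fund_deriv_def D_def W_def)

lemma D_rho_D_rho_eq: "D_rho_D_rho M \<sigma> u C C' = D (rep C) (D (rep C') \<sigma>) u"
  by (simp add: D_rho_D_rho_def D_rho_total_def D_rho_eq)

section \<open>Vanishing of values and first derivatives when the jet of a section vanishes\<close>

subsection \<open>Vanishing jets\<close>

lemma fibre_transitive: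
  assumes "\<pi> u = \<pi> u'" obtains g where "g \<in> Q" "act' u g = u'"
proof -
  obtain U \<Phi> \<Psi> where t0: "open U" "\<pi> u \<in> U" "smooth_map Et At (\<pi> -` U) \<Phi>"
    "\<forall>u. \<pi> u \<in> U \<longrightarrow> \<Phi> u \<in> Q" "\<forall>u. \<pi> u \<in> U \<longrightarrow> \<Psi> (\<pi> u, \<Phi> u) = u"
    "\<forall>u g. \<pi> u \<in> U \<longrightarrow> g \<in> Q \<longrightarrow> \<Phi> (act' u g) = \<Phi> u \<otimes> g"
    using trivialization[of "\<pi> u"] by (elim exE conjE)
  note t = t0(1-3) t0(4-6)[rule_format]
  let ?g = "inv (\<Phi> u) \<otimes> \<Phi> u'"
  have g: "?g \<in> Q" using t(2,4) assms by (simp add: Q_mult Q_inv)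
  have "\<Phi> (act' u ?g) = \<Phi> u'" using t(6)[OF t(2) g] by (simp add: m_assoc[symmetric])
  then have "act' u ?g = u'" using t(5)[of "act' u ?g"] t(5)[of u'] proj_act[OF g] t(2) assms by simp
  then show thesis using that g by blast
qed

text \<open>The jet condition concerns only the point \<tau> (\<pi> u) of the fibre; equivariance
  carries the vanishing to u.\<close>

lemma jet_vanishes_value:
  assumes s: "sec (\<pi> -` U) \<sigma>" and u: "\<pi> u \<in> U" and "section_jet_vanishes M k \<sigma> (\<pi> u)"
  shows "\<sigma> u = 0"
proof -
  obtain V \<phi> N \<tau> where V: "(V, \<phi>) \<in> Bt" "\<pi> u \<in> V" "\<pi> u \<in> N" "\<forall>y\<in>N. \<pi> (\<tau> y) = y"
    "\<forall>j. jet_vanishes k (\<lambda>z. \<sigma> (\<tau> (inv_into V \<phi> z)) $ j) (\<phi> (\<pi> u))"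
    using assms(3) unfolding section_jet_vanishes_def by auto
  have "\<sigma> (\<tau> (\<pi> u)) $ j = 0" for j
    using V(5)[rule_format, of j] chartD(5)[OF B V(1,2)] by (cases k) simp_all
  then have z: "\<sigma> (\<tau> (\<pi> u)) = 0" by (simp add: vec_eq_iff)
  have "\<pi> (\<tau> (\<pi> u)) = \<pi> u" using V(3,4) by blast
  then obtain g where g: "g \<in> Q" "act' (\<tau> (\<pi> u)) g = u" by (rule fibre_transitive)
  have "\<sigma> u = \<rho> (inv g) (\<sigma> (\<tau> (\<pi> u)))" using secD(4)[OF s _ g(1), of "\<tau> (\<pi> u)"] g(2) u \<open>\<pi> (\<tau> (\<pi> u)) = \<pi> u\<close> by simp
  then show ?thesis using z lin_0[OF rho_lin[OF Q_inv[OF g(1)]]] by simp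
qed

text \<open>A curve \<open>c\<close> in the total space is \<open>\<tau> (\<pi> (c t))\<close> acted on by a curve \<open>g\<close> in \<open>Q\<close>; by the product rule only
  the 1-jet of \<open>\<sigma> \<circ> \<tau>\<close> at \<open>\<pi> u\<close> enters.\<close>

lemma jet_vanishes_deriv:
  assumes s: "sec (\<pi> -` U) \<sigma>" and U: "open U" "\<pi> u \<in> U" and j: "section_jet_vanishes M 1 \<sigma> (\<pi> u)"
  shows "D X \<sigma> u = 0"
proof -
  obtain V \<phi> N \<tau> where V: "(V, \<phi>) \<in> Bt" "\<pi> u \<in> V" "\<pi> u \<in> N" "smooth_map Bt Et N \<tau>" "\<forall>y\<in>N. \<pi> (\<tau> y) = y"
    "\<forall>j. jet_vanishes 1 (\<lambda>z. \<sigma> (\<tau> (inv_into V \<phi> z)) $ j) (\<phi> (\<pi> u))"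
    using j unfolding section_jet_vanishes_def by auto
  obtain U1 \<Phi> \<Psi> where t0: "open U1" "\<pi> u \<in> U1" "smooth_map Et At (\<pi> -` U1) \<Phi>"
    "\<forall>u. \<pi> u \<in> U1 \<longrightarrow> \<Phi> u \<in> Q" "\<forall>u. \<pi> u \<in> U1 \<longrightarrow> \<Psi> (\<pi> u, \<Phi> u) = u"
    "\<forall>u g. \<pi> u \<in> U1 \<longrightarrow> g \<in> Q \<longrightarrow> \<Phi> (act' u g) = \<Phi> u \<otimes> g"
    using trivialization[of "\<pi> u"] by (elim exE conjE)
  note t = t0(1-3) t0(4-6)[rule_format]
  obtain c where c: "curve_at Et c" "c 0 = u" "W u X = velocity Et c" using tangent_velocity[OF E W_tangent] .
  define y where "y t = \<pi> (c t)" for t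
  \<comment> \<open>The element of Q that takes \<tau> (y t) to c t, read off from the group
    component \<Phi> of a trivialisation; this makes it a differentiable curve.\<close>
  define g where "g t = inv (\<Phi> (\<tau> (y t))) \<otimes> \<Phi> (c t)" for t
  have y0: "y 0 = \<pi> u" by (simp add: y_def c)
  have cy: "curve_at Bt y" unfolding y_def by (rule smooth_map_curve[OF proj_smooth c(1) UNIV_I])
  have cs: "curve_at Et (\<lambda>t. \<tau> (y t))" by (rule smooth_map_curve[OF V(4) cy]) (simp add: y0 V(3))
  have \<pi>s0: "\<pi> (\<tau> (y 0)) = \<pi> u" using V(3,5) y0 by simp
  have c1: "curve_at At (\<lambda>t. \<Phi> (\<tau> (y t)))" by (rule smooth_map_curve[OF t(3) cs]) (simp add: \<pi>s0 t(2))
  have c2: "curve_at At (\<lambda>t. \<Phi> (c t))" by (rule smooth_map_curve[OF t(3) c(1)]) (simp add: c(2) t(2))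
  have c3: "curve_at At (\<lambda>t. inv (g t))"
  proof -
    have sm: "smooth_map (prod_atlas At At) At UNIV (\<lambda>p. inv (inv (fst p) \<otimes> snd p))" by (intro smooth_intros)
    show ?thesis using smooth_map_curve[OF sm curve_at_Pair[OF A A c1 c2] UNIV_I] by (simp add: g_def)
  qed
  have oN: "open N" using V(4) by (simp add: smooth_map_def)
  have "eventually (\<lambda>t. y t \<in> U1 \<inter> N \<inter> U) (nhds 0)"
    using cy by (intro isCont_eventually) (use t(1,2) oN V(3) U y0 in \<open>auto simp: curve_at_def\<close>)
  then have ev: "eventually (\<lambda>t. inv (g t) \<in> Q \<and> \<sigma> (c t) = \<rho> (inv (g t)) (\<sigma> (\<tau> (y t)))) (nhds 0)"
  proof eventually_elim
    case (elim t)
    have \<pi>s: "\<pi> (\<tau> (y t)) = y t" using V(5) elim by blast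
    have gQ: "g t \<in> Q" using t(4)[of "\<tau> (y t)"] t(4)[of "c t"] elim \<pi>s by (simp add: g_def y_def Q_mult Q_inv)
    have "\<Phi> (act' (\<tau> (y t)) (g t)) = \<Phi> (c t)" using t(6)[of "\<tau> (y t)", OF _ gQ] \<pi>s elim by (simp add: g_def m_assoc[symmetric])
    moreover have "\<pi> (act' (\<tau> (y t)) (g t)) = \<pi> (c t)" using proj_act[OF gQ] \<pi>s by (simp add: y_def)
    ultimately have "act' (\<tau> (y t)) (g t) = c t"
      using t(5)[of "act' (\<tau> (y t)) (g t)"] t(5)[of "c t"] elim by (simp add: y_def)
    then show ?case using secD(4)[OF s _ gQ, of "\<tau> (y t)"] \<pi>s elim Q_inv[OF gQ] by simp
  qed
  have g0: "inv (g 0) \<in> Q" and ev1: "eventually (\<lambda>t. inv (g t) \<in> Q) (nhds 0)"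
    using eventually_nhds_x_imp_x[OF ev] ev by (auto elim: eventually_mono)
  have z: "((\<lambda>t. \<sigma> (\<tau> (y t)) $ l) has_field_derivative 0) (at 0)" and z0: "\<sigma> (\<tau> (y 0)) $ l = 0" for l
  proof -
    let ?h = "\<lambda>z. \<sigma> (\<tau> (inv_into V \<phi> z)) $ l"
    have jv: "?h (\<phi> (\<pi> u)) = 0" "deriv (\<lambda>t. ?h (\<phi> (\<pi> u) + t *s v)) 0 = 0" for v
      using V(6)[rule_format, of l] by simp_all
    show "\<sigma> (\<tau> (y 0)) $ l = 0" using jv(1) chartD(5)[OF B V(1,2)] by (simp add: y0)
    have "smooth_near Et (\<tau> (\<pi> u)) (\<lambda>u'. \<sigma> u' $ l)"
      using secD(3)[OF s, of "\<tau> (\<pi> u)"] U(2) \<pi>s0 y0 by (simp add: smooth_at_def)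
    then have sn: "smooth_near Bt (\<pi> u) (\<lambda>x. \<sigma> (\<tau> x) $ l)" by (rule smooth_map_near[OF V(4,3)])
    have kd: "kdiff ?h (\<phi> (\<pi> u))" by (rule smooth_near_kdiff[OF B V(1,2) sn])
    have pd0: "pd i ?h (\<phi> (\<pi> u)) = 0" for i
    proof -
      have "((\<lambda>t. ?h (\<phi> (\<pi> u) + t *s axis i 1)) has_field_derivative (\<Sum>k\<in>UNIV. pd k ?h (\<phi> (\<pi> u) + 0 *s axis i 1) * axis i 1 $ k)) (at 0)"
        by (rule deriv_compose) (use kd in \<open>auto intro!: derivative_eq_intros\<close>)
      from DERIV_imp_deriv[OF this] show ?thesis
        using jv(2)[of "axis i 1"] by (simp add: axis_def if_distrib[of "\<lambda>c. _ * c"] cong: if_cong)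
    qed
    obtain w where w: "\<And>i. ((\<lambda>t. \<phi> (y t) $ i) has_field_derivative w $ i) (at 0)"
      using curve_coords[OF B V(1) _ cy] V(2) y0 by auto
    have "((\<lambda>t. \<sigma> (\<tau> (y t)) $ l) has_field_derivative (\<Sum>i\<in>UNIV. pd i ?h (\<phi> (y 0)) * w $ i)) (at 0)"
      by (rule curve_chain[OF B V(1) _ _ w]) (use V(2) y0 cy sn in \<open>auto simp: curve_at_def\<close>)
    then show "((\<lambda>t. \<sigma> (\<tau> (y t)) $ l) has_field_derivative 0) (at 0)" by (simp add: y0 pd0)
  qed
  have "D X \<sigma> u $ j = 0" for j
  proof -
    \<comment> \<open>Existence of these derivatives is all that matters: in the product rule they
      are multiplied by the components of \<sigma> at \<tau> (y 0), which are zero.\<close>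
    have "\<exists>r. \<forall>l. ((\<lambda>t. \<rho> (inv (g t)) (axis l 1) $ j) has_field_derivative r l) (at 0)"
      using rho_curve_differentiable[OF c3 ev1 g0] unfolding field_differentiable_def by (intro choice) blast
    then obtain r where r: "\<And>l. ((\<lambda>t. \<rho> (inv (g t)) (axis l 1) $ j) has_field_derivative r l) (at 0)" by blast
    have "((\<lambda>t. \<Sum>l\<in>UNIV. \<sigma> (\<tau> (y t)) $ l * \<rho> (inv (g t)) (axis l 1) $ j) has_field_derivative
      (\<Sum>l\<in>UNIV. 0 * \<rho> (inv (g 0)) (axis l 1) $ j + r l * \<sigma> (\<tau> (y 0)) $ l)) (at 0)"
      by (intro DERIV_sum DERIV_mult z r)
    then have d: "((\<lambda>t. \<Sum>l\<in>UNIV. \<sigma> (\<tau> (y t)) $ l * \<rho> (inv (g t)) (axis l 1) $ j) has_field_derivative 0) (at 0)"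
      by (simp add: z0)
    have "eventually (\<lambda>t. (\<Sum>l\<in>UNIV. \<sigma> (\<tau> (y t)) $ l * \<rho> (inv (g t)) (axis l 1) $ j) = \<sigma> (c t) $ j) (nhds 0)"
      using ev by eventually_elim (simp add: linear_componentwise[OF rho_lin, symmetric])
    from DERIV_eventually_eq[OF d this]
    have "((\<lambda>t. \<sigma> (c t) $ j) has_field_derivative 0) (at 0)" .
    then have "velocity Et c (\<lambda>u'. \<sigma> u' $ j) = 0"
      using secD(3)[OF s, of u] U(2) by (intro velocity_eqI[OF c(1)]) (auto simp: smooth_at_def c(2))
    then show ?thesis by (simp add: D_nth c(3))
  qed
  then show ?thesis by (simp add: vec_eq_iff)
qed

end

section \<open>Dual systems in p modulo p_plus and the contraction with the inverse form\<close>

section \<open>Dual pairs and contraction\<close>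

lemma lin_mem_span:
  assumes f: "lin f" and S: "vec.subspace S" and B: "\<And>b. b \<in> B \<Longrightarrow> f b \<in> S" and x: "x \<in> vec.span B"
  shows "f x \<in> S"
proof -
  have "vec.subspace (f -` S)"
    using vec.subspace_0[OF S] vec.subspace_add[OF S] vec.subspace_scale[OF S]
    by (intro vec.subspaceI) (simp_all add: lin_0[OF f] lin_add[OF f] lin_scale[OF f])
  then have "vec.span B \<subseteq> f -` S" using B by (intro vec.span_minimal) auto
  then show ?thesis using x by auto
qed

lemma tr_rank_one:
  assumes "\<And>v w. f (v + w) = f v + f w" "\<And>c v. f (c *s v) = c * f v"
  shows "tr (\<lambda>v. f v *s b) = f (b :: 'k::field ^ 'n)"
proof -
  have "lin (\<lambda>v. f v *s axis undefined 1 :: 'k ^ 'n)"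
    by (rule linI) (simp_all add: assms vector_sadd_rdistrib vector_smult_assoc)
  from linear_componentwise[OF this, of b undefined]
  show ?thesis by (simp add: tr_alt mult.commute)
qed

lemma tr_sum: "tr (\<lambda>x. \<Sum>i\<in>I. f i x) = (\<Sum>i\<in>I. tr (f i))"
  unfolding tr_alt sum_component by (rule sum.swap)

context nested_par
begin

lemma mem_p_iff: "X \<in> \<pp> \<longleftrightarrow> (\<forall>Y\<in>p_plus G. K X Y = 0)"
  using perp_perp[OF sub_p] by (auto simp: p_plus_perp perp_def)

lemma lin_expand: "lin (\<lambda>X. X - (\<Sum>a\<in>J. K (y a) X *s x a))"
  by (rule linI) (simp_all add: K_add_right K_scale_right vector_sadd_rdistrib sum.distrib vec.scale_right_diff_distrib
      vec.scale_sum_right vector_smult_assoc)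

text \<open>Says that the sum of the x a \<otimes> x' a represents the inverse form on p / p_plus.
  In this shape it is symmetric in both systems and compatible with Ad, and it covers bases with
  their duals as well as frames evaluated at a point.\<close>

definition dual_pair :: "'j set \<Rightarrow> ('j \<Rightarrow> 'k ^ 'n) \<Rightarrow> ('j \<Rightarrow> 'k ^ 'n) \<Rightarrow> bool" where
  "dual_pair J x x' \<longleftrightarrow> finite J \<and> (\<forall>a\<in>J. x a \<in> \<pp> \<and> x' a \<in> \<pp>) \<and>
     (\<forall>X\<in>\<pp>. X - (\<Sum>a\<in>J. K (x' a) X *s x a) \<in> p_plus G)"

lemma dual_pairD: assumes "dual_pair J x x'"
  shows "finite J" "a \<in> J \<Longrightarrow> x a \<in> \<pp>" "a \<in> J \<Longrightarrow> x' a \<in> \<pp>" "X \<in> \<pp> \<Longrightarrow> X - (\<Sum>a\<in>J. K (x' a) X *s x a) \<in> p_plus G"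
  using assms by (auto simp: dual_pair_def)

text \<open>The difference is tested against Y in p: symmetry of K moves the expansion from X to Y,
  where the given one applies.\<close>

lemma dual_pair_swap: assumes d: "dual_pair J x x'" shows "dual_pair J x' x"
  unfolding dual_pair_def
proof (intro conjI ballI)
  fix X assume X: "X \<in> \<pp>"
  show "X - (\<Sum>a\<in>J. K (x a) X *s x' a) \<in> p_plus G"
    unfolding mem_p_plus_iff
  proof
    fix Y assume Y: "Y \<in> \<pp>"
    have "K (X - (\<Sum>a\<in>J. K (x a) X *s x' a)) Y = K X (Y - (\<Sum>a\<in>J. K (x' a) Y *s x a))"
      by (simp add: K_diff_left K_diff_right K_sum_left K_sum_right K_scale_left K_scale_right K_sym[of X] mult.commute)
    also have "\<dots> = 0" by (rule K_p_plus(1)[OF X dual_pairD(4)[OF d Y]])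
    finally show "K (X - (\<Sum>a\<in>J. K (x a) X *s x' a)) Y = 0" .
  qed
qed (use d in \<open>auto simp: dual_pair_def\<close>)

lemma dual_pairI:
  assumes J: "finite J" "\<And>a. a \<in> J \<Longrightarrow> x a \<in> \<pp>" "\<And>a. a \<in> J \<Longrightarrow> x' a \<in> \<pp>"
    and span: "\<And>X. X \<in> \<pp> \<Longrightarrow> \<exists>t. X - (\<Sum>a\<in>J. t a *s x a) \<in> p_plus G"
    and dual: "\<And>a b. a \<in> J \<Longrightarrow> b \<in> J \<Longrightarrow> K (x' a) (x b) = (if a = b then 1 else 0)"
  shows "dual_pair J x x'"
  unfolding dual_pair_def
proof (intro conjI ballI J)
  fix X assume X: "X \<in> \<pp>"
  obtain t where t: "X - (\<Sum>a\<in>J. t a *s x a) \<in> p_plus G" using span[OF X] by blast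
  have "K (x' a) X = t a" if a: "a \<in> J" for a
  proof -
    have "0 = K (x' a) (X - (\<Sum>b\<in>J. t b *s x b))" using K_p_plus(1)[OF J(3)[OF a] t] by simp
    also have "\<dots> = K (x' a) X - (\<Sum>b\<in>J. t b * (if a = b then 1 else 0))"
      unfolding K_diff_right K_sum_right K_scale_right using dual[OF a] by simp
    finally show ?thesis using J(1) a by (simp add: if_distrib[of "\<lambda>c. _ * c"] cong: if_cong)
  qed
  then have "(\<Sum>a\<in>J. K (x' a) X *s x a) = (\<Sum>a\<in>J. t a *s x a)" by simp
  then show "X - (\<Sum>a\<in>J. K (x' a) X *s x a) \<in> p_plus G" using t by simp
qed

text \<open>Each x a is expanded in the system y; collecting the coefficients in the second slot
  recovers y' b. The vanishing on p_plus discards the errors of both expansions.\<close>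

lemma contract_eq:
  fixes \<beta> :: "'k ^ 'n \<Rightarrow> 'k ^ 'n \<Rightarrow> 'k ^ 'w"
  assumes \<beta>: "\<And>Y. lin (\<lambda>X. \<beta> X Y)" "\<And>X. lin (\<beta> X)"
    and van: "\<And>X Z. X \<in> \<pp> \<Longrightarrow> Z \<in> p_plus G \<Longrightarrow> \<beta> X Z = 0" "\<And>X Z. X \<in> \<pp> \<Longrightarrow> Z \<in> p_plus G \<Longrightarrow> \<beta> Z X = 0"
    and d: "dual_pair J x x'" "dual_pair I y y'"
  shows "(\<Sum>a\<in>J. \<beta> (x a) (x' a)) = (\<Sum>b\<in>I. \<beta> (y b) (y' b))"
proof -
  have "\<beta> (x a) (x' a) = (\<Sum>b\<in>I. K (y' b) (x a) *s \<beta> (y b) (x' a))" if a: "a \<in> J" for a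
    using van(2)[OF dual_pairD(3)[OF d(1) a] dual_pairD(4)[OF d(2) dual_pairD(2)[OF d(1) a]]]
    by (simp add: lin_diff[OF \<beta>(1)] lin_sum[OF \<beta>(1)] lin_scale[OF \<beta>(1)])
  then have "(\<Sum>a\<in>J. \<beta> (x a) (x' a)) = (\<Sum>a\<in>J. \<Sum>b\<in>I. K (y' b) (x a) *s \<beta> (y b) (x' a))" by simp
  also have "\<dots> = (\<Sum>b\<in>I. \<Sum>a\<in>J. K (x a) (y' b) *s \<beta> (y b) (x' a))"
    unfolding K_sym[of "y' _"] by (rule sum.swap)
  also have "\<dots> = (\<Sum>b\<in>I. \<beta> (y b) (y' b))"
  proof (rule sum.cong[OF refl])
    fix b assume b: "b \<in> I"
    show "(\<Sum>a\<in>J. K (x a) (y' b) *s \<beta> (y b) (x' a)) = \<beta> (y b) (y' b)"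
      using van(1)[OF dual_pairD(2)[OF d(2) b] dual_pairD(4)[OF dual_pair_swap[OF d(1)] dual_pairD(3)[OF d(2) b]]]
      by (simp add: lin_diff[OF \<beta>(2)] lin_sum[OF \<beta>(2)] lin_scale[OF \<beta>(2)])
  qed
  finally show ?thesis .
qed

lemma dual_pair_Ad:
  assumes d: "dual_pair J x x'" and g: "g \<in> Q" shows "dual_pair J (\<lambda>a. Ad G g (x a)) (\<lambda>a. Ad G g (x' a))"
  unfolding dual_pair_def
proof (intro conjI ballI)
  show "finite J" by (rule dual_pairD(1)[OF d])
  show "Ad G g (x a) \<in> \<pp>" "Ad G g (x' a) \<in> \<pp>" if "a \<in> J" for a using Ad_mem_p[OF g] dual_pairD(2,3)[OF d that] by auto
  fix X assume X: "X \<in> \<pp>"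
  have e: "K (Ad G g Y) X = K Y (Ad G (inv g) X)" for Y using K_Ad[of g Y "Ad G (inv g) X"] by (simp add: Ad_inv)
  have "Ad G g (Ad G (inv g) X - (\<Sum>a\<in>J. K (x' a) (Ad G (inv g) X) *s x a)) \<in> p_plus G"
    by (rule Ad_mem_p_plus[OF g dual_pairD(4)[OF d Ad_mem_p[OF Q_inv[OF g] X]]])
  then show "X - (\<Sum>a\<in>J. K (Ad G g (x' a)) X *s Ad G g (x a)) \<in> p_plus G"
    by (simp add: lin_diff[OF lin_Ad] lin_sum[OF lin_Ad] lin_scale[OF lin_Ad] Ad_inv e)
qed

text \<open>\<open>N\<close>, \<open>N \<union> R\<close> and \<open>N \<union> R \<union> C\<close> induce bases of \<open>q_plus / p_plus\<close>, \<open>q / p_plus\<close> and \<open>p / p_plus\<close>;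
  the duality between \<open>N\<close> and \<open>C\<close> reflects that \<open>q\<close> is the orthogonal complement of \<open>q_plus\<close>.\<close>

lemma adapted_dual_pair:
  obtains N R C :: "('k ^ 'n) set" and x' where
    "N \<inter> R = {}" "N \<inter> C = {}" "R \<inter> C = {}" "N \<subseteq> q_plus G" "R \<subseteq> \<qq>" "C \<subseteq> \<pp>"
    "dual_pair (N \<union> R \<union> C) (\<lambda>b. b) x'"
    "\<And>b c. b \<in> N \<union> R \<union> C \<Longrightarrow> c \<in> N \<union> R \<union> C \<Longrightarrow> K (x' b) c = (if b = c then 1 else 0)"
    "\<And>b. b \<in> R \<Longrightarrow> x' b \<in> \<qq>" "\<And>b. b \<in> C \<Longrightarrow> x' b \<in> q_plus G"
    "\<And>X. X \<in> q_plus G \<Longrightarrow> X - (\<Sum>b\<in>N. K (x' b) X *s b) \<in> p_plus G"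
proof -
  have ext: "\<exists>B'. B \<subseteq> B' \<and> vec.independent B' \<and> vec.span B' = S"
    if ii: "vec.independent B" "B \<subseteq> S" and ss: "vec.subspace S" for B S :: "('k ^ 'n) set"
  proof -
    obtain B' where "B \<subseteq> B'" "B' \<subseteq> S" "vec.independent B'" "S \<subseteq> vec.span B'"
      using vec.maximal_independent_subset_extend[OF ii(2,1)] by metis
    then show ?thesis using vec.span_subspace[of B' S] ss by blast
  qed
  obtain B0 where B0: "vec.independent B0" "vec.span B0 = p_plus G"
    using ext[OF vec.independent_empty empty_subsetI sub_p_plus] by blast
  obtain B1 where B1: "B0 \<subseteq> B1" "vec.independent B1" "vec.span B1 = q_plus G"
    using ext[OF B0(1) _ sub_q_plus] B0(2) p_plus_q_plus vec.span_superset[of B0] by blast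
  obtain B2 where B2: "B1 \<subseteq> B2" "vec.independent B2" "vec.span B2 = \<qq>"
    using ext[OF B1(2) _ sub_q] B1(3) q_plus_q vec.span_superset[of B1] by blast
  obtain B3 where B3: "B2 \<subseteq> B3" "vec.independent B3" "vec.span B3 = \<pp>"
    using ext[OF B2(2) _ sub_p] B2(3) qp vec.span_superset[of B2] by blast
  have fin: "finite B3" by (rule vec.finiteI_independent[OF B3(2)])
  have "\<exists>y. \<forall>c\<in>B3. K y c = (if b = c then 1 else 0)" for b
  proof -
    obtain g :: "'k ^ 'n \<Rightarrow> 'k ^ 'n" where g: "lin g" "\<forall>c\<in>B3. g c = (if b = c then axis undefined 1 else 0)"
      using vec.linear_independent_extend[OF B3(2), of "\<lambda>c. if b = c then axis undefined 1 else 0"] by blast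
    obtain y where y: "\<forall>x. K x y = (\<Sum>i\<in>UNIV. g (axis i 1) $ undefined * x $ i)" using represent_functional[of "\<lambda>i. g (axis i 1) $ undefined"] by blast
    have "K y x = g x $ undefined" for x
      using linear_componentwise[OF g(1), of x undefined] y K_sym[of y x] by (simp add: mult.commute)
    then show ?thesis using g(2) by (intro exI[of _ y]) simp
  qed
  then obtain x' where x': "\<And>b c. c \<in> B3 \<Longrightarrow> K (x' b) c = (if b = c then 1 else 0)" by metis
  have perp: "K (x' b) X = 0" if "X \<in> vec.span B" "B \<subseteq> B3" "b \<notin> B" for b X B
  proof -
    have "vec.subspace {X. K (x' b) X = 0}" by (rule vec.subspaceI) (simp_all add: K_add_right K_scale_right)
    then have "vec.span B \<subseteq> {X. K (x' b) X = 0}" by (intro vec.span_minimal) (use x' that in auto)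
    then show ?thesis using that(1) by blast
  qed
  \<comment> \<open>Dual vectors for basis elements outside B0, B1 or B2 are orthogonal to p_plus,
    q_plus or q, and thus lie in p, q or q_plus respectively.\<close>
  have mp: "x' b \<in> \<pp>" if "b \<notin> B0" for b
    unfolding mem_p_iff using perp[of _ B0 b] B0(2) B1(1) B2(1) B3(1) that by auto
  have mq: "x' b \<in> \<qq>" if "b \<notin> B1" for b
    unfolding mem_q_iff using perp[of _ B1 b] B1(3) B2(1) B3(1) that by auto
  have mqp: "x' b \<in> q_plus G" if "b \<notin> B2" for b
    unfolding mem_q_plus_iff using perp[of _ B2 b] B2(3) B3(1) that by auto
  have expand: "X - (\<Sum>b\<in>B - B0. K (x' b) X *s b) \<in> p_plus G" if B: "B0 \<subseteq> B" "B \<subseteq> B3" and X: "X \<in> vec.span B" for B X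
  proof (rule lin_mem_span[OF lin_expand sub_p_plus _ X])
    have fB: "finite (B - B0)" using finite_subset[OF B(2) fin] by simp
    fix b assume b: "b \<in> B"
    show "b - (\<Sum>a\<in>B - B0. K (x' a) b *s a) \<in> p_plus G"
    proof (cases "b \<in> B0")
      case True
      then have bp: "b \<in> p_plus G" using B0(2) vec.span_superset[of B0] by blast
      then have "K (x' a) b = 0" if "a \<in> B - B0" for a using K_p_plus(1)[OF mp] that by blast
      then show ?thesis using bp by simp
    next
      case False
      have "(\<Sum>a\<in>B - B0. K (x' a) b *s a) = (\<Sum>a\<in>B - B0. if a = b then a else 0)"
        by (rule sum.cong) (use b B(2) x' in auto)
      also have "\<dots> = b" using fB b False by simp
      finally show ?thesis using vec.subspace_0[OF sub_p_plus] by simp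
    qed
  qed
  have J: "(B1 - B0) \<union> (B2 - B1) \<union> (B3 - B2) = B3 - B0" using B1(1) B2(1) B3(1) by blast
  show thesis
  proof (rule that[of "B1 - B0" "B2 - B1" "B3 - B2" x'])
    show "dual_pair ((B1 - B0) \<union> (B2 - B1) \<union> (B3 - B2)) (\<lambda>b. b) x'"
      unfolding dual_pair_def J
      using fin mp expand[of B3] B3 B1(1) B2(1) vec.span_superset[of B3] by auto
    show "B1 - B0 \<subseteq> q_plus G" using B1(3) vec.span_superset[of B1] by blast
    show "B2 - B1 \<subseteq> \<qq>" using B2(3) vec.span_superset[of B2] by blast
    show "B3 - B2 \<subseteq> \<pp>" using B3(3) vec.span_superset[of B3] by blast
    show "X - (\<Sum>b\<in>B1 - B0. K (x' b) X *s b) \<in> p_plus G" if "X \<in> q_plus G" for X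
      using expand[of B1 X] B1 B2(1) B3(1) that by auto
    show "K (x' b) c = (if b = c then 1 else 0)"
      if "b \<in> (B1 - B0) \<union> (B2 - B1) \<union> (B3 - B2)" "c \<in> (B1 - B0) \<union> (B2 - B1) \<union> (B3 - B2)" for b c
      using x' that unfolding J by simp
    show "x' b \<in> \<qq>" if "b \<in> B2 - B1" for b using mq that by blast
    show "x' b \<in> q_plus G" if "b \<in> B3 - B2" for b using mqp that by blast
  qed (use B1(1) B2(1) in auto)
qed

text \<open>The Killing form of this element with \<open>z \<in> q_plus\<close> is the trace of the nilpotent map that \<open>ad z\<close>
  induces on \<open>q_plus / p_plus\<close>.\<close>

lemma sum_bracket_mem_q:
  assumes N: "N \<subseteq> q_plus G" "finite N" "\<And>b. b \<in> N \<Longrightarrow> x' b \<in> \<pp>"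
    and exp: "\<And>X. X \<in> q_plus G \<Longrightarrow> X - (\<Sum>b\<in>N. K (x' b) X *s b) \<in> p_plus G"
  shows "(\<Sum>b\<in>N. br b (x' b)) \<in> \<qq>"
  unfolding mem_q_iff
proof
  fix z assume z: "z \<in> q_plus G"
  \<comment> \<open>On q_plus this is ad z up to an error in p_plus, written in the coordinates K
    (x' b). As a map of the whole algebra with values in q_plus it has a trace in the ordinary
    sense.\<close>
  define T where "T v = (\<Sum>b\<in>N. K (x' b) (br z v) *s b)" for v
  have zp: "z \<in> \<pp>" and zq: "z \<in> \<qq>" using z q_plus_p q_plus_q by auto
  have linT: "lin T"
    unfolding T_def by (rule linI) (simp_all add: lin_add[OF lin_right] lin_scale[OF lin_right] K_add_right K_scale_right
      vector_sadd_rdistrib sum.distrib vec.scale_sum_right vector_smult_assoc)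
  have Tq: "T v \<in> q_plus G" for v
    unfolding T_def using N(1) by (intro vec.subspace_sum[OF sub_q_plus] vec.subspace_scale[OF sub_q_plus]) auto
  have Tp: "T v = 0" if "v \<in> p_plus G" for v
    unfolding T_def using K_p_plus(1)[OF N(3) br_p_plus[OF zp that]] by simp
  have Tad: "br z v - T v \<in> p_plus G" if "v \<in> q_plus G" for v
    unfolding T_def by (rule exp[OF br_q_plus[OF zq that]])
  have iter: "(br z ^^ j) v - (T ^^ j) v \<in> p_plus G \<and> (T ^^ j) v \<in> q_plus G" if v: "v \<in> q_plus G" for j v
  proof (induction j)
    case 0
    show ?case using v vec.subspace_0[OF sub_p_plus] by simp
  next
    case (Suc j)
    have "br z ((br z ^^ j) v - (T ^^ j) v) + (br z ((T ^^ j) v) - T ((T ^^ j) v)) \<in> p_plus G"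
      by (rule vec.subspace_add[OF sub_p_plus br_p_plus[OF zp] Tad]) (use Suc in auto)
    then show ?case using Tq by (simp add: diff_right)
  qed
  obtain k where k: "(act_span br (perp br \<qq>) ^^ k) UNIV = {0}"
    using parabolic_perp_nilpotent_rep[OF par_q bilin_br rep_on_br] by blast
  have "(br z ^^ j) v \<in> (act_span br (perp br \<qq>) ^^ j) UNIV" for j v
    by (induction j) (use z in \<open>simp_all add: act_spanI q_plus_perp\<close>)
  then have adk: "(br z ^^ k) v = 0" for v using k by blast
  have "T ((T ^^ k) v) = 0" if "v \<in> q_plus G" for v
    using iter[OF that, of k] adk vec.subspace_neg[OF sub_p_plus, of "- (T ^^ k) v"] by (intro Tp) simp
  \<comment> \<open>Of the two extra factors, the first T leads into q_plus; the power k leads from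
    there into p_plus, which the last T kills.\<close>
  from this[OF Tq] have "(T ^^ Suc (Suc k)) v = 0" for v by (simp add: funpow_swap1)
  then have "tr T = 0" by (rule tr_nilpotent[OF linT])
  moreover have "tr T = (\<Sum>b\<in>N. K (x' b) (br z b))"
    unfolding T_def tr_sum
    by (intro sum.cong refl tr_rank_one) (simp_all add: lin_add[OF lin_right] lin_scale[OF lin_right] K_add_right K_scale_right)
  moreover have "K (x' b) (br z b) = K (br b (x' b)) z" for b
  proof -
    have "K (x' b) (br z b) = K z (br b (x' b))" using K_inv[of z b "x' b"] K_sym by simp
    then show ?thesis using K_sym by simp
  qed
  ultimately show "K (\<Sum>b\<in>N. br b (x' b)) z = 0" by (simp add: K_sum_left)
qed

lemma rep_coset: "rep (coset G X) - X \<in> p_plus G"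
proof -
  have "X \<in> coset G X" using vec.subspace_0[OF sub_p_plus] by (auto simp: coset_def intro!: exI[of _ 0])
  then have "rep (coset G X) \<in> coset G X" unfolding rep_def by (rule someI)
  then show ?thesis by (auto simp: coset_def)
qed

lemma rep_mem:
  assumes "C \<in> coset G ` S" "vec.subspace S" "p_plus G \<subseteq> S" shows "rep C \<in> S"
proof -
  obtain X where X: "X \<in> S" "C = coset G X" using assms(1) by blast
  have "X + (rep C - X) \<in> S" using rep_coset[of X] X assms(2,3) by (intro vec.subspace_add) auto
  then show ?thesis by simp
qed

text \<open>Supplies the witness for the definite description in \<open>B_inv_contract\<close>, with
  indices below a natural number as required there.\<close>

lemma quotient_basis_exists:
  obtains d :: nat and e y where "quotient_basis G {..<d} e" "dual_pair {..<d} (\<lambda>a. rep (e a)) y"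
    "\<And>a b. a < d \<Longrightarrow> b < d \<Longrightarrow> K (y a) (rep (e b)) = (if a = b then 1 else 0)"
proof -
  obtain N R C x' where J0: "dual_pair (N \<union> R \<union> C) (\<lambda>b. b) x'"
    "\<And>b c. b \<in> N \<union> R \<union> C \<Longrightarrow> c \<in> N \<union> R \<union> C \<Longrightarrow> K (x' b) c = (if b = c then 1 else 0)"
    by (rule adapted_dual_pair) blast
  define J where "J = N \<union> R \<union> C"
  note d = J0(1)[folded J_def] and dual = J0(2)[folded J_def]
  obtain h where h: "bij_betw h {..<card J} J"
    using ex_bij_betw_nat_finite[OF dual_pairD(1)[OF d]] by (auto simp: lessThan_atLeast0)
  let ?d = "card J" let ?e = "\<lambda>a. coset G (h a)" let ?y = "\<lambda>a. x' (h a)"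
  have hJ: "h a \<in> J" if "a < ?d" for a using bij_betwE[OF h] that by blast
  have hp: "h a \<in> \<pp>" if "a < ?d" for a using dual_pairD(2)[OF d hJ[OF that]] .
  have ep: "?e a \<in> coset G ` \<pp>" if "a < ?d" for a using hp[OF that] by blast
  have rp: "rep (?e a) \<in> \<pp>" if "a < ?d" for a by (rule rep_mem[OF ep[OF that] sub_p p_plus_p])
  have yp: "?y a \<in> \<pp>" if "a < ?d" for a by (rule dual_pairD(3)[OF d hJ[OF that]])
  have K1: "K (?y a) (rep (?e b)) = (if a = b then 1 else 0)" if "a < ?d" "b < ?d" for a b
  proof -
    have "K (?y a) (rep (?e b)) = K (?y a) (h b)"
      using K_p_plus(1)[OF yp[OF that(1)] rep_coset[of "h b"]] by (simp add: K_diff_right)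
    also have "\<dots> = (if a = b then 1 else 0)"
      using dual[OF hJ hJ] that bij_betw_imp_inj_on[OF h] by (auto simp: inj_on_def)
    finally show ?thesis .
  qed
  have sp: "\<exists>t. X - (\<Sum>a<?d. t a *s rep (?e a)) \<in> p_plus G" if X: "X \<in> \<pp>" for X
  proof -
    have "(X - (\<Sum>b\<in>J. K (x' b) X *s b)) - (\<Sum>a<?d. K (?y a) X *s (rep (?e a) - h a)) \<in> p_plus G"
      by (rule vec.subspace_diff[OF sub_p_plus dual_pairD(4)[OF d X]])
        (intro vec.subspace_sum[OF sub_p_plus] vec.subspace_scale[OF sub_p_plus] rep_coset)
    moreover have "(\<Sum>b\<in>J. K (x' b) X *s b) = (\<Sum>a<?d. K (?y a) X *s h a)"
      by (rule sum.reindex_bij_betw[OF h, symmetric])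
    ultimately have "X - (\<Sum>a<?d. K (?y a) X *s rep (?e a)) \<in> p_plus G"
      by (simp add: vec.scale_right_diff_distrib sum_subtractf)
    then show ?thesis by (intro exI[of _ "\<lambda>a. K (?y a) X"])
  qed
  show thesis
  proof (rule that[of ?d ?e ?y])
    show "dual_pair {..<?d} (\<lambda>a. rep (?e a)) ?y"
      by (rule dual_pairI) (use rp yp sp K1 in auto)
    show "quotient_basis G {..<?d} ?e"
      unfolding quotient_basis_def
    proof (intro conjI ballI allI impI)
      show "?e a \<in> coset G ` \<pp>" if "a \<in> {..<?d}" for a using ep that by simp
      show "\<exists>c. X - (\<Sum>a<?d. c a *s rep (?e a)) \<in> p_plus G" if "X \<in> \<pp>" for X by (rule sp[OF that])
      fix c a assume c: "(\<Sum>a<?d. c a *s rep (?e a)) \<in> p_plus G" and a: "a \<in> {..<?d}"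
      then have "0 = K (?y a) (\<Sum>a<?d. c a *s rep (?e a))" using K_p_plus(1)[OF yp c] by simp
      also have "\<dots> = (\<Sum>b<?d. c b * (if a = b then 1 else 0))"
        unfolding K_sum_right K_scale_right using K1 a by simp
      finally show "c a = 0" using a by (simp add: if_distrib[of "\<lambda>c. _ * c"] cong: if_cong)
    qed simp
  qed (use K1 in auto)
qed

text \<open>For an admissible basis e with inverse Gram matrix c, the vectors with coefficients c a
  b in the representatives of e form the dual system; by \<open>contract_eq\<close> every such
  choice gives the same value as the pair x, x'.\<close>

lemma B_inv_contract_eq:
  fixes \<beta> :: "'k ^ 'n \<Rightarrow> 'k ^ 'n \<Rightarrow> 'k ^ 'w"
  assumes \<beta>: "\<And>Y. lin (\<lambda>X. \<beta> X Y)" "\<And>X. lin (\<beta> X)"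
    and van: "\<And>X Z. X \<in> \<pp> \<Longrightarrow> Z \<in> p_plus G \<Longrightarrow> \<beta> X Z = 0" "\<And>X Z. X \<in> \<pp> \<Longrightarrow> Z \<in> p_plus G \<Longrightarrow> \<beta> Z X = 0"
    and dp: "dual_pair J x x'"
  shows "B_inv_contract G (\<lambda>C C'. \<beta> (rep C) (rep C')) = (\<Sum>a\<in>J. \<beta> (x a) (x' a))"
  unfolding B_inv_contract_def
proof (rule the_equality)
  let ?S = "\<Sum>a\<in>J. \<beta> (x a) (x' a)"
  have uniq: "(\<Sum>a<d. \<Sum>b<d. c a b *s \<beta> (rep (e a)) (rep (e b))) = ?S"
    if e: "quotient_basis G {..<d} e" and c: "\<And>a b. a < d \<Longrightarrow> b < d \<Longrightarrow> (\<Sum>k<d. c a k * coset_B G (e k) (e b)) = (if a = b then 1 else 0)"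
    for d :: nat and e c
  proof -
    let ?x' = "\<lambda>a. \<Sum>b<d. c a b *s rep (e b)"
    have rp: "rep (e a) \<in> \<pp>" if "a < d" for a
      by (rule rep_mem[OF _ sub_p p_plus_p]) (use e that in \<open>simp add: quotient_basis_def\<close>)
    have "dual_pair {..<d} (\<lambda>a. rep (e a)) ?x'"
    proof (rule dual_pairI)
      show "?x' a \<in> \<pp>" for a by (intro vec.subspace_sum[OF sub_p] vec.subspace_scale[OF sub_p]) (use rp in auto)
      show "\<exists>t. X - (\<Sum>a<d. t a *s rep (e a)) \<in> p_plus G" if "X \<in> \<pp>" for X
        using e that by (simp add: quotient_basis_def)
      show "K (?x' a) (rep (e b)) = (if a = b then 1 else 0)" if "a \<in> {..<d}" "b \<in> {..<d}" for a b
        using c[of a b] that by (simp add: K_sum_left K_scale_left coset_B_def)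
    qed (use rp in auto)
    from contract_eq[OF \<beta> van this dp]
    show ?thesis by (simp add: lin_sum[OF \<beta>(2)] lin_scale[OF \<beta>(2)])
  qed
  show "y = ?S" if "\<exists>(d::nat) e c. quotient_basis G {..<d} e \<and>
        (\<forall>a<d. \<forall>b<d. (\<Sum>k<d. c a k * coset_B G (e k) (e b)) = (if a = b then 1 else 0)) \<and>
        y = (\<Sum>a<d. \<Sum>b<d. c a b *s \<beta> (rep (e a)) (rep (e b)))" for y
    using that by (elim exE conjE) (simp only: uniq)
  obtain d :: nat and e y where e: "quotient_basis G {..<d} e" "dual_pair {..<d} (\<lambda>a. rep (e a)) y"
    "\<And>a b. a < d \<Longrightarrow> b < d \<Longrightarrow> K (y a) (rep (e b)) = (if a = b then 1 else 0)"
    by (rule quotient_basis_exists) blast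
  \<comment> \<open>The Gram matrix of the dual system inverts that of the basis: y a equals the sum
    of the K (y k) (y a) times the representatives of e k, up to p_plus.\<close>
  have c: "(\<Sum>k<d. K (y k) (y a) * coset_B G (e k) (e b)) = (if a = b then 1 else 0)" if ab: "a < d" "b < d" for a b
  proof -
    have ya: "y a \<in> \<pp>" and rb: "rep (e b) \<in> \<pp>" using dual_pairD(2,3)[OF e(2)] ab by auto
    have "K (y a - (\<Sum>k<d. K (y k) (y a) *s rep (e k))) (rep (e b)) = 0"
      by (rule K_p_plus(2)[OF rb dual_pairD(4)[OF e(2) ya]])
    then show ?thesis using e(3)[OF ab] by (simp add: K_diff_left K_sum_left K_scale_left coset_B_def)
  qed
  show "\<exists>(d::nat) e c. quotient_basis G {..<d} e \<and>
        (\<forall>a<d. \<forall>b<d. (\<Sum>k<d. c a k * coset_B G (e k) (e b)) = (if a = b then 1 else 0)) \<and>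
        ?S = (\<Sum>a<d. \<Sum>b<d. c a b *s \<beta> (rep (e a)) (rep (e b)))"
    by (intro exI[of _ d] exI[of _ e] exI[of _ "\<lambda>a k. K (y k) (y a)"] conjI allI impI e(1) c
        uniq[OF e(1) c, symmetric])
qed

end

section \<open>The relative curved Casimir operator: order and formula in adapted frames\<close>

section \<open>The relative curved Casimir operator\<close>

lemma sum_Plus:
  assumes "finite A" "finite B" shows "(\<Sum>a\<in>A <+> B. f a) = (\<Sum>a\<in>A. f (Inl a)) + (\<Sum>b\<in>B. f (Inr b))"
proof -
  have "(\<Sum>a\<in>A <+> B. f a) = (\<Sum>a\<in>Inl ` A. f a) + (\<Sum>a\<in>Inr ` B. f a)"
    unfolding Plus_def by (rule sum.union_disjoint) (use assms in auto)
  then show ?thesis by (simp add: sum.reindex)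
qed

context cartan_geo
begin

lemma lin_scaling: "lin (\<lambda>x :: 'k ^ 'v::finite. c *s x)"
  by (rule linI) (simp_all add: vector_add_ldistrib vector_smult_assoc mult.commute)

lemma lin_D2: assumes s: "smooth_at u \<sigma>" shows "lin (\<lambda>Y. D X (D Y \<sigma>) u)"
proof (rule linI)
  show "D X (D (Y + Z) \<sigma>) u = D X (D Y \<sigma>) u + D X (D Z \<sigma>) u" for Y Z
  proof -
    have "D (Y + Z) \<sigma> = (\<lambda>u'. D Y \<sigma> u' + D Z \<sigma> u')" by (rule ext) (rule D_add_left)
    then show ?thesis using D_add[OF D_smooth[OF s] D_smooth[OF s]] by simp
  qed
  show "D X (D (c *s Y) \<sigma>) u = c *s D X (D Y \<sigma>) u" for c Y
  proof -
    have "D (c *s Y) \<sigma> = (\<lambda>u'. c *s D Y \<sigma> u')" by (rule ext) (rule D_scale_left)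
    then show ?thesis using D_lin[OF lin_scaling D_smooth[OF s]] by simp
  qed
qed

text \<open>The vanishing hypotheses for the contraction: p_plus acts trivially on the fibre and is
  an ideal of p, so that the bracket term disappears as well.\<close>

lemma D2_p_plus:
  assumes s: "sec V \<sigma>" "u \<in> V" and X: "X \<in> \<pp>" and Z: "Z \<in> p_plus G"
  shows "D X (D Z \<sigma>) u = 0" "D Z (D X \<sigma>) u = 0"
proof -
  have Zq: "Z \<in> \<qq>" using Z p_plus_q by auto
  show "D X (D Z \<sigma>) u = 0" unfolding D2_second[OF s Zq] inf_rep_p_plus[OF Z] by simp
  have "br Z X = - br X Z" by (rule anti)
  then have b: "br Z X \<in> p_plus G" using vec.subspace_neg[OF sub_p_plus br_p_plus[OF X Z]] by simp
  have bq: "br Z X \<in> \<qq>" using b p_plus_q by auto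
  show "D Z (D X \<sigma>) u = 0"
    unfolding D2_first[OF s Zq] D_vertical[OF s bq] inf_rep_p_plus[OF Z] inf_rep_p_plus[OF b] by simp
qed

text \<open>The operator contracts at each point separately, so the same constant elements of p
  serve at every u, although they need not be values of sections.\<close>

lemma casimir_eq:
  assumes s: "sec V \<sigma>" "u \<in> V" and d: "dual_pair J x x'"
  shows "relative_casimir G M \<sigma> u = (\<Sum>a\<in>J. D (x a) (D (x' a) \<sigma>) u)"
proof -
  have "D_rho_D_rho M \<sigma> u = (\<lambda>C C'. D (rep C) (D (rep C') \<sigma>) u)"
    by (intro ext) (rule D_rho_D_rho_eq)
  then show ?thesis
    unfolding relative_casimir_def
    using B_inv_contract_eq[OF lin_D lin_D2[OF secD(3)[OF s]] D2_p_plus[OF s] d] by simp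
qed

lemma sec_add: assumes s: "sec V \<sigma>" and t: "sec V \<tau>" shows "sec V (\<lambda>u. \<sigma> u + \<tau> u)"
  unfolding sec_def using secD[OF s] secD[OF t] lin_add[OF rho_lin[OF Q_inv]]
  by (intro conjI ballI) (simp_all add: smooth_at_add)

lemma sec_scale: assumes s: "sec V \<sigma>" shows "sec V (\<lambda>u. c *s \<sigma> u)"
  unfolding sec_def
proof (intro conjI ballI secD(1,2)[OF s] smooth_at_lin[OF lin_scaling] secD(3)[OF s])
  show "c *s \<sigma> (act' u g) = \<rho> (inv g) (c *s \<sigma> u)" if "u \<in> V" "g \<in> Q" for u g
    using secD(4)[OF s that] lin_scale[OF rho_lin[OF Q_inv[OF that(2)]]] by simp
qed

lemma D2_add:
  assumes s: "sec V \<sigma>" "sec V \<tau>" "u \<in> V"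
  shows "D X (D Y (\<lambda>u'. \<sigma> u' + \<tau> u')) u = D X (D Y \<sigma>) u + D X (D Y \<tau>) u"
proof -
  have "D X (D Y (\<lambda>u'. \<sigma> u' + \<tau> u')) u = D X (\<lambda>u'. D Y \<sigma> u' + D Y \<tau> u') u"
    by (rule D_cong[OF secD(1)[OF s(1)] s(3)]) (rule D_add[OF secD(3)[OF s(1)] secD(3)[OF s(2)]])
  then show ?thesis using D_add[OF D_smooth[OF secD(3)[OF s(1,3)]] D_smooth[OF secD(3)[OF s(2,3)]]] by simp
qed

lemma D2_scale:
  assumes s: "sec V \<sigma>" "u \<in> V"
  shows "D X (D Y (\<lambda>u'. c *s \<sigma> u')) u = c *s D X (D Y \<sigma>) u"
proof -
  have "D X (D Y (\<lambda>u'. c *s \<sigma> u')) u = D X (\<lambda>u'. c *s D Y \<sigma> u') u"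
    by (rule D_cong[OF secD(1)[OF s(1)] s(2)]) (rule D_lin[OF lin_scaling secD(3)[OF s(1)]])
  then show ?thesis using D_lin[OF lin_scaling D_smooth[OF secD(3)[OF s]]] by simp
qed

text \<open>Smoothness is seen from a fixed dual pair. For equivariance, g replaces the pair by its
  image under Ad g, again a dual pair, and the contraction is the same for both.\<close>

lemma sec_casimir: assumes s: "sec V \<sigma>" shows "sec V (relative_casimir G M \<sigma>)"
proof -
  obtain N R C x' where "dual_pair (N \<union> R \<union> C) (\<lambda>b. b) x'" by (rule adapted_dual_pair)
  then obtain J and x :: "'k ^ 'n \<Rightarrow> 'k ^ 'n" and y where d: "dual_pair J x y" by blast
  show ?thesis
    unfolding sec_def
  proof (intro conjI ballI secD(1,2)[OF s])
    fix u assume u: "u \<in> V"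
    have "smooth_at u (\<lambda>u. \<Sum>a\<in>J. D (x a) (D (y a) \<sigma>) u)"
      using D_smooth[OF D_smooth[OF secD(3)[OF s u]]]
      unfolding smooth_at_def sum_component by (intro allI smooth_near_sum[OF E]) simp
    then show "smooth_at u (relative_casimir G M \<sigma>)"
      by (rule smooth_at_cong[OF secD(1)[OF s] u, rotated]) (simp add: casimir_eq[OF s _ d])
    fix g assume g: "g \<in> Q"
    have "relative_casimir G M \<sigma> (act' u g) = (\<Sum>a\<in>J. \<rho> (inv g) (D (Ad G g (x a)) (D (Ad G g (y a)) \<sigma>) u))"
      unfolding casimir_eq[OF s secD(2)[OF s u g] d] D2_equivariant[OF s u g] ..
    also have "\<dots> = \<rho> (inv g) (\<Sum>a\<in>J. D (Ad G g (x a)) (D (Ad G g (y a)) \<sigma>) u)"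
      by (rule lin_sum[OF rho_lin[OF Q_inv[OF g]], symmetric])
    also have "\<dots> = \<rho> (inv g) (relative_casimir G M \<sigma> u)"
      unfolding casimir_eq[OF s u dual_pair_Ad[OF d g]] ..
    finally show "relative_casimir G M \<sigma> (act' u g) = \<rho> (inv g) (relative_casimir G M \<sigma> u)" .
  qed
qed

lemma casimir_diff_operator:
  assumes jet: "\<And>U \<sigma> u. open U \<Longrightarrow> sec (\<pi> -` U) \<sigma> \<Longrightarrow> \<pi> u \<in> U \<Longrightarrow> section_jet_vanishes M k \<sigma> (\<pi> u) \<Longrightarrow>
    relative_casimir G M \<sigma> u = 0"
  shows "diff_operator_of_order_le G M \<rho> k (relative_casimir G M)"
  unfolding diff_operator_of_order_le_def
proof (intro allI impI conjI ballI)
  obtain N R C x' where "dual_pair (N \<union> R \<union> C) (\<lambda>b. b) x'" by (rule adapted_dual_pair)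
  then obtain J and x :: "'k ^ 'n \<Rightarrow> 'k ^ 'n" and y where d: "dual_pair J x y" by blast
  fix U :: "'m set" and \<sigma> assume U: "open U" and "\<sigma> \<in> E_sections G M \<rho> U"
  then have s: "sec (\<pi> -` U) \<sigma>" by (rule_tac sec_E_sections)
  show "relative_casimir G M \<sigma> \<in> E_sections G M \<rho> U" by (rule E_sections_sec[OF sec_casimir[OF s]])
  fix u assume u: "u \<in> \<pi> -` U"
  show "relative_casimir G M (\<lambda>u'. c *s \<sigma> u') u = c *s relative_casimir G M \<sigma> u" for c
    unfolding casimir_eq[OF sec_scale[OF s] u d] casimir_eq[OF s u d] D2_scale[OF s u] by (simp add: vec.scale_sum_right)
  show "relative_casimir G M \<sigma> u = 0" if "section_jet_vanishes M k \<sigma> (\<pi> u)"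
    using jet[OF U s _ that] u by simp
  fix \<tau> assume "\<tau> \<in> E_sections G M \<rho> U"
  then have t: "sec (\<pi> -` U) \<tau>" by (rule sec_E_sections)
  show "relative_casimir G M (\<lambda>u'. \<sigma> u' + \<tau> u') u = relative_casimir G M \<sigma> u + relative_casimir G M \<tau> u"
    unfolding casimir_eq[OF sec_add[OF s t] u d] casimir_eq[OF s u d] casimir_eq[OF t u d] D2_add[OF s t u]
    by (simp add: sum.distrib)
qed

text \<open>Every term has an argument in q: the basis element for N and R, its dual for C. So each
  second derivative reduces to an expression in first derivatives.\<close>

lemma casimir_order_one: "diff_operator_of_order_le G M \<rho> 1 (relative_casimir G M)"
proof (rule casimir_diff_operator)
  fix U \<sigma> u assume U: "open U" and s: "sec (\<pi> -` U) \<sigma>" and u: "\<pi> u \<in> U" and j: "section_jet_vanishes M 1 \<sigma> (\<pi> u)"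
  have u': "u \<in> \<pi> -` U" using u by simp
  have d0: "D X \<sigma> u = 0" for X by (rule jet_vanishes_deriv[OF s U u j])
  have l0: "d\<rho> X 0 = 0" if "X \<in> \<qq>" for X by (rule lin_0[OF inf_rep_lin[OF that]])
  obtain N R C x' where J: "N \<subseteq> q_plus G" "R \<subseteq> \<qq>" "dual_pair (N \<union> R \<union> C) (\<lambda>b. b) x'"
    "\<And>b. b \<in> C \<Longrightarrow> x' b \<in> q_plus G" by (rule adapted_dual_pair) blast
  have "D b (D (x' b) \<sigma>) u = 0" if b: "b \<in> N \<union> R \<union> C" for b
  proof (cases "b \<in> C")
    case True
    then have q: "x' b \<in> \<qq>" using J(4) q_plus_q by blast
    show ?thesis unfolding D2_second[OF s u' q] d0 l0[OF q] by simp
  next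
    case False
    then have q: "b \<in> \<qq>" using b J(1,2) q_plus_q by blast
    show ?thesis unfolding D2_first[OF s u' q] d0 l0[OF q] by simp
  qed
  then show "relative_casimir G M \<sigma> u = 0" unfolding casimir_eq[OF s u' J(3)] by simp
qed

text \<open>The terms from C vanish because their duals lie in q_plus, and those from R because both
  arguments lie in q, where only the value of \<sigma> matters. From N, only derivatives along the
  brackets of b and x' b survive, and these are added before \<open>sum_bracket_mem_q\<close>
  applies.\<close>

lemma casimir_order_zero:
  assumes cr: "completely_reducible G \<rho>"
  shows "diff_operator_of_order_le G M \<rho> 0 (relative_casimir G M)"
proof (rule casimir_diff_operator)
  fix U \<sigma> u assume U: "open U" and s: "sec (\<pi> -` U) \<sigma>" and u: "\<pi> u \<in> U" and j: "section_jet_vanishes M 0 \<sigma> (\<pi> u)"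
  have u': "u \<in> \<pi> -` U" using u by simp
  have s0: "\<sigma> u = 0" by (rule jet_vanishes_value[OF s u j])
  have l0: "d\<rho> X 0 = 0" if "X \<in> \<qq>" for X by (rule lin_0[OF inf_rep_lin[OF that]])
  have d0: "D X \<sigma> u = 0" if "X \<in> \<qq>" for X unfolding D_vertical[OF s u' that] s0 l0[OF that] by simp
  note q0 = completely_reducible_q_plus[OF cr]
  obtain N R C x' where J: "N \<inter> R = {}" "N \<inter> C = {}" "R \<inter> C = {}" "N \<subseteq> q_plus G" "R \<subseteq> \<qq>"
    "dual_pair (N \<union> R \<union> C) (\<lambda>b. b) x'" "\<And>b. b \<in> R \<Longrightarrow> x' b \<in> \<qq>" "\<And>b. b \<in> C \<Longrightarrow> x' b \<in> q_plus G"
    "\<And>X. X \<in> q_plus G \<Longrightarrow> X - (\<Sum>b\<in>N. K (x' b) X *s b) \<in> p_plus G"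
    by (rule adapted_dual_pair) blast
  have fin: "finite N" "finite R" "finite C" using dual_pairD(1)[OF J(6)] by auto
  have C: "D b (D (x' b) \<sigma>) u = 0" if b: "b \<in> C" for b
  proof -
    have q: "x' b \<in> \<qq>" using J(8)[OF b] q_plus_q by blast
    show ?thesis unfolding D2_second[OF s u' q] q0[OF J(8)[OF b]] by simp
  qed
  have R: "D b (D (x' b) \<sigma>) u = 0" if b: "b \<in> R" for b
  proof -
    have q: "b \<in> \<qq>" using b J(5) by blast
    show ?thesis unfolding D2_first[OF s u' q] d0[OF J(7)[OF b]] d0[OF br_q[OF q J(7)[OF b]]] l0[OF q] by simp
  qed
  have N: "D b (D (x' b) \<sigma>) u = D (br b (x' b)) \<sigma> u" if b: "b \<in> N" for b
  proof -
    have bq: "b \<in> q_plus G" and q: "b \<in> \<qq>" using b J(4) q_plus_q by auto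
    show ?thesis unfolding D2_first[OF s u' q] q0[OF bq] by simp
  qed
  have "(\<Sum>b\<in>N. D (br b (x' b)) \<sigma> u) = D (\<Sum>b\<in>N. br b (x' b)) \<sigma> u" by (rule lin_sum[OF lin_D, symmetric])
  also have "\<dots> = 0"
    by (rule d0[OF sum_bracket_mem_q[OF J(4) fin(1) _ J(9)]]) (use dual_pairD(3)[OF J(6)] in auto)
  finally have N': "(\<Sum>b\<in>N. D b (D (x' b) \<sigma>) u) = 0" by (simp add: N)
  have "relative_casimir G M \<sigma> u = (\<Sum>b\<in>N \<union> R \<union> C. D b (D (x' b) \<sigma>) u)" by (rule casimir_eq[OF s u' J(6)])
  also have "\<dots> = (\<Sum>b\<in>N \<union> R. D b (D (x' b) \<sigma>) u) + (\<Sum>b\<in>C. D b (D (x' b) \<sigma>) u)"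
    by (rule sum.union_disjoint) (use fin J(2,3) in auto)
  also have "(\<Sum>b\<in>N \<union> R. D b (D (x' b) \<sigma>) u) = (\<Sum>b\<in>N. D b (D (x' b) \<sigma>) u) + (\<Sum>b\<in>R. D b (D (x' b) \<sigma>) u)"
    by (rule sum.union_disjoint) (use fin J(1) in auto)
  finally show "relative_casimir G M \<sigma> u = 0" using N' R C by simp
qed

lemma sum_frame_index: "(\<Sum>a\<in>frame_index m l. f a) = (\<Sum>i<m. f (Inl (Inl i))) + (\<Sum>r<l. f (Inl (Inr r))) + (\<Sum>i<m. f (Inr i))"
  unfolding frame_index_def by (simp add: sum_Plus)

text \<open>At u, the frame and its dual form a dual pair. Each index i occurs twice, once with X i
  and once with Z i as the outer direction, whence the factor 2; the bracket term stems from the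
  second occurrence.\<close>

lemma casimir_adapted_frame:
  assumes ad: "adapted_frame G M U m l X A Z"
    and df: "dual_frames G M U (frame_index m l) (frame_of X A Z) (frame_of Z A' X)"
    and \<sigma>: "\<sigma> \<in> E_sections G M \<rho> U" and u: "u \<in> \<pi> -` U"
  shows "relative_casimir G M \<sigma> u =
      - (2 *s (\<Sum>i<m. bullet G \<rho> (Z i) (D_rho M (X i) \<sigma>) u))
      - (\<Sum>i<m. bullet G \<rho> (algebraic_bracket G (Z i) (X i)) \<sigma> u)
      + (\<Sum>r<l. bullet G \<rho> (A' r) (bullet G \<rho> (A r) \<sigma>) u)"
proof -
  let ?J = "frame_index m l"
  let ?F = "\<lambda>a. rep (frame_of X A Z a u)" let ?F' = "\<lambda>a. rep (frame_of Z A' X a u)"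
  let ?x = "\<lambda>i. rep (X i u)" let ?z = "\<lambda>i. rep (Z i u)" let ?a = "\<lambda>r. rep (A r u)" let ?a' = "\<lambda>r. rep (A' r u)"
  have s: "sec (\<pi> -` U) \<sigma>" by (rule sec_E_sections[OF \<sigma>])
  have qb: "quotient_basis G ?J (\<lambda>a. frame_of X A Z a u)" "quotient_basis G ?J (\<lambda>a. frame_of Z A' X a u)"
    and dual: "\<And>a b. a \<in> ?J \<Longrightarrow> b \<in> ?J \<Longrightarrow> K (?F a) (?F' b) = (if a = b then 1 else 0)"
    using df u by (auto simp: dual_frames_def local_frame_def coset_B_def)
  have Fp: "?F a \<in> \<pp>" "?F' a \<in> \<pp>" if "a \<in> ?J" for a
    using qb that by (auto simp: quotient_basis_def intro!: rep_mem[OF _ sub_p p_plus_p])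
  have J: "Inl (Inl i) \<in> ?J \<longleftrightarrow> i < m" "Inl (Inr r) \<in> ?J \<longleftrightarrow> r < l" "Inr i \<in> ?J \<longleftrightarrow> i < m" for i r
    by (auto simp: frame_index_def)
  have dp: "dual_pair ?J ?F ?F'"
  proof (rule dual_pairI)
    show "finite ?J" by (simp add: frame_index_def)
    show "\<exists>t. Y - (\<Sum>a\<in>?J. t a *s ?F a) \<in> p_plus G" if "Y \<in> \<pp>" for Y
      using qb(1) that by (simp add: quotient_basis_def)
    show "K (?F' a) (?F b) = (if a = b then 1 else 0)" if "a \<in> ?J" "b \<in> ?J" for a b
      using dual[OF that(2,1)] K_sym by auto
  qed (use Fp in auto)
  have zq: "?z i \<in> q_plus G" if "i < m" for i
    using ad u that by (auto simp: adapted_frame_def A1_sections_def intro!: rep_mem[OF _ sub_q_plus p_plus_q_plus])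
  then have zq': "?z i \<in> \<qq>" if "i < m" for i using that q_plus_q by blast
  have aq: "?a r \<in> \<qq>" if "r < l" for r
    using ad u that by (auto simp: adapted_frame_def A0_sections_def intro!: rep_mem[OF _ sub_q p_plus_q])
  have xp: "?x i \<in> \<pp>" if "i < m" for i using Fp(1)[of "Inl (Inl i)"] that by (simp add: J frame_of_def)
  have a'p: "?a' r \<in> \<pp>" if "r < l" for r using Fp(2)[of "Inl (Inr r)"] that by (simp add: J frame_of_def)
  \<comment> \<open>\<open>dual_frames\<close> gives A' r in p only. Membership in q is
    orthogonality to q_plus: expanding z in the dual frame, the coefficients at A' and X vanish
    because q is orthogonal to q_plus, and the vectors Z are orthogonal to A' r by duality.\<close>
  have a'q: "?a' r \<in> \<qq>" if r: "r < l" for r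
    unfolding mem_q_iff
  proof
    fix z assume z: "z \<in> q_plus G"
    then have zp: "z \<in> \<pp>" using q_plus_p by auto
    have "K (?a' r) (z - (\<Sum>a\<in>?J. K (?F a) z *s ?F' a)) = 0"
      by (rule K_p_plus(1)[OF a'p[OF r] dual_pairD(4)[OF dual_pair_swap[OF dp] zp]])
    then have "K (?a' r) z = (\<Sum>a\<in>?J. K (?F a) z * K (?a' r) (?F' a))"
      by (simp add: K_diff_right K_sum_right K_scale_right)
    also have "\<dots> = 0"
    proof (rule sum.neutral, rule ballI)
      have kz: "K Y z = 0" if "Y \<in> \<qq>" for Y using z that K_sym[of Y z] by (simp add: mem_q_plus_iff)
      fix a assume a: "a \<in> ?J"
      then consider i where "i < m" "a = Inl (Inl i)" | t where "t < l" "a = Inl (Inr t)" | i where "i < m" "a = Inr i"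
        by (auto simp: frame_index_def)
      then show "K (?F a) z * K (?a' r) (?F' a) = 0"
      proof cases
        case 1
        have "K (?F (Inr i)) (?F' (Inl (Inr r))) = 0" using dual[of "Inr i" "Inl (Inr r)"] 1 r by (simp add: J)
        then show ?thesis using 1 K_sym[of "?a' r"] by (simp add: frame_of_def)
      next
        case 2
        then show ?thesis using kz[OF aq] by (simp add: frame_of_def)
      next
        case 3
        then show ?thesis using kz[OF zq'] by (simp add: frame_of_def)
      qed
    qed
    finally show "K (?a' r) z = 0" .
  qed
  \<comment> \<open>\<open>algebraic_bracket\<close> brackets representatives and passes to a coset,
    of which \<open>bullet\<close> takes a representative again. The discrepancy lies in p_plus,
    hence in q, and acts by zero.\<close>
  have br: "br (?z i) (?x i) \<in> \<qq>" "d\<rho> (br (?z i) (?x i)) w = bullet G \<rho> (algebraic_bracket G (Z i) (X i)) (\<lambda>_. w) u"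
    if i: "i < m" for i w
  proof -
    let ?b = "br (?z i) (?x i)"
    have "coset G ?b \<in> coset G ` \<qq>"
      using ad u i by (auto simp: adapted_frame_def A0_sections_def algebraic_bracket_def coset_bracket_def)
    then have r: "rep (coset G ?b) \<in> \<qq>" by (rule rep_mem[OF _ sub_q p_plus_q])
    have "rep (coset G ?b) - (rep (coset G ?b) - ?b) \<in> \<qq>" by (rule vec.subspace_diff[OF sub_q r subsetD[OF p_plus_q rep_coset]])
    then show q: "?b \<in> \<qq>" by simp
    show "d\<rho> ?b w = bullet G \<rho> (algebraic_bracket G (Z i) (X i)) (\<lambda>_. w) u"
      unfolding bullet_def algebraic_bracket_def coset_bracket_def
      using inf_rep_cong[OF r q rep_coset] by simp
  qed
  have XZ: "D (?x i) (D (?z i) \<sigma>) u = - bullet G \<rho> (Z i) (D_rho M (X i) \<sigma>) u" if "i < m" for i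
    unfolding D2_second[OF s u zq'[OF that]] bullet_def D_rho_eq ..
  have ZX: "D (?z i) (D (?x i) \<sigma>) u = - bullet G \<rho> (Z i) (D_rho M (X i) \<sigma>) u
      - bullet G \<rho> (algebraic_bracket G (Z i) (X i)) \<sigma> u" if "i < m" for i
    unfolding D2_first[OF s u zq'[OF that]] D_vertical[OF s u br(1)[OF that]] br(2)[OF that]
    by (simp add: bullet_def D_rho_eq)
  \<comment> \<open>Each of the two derivatives in a direction of q contributes a minus sign, and
    the signs cancel. The dual element, in the inner derivative, becomes the outer factor of the
    action.\<close>
  have AA: "D (?a r) (D (?a' r) \<sigma>) u = bullet G \<rho> (A' r) (bullet G \<rho> (A r) \<sigma>) u" if "r < l" for r
    unfolding D2_second[OF s u a'q[OF that]] D_vertical[OF s u aq[OF that]] lin_neg[OF inf_rep_lin[OF a'q[OF that]]]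
    by (simp add: bullet_def)
  have two: "2 *s v = v + v" for v :: "'k ^ 'w" by (simp add: vec_eq_iff)
  have "relative_casimir G M \<sigma> u = (\<Sum>i<m. D (?x i) (D (?z i) \<sigma>) u) + (\<Sum>r<l. D (?a r) (D (?a' r) \<sigma>) u)
      + (\<Sum>i<m. D (?z i) (D (?x i) \<sigma>) u)"
    unfolding casimir_eq[OF s u dp] sum_frame_index by (simp add: frame_of_def)
  then show ?thesis
    by (simp add: XZ ZX AA two sum_negf sum_subtractf)
qed

end

theorem proposition2p6:
  fixes G :: "('g::{t2_space, second_countable_topology}, 'k::real_or_complex, 'n::finite) nested_parabolics"
    and M :: "('e::{t2_space, second_countable_topology}, 'm::{t2_space, second_countable_topology},
               'g, 'k, 'n, 'b::finite) cartan_geometry"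
    and \<rho> :: "'g \<Rightarrow> 'k ^ 'w \<Rightarrow> 'k ^ 'w"
  assumes "nested_parabolics G"
    and "parabolic_geometry G M"
    and "relative_representation G \<rho>"
  shows "(\<forall>U m l X A Z A' \<sigma>.
            adapted_frame G M U m l X A Z \<and>
            dual_frames G M U (frame_index m l) (frame_of X A Z) (frame_of Z A' X) \<and>
            \<sigma> \<in> E_sections G M \<rho> U \<longrightarrow>
            (\<forall>u\<in>proj M -` U.
               relative_casimir G M \<sigma> u =
                 - (2 *s (\<Sum>i<m. bullet G \<rho> (Z i) (D_rho M (X i) \<sigma>) u))
                 - (\<Sum>i<m. bullet G \<rho> (algebraic_bracket G (Z i) (X i)) \<sigma> u)
                 + (\<Sum>r<l. bullet G \<rho> (A' r) (bullet G \<rho> (A r) \<sigma>) u)))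
       \<and> diff_operator_of_order_le G M \<rho> 1 (relative_casimir G M)
       \<and> (completely_reducible G \<rho> \<longrightarrow> diff_operator_of_order_le G M \<rho> 0 (relative_casimir G M))"
proof -
  interpret cartan_geo G \<rho> M using assms by unfold_locales
  show ?thesis
    using casimir_adapted_frame casimir_order_one casimir_order_zero
    by (intro conjI allI impI ballI) (elim conjE, assumption | blast)+
qed

end
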